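(* Let $r\ge1$, $n=2r$, and let $B$ be an antisymmetric integer $2r\times2r$-matrix such that the submatrix $B^0$ formed by the first $r$ columns of $B$ has as complementary part (last $r$ rows) the $r\times r$ identity matrix. Let $\mathcal{C}$ be a triangulated $2$-Calabi-Yau realization of $B$ with cluster-tilting object $T=T_1\oplus\dots\oplus T_{2r}$, let $\mathcal{P}=\mathrm{add}(T_{r+1}\oplus\dots\oplus T_{2r})$ and $\mathcal{U}=\{X\in\mathcal{C}\mid\mathrm{Ext}^1_{\mathcal{C}}(T_i,X)=0\text{ for }r<i\le2r\}$. Let $M$ be an indecomposable rigid object of $\mathcal{U}$ reachable from $T$ and not isomorphic to $T_i$ for $1\le i\le2r$. Let $(d_1,\dots,d_r)$ be the dimension vector of $\mathrm{Hom}_{\mathcal{C}}(T,\Sigma M)$ (its components at the vertices $1,\dots,r$) and let $f_T(M)=(f_1,\dots,f_r)$ be the $f$-vector of $M$ with respect to $T$. Then $d_i=f_i$ for $1\le i\le r$.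
   Context: Triangulated $2$-Calabi-Yau categories. $k$ is an algebraically closed field; $\mathcal{C}$ is a $k$-linear $\mathrm{Hom}$-finite triangulated category with split idempotents and suspension $\Sigma$, $\mathrm{Ext}^i(X,Y)=\mathcal{C}(X,\Sigma^iY)$, which is $2$-Calabi-Yau: there are linear forms $t_X:\mathcal{C}(X,\Sigma^2X)\to k$ such that the forms $\langle f,g\rangle=t_X(f\circ g)$ on $\mathcal{C}(Y,\Sigma^2X)\times\mathcal{C}(X,Y)$ are non-degenerate and $\langle\Sigma^pf,g\rangle=(-1)^{pq}\langle\Sigma^qg,f\rangle$ for $f\in\mathcal{C}(Y,\Sigma^qX)$, $g\in\mathcal{C}(X,\Sigma^pY)$, $p+q=2$. $X$ is rigid if $\mathrm{Ext}^1(X,X)=0$. A cluster-tilting subcategory is a full additive subcategory $\mathcal{T}$, closed under direct factors, such that for each $X$ the functors $\mathcal{C}(X,?)|_{\mathcal{T}}$ and $\mathcal{C}(?,X)|_{\mathcal{T}}$ are finitely generated and $X\in\mathcal{T}$ iff $\mathrm{Ext}^1(T',X)=0$ for all $T'\in\mathcal{T}$. A cluster-tilting object is a basic object $T$ with $\mathrm{add}(T)$ cluster-tilting. The quiver $Q(\mathcal{T})$ has as vertices the isoclasses of indecomposables of $\mathcal{T}$ and $\dim\mathrm{rad}(T_1,T_2)/\mathrm{rad}^2(T_1,T_2)$ arrows from $T_1$ to $T_2$. The antisymmetric matrix of a quiver has entries $b_{ij}=\#\{i\to j\}-\#\{j\to i\}$; quiver mutation $\mu_s$ is defined via matrix mutation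 $b'_{ij}=-b_{ij}$ if $i=s$ or $j=s$, $b'_{ij}=b_{ij}+\mathrm{sgn}(b_{is})[b_{is}b_{sj}]_+$ otherwise, with $[x]_+=\max(x,0)$ and $\mathrm{sgn}$ the usual sign. Cluster structure on $\mathcal{C}$: (0) a cluster-tilting subcategory exists; (1) for each cluster-tilting $\mathcal{T}'$ and indecomposable $M\in\mathcal{T}'$ there is a unique (up to isomorphism) indecomposable $M^*\not\cong M$ such that the subcategory $\mathcal{T}''=\mu_M(\mathcal{T}')$ with indecomposables $\mathrm{indec}(\mathcal{T}')\setminus\{M\}\cup\{M^*\}$ is cluster-tilting; (2) there are then triangles $M^*\xrightarrow{f}E\xrightarrow{g}M\to\Sigma M^*$ and $M\xrightarrow{s}E'\xrightarrow{t}M^*\to\Sigma M$ with $g,t$ minimal right and $f,s$ minimal left $\mathcal{T}'\cap\mathcal{T}''$-approximations; (3) no $Q(\mathcal{T}')$ has loops or $2$-cycles; (4) $Q(\mu_M(\mathcal{T}'))=\mu_M(Q(\mathcal{T}'))$. Mutation of cluster-tilting objects is defined via $\mathrm{add}$. A triangulated $2$-Calabi-Yau realization of an antisymmetric integer $n\times n$-matrix $B$ is such a $\mathcal{C}$ having a cluster structure, with a cluster-tilting object $T$ having exactly $n$ non-isomorphic indecomposable summands $T_1,\dots,T_n$, such that the antisymmetric matrix of the quiver of $\mathrm{End}_{\mathcal{C}}(T)$ (i.e. of $Q(\mathrm{add}\,T)$) equals $B$. Reachability. A cluster-tilting object of $\mathcal{U}$ (one of $\mathcal{C}$ lying in $\mathcal{U}$)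 is reachable from $T$ if obtained from $T$ by mutations at indecomposable rigid objects of $\mathcal{U}$ not in $\mathcal{P}$; an indecomposable rigid object of $\mathcal{U}$ is reachable if it is a direct factor of a reachable cluster-tilting object. The polynomial $\mathcal{F}_M$. For $M\in\mathcal{C}$ there is a triangle $T_1^M\to T_0^M\to M\to\Sigma T_1^M$ with $T_0^M,T_1^M\in\mathrm{add}\,T$; $\mathrm{ind}_T(M)=[T_0^M]-[T_1^M]$ and $[\,\cdot:T_i]$ is the coefficient of $[T_i]$. $S_i$ is the simple top of the projective right $\mathrm{End}_{\mathcal{C}}(T)$-module $\mathcal{C}(T,T_i)$; $\langle L,N\rangle=\dim\mathrm{Hom}(L,N)-\dim\mathrm{Ext}^1(L,N)$, $\langle L,N\rangle_a=\langle L,N\rangle-\langle N,L\rangle$ (well defined on $K_0$). Put $$X'_M=\prod_{i=1}^nx_i^{[\mathrm{ind}_TM:T_i]}\sum_e\chi\big(Gr_e(\mathrm{Hom}_{\mathcal{C}}(T,\Sigma M))\big)\prod_{i=1}^nx_i^{\langle S_i,e\rangle_a},$$ $Gr_e(L)$ being the variety of submodules of $L$ of class $e$, $\chi$ the Euler characteristic (topological if $k=\mathbb{C}$, $l$-adic in general), and $\mathcal{F}_M=X'_M|_{x_1=\dots=x_r=1}$. For reachable $M\notin\mathcal{P}$, $X'_M$ is a cluster variable of the cluster algebra with initial seed $(B^0,\{x_1,\dots,x_r\})$, and $\mathcal{F}_M$ is its $F$-polynomial, a polynomial in $x_{r+1},\dots,x_{2r}$ admitting a subtraction-free rational expression (from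 the exchange relations). The $f$-vector. The tropical semifield $\mathrm{Trop}(u_1,\dots,u_r)$ is the free abelian (multiplicative) group on $u_1,\dots,u_r$ with addition $\prod u_j^{a_j}\oplus\prod u_j^{b_j}=\prod u_j^{\min(a_j,b_j)}$. The $f$-vector $f_T(M)=(f_1,\dots,f_r)$ is defined by $$\mathcal{F}_M|_{\mathrm{Trop}(u_1,\dots,u_r)}(u_1^{-1},\dots,u_r^{-1})=u_1^{-f_1}\cdots u_r^{-f_r},$$ where the left side is the evaluation of (a subtraction-free expression of) $\mathcal{F}_M$ in the semifield at $x_{r+j}=u_j^{-1}$. *)

theory Defs
  imports
    "HOL-Homology.Homology"
    "HOL-Library.Function_Algebras"
    "HOL-Library.Poly_Mapping"
    "HOL-Computational_Algebra.Computational_Algebra"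
    "HOL-Number_Theory.Cong"
begin

section \<open>Linear categories\<close>

text \<open>
  The objects are the elements of the type \<open>'o\<close>. All morphism spaces are subspaces of one ambient
  \<open>k\<close>-vector space \<open>'v\<close> (for instance the direct sum of all of them), so that the library's
  linear algebra applies to them. This is no restriction: composition and suspension are indexed by
  the objects concerned, hence different morphism spaces may overlap without being identified.
  \<open>Cmp C X Y Z g f\<close> is \<open>g \<circ> f\<close> for \<open>f : X \<rightarrow> Y\<close> and \<open>g : Y \<rightarrow> Z\<close>, and \<open>Tri C X Y Z u v w\<close> says
  that \<open>X \<rightarrow> Y \<rightarrow> Z \<rightarrow> \<Sigma> X\<close> with maps \<open>u, v, w\<close> is a distinguished triangle.
\<close>

record ('k, 'o, 'v) tcat =
  Scal :: "'k \<Rightarrow> 'v \<Rightarrow> 'v"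
  Mor :: "'o \<Rightarrow> 'o \<Rightarrow> 'v set"
  Cmp :: "'o \<Rightarrow> 'o \<Rightarrow> 'o \<Rightarrow> 'v \<Rightarrow> 'v \<Rightarrow> 'v"
  Idm :: "'o \<Rightarrow> 'v"
  Sus :: "'o \<Rightarrow> 'o"
  SusM :: "'o \<Rightarrow> 'o \<Rightarrow> 'v \<Rightarrow> 'v"
  Tri :: "'o \<Rightarrow> 'o \<Rightarrow> 'o \<Rightarrow> 'v \<Rightarrow> 'v \<Rightarrow> 'v \<Rightarrow> bool"

definition linear_on_sub ::
  "('k::field \<Rightarrow> 'v::ab_group_add \<Rightarrow> 'v) \<Rightarrow> ('k \<Rightarrow> 'w::ab_group_add \<Rightarrow> 'w) \<Rightarrow> 'v set \<Rightarrow> 'w set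
     \<Rightarrow> ('v \<Rightarrow> 'w) \<Rightarrow> bool" where
  "linear_on_sub s s' V W f \<longleftrightarrow>
     (\<forall>x\<in>V. f x \<in> W) \<and> (\<forall>x\<in>V. \<forall>y\<in>V. f (x + y) = f x + f y) \<and> (\<forall>c. \<forall>x\<in>V. f (s c x) = s' c (f x))"

definition finite_dim_sub :: "('k::field \<Rightarrow> 'v::ab_group_add \<Rightarrow> 'v) \<Rightarrow> 'v set \<Rightarrow> bool" where
  "finite_dim_sub s V \<longleftrightarrow> (\<exists>B. finite B \<and> V \<subseteq> Modules.module.span s B)"

definition linear_category :: "('k::field, 'o, 'v::ab_group_add) tcat \<Rightarrow> bool" where
  "linear_category C \<longleftrightarrow>
     vector_space (Scal C) \<and>
     (\<forall>X Y. Modules.module.subspace (Scal C) (Mor C X Y)) \<and>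
     (\<forall>X. Idm C X \<in> Mor C X X) \<and>
     (\<forall>X Y. \<forall>f\<in>Mor C X Y. Cmp C X X Y f (Idm C X) = f \<and> Cmp C X Y Y (Idm C Y) f = f) \<and>
     (\<forall>X Y Z. \<forall>f\<in>Mor C X Y. linear_on_sub (Scal C) (Scal C) (Mor C Y Z) (Mor C X Z) (\<lambda>g. Cmp C X Y Z g f)) \<and>
     (\<forall>X Y Z. \<forall>g\<in>Mor C Y Z. linear_on_sub (Scal C) (Scal C) (Mor C X Y) (Mor C X Z) (Cmp C X Y Z g)) \<and>
     (\<forall>W X Y Z. \<forall>f\<in>Mor C W X. \<forall>g\<in>Mor C X Y. \<forall>h\<in>Mor C Y Z.
        Cmp C W Y Z h (Cmp C W X Y g f) = Cmp C W X Z (Cmp C X Y Z h g) f)"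

definition hom_finite :: "('k::field, 'o, 'v::ab_group_add) tcat \<Rightarrow> bool" where
  "hom_finite C \<longleftrightarrow> (\<forall>X Y. finite_dim_sub (Scal C) (Mor C X Y))"

definition inverse_maps :: "('k::field, 'o, 'v::ab_group_add) tcat \<Rightarrow> 'o \<Rightarrow> 'o \<Rightarrow> 'v \<Rightarrow> 'v \<Rightarrow> bool" where
  "inverse_maps C X Y f g \<longleftrightarrow>
     f \<in> Mor C X Y \<and> g \<in> Mor C Y X \<and> Cmp C X Y X g f = Idm C X \<and> Cmp C Y X Y f g = Idm C Y"

definition is_iso :: "('k::field, 'o, 'v::ab_group_add) tcat \<Rightarrow> 'o \<Rightarrow> 'o \<Rightarrow> 'v \<Rightarrow> bool" where
  "is_iso C X Y f \<longleftrightarrow> (\<exists>g. inverse_maps C X Y f g)"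

definition isomorphic :: "('k::field, 'o, 'v::ab_group_add) tcat \<Rightarrow> 'o \<Rightarrow> 'o \<Rightarrow> bool" where
  "isomorphic C X Y \<longleftrightarrow> (\<exists>f. is_iso C X Y f)"

definition zero_object :: "('k::field, 'o, 'v::ab_group_add) tcat \<Rightarrow> 'o \<Rightarrow> bool" where
  "zero_object C X \<longleftrightarrow> Idm C X = 0"

text \<open>\<open>S\<close> is the direct sum of the finite family \<open>Xs\<close> with inclusions \<open>\<iota>\<close> and projections \<open>\<pi>\<close>;
  for an empty index set this says that \<open>S\<close> is a zero object.\<close>

definition direct_sum ::
  "('k::field, 'o, 'v::ab_group_add) tcat \<Rightarrow> 'o \<Rightarrow> 'i set \<Rightarrow> ('i \<Rightarrow> 'o) \<Rightarrow> ('i \<Rightarrow> 'v) \<Rightarrow> ('i \<Rightarrow> 'v) \<Rightarrow> bool" where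
  "direct_sum C S I Xs \<iota> \<pi> \<longleftrightarrow>
     finite I \<and> (\<forall>i\<in>I. \<iota> i \<in> Mor C (Xs i) S \<and> \<pi> i \<in> Mor C S (Xs i)) \<and>
     (\<forall>i\<in>I. \<forall>j\<in>I. Cmp C (Xs i) S (Xs j) (\<pi> j) (\<iota> i) = (if i = j then Idm C (Xs i) else 0)) \<and>
     (\<Sum>i\<in>I. Cmp C S (Xs i) S (\<iota> i) (\<pi> i)) = Idm C S"

definition is_sum_of_two :: "('k::field, 'o, 'v::ab_group_add) tcat \<Rightarrow> 'o \<Rightarrow> 'o \<Rightarrow> 'o \<Rightarrow> bool" where
  "is_sum_of_two C S X Y \<longleftrightarrow> (\<exists>\<iota> \<pi>. direct_sum C S (UNIV :: bool set) (\<lambda>b. if b then X else Y) \<iota> \<pi>)"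

definition direct_factor :: "('k::field, 'o, 'v::ab_group_add) tcat \<Rightarrow> 'o \<Rightarrow> 'o \<Rightarrow> bool" where
  "direct_factor C X S \<longleftrightarrow> (\<exists>Y. is_sum_of_two C S X Y)"

definition indecomposable :: "('k::field, 'o, 'v::ab_group_add) tcat \<Rightarrow> 'o \<Rightarrow> bool" where
  "indecomposable C X \<longleftrightarrow>
     \<not> zero_object C X \<and> (\<forall>Y Z. is_sum_of_two C X Y Z \<longrightarrow> zero_object C Y \<or> zero_object C Z)"

definition additive_category :: "('k::field, 'o, 'v::ab_group_add) tcat \<Rightarrow> bool" where
  "additive_category C \<longleftrightarrow> (\<exists>Z. zero_object C Z) \<and> (\<forall>X Y. \<exists>S. is_sum_of_two C S X Y)"

definition split_idempotents :: "('k::field, 'o, 'v::ab_group_add) tcat \<Rightarrow> bool" where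
  "split_idempotents C \<longleftrightarrow>
     (\<forall>X. \<forall>e\<in>Mor C X X. Cmp C X X X e e = e \<longrightarrow>
        (\<exists>Y. \<exists>p\<in>Mor C X Y. \<exists>i\<in>Mor C Y X. Cmp C X Y X i p = e \<and> Cmp C Y X Y p i = Idm C Y))"

section \<open>Triangulated 2-Calabi-Yau categories\<close>

text \<open>The suspension is allowed to be any \<open>k\<close>-linear autoequivalence.\<close>

definition suspension :: "('k::field, 'o, 'v::ab_group_add) tcat \<Rightarrow> bool" where
  "suspension C \<longleftrightarrow>
     (\<forall>X Y. linear_on_sub (Scal C) (Scal C) (Mor C X Y) (Mor C (Sus C X) (Sus C Y)) (SusM C X Y)) \<and>
     (\<forall>X Y. bij_betw (SusM C X Y) (Mor C X Y) (Mor C (Sus C X) (Sus C Y))) \<and>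
     (\<forall>X. SusM C X X (Idm C X) = Idm C (Sus C X)) \<and>
     (\<forall>X Y Z. \<forall>f\<in>Mor C X Y. \<forall>g\<in>Mor C Y Z.
        SusM C X Z (Cmp C X Y Z g f) = Cmp C (Sus C X) (Sus C Y) (Sus C Z) (SusM C Y Z g) (SusM C X Y f)) \<and>
     (\<forall>Y. \<exists>X. isomorphic C (Sus C X) Y)"

definition triangulated :: "('k::field, 'o, 'v::ab_group_add) tcat \<Rightarrow> bool" where
  "triangulated C \<longleftrightarrow>
     additive_category C \<and> suspension C \<and>
     (\<forall>X Y Z u v w. Tri C X Y Z u v w \<longrightarrow> u \<in> Mor C X Y \<and> v \<in> Mor C Y Z \<and> w \<in> Mor C Z (Sus C X)) \<and>
     \<comment> \<open>TR1\<close>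
     (\<forall>X Y Z u v w X' Y' Z' u' v' w' a b c.
        Tri C X Y Z u v w \<and> u' \<in> Mor C X' Y' \<and> v' \<in> Mor C Y' Z' \<and> w' \<in> Mor C Z' (Sus C X') \<and>
        is_iso C X X' a \<and> is_iso C Y Y' b \<and> is_iso C Z Z' c \<and>
        Cmp C X Y Y' b u = Cmp C X X' Y' u' a \<and> Cmp C Y Z Z' c v = Cmp C Y Y' Z' v' b \<and>
        Cmp C Z (Sus C X) (Sus C X') (SusM C X X' a) w = Cmp C Z Z' (Sus C X') w' c
        \<longrightarrow> Tri C X' Y' Z' u' v' w') \<and>
     (\<forall>X Z. zero_object C Z \<longrightarrow> Tri C X X Z (Idm C X) 0 0) \<and>
     (\<forall>X Y. \<forall>u\<in>Mor C X Y. \<exists>Z v w. Tri C X Y Z u v w) \<and>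
     \<comment> \<open>TR2\<close>
     (\<forall>X Y Z. \<forall>u\<in>Mor C X Y. \<forall>v\<in>Mor C Y Z. \<forall>w\<in>Mor C Z (Sus C X).
        Tri C X Y Z u v w \<longleftrightarrow> Tri C Y Z (Sus C X) v w (- SusM C X Y u)) \<and>
     \<comment> \<open>TR3\<close>
     (\<forall>X Y Z u v w X' Y' Z' u' v' w'. \<forall>a\<in>Mor C X X'. \<forall>b\<in>Mor C Y Y'.
        Tri C X Y Z u v w \<and> Tri C X' Y' Z' u' v' w' \<and> Cmp C X Y Y' b u = Cmp C X X' Y' u' a \<longrightarrow>
        (\<exists>c\<in>Mor C Z Z'. Cmp C Y Z Z' c v = Cmp C Y Y' Z' v' b \<and>
           Cmp C Z (Sus C X) (Sus C X') (SusM C X X' a) w = Cmp C Z Z' (Sus C X') w' c)) \<and>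
     \<comment> \<open>TR4\<close>
     (\<forall>X Y Z X' Y' Z' u v i i' j j' m m'.
        Tri C X Y Z' u i i' \<and> Tri C Y Z X' v j j' \<and> Tri C X Z Y' (Cmp C X Y Z v u) m m' \<longrightarrow>
        (\<exists>f\<in>Mor C Z' Y'. \<exists>g\<in>Mor C Y' X'.
           Tri C Z' Y' X' f g (Cmp C X' (Sus C Y) (Sus C Z') (SusM C Y Z' i) j') \<and>
           Cmp C Y Z Y' m v = Cmp C Y Z' Y' f i \<and> Cmp C Z' Y' (Sus C X) m' f = i' \<and>
           Cmp C Z Y' X' g m = j \<and>
           Cmp C Y' X' (Sus C Y) j' g = Cmp C Y' (Sus C X) (Sus C Y) (SusM C X Y u) m'))"

definition SusPow :: "('k, 'o, 'v) tcat \<Rightarrow> nat \<Rightarrow> 'o \<Rightarrow> 'o" where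
  "SusPow C p X = (Sus C ^^ p) X"

primrec SusPowM :: "('k, 'o, 'v) tcat \<Rightarrow> nat \<Rightarrow> 'o \<Rightarrow> 'o \<Rightarrow> 'v \<Rightarrow> 'v" where
  "SusPowM C 0 X Y f = f"
| "SusPowM C (Suc p) X Y f = SusM C (SusPow C p X) (SusPow C p Y) (SusPowM C p X Y f)"

text \<open>
  The sign rule is imposed for natural numbers \<open>p + q = 2\<close>. The case \<open>p = q = 1\<close> with an identity as
  second argument gives \<open>t (\<Sigma> h) = - t h\<close>, and with this the rule for all integers \<open>p, q\<close> follows.
\<close>

definition two_calabi_yau :: "('k::field, 'o, 'v::ab_group_add) tcat \<Rightarrow> bool" where
  "two_calabi_yau C \<longleftrightarrow> (\<exists>t :: 'o \<Rightarrow> 'v \<Rightarrow> 'k.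
     (\<forall>X. linear_on_sub (Scal C) (*) (Mor C X (SusPow C 2 X)) UNIV (t X)) \<and>
     (\<forall>X Y. \<forall>g\<in>Mor C X Y. (\<forall>f\<in>Mor C Y (SusPow C 2 X). t X (Cmp C X Y (SusPow C 2 X) f g) = 0) \<longrightarrow> g = 0) \<and>
     (\<forall>X Y. \<forall>f\<in>Mor C Y (SusPow C 2 X). (\<forall>g\<in>Mor C X Y. t X (Cmp C X Y (SusPow C 2 X) f g) = 0) \<longrightarrow> f = 0) \<and>
     (\<forall>p q X Y. p + q = 2 \<longrightarrow>
        (\<forall>f\<in>Mor C Y (SusPow C q X). \<forall>g\<in>Mor C X (SusPow C p Y).
           t X (Cmp C X (SusPow C p Y) (SusPow C 2 X) (SusPowM C p Y (SusPow C q X) f) g)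
           = (-1) ^ (p * q) * t Y (Cmp C Y (SusPow C q X) (SusPow C 2 Y) (SusPowM C q X (SusPow C p Y) g) f))))"

definition ext1_zero :: "('k, 'o, 'v::ab_group_add) tcat \<Rightarrow> 'o \<Rightarrow> 'o \<Rightarrow> bool" where
  "ext1_zero C X Y \<longleftrightarrow> Mor C X (Sus C Y) = {0}"

definition rigid :: "('k, 'o, 'v::ab_group_add) tcat \<Rightarrow> 'o \<Rightarrow> bool" where
  "rigid C X \<longleftrightarrow> ext1_zero C X X"

section \<open>Cluster-tilting subcategories and cluster structures\<close>

text \<open>Full subcategories are represented by their sets of objects.\<close>

definition additive_subcat :: "('k::field, 'o, 'v::ab_group_add) tcat \<Rightarrow> 'o set \<Rightarrow> bool" where
  "additive_subcat C \<T> \<longleftrightarrow>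
     (\<forall>Z. zero_object C Z \<longrightarrow> Z \<in> \<T>) \<and>
     (\<forall>X\<in>\<T>. \<forall>Y\<in>\<T>. \<forall>S. is_sum_of_two C S X Y \<longrightarrow> S \<in> \<T>) \<and>
     (\<forall>Y\<in>\<T>. \<forall>X. direct_factor C X Y \<longrightarrow> X \<in> \<T>)"

definition add_of :: "('k::field, 'o, 'v::ab_group_add) tcat \<Rightarrow> 'o set \<Rightarrow> 'o set" where
  "add_of C \<S> = {X. \<exists>S m Xs \<iota> \<pi>. direct_sum C S {..<m::nat} Xs \<iota> \<pi> \<and> (\<forall>i<m. Xs i \<in> \<S>) \<and> direct_factor C X S}"

definition left_approx :: "('k, 'o, 'v) tcat \<Rightarrow> 'o set \<Rightarrow> 'o \<Rightarrow> 'o \<Rightarrow> 'v \<Rightarrow> bool" where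
  "left_approx C \<W> X W f \<longleftrightarrow>
     W \<in> \<W> \<and> f \<in> Mor C X W \<and> (\<forall>W'\<in>\<W>. \<forall>g\<in>Mor C X W'. \<exists>h\<in>Mor C W W'. g = Cmp C X W W' h f)"

definition right_approx :: "('k, 'o, 'v) tcat \<Rightarrow> 'o set \<Rightarrow> 'o \<Rightarrow> 'o \<Rightarrow> 'v \<Rightarrow> bool" where
  "right_approx C \<W> W X f \<longleftrightarrow>
     W \<in> \<W> \<and> f \<in> Mor C W X \<and> (\<forall>W'\<in>\<W>. \<forall>g\<in>Mor C W' X. \<exists>h\<in>Mor C W' W. g = Cmp C W' W X f h)"

definition min_left_approx :: "('k::field, 'o, 'v::ab_group_add) tcat \<Rightarrow> 'o set \<Rightarrow> 'o \<Rightarrow> 'o \<Rightarrow> 'v \<Rightarrow> bool" where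
  "min_left_approx C \<W> X W f \<longleftrightarrow>
     left_approx C \<W> X W f \<and> (\<forall>h\<in>Mor C W W. Cmp C X W W h f = f \<longrightarrow> is_iso C W W h)"

definition min_right_approx :: "('k::field, 'o, 'v::ab_group_add) tcat \<Rightarrow> 'o set \<Rightarrow> 'o \<Rightarrow> 'o \<Rightarrow> 'v \<Rightarrow> bool" where
  "min_right_approx C \<W> W X f \<longleftrightarrow>
     right_approx C \<W> W X f \<and> (\<forall>h\<in>Mor C W W. Cmp C W W X f h = f \<longrightarrow> is_iso C W W h)"

text \<open>
  By Yoneda, an epimorphism from a representable functor onto the restriction of \<open>C(X,?)\<close>
  (respectively \<open>C(?,X)\<close>) to \<open>\<T>\<close> is a left (respectively right) \<open>\<T>\<close>-approximation of \<open>X\<close>; since \<open>\<T>\<close>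
  is additive, one representable functor suffices for finite generation.
\<close>

definition cluster_tilting :: "('k::field, 'o, 'v::ab_group_add) tcat \<Rightarrow> 'o set \<Rightarrow> bool" where
  "cluster_tilting C \<T> \<longleftrightarrow>
     additive_subcat C \<T> \<and>
     (\<forall>X. (\<exists>W f. left_approx C \<T> X W f) \<and> (\<exists>W f. right_approx C \<T> W X f)) \<and>
     (\<forall>X. X \<in> \<T> \<longleftrightarrow> (\<forall>T'\<in>\<T>. ext1_zero C T' X))"

definition basic :: "('k::field, 'o, 'v::ab_group_add) tcat \<Rightarrow> 'o \<Rightarrow> bool" where
  "basic C T \<longleftrightarrow> (\<exists>m Xs \<iota> \<pi>. direct_sum C T {..<m::nat} Xs \<iota> \<pi> \<and> (\<forall>i<m. indecomposable C (Xs i)) \<and>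
      (\<forall>i<m. \<forall>j<m. i \<noteq> j \<longrightarrow> \<not> isomorphic C (Xs i) (Xs j)))"

definition cluster_tilting_object :: "('k::field, 'o, 'v::ab_group_add) tcat \<Rightarrow> 'o \<Rightarrow> bool" where
  "cluster_tilting_object C T \<longleftrightarrow> basic C T \<and> cluster_tilting C (add_of C {T})"

definition indec :: "('k::field, 'o, 'v::ab_group_add) tcat \<Rightarrow> 'o set \<Rightarrow> 'o set" where
  "indec C \<T> = {X \<in> \<T>. indecomposable C X}"

definition rad :: "('k::field, 'o, 'v::ab_group_add) tcat \<Rightarrow> 'o \<Rightarrow> 'o \<Rightarrow> 'v set" where
  "rad C X Y = {f \<in> Mor C X Y. \<forall>g\<in>Mor C Y X. is_iso C X X (Idm C X - Cmp C X Y X g f)}"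

definition rad2 :: "('k::field, 'o, 'v::ab_group_add) tcat \<Rightarrow> 'o set \<Rightarrow> 'o \<Rightarrow> 'o \<Rightarrow> 'v set" where
  "rad2 C \<T> X Y = Modules.module.span (Scal C)
     (\<Union>Z\<in>\<T>. {Cmp C X Z Y g f |f g. f \<in> rad C X Z \<and> g \<in> rad C Z Y})"

definition vdim :: "('k::field, 'o, 'v::ab_group_add) tcat \<Rightarrow> 'v set \<Rightarrow> nat" where
  "vdim C V = vector_space.dim (Scal C) V"

text \<open>The quiver \<open>Q(\<T>)\<close> is given by its arrow numbers on representatives of the isoclasses.\<close>

definition arrows :: "('k::field, 'o, 'v::ab_group_add) tcat \<Rightarrow> 'o set \<Rightarrow> 'o \<Rightarrow> 'o \<Rightarrow> nat" where
  "arrows C \<T> X Y = vdim C (rad C X Y) - vdim C (rad2 C \<T> X Y)"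

definition quiver_matrix :: "('a \<Rightarrow> 'a \<Rightarrow> nat) \<Rightarrow> 'a \<Rightarrow> 'a \<Rightarrow> int" where
  "quiver_matrix q i j = int (q i j) - int (q j i)"

definition matrix_mutation :: "'a \<Rightarrow> ('a \<Rightarrow> 'a \<Rightarrow> int) \<Rightarrow> 'a \<Rightarrow> 'a \<Rightarrow> int" where
  "matrix_mutation s b i j =
     (if i = s \<or> j = s then - b i j else b i j + sgn (b i s) * max 0 (b i s * b s j))"

text \<open>The quiver without loops and 2-cycles whose antisymmetric matrix is the mutated one.\<close>

definition quiver_mutation :: "'a \<Rightarrow> ('a \<Rightarrow> 'a \<Rightarrow> nat) \<Rightarrow> 'a \<Rightarrow> 'a \<Rightarrow> nat" where
  "quiver_mutation s q i j = nat (matrix_mutation s (quiver_matrix q) i j)"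

definition is_mutation ::
  "('k::field, 'o, 'v::ab_group_add) tcat \<Rightarrow> 'o set \<Rightarrow> 'o \<Rightarrow> 'o \<Rightarrow> 'o set \<Rightarrow> bool" where
  "is_mutation C \<T> M M' \<T>' \<longleftrightarrow>
     indecomposable C M' \<and> \<not> isomorphic C M' M \<and> cluster_tilting C \<T>' \<and>
     indec C \<T>' = {X \<in> indec C \<T>. \<not> isomorphic C X M} \<union> {X. isomorphic C X M'}"

text \<open>In the last clause the vertex \<open>M'\<close> of the mutated quiver corresponds to the vertex \<open>M\<close>.\<close>

definition cluster_structure :: "('k::field, 'o, 'v::ab_group_add) tcat \<Rightarrow> bool" where
  "cluster_structure C \<longleftrightarrow>
     (\<exists>\<T>. cluster_tilting C \<T>) \<and>
     (\<forall>\<T> M. cluster_tilting C \<T> \<and> M \<in> indec C \<T> \<longrightarrow>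
        (\<exists>M' \<T>'. is_mutation C \<T> M M' \<T>') \<and>
        (\<forall>M1 M2 \<T>1 \<T>2. is_mutation C \<T> M M1 \<T>1 \<and> is_mutation C \<T> M M2 \<T>2 \<longrightarrow> isomorphic C M1 M2)) \<and>
     (\<forall>\<T> M M' \<T>'. cluster_tilting C \<T> \<and> M \<in> indec C \<T> \<and> is_mutation C \<T> M M' \<T>' \<longrightarrow>
        (\<exists>E f g w. Tri C M' E M f g w \<and>
           min_right_approx C (\<T> \<inter> \<T>') E M g \<and> min_left_approx C (\<T> \<inter> \<T>') M' E f) \<and>
        (\<exists>E s t w. Tri C M E M' s t w \<and>
           min_right_approx C (\<T> \<inter> \<T>') E M' t \<and> min_left_approx C (\<T> \<inter> \<T>') M E s)) \<and>
     (\<forall>\<T>. cluster_tilting C \<T> \<longrightarrow>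
        (\<forall>X\<in>indec C \<T>. arrows C \<T> X X = 0) \<and>
        (\<forall>X\<in>indec C \<T>. \<forall>Y\<in>indec C \<T>. arrows C \<T> X Y = 0 \<or> arrows C \<T> Y X = 0)) \<and>
     (\<forall>\<T> M M' \<T>'. cluster_tilting C \<T> \<and> M \<in> indec C \<T> \<and> is_mutation C \<T> M M' \<T>' \<longrightarrow>
        (let \<rho> = (\<lambda>Z. if isomorphic C Z M' then M else Z) in
         \<forall>X\<in>indec C \<T>'. \<forall>Y\<in>indec C \<T>'.
           arrows C \<T>' X Y = quiver_mutation M (arrows C \<T>) (\<rho> X) (\<rho> Y)))"

definition cy_realization ::
  "('k::alg_closed_field, 'o, 'v::ab_group_add) tcat \<Rightarrow> nat \<Rightarrow> (nat \<Rightarrow> nat \<Rightarrow> int) \<Rightarrow> 'o \<Rightarrow> (nat \<Rightarrow> 'o)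
     \<Rightarrow> (nat \<Rightarrow> 'v) \<Rightarrow> (nat \<Rightarrow> 'v) \<Rightarrow> bool" where
  "cy_realization C n B T Ts \<iota> \<pi> \<longleftrightarrow>
     linear_category C \<and> hom_finite C \<and> triangulated C \<and> split_idempotents C \<and> two_calabi_yau C \<and>
     cluster_structure C \<and> cluster_tilting_object C T \<and>
     direct_sum C T {1..n} Ts \<iota> \<pi> \<and>
     (\<forall>i\<in>{1..n}. indecomposable C (Ts i)) \<and>
     (\<forall>i\<in>{1..n}. \<forall>j\<in>{1..n}. i \<noteq> j \<longrightarrow> \<not> isomorphic C (Ts i) (Ts j)) \<and>
     (\<forall>i\<in>{1..n}. \<forall>j\<in>{1..n}. quiver_matrix (arrows C (add_of C {T})) (Ts i) (Ts j) = B i j)"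

inductive reachable_ct ::
  "('k::field, 'o, 'v::ab_group_add) tcat \<Rightarrow> 'o set \<Rightarrow> 'o set \<Rightarrow> 'o \<Rightarrow> 'o \<Rightarrow> bool"
  for C \<U> \<P> T where
  start: "reachable_ct C \<U> \<P> T T"
| mutate: "reachable_ct C \<U> \<P> T R'"
    if "reachable_ct C \<U> \<P> T R" "X \<in> \<U>" "indecomposable C X" "rigid C X" "X \<notin> \<P>" "X \<in> add_of C {R}"
       "cluster_tilting_object C R'" "R' \<in> \<U>" "is_mutation C (add_of C {R}) X X' (add_of C {R'})"

definition reachable ::
  "('k::field, 'o, 'v::ab_group_add) tcat \<Rightarrow> 'o set \<Rightarrow> 'o set \<Rightarrow> 'o \<Rightarrow> 'o \<Rightarrow> bool" where
  "reachable C \<U> \<P> T M \<longleftrightarrow>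
     indecomposable C M \<and> rigid C M \<and> M \<in> \<U> \<and> (\<exists>R. reachable_ct C \<U> \<P> T R \<and> direct_factor C M R)"

section \<open>Modules over the endomorphism algebra\<close>

text \<open>A right module over \<open>End(T)\<close> whose underlying space is a subspace of the ambient space.\<close>

record 'v rmod =
  Car :: "'v set"
  Act :: "'v \<Rightarrow> 'v \<Rightarrow> 'v"

definition is_rmod :: "('k::field, 'o, 'v::ab_group_add) tcat \<Rightarrow> 'o \<Rightarrow> 'v rmod \<Rightarrow> bool" where
  "is_rmod C T L \<longleftrightarrow>
     Modules.module.subspace (Scal C) (Car L) \<and>
     (\<forall>a\<in>Mor C T T. linear_on_sub (Scal C) (Scal C) (Car L) (Car L) (\<lambda>x. Act L x a)) \<and>
     (\<forall>x\<in>Car L. linear_on_sub (Scal C) (Scal C) (Mor C T T) (Car L) (Act L x)) \<and>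
     (\<forall>x\<in>Car L. Act L x (Idm C T) = x) \<and>
     (\<forall>x\<in>Car L. \<forall>a\<in>Mor C T T. \<forall>b\<in>Mor C T T. Act L (Act L x a) b = Act L x (Cmp C T T T a b))"

definition rmod_map ::
  "('k::field, 'o, 'v::ab_group_add) tcat \<Rightarrow> 'o \<Rightarrow> 'v rmod \<Rightarrow> 'v rmod \<Rightarrow> ('v \<Rightarrow> 'v) \<Rightarrow> bool" where
  "rmod_map C T L N f \<longleftrightarrow> linear_on_sub (Scal C) (Scal C) (Car L) (Car N) f \<and>
     (\<forall>x\<in>Car L. \<forall>a\<in>Mor C T T. f (Act L x a) = Act N (f x) a)"

definition submodule :: "('k::field, 'o, 'v::ab_group_add) tcat \<Rightarrow> 'o \<Rightarrow> 'v rmod \<Rightarrow> 'v set \<Rightarrow> bool" where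
  "submodule C T L N \<longleftrightarrow> N \<subseteq> Car L \<and> Modules.module.subspace (Scal C) N \<and>
     (\<forall>x\<in>N. \<forall>a\<in>Mor C T T. Act L x a \<in> N)"

definition simple_rmod :: "('k::field, 'o, 'v::ab_group_add) tcat \<Rightarrow> 'o \<Rightarrow> 'v rmod \<Rightarrow> bool" where
  "simple_rmod C T L \<longleftrightarrow>
     is_rmod C T L \<and> Car L \<noteq> {0} \<and> (\<forall>N. submodule C T L N \<longrightarrow> N = {0} \<or> N = Car L)"

definition hom_module :: "('k, 'o, 'v) tcat \<Rightarrow> 'o \<Rightarrow> 'o \<Rightarrow> 'v rmod" where
  "hom_module C T X = \<lparr>Car = Mor C T X, Act = Cmp C T T X\<rparr>"

text \<open>
  The simple top of the indecomposable projective \<open>C(T,X)\<close> is its simple quotient. It is determined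
  up to isomorphism, and it can be realised on a subspace of the ambient space, namely on a
  complement of the maximal submodule of \<open>C(T,X)\<close>.
\<close>

definition simple_top :: "('k::field, 'o, 'v::ab_group_add) tcat \<Rightarrow> 'o \<Rightarrow> 'o \<Rightarrow> 'v rmod" where
  "simple_top C T X = (SOME S. simple_rmod C T S \<and>
     (\<exists>\<phi>. rmod_map C T (hom_module C T X) S \<phi> \<and> \<phi> ` Mor C T X = Car S))"

text \<open>Spaces of maps consist of functions vanishing outside the module(s) concerned.\<close>

definition hom_space :: "('k::field, 'o, 'v::ab_group_add) tcat \<Rightarrow> 'o \<Rightarrow> 'v rmod \<Rightarrow> 'v rmod \<Rightarrow> ('v \<Rightarrow> 'v) set" where
  "hom_space C T L N = {f. rmod_map C T L N f \<and> (\<forall>x. x \<notin> Car L \<longrightarrow> f x = 0)}"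

definition dim_hom :: "('k::field, 'o, 'v::ab_group_add) tcat \<Rightarrow> 'o \<Rightarrow> 'v rmod \<Rightarrow> 'v rmod \<Rightarrow> nat" where
  "dim_hom C T L N = vector_space.dim (\<lambda>c f x. Scal C c (f x)) (hom_space C T L N)"

text \<open>
  An extension of \<open>L\<close> by \<open>N\<close> splits over \<open>k\<close>, hence is \<open>N \<times> L\<close> with
  \<open>(y, x) a = (y a + \<psi> x a, x a)\<close> for a bilinear \<open>\<psi>\<close>. Associativity of this action is the condition
  in \<open>ext_cocycles\<close>, and \<open>\<psi>\<close> and \<open>\<psi>'\<close> yield equivalent extensions iff \<open>\<psi> - \<psi>'\<close> lies in
  \<open>ext_coboundaries\<close>.
\<close>

definition ext_cocycles ::
  "('k::field, 'o, 'v::ab_group_add) tcat \<Rightarrow> 'o \<Rightarrow> 'v rmod \<Rightarrow> 'v rmod \<Rightarrow> ('v \<Rightarrow> 'v \<Rightarrow> 'v) set" where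
  "ext_cocycles C T L N = {\<psi>.
     (\<forall>x a. x \<notin> Car L \<or> a \<notin> Mor C T T \<longrightarrow> \<psi> x a = 0) \<and>
     (\<forall>a\<in>Mor C T T. linear_on_sub (Scal C) (Scal C) (Car L) (Car N) (\<lambda>x. \<psi> x a)) \<and>
     (\<forall>x\<in>Car L. linear_on_sub (Scal C) (Scal C) (Mor C T T) (Car N) (\<psi> x)) \<and>
     (\<forall>x\<in>Car L. \<forall>a\<in>Mor C T T. \<forall>b\<in>Mor C T T.
        \<psi> x (Cmp C T T T a b) = Act N (\<psi> x a) b + \<psi> (Act L x a) b)}"

definition ext_coboundaries ::
  "('k::field, 'o, 'v::ab_group_add) tcat \<Rightarrow> 'o \<Rightarrow> 'v rmod \<Rightarrow> 'v rmod \<Rightarrow> ('v \<Rightarrow> 'v \<Rightarrow> 'v) set" where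
  "ext_coboundaries C T L N = {\<psi>.
     (\<forall>x a. x \<notin> Car L \<or> a \<notin> Mor C T T \<longrightarrow> \<psi> x a = 0) \<and>
     (\<exists>\<theta>. linear_on_sub (Scal C) (Scal C) (Car L) (Car N) \<theta> \<and>
        (\<forall>x\<in>Car L. \<forall>a\<in>Mor C T T. \<psi> x a = Act N (\<theta> x) a - \<theta> (Act L x a)))}"

definition dim_ext1 :: "('k::field, 'o, 'v::ab_group_add) tcat \<Rightarrow> 'o \<Rightarrow> 'v rmod \<Rightarrow> 'v rmod \<Rightarrow> nat" where
  "dim_ext1 C T L N =
     vector_space.dim (\<lambda>c \<psi> x a. Scal C c (\<psi> x a)) (ext_cocycles C T L N)
     - vector_space.dim (\<lambda>c \<psi> x a. Scal C c (\<psi> x a)) (ext_coboundaries C T L N)"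

definition mod_form :: "('k::field, 'o, 'v::ab_group_add) tcat \<Rightarrow> 'o \<Rightarrow> 'v rmod \<Rightarrow> 'v rmod \<Rightarrow> int" where
  "mod_form C T L N = int (dim_hom C T L N) - int (dim_ext1 C T L N)"

definition mod_form_a :: "('k::field, 'o, 'v::ab_group_add) tcat \<Rightarrow> 'o \<Rightarrow> 'v rmod \<Rightarrow> 'v rmod \<Rightarrow> int" where
  "mod_form_a C T L N = mod_form C T L N - mod_form C T N L"

text \<open>
  By Jordan-Hoelder, the Grothendieck group of finite-dimensional modules is free on the classes of
  the simples \<open>S\<^sub>1, \<dots>, S\<^sub>n\<close>: \<open>mod_class C T Ts n act N e\<close> says that \<open>N\<close> (with the action \<open>act\<close>) has
  the class \<open>\<Sum> e\<^sub>i [S\<^sub>i]\<close>, read off a composition series.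
\<close>

inductive mod_class ::
  "('k::field, 'o, 'v::ab_group_add) tcat \<Rightarrow> 'o \<Rightarrow> (nat \<Rightarrow> 'o) \<Rightarrow> nat \<Rightarrow> ('v \<Rightarrow> 'v \<Rightarrow> 'v) \<Rightarrow> 'v set \<Rightarrow> (nat \<Rightarrow> nat) \<Rightarrow> bool"
  for C T Ts n act where
  zero: "mod_class C T Ts n act {0} (\<lambda>_. 0)"
| step: "mod_class C T Ts n act N (e(i := Suc (e i)))"
    if "mod_class C T Ts n act N' e" "is_rmod C T \<lparr>Car = N, Act = act\<rparr>" "i \<in> {1..n}"
       "rmod_map C T \<lparr>Car = N, Act = act\<rparr> (simple_top C T (Ts i)) \<phi>"
       "\<phi> ` N = Car (simple_top C T (Ts i))" "{x \<in> N. \<phi> x = 0} = N'"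

text \<open>The dimension of the component \<open>L \<epsilon>\<^sub>i\<close> of \<open>L\<close> at the vertex \<open>i\<close>, where \<open>\<epsilon>\<^sub>i = \<iota>\<^sub>i \<pi>\<^sub>i\<close> is the
  idempotent of \<open>End(T)\<close> belonging to \<open>T\<^sub>i\<close>.\<close>

definition dim_vector ::
  "('k::field, 'o, 'v::ab_group_add) tcat \<Rightarrow> 'o \<Rightarrow> (nat \<Rightarrow> 'o) \<Rightarrow> (nat \<Rightarrow> 'v) \<Rightarrow> (nat \<Rightarrow> 'v) \<Rightarrow> 'v rmod \<Rightarrow> nat \<Rightarrow> nat" where
  "dim_vector C T Ts \<iota> \<pi> L i = vdim C ((\<lambda>x. Act L x (Cmp C T (Ts i) T (\<iota> i) (\<pi> i))) ` Car L)"

section \<open>Euler characteristics\<close>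

text \<open>
  A variety over \<open>k\<close> is given by its set of \<open>k\<close>-points together with a set of affine charts; a chart
  \<open>(D, \<psi>)\<close> identifies a closed subset \<open>D\<close> of an affine space (with coordinates indexed by \<open>'i\<close>, only
  finitely many of which are nonzero on \<open>D\<close>) with an open subset of the variety.
\<close>

type_synonym ('i, 'k, 'p) chart = "('i \<Rightarrow> 'k) set \<times> (('i \<Rightarrow> 'k) \<Rightarrow> 'p)"

inductive_set polyfuns :: "(('j \<Rightarrow> 'k::comm_ring_1) \<Rightarrow> 'k) set" where
  const: "(\<lambda>_. c) \<in> polyfuns"
| coord: "(\<lambda>x. x j) \<in> polyfuns"
| add: "p \<in> polyfuns \<Longrightarrow> q \<in> polyfuns \<Longrightarrow> (\<lambda>x. p x + q x) \<in> polyfuns"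
| mult: "p \<in> polyfuns \<Longrightarrow> q \<in> polyfuns \<Longrightarrow> (\<lambda>x. p x * q x) \<in> polyfuns"

definition regular_on :: "('j \<Rightarrow> 'k::field) set \<Rightarrow> (('j \<Rightarrow> 'k) \<Rightarrow> 'k) \<Rightarrow> bool" where
  "regular_on Z g \<longleftrightarrow> (\<forall>z\<in>Z. \<exists>p\<in>polyfuns. \<exists>q\<in>polyfuns. q z \<noteq> 0 \<and>
     (\<forall>z'\<in>Z. q z' \<noteq> 0 \<longrightarrow> g z' = p z' / q z'))"

subsection \<open>Etale coverings and \<open>l\<close>-adic cohomology\<close>

text \<open>
  Locally for the Zariski topology, every etale map to the variety is standard etale: over a chart
  \<open>D\<close> it is the projection to \<open>D\<close> of the set of all \<open>(a, t)\<close> with \<open>f(a)(t) = 0\<close>, \<open>f(a)'(t) \<noteq> 0\<close> and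
  \<open>h(a)(t) \<noteq> 0\<close>, where \<open>f\<close> and \<open>h\<close> are polynomials in \<open>t\<close> whose coefficients are polynomial functions
  of \<open>a\<close>. Hence the finite coverings by such pieces are cofinal among all etale coverings. The point
  \<open>(a, t)\<close> is encoded as \<open>z\<close> with \<open>a = z \<circ> Some\<close> and \<open>t = z None\<close>.
\<close>

type_synonym ('i, 'k, 'p) piece =
  "('i, 'k, 'p) chart \<times> (('i \<Rightarrow> 'k) \<Rightarrow> 'k poly) \<times> (('i \<Rightarrow> 'k) \<Rightarrow> 'k poly)"

definition poly_family :: "(('i \<Rightarrow> 'k::field) \<Rightarrow> 'k poly) \<Rightarrow> bool" where
  "poly_family f \<longleftrightarrow> (\<exists>N. \<forall>a. degree (f a) \<le> N) \<and> (\<forall>m. (\<lambda>a. coeff (f a) m) \<in> polyfuns)"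

fun piece_pts :: "('i, 'k::field, 'p) piece \<Rightarrow> ('i option \<Rightarrow> 'k) set" where
  "piece_pts ((D, \<psi>), f, h) = {z. z \<circ> Some \<in> D \<and> poly (f (z \<circ> Some)) (z None) = 0 \<and>
     poly (pderiv (f (z \<circ> Some))) (z None) \<noteq> 0 \<and> poly (h (z \<circ> Some)) (z None) \<noteq> 0}"

fun piece_map :: "('i, 'k, 'p) piece \<Rightarrow> ('i option \<Rightarrow> 'k) \<Rightarrow> 'p" where
  "piece_map ((D, \<psi>), f, h) z = \<psi> (z \<circ> Some)"

definition etale_cover :: "'p set \<Rightarrow> ('i, 'k::field, 'p) chart set \<Rightarrow> ('i, 'k, 'p) piece list \<Rightarrow> bool" where
  "etale_cover X \<A> Us \<longleftrightarrow>
     (\<forall>(c, f, h)\<in>set Us. c \<in> \<A> \<and> poly_family f \<and> poly_family h) \<and>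
     (\<Union>u\<in>set Us. piece_map u ` piece_pts u) = X"

text \<open>
  The points of the fibre product over \<open>X\<close> of \<open>p + 1\<close> copies of the disjoint union of the pieces,
  as lists of pairs (index of a piece, point of that piece). For fixed indices they form a closed
  subset of a product of pieces, which carries the Zariski topology given by the coordinates
  \<open>tuple_coords\<close>. Cochains with values in \<open>\<int>/m\<close> are represented by integer-valued functions.
\<close>

type_synonym ('i, 'k) cpoint = "nat \<times> ('i option \<Rightarrow> 'k)"

definition cech_pts :: "('i, 'k::field, 'p) piece list \<Rightarrow> nat \<Rightarrow> ('i, 'k) cpoint list set" where
  "cech_pts Us p = {w. length w = Suc p \<and>
     (\<forall>(i, z)\<in>set w. i < length Us \<and> z \<in> piece_pts (Us ! i)) \<and>
     (\<forall>(i, z)\<in>set w. \<forall>(i', z')\<in>set w. piece_map (Us ! i) z = piece_map (Us ! i') z')}"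

definition tuple_coords :: "('i, 'k::zero) cpoint list \<Rightarrow> nat \<times> 'i option \<Rightarrow> 'k" where
  "tuple_coords w = (\<lambda>(s, c). if s < length w then snd (w ! s) c else 0)"

definition cochain :: "('i, 'k::field, 'p) piece list \<Rightarrow> nat \<Rightarrow> (('i, 'k) cpoint list \<Rightarrow> int) \<Rightarrow> bool" where
  "cochain Us p \<phi> \<longleftrightarrow> (\<forall>w\<in>cech_pts Us p. \<exists>q\<in>polyfuns. q (tuple_coords w) \<noteq> 0 \<and>
     (\<forall>w'\<in>cech_pts Us p. map fst w' = map fst w \<and> q (tuple_coords w') \<noteq> 0 \<longrightarrow> \<phi> w' = \<phi> w))"

definition cech_diff :: "(('i, 'k) cpoint list \<Rightarrow> int) \<Rightarrow> ('i, 'k) cpoint list \<Rightarrow> int" where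
  "cech_diff \<phi> w = (\<Sum>s<length w. (-1) ^ s * \<phi> (take s w @ drop (Suc s) w))"

definition cocycle ::
  "('i, 'k::field, 'p) piece list \<Rightarrow> int \<Rightarrow> nat \<Rightarrow> (('i, 'k) cpoint list \<Rightarrow> int) \<Rightarrow> bool" where
  "cocycle Us m p \<phi> \<longleftrightarrow> cochain Us p \<phi> \<and> (\<forall>w\<in>cech_pts Us (Suc p). m dvd cech_diff \<phi> w)"

definition refinement ::
  "('i, 'k::field, 'p) piece list \<Rightarrow> ('i, 'k, 'p) piece list \<Rightarrow> (('i, 'k) cpoint \<Rightarrow> ('i, 'k) cpoint) \<Rightarrow> bool" where
  "refinement Vs Us \<rho> \<longleftrightarrow> (\<forall>j<length Vs. \<exists>i<length Us.
     (\<forall>z\<in>piece_pts (Vs ! j). fst (\<rho> (j, z)) = i \<and> snd (\<rho> (j, z)) \<in> piece_pts (Us ! i) \<and>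
        piece_map (Us ! i) (snd (\<rho> (j, z))) = piece_map (Vs ! j) z) \<and>
     (\<forall>c. regular_on (piece_pts (Vs ! j)) (\<lambda>z. snd (\<rho> (j, z)) c)))"

text \<open>
  A class in the Cech cohomology of the constant sheaf \<open>\<int>/m\<close> (the direct limit over all coverings) is
  represented by a covering and a cocycle. \<open>cech_zero X \<A> m p cs\<close> says that the integral linear
  combination \<open>cs\<close> of such classes is zero, that is, becomes a coboundary on a common refinement.
  For projective varieties, this Cech cohomology is etale cohomology (Artin).
\<close>

type_synonym ('i, 'k, 'p) cclass = "('i, 'k, 'p) piece list \<times> (('i, 'k) cpoint list \<Rightarrow> int)"

definition cech_zero ::
  "'p set \<Rightarrow> ('i, 'k::field, 'p) chart set \<Rightarrow> int \<Rightarrow> nat \<Rightarrow> (int \<times> ('i, 'k, 'p) cclass) list \<Rightarrow> bool" where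
  "cech_zero X \<A> m p cs \<longleftrightarrow> (\<exists>Vs \<rho> \<eta>. etale_cover X \<A> Vs \<and>
     (\<forall>s<length cs. refinement Vs (fst (snd (cs ! s))) (\<rho> s)) \<and>
     (p > 0 \<longrightarrow> cochain Vs (p - 1) \<eta>) \<and>
     (\<forall>w\<in>cech_pts Vs p. [(\<Sum>s<length cs. fst (cs ! s) * snd (snd (cs ! s)) (map (\<rho> s) w))
                          = (if p = 0 then 0 else cech_diff \<eta> w)] (mod m)))"

text \<open>Elements of the inverse limit over \<open>m\<close> of the cohomology groups with coefficients \<open>\<int>/l\<^sup>m\<close>,
  as compatible systems of classes; similarly for the \<open>l\<close>-adic integers.\<close>

definition ladic_class ::
  "'p set \<Rightarrow> ('i, 'k::field, 'p) chart set \<Rightarrow> nat \<Rightarrow> nat \<Rightarrow> (nat \<Rightarrow> ('i, 'k, 'p) cclass) \<Rightarrow> bool" where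
  "ladic_class X \<A> l p \<xi> \<longleftrightarrow>
     (\<forall>m. etale_cover X \<A> (fst (\<xi> m)) \<and> cocycle (fst (\<xi> m)) (int l ^ m) p (snd (\<xi> m))) \<and>
     (\<forall>m. cech_zero X \<A> (int l ^ m) p [(1, \<xi> (Suc m)), (-1, \<xi> m)])"

definition ladic_int :: "nat \<Rightarrow> (nat \<Rightarrow> int) \<Rightarrow> bool" where
  "ladic_int l c \<longleftrightarrow> (\<forall>m. [c (Suc m) = c m] (mod (int l ^ m)))"

text \<open>The dimension over \<open>\<rat>\<^sub>l\<close> of the \<open>p\<close>-th \<open>l\<close>-adic cohomology, which is the maximal number of
  elements of the inverse limit that are linearly independent over the \<open>l\<close>-adic integers.\<close>

definition ladic_betti :: "'p set \<Rightarrow> ('i, 'k::field, 'p) chart set \<Rightarrow> nat \<Rightarrow> nat \<Rightarrow> nat" where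
  "ladic_betti X \<A> l p = (GREATEST R. \<exists>\<xi>. (\<forall>s<R. ladic_class X \<A> l p (\<xi> s)) \<and>
     (\<forall>c. (\<forall>s<R. ladic_int l (c s)) \<and>
          (\<forall>m. cech_zero X \<A> (int l ^ m) p (map (\<lambda>s. (c s m, \<xi> s m)) [0..<R]))
        \<longrightarrow> (\<forall>s<R. \<forall>m. int l ^ m dvd c s m)))"

subsection \<open>Singular homology\<close>

text \<open>For a field isomorphism \<open>\<tau>\<close> from \<open>\<complex>\<close> to \<open>k\<close>: the classical topology of the variety, that is, the
  finest topology for which all charts are continuous.\<close>

definition classical_topology ::
  "'p set \<Rightarrow> ('i, 'k, 'p) chart set \<Rightarrow> (complex \<Rightarrow> 'k) \<Rightarrow> 'p topology" where
  "classical_topology X \<A> \<tau> = topology (\<lambda>S. S \<subseteq> X \<and>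
     (\<forall>(D, \<psi>)\<in>\<A>. openin (top_of_set {y. \<tau> \<circ> y \<in> D}) {y. \<tau> \<circ> y \<in> D \<and> \<psi> (\<tau> \<circ> y) \<in> S}))"

lemma openin_classical_topology:
  fixes X :: "'p set" and \<A> :: "('i, 'k, 'p) chart set" and \<tau> :: "complex \<Rightarrow> 'k"
  shows "openin (classical_topology X \<A> \<tau>) S \<longleftrightarrow> S \<subseteq> X \<and>
     (\<forall>(D, \<psi>)\<in>\<A>. openin (top_of_set {y. \<tau> \<circ> y \<in> D}) {y. \<tau> \<circ> y \<in> D \<and> \<psi> (\<tau> \<circ> y) \<in> S})"
proof -
  let ?P = "\<lambda>S. S \<subseteq> X \<and>
     (\<forall>(D, \<psi>)\<in>\<A>. openin (top_of_set {y. \<tau> \<circ> y \<in> D}) {y. \<tau> \<circ> y \<in> D \<and> \<psi> (\<tau> \<circ> y) \<in> S})"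
  have "istopology ?P"
    unfolding istopology_def
  proof (intro conjI allI impI)
    fix S S' assume S: "?P S" and S': "?P S'"
    have "{y. \<tau> \<circ> y \<in> D \<and> \<psi> (\<tau> \<circ> y) \<in> S \<inter> S'} =
          {y. \<tau> \<circ> y \<in> D \<and> \<psi> (\<tau> \<circ> y) \<in> S} \<inter> {y. \<tau> \<circ> y \<in> D \<and> \<psi> (\<tau> \<circ> y) \<in> S'}"
      for D :: "('i \<Rightarrow> 'k) set" and \<psi> by blast
    then show "S \<inter> S' \<subseteq> X" "\<forall>(D, \<psi>)\<in>\<A>. openin (top_of_set {y. \<tau> \<circ> y \<in> D})
        {y. \<tau> \<circ> y \<in> D \<and> \<psi> (\<tau> \<circ> y) \<in> S \<inter> S'}"
      using S S' by (fastforce intro: openin_Int)+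
  next
    fix \<K> assume K: "\<forall>S\<in>\<K>. ?P S"
    then show "\<Union>\<K> \<subseteq> X" by blast
    have "{y. \<tau> \<circ> y \<in> D \<and> \<psi> (\<tau> \<circ> y) \<in> \<Union>\<K>} = (\<Union>S\<in>\<K>. {y. \<tau> \<circ> y \<in> D \<and> \<psi> (\<tau> \<circ> y) \<in> S})"
      for D :: "('i \<Rightarrow> 'k) set" and \<psi> by blast
    moreover have "openin (top_of_set {y. \<tau> \<circ> y \<in> D}) (\<Union>S\<in>\<K>. {y. \<tau> \<circ> y \<in> D \<and> \<psi> (\<tau> \<circ> y) \<in> S})"
      if "(D, \<psi>) \<in> \<A>" for D \<psi>
      using K that by (intro openin_Union) blast
    ultimately show "\<forall>(D, \<psi>)\<in>\<A>. openin (top_of_set {y. \<tau> \<circ> y \<in> D})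
        {y. \<tau> \<circ> y \<in> D \<and> \<psi> (\<tau> \<circ> y) \<in> \<Union>\<K>}"
      by auto
  qed
  then show ?thesis by (simp add: classical_topology_def)
qed

definition group_rank :: "('a, 'b) monoid_scheme \<Rightarrow> nat" where
  "group_rank G = (GREATEST R. \<exists>g :: nat \<Rightarrow> 'a. (\<forall>s<R. g s \<in> carrier G) \<and>
     (\<forall>c :: nat \<Rightarrow> int. finprod G (\<lambda>s. g s [^]\<^bsub>G\<^esub> c s) {..<R} = \<one>\<^bsub>G\<^esub> \<longrightarrow> (\<forall>s<R. c s = 0)))"

definition singular_betti :: "'p set \<Rightarrow> ('i, 'k, 'p) chart set \<Rightarrow> (complex \<Rightarrow> 'k) \<Rightarrow> nat \<Rightarrow> nat" where
  "singular_betti X \<A> \<tau> p = group_rank (homology_group (int p) (classical_topology X \<A> \<tau>))"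

subsection \<open>The Euler characteristic\<close>

text \<open>Either the \<open>l\<close>-adic Euler characteristic for a prime \<open>l\<close> invertible in \<open>k\<close>, or, when an isomorphism
  between \<open>k\<close> and the field of complex numbers is given, the topological one.\<close>

datatype 'k cohomology = Ladic nat | Topological "complex \<Rightarrow> 'k"

fun admissible :: "'k::field cohomology \<Rightarrow> bool" where
  "admissible (Ladic l) \<longleftrightarrow> prime l \<and> (of_nat l :: 'k) \<noteq> 0"
| "admissible (Topological \<tau>) \<longleftrightarrow> bij \<tau> \<and> (\<forall>x y. \<tau> (x + y) = \<tau> x + \<tau> y) \<and> (\<forall>x y. \<tau> (x * y) = \<tau> x * \<tau> y)"

fun betti :: "'k::field cohomology \<Rightarrow> 'p set \<Rightarrow> ('i, 'k, 'p) chart set \<Rightarrow> nat \<Rightarrow> nat" where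
  "betti (Ladic l) X \<A> p = ladic_betti X \<A> l p"
| "betti (Topological \<tau>) X \<A> p = singular_betti X \<A> \<tau> p"

definition euler_char :: "'k::field cohomology \<Rightarrow> 'p set \<Rightarrow> ('i, 'k, 'p) chart set \<Rightarrow> int" where
  "euler_char H X \<A> = (\<Sum>p | betti H X \<A> p \<noteq> 0. (-1) ^ p * int (betti H X \<A> p))"

subsection \<open>Quiver Grassmannians\<close>

definition quiver_grass ::
  "('k::field, 'o, 'v::ab_group_add) tcat \<Rightarrow> 'o \<Rightarrow> (nat \<Rightarrow> 'o) \<Rightarrow> nat \<Rightarrow> 'v rmod \<Rightarrow> (nat \<Rightarrow> nat) \<Rightarrow> 'v set set" where
  "quiver_grass C T Ts n L e = {N. submodule C T L N \<and> mod_class C T Ts n (Act L) N e}"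

text \<open>
  The standard charts of the Grassmannian of \<open>d\<close>-dimensional subspaces, one for each ordered basis
  \<open>bs\<close>: a matrix \<open>a\<close> gives the subspace spanned by the vectors
  \<open>bs ! j + (\<Sum>l. a (j, l) *s bs ! l)\<close>, where \<open>j < d \<le> l\<close>.
\<close>

definition grass_point :: "('k::field \<Rightarrow> 'v::ab_group_add \<Rightarrow> 'v) \<Rightarrow> nat \<Rightarrow> 'v list \<Rightarrow> (nat \<times> nat \<Rightarrow> 'k) \<Rightarrow> 'v set" where
  "grass_point s d bs a =
     Modules.module.span s ((\<lambda>j. bs ! j + (\<Sum>l\<in>{d..<length bs}. s (a (j, l)) (bs ! l))) ` {..<d})"

definition grass_charts ::
  "('k::field \<Rightarrow> 'v::ab_group_add \<Rightarrow> 'v) \<Rightarrow> 'v set \<Rightarrow> nat \<Rightarrow> 'v set set \<Rightarrow> (nat \<times> nat, 'k, 'v set) chart set" where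
  "grass_charts s V d X =
     {({a. (\<forall>j l. \<not> (j < d \<and> d \<le> l \<and> l < length bs) \<longrightarrow> a (j, l) = 0) \<and> grass_point s d bs a \<in> X},
       grass_point s d bs) |bs.
      distinct bs \<and> d \<le> length bs \<and> \<not> Modules.module.dependent s (set bs) \<and> Modules.module.span s (set bs) = V}"

definition grass_euler ::
  "'k::field cohomology \<Rightarrow> ('k, 'o, 'v::ab_group_add) tcat \<Rightarrow> 'o \<Rightarrow> (nat \<Rightarrow> 'o) \<Rightarrow> nat \<Rightarrow> 'v rmod \<Rightarrow> (nat \<Rightarrow> nat) \<Rightarrow> int" where
  "grass_euler H C T Ts n L e =
     (let X = quiver_grass C T Ts n L e;
          d = (\<Sum>i=1..n. e i * vdim C (Car (simple_top C T (Ts i))))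
      in euler_char H X (grass_charts (Scal C) (Car L) d X))"

section \<open>Index, cluster character and \<open>f\<close>-vector\<close>

definition has_multiplicities ::
  "('k::field, 'o, 'v::ab_group_add) tcat \<Rightarrow> (nat \<Rightarrow> 'o) \<Rightarrow> nat \<Rightarrow> 'o \<Rightarrow> (nat \<Rightarrow> nat) \<Rightarrow> bool" where
  "has_multiplicities C Ts n S a \<longleftrightarrow>
     (\<exists>\<iota> \<pi>. direct_sum C S {(i, s). i \<in> {1..n} \<and> s < a i} (\<lambda>(i, s :: nat). Ts i) \<iota> \<pi>)"

definition is_index ::
  "('k::field, 'o, 'v::ab_group_add) tcat \<Rightarrow> (nat \<Rightarrow> 'o) \<Rightarrow> nat \<Rightarrow> 'o \<Rightarrow> (nat \<Rightarrow> int) \<Rightarrow> bool" where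
  "is_index C Ts n M g \<longleftrightarrow> (\<exists>T1 T0 u v w a1 a0. Tri C T1 T0 M u v w \<and>
     has_multiplicities C Ts n T1 a1 \<and> has_multiplicities C Ts n T0 a0 \<and>
     (\<forall>i\<in>{1..n}. g i = int (a0 i) - int (a1 i)))"

definition index_coeff :: "('k::field, 'o, 'v::ab_group_add) tcat \<Rightarrow> (nat \<Rightarrow> 'o) \<Rightarrow> nat \<Rightarrow> 'o \<Rightarrow> nat \<Rightarrow> int" where
  "index_coeff C Ts n M = (SOME g. is_index C Ts n M g)"

text \<open>The value of \<open>X'\<^sub>M\<close> at \<open>(x\<^sub>1, \<dots>, x\<^sub>n)\<close>. The form \<open>\<langle>S\<^sub>i, e\<rangle>\<^sub>a\<close> is extended additively in \<open>e = \<Sum> e\<^sub>j [S\<^sub>j]\<close>.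
  The sum runs over the finitely many \<open>e\<close> with nonempty Grassmannian.\<close>

definition cluster_character ::
  "'k::field cohomology \<Rightarrow> ('k, 'o, 'v::ab_group_add) tcat \<Rightarrow> 'o \<Rightarrow> (nat \<Rightarrow> 'o) \<Rightarrow> nat \<Rightarrow> 'o \<Rightarrow> (nat \<Rightarrow> 'b::field) \<Rightarrow> 'b" where
  "cluster_character H C T Ts n M x =
     (let L = hom_module C T (Sus C M); S = (\<lambda>i. simple_top C T (Ts i)) in
      (\<Prod>i=1..n. x i powi index_coeff C Ts n M i) *
      (\<Sum>e | quiver_grass C T Ts n L e \<noteq> {}.
         of_int (grass_euler H C T Ts n L e) *
         (\<Prod>i=1..n. x i powi (\<Sum>j=1..n. int (e j) * mod_form_a C T (S i) (S j)))))"

text \<open>The field of rational functions over \<open>\<int>\<close> in indeterminates \<open>x\<^sub>0, x\<^sub>1, x\<^sub>2, \<dots>\<close>\<close>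

type_synonym ratfun = "((nat \<Rightarrow>\<^sub>0 nat) \<Rightarrow>\<^sub>0 int) fract"

definition indet :: "nat \<Rightarrow> ratfun" where
  "indet i = Fract (Poly_Mapping.single (Poly_Mapping.single i 1) 1) 1"

definition F_poly ::
  "'k::field cohomology \<Rightarrow> ('k, 'o, 'v::ab_group_add) tcat \<Rightarrow> nat \<Rightarrow> 'o \<Rightarrow> (nat \<Rightarrow> 'o) \<Rightarrow> 'o \<Rightarrow> ratfun" where
  "F_poly H C r T Ts M = cluster_character H C T Ts (2 * r) M (\<lambda>i. if i \<le> r then 1 else indet i)"

datatype sfexp = SFVar nat | SFOne | SFAdd sfexp sfexp | SFMul sfexp sfexp | SFDiv sfexp sfexp

primrec sf_vars :: "sfexp \<Rightarrow> nat set" where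
  "sf_vars (SFVar i) = {i}"
| "sf_vars SFOne = {}"
| "sf_vars (SFAdd E E') = sf_vars E \<union> sf_vars E'"
| "sf_vars (SFMul E E') = sf_vars E \<union> sf_vars E'"
| "sf_vars (SFDiv E E') = sf_vars E \<union> sf_vars E'"

primrec sf_eval ::
  "('b \<Rightarrow> 'b \<Rightarrow> 'b) \<Rightarrow> ('b \<Rightarrow> 'b \<Rightarrow> 'b) \<Rightarrow> ('b \<Rightarrow> 'b \<Rightarrow> 'b) \<Rightarrow> 'b \<Rightarrow> (nat \<Rightarrow> 'b) \<Rightarrow> sfexp \<Rightarrow> 'b" where
  "sf_eval pl tm dv un x (SFVar i) = x i"
| "sf_eval pl tm dv un x SFOne = un"
| "sf_eval pl tm dv un x (SFAdd E E') = pl (sf_eval pl tm dv un x E) (sf_eval pl tm dv un x E')"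
| "sf_eval pl tm dv un x (SFMul E E') = tm (sf_eval pl tm dv un x E) (sf_eval pl tm dv un x E')"
| "sf_eval pl tm dv un x (SFDiv E E') = dv (sf_eval pl tm dv un x E) (sf_eval pl tm dv un x E')"

text \<open>An element \<open>u\<^sub>1\<^bsup>a 1\<^esup> \<dots> u\<^sub>r\<^bsup>a r\<^esup>\<close> of the tropical semifield is represented by its exponents
  \<open>a :: nat \<Rightarrow> int\<close>, of which only those at \<open>1, \<dots>, r\<close> matter. So the product is the pointwise sum and
  the unit is the zero function.\<close>

type_synonym trop = "nat \<Rightarrow> int"

definition trop_add :: "trop \<Rightarrow> trop \<Rightarrow> trop" where
  "trop_add a b = (\<lambda>j. min (a j) (b j))"

definition trop_eval :: "(nat \<Rightarrow> trop) \<Rightarrow> sfexp \<Rightarrow> trop" where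
  "trop_eval = sf_eval trop_add (\<lambda>a b j. a j + b j) (\<lambda>a b j. a j - b j) (\<lambda>_. 0)"

definition trop_gen_inv :: "nat \<Rightarrow> trop" where
  "trop_gen_inv j = (\<lambda>j'. if j' = j then - 1 else 0)"

text \<open>\<open>f\<close> is the \<open>f\<close>-vector: a subtraction-free expression of the \<open>F\<close>-polynomial in \<open>x\<^sub>r\<^sub>+\<^sub>1, \<dots>, x\<^sub>2\<^sub>r\<close>, evaluated
  in the tropical semifield at \<open>x\<^sub>r\<^sub>+\<^sub>j = u\<^sub>j\<^sup>-\<^sup>1\<close>, has the exponents \<open>-f 1, \<dots>, -f r\<close>.\<close>

definition is_f_vector ::
  "'k::field cohomology \<Rightarrow> ('k, 'o, 'v::ab_group_add) tcat \<Rightarrow> nat \<Rightarrow> 'o \<Rightarrow> (nat \<Rightarrow> 'o) \<Rightarrow> 'o \<Rightarrow> (nat \<Rightarrow> int) \<Rightarrow> bool" where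
  "is_f_vector H C r T Ts M f \<longleftrightarrow> (\<exists>E. sf_vars E \<subseteq> {r+1..2*r} \<and>
     sf_eval (+) (*) (/) 1 indet E = F_poly H C r T Ts M \<and>
     (\<forall>j\<in>{1..r}. trop_eval (\<lambda>i. trop_gen_inv (i - r)) E j = - f j))"

end

theory Submission
  imports Defs
begin

text \<open>
  Nothing cancels in a subtraction-free expression, so the \<open>f\<close>-vector consists of the degrees of \<open>\<F>\<^sub>M\<close> in
  \<open>x\<^sub>r\<^sub>+\<^sub>1, \<dots>, x\<^sub>2\<^sub>r\<close>.  No arrow leads from a vertex \<open>l \<le> r\<close> to a frozen vertex \<open>r + j\<close>, whence the index of \<open>M\<close>
  vanishes at \<open>r + j\<close>; and \<open>\<langle>S\<^sub>r\<^sub>+\<^sub>j, e\<rangle>\<^sub>a = e\<^sub>j\<close>, because \<open>Ext\<^sup>1\<close> between simple modules counts arrows and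
  \<open>Hom(T, \<Sigma>M)\<close> vanishes at the frozen vertices.  Hence \<open>\<F>\<^sub>M = \<Sum>\<^sub>e \<chi>(Gr\<^sub>e) x\<^sup>e\<close>.  The dimension vector \<open>d\<close> of
  \<open>Hom(T, \<Sigma>M)\<close> dominates all exponents \<open>e\<close>, and its coefficient is 1, since \<open>Gr\<^sub>d\<close> is a point.
\<close>

section \<open>Tropical evaluation of subtraction-free expressions\<close>

text \<open>Only the Euler characteristic of a point is ever computed. The other coefficients of the
  F-polynomial stay unknown integers, possibly zero or negative, so a degree cannot be read off from
  the set of exponents. What helps is that among the exponents e with e_j = d_j only d has the top
  total degree: even when all variables but the j-th are merged into one, its coefficient 1 cannot
  be cancelled. Positivity enters through the subtraction-free expression alone, at a positive real
  number that is not a root of the merged leading coefficient. The index needs Ext in both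
  directions: the category U is cut out by Ext(T_l, M) = 0, whereas extending maps along T_1 -> T_0
  needs Ext(M, T_l) = 0, which the 2-Calabi-Yau form supplies. Since k is algebraically closed and
  Hom spaces are finite-dimensional, endomorphism rings of indecomposables have residue field k.
  Hence simple modules are lines, given by characters of End(T), classes of modules are dimension
  vectors, and extensions of simple modules become twisted derivations with values in k.\<close>

definition monom_eval :: "(nat \<Rightarrow> 'a::comm_ring_1) \<Rightarrow> (nat \<Rightarrow>\<^sub>0 nat) \<Rightarrow> 'a" where
  "monom_eval g m = (\<Prod>i\<in>Poly_Mapping.keys m. g i ^ Poly_Mapping.lookup m i)"

text \<open>Substitution of \<open>g\<close> for the variables, a homomorphism on the polynomial
  ring whose fractions are \<open>ratfun\<close>. It will be used with values in real polynomials of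
  one variable.\<close>

definition mpoly_eval :: "(nat \<Rightarrow> 'a::comm_ring_1) \<Rightarrow> ((nat \<Rightarrow>\<^sub>0 nat) \<Rightarrow>\<^sub>0 int) \<Rightarrow> 'a" where
  "mpoly_eval g P = (\<Sum>m\<in>Poly_Mapping.keys P. of_int (Poly_Mapping.lookup P m) * monom_eval g m)"

lemma monom_eval_superset:
  assumes "finite A" "Poly_Mapping.keys m \<subseteq> A"
  shows "monom_eval g m = (\<Prod>i\<in>A. g i ^ Poly_Mapping.lookup m i)"
  unfolding monom_eval_def using assms by (intro prod.mono_neutral_left) (auto simp: in_keys_iff)

lemma monom_eval_add: "monom_eval g (m + m') = monom_eval g m * monom_eval g m'"
proof -
  let ?A = "Poly_Mapping.keys m \<union> Poly_Mapping.keys m'"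
  have "Poly_Mapping.keys (m + m') \<subseteq> ?A" by (rule keys_add)
  then show ?thesis
    by (subst (1 2 3) monom_eval_superset[of ?A]) (simp_all add: lookup_add power_add prod.distrib)
qed

lemma mpoly_eval_superset:
  assumes "finite A" "Poly_Mapping.keys P \<subseteq> A"
  shows "mpoly_eval g P = (\<Sum>m\<in>A. of_int (Poly_Mapping.lookup P m) * monom_eval g m)"
  unfolding mpoly_eval_def using assms by (intro sum.mono_neutral_left) (auto simp: in_keys_iff)

lemma mpoly_eval_add: "mpoly_eval g (P + Q) = mpoly_eval g P + mpoly_eval g Q"
proof -
  let ?A = "Poly_Mapping.keys P \<union> Poly_Mapping.keys Q"
  have "Poly_Mapping.keys (P + Q) \<subseteq> ?A" by (rule keys_add)
  then show ?thesis
    by (subst (1 2 3) mpoly_eval_superset[of ?A]) (simp_all add: lookup_add distrib_right sum.distrib)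
qed

lemma mpoly_eval_0 [simp]: "mpoly_eval g 0 = 0"
  by (simp add: mpoly_eval_def)

lemma mpoly_eval_diff: "mpoly_eval g (P - Q) = mpoly_eval g P - mpoly_eval g Q"
  using mpoly_eval_add[of g "P - Q" Q] by simp

lemma mpoly_eval_single: "mpoly_eval g (Poly_Mapping.single m c) = of_int c * monom_eval g m"
  by (simp add: mpoly_eval_def)

text \<open>Integer polynomials are the free abelian group on the monomials, so
  \<open>frag_induction\<close>, applied to one factor after the other, leaves only the product of
  two monomials.\<close>

lemma mpoly_eval_mult: "mpoly_eval g (P * Q) = mpoly_eval g P * mpoly_eval g Q"
proof -
  have 1: "mpoly_eval g (frag_of m * frag_of m') = mpoly_eval g (frag_of m) * mpoly_eval g (frag_of m')" for m m'
    by (simp add: mult_single mpoly_eval_single monom_eval_add)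
  have 2: "mpoly_eval g (frag_of m * Q) = mpoly_eval g (frag_of m) * mpoly_eval g Q" for m
    using subset_UNIV[of "Poly_Mapping.keys Q"]
    by (induction Q rule: frag_induction) (simp_all add: 1 right_diff_distrib mpoly_eval_diff)
  show ?thesis
    using subset_UNIV[of "Poly_Mapping.keys P"]
    by (induction P rule: frag_induction) (simp_all add: 2 left_diff_distrib mpoly_eval_diff)
qed

lemma mpoly_eval_1 [simp]: "mpoly_eval g 1 = 1"
proof -
  have "mpoly_eval g (Poly_Mapping.single 0 1) = 1"
    by (simp only: mpoly_eval_single) (simp add: monom_eval_def)
  then show ?thesis by simp
qed

lemma mpoly_eval_of_int: "mpoly_eval g (of_int c) = of_int c"
proof -
  have nat: "mpoly_eval g (of_nat k) = of_nat k" for k by (induction k) (simp_all add: mpoly_eval_add)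
  have neg: "mpoly_eval g (- P) = - mpoly_eval g P" for P using mpoly_eval_diff[of g 0 P] by simp
  show ?thesis by (cases c) (simp_all add: nat neg mpoly_eval_diff)
qed

lemma mpoly_eval_sum: "mpoly_eval g (sum f A) = (\<Sum>a\<in>A. mpoly_eval g (f a))"
  by (induction A rule: infinite_finite_induct) (simp_all add: mpoly_eval_add)

lemma mpoly_eval_prod: "mpoly_eval g (prod f A) = (\<Prod>a\<in>A. mpoly_eval g (f a))"
  by (induction A rule: infinite_finite_induct) (simp_all add: mpoly_eval_mult)

lemma mpoly_eval_power: "mpoly_eval g (P ^ k) = mpoly_eval g P ^ k"
  by (induction k) (simp_all add: mpoly_eval_mult)

definition mpoly_var :: "nat \<Rightarrow> (nat \<Rightarrow>\<^sub>0 nat) \<Rightarrow>\<^sub>0 int" where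
  "mpoly_var i = Poly_Mapping.single (Poly_Mapping.single i 1) 1"

lemma indet_eq: "indet i = Fract (mpoly_var i) 1"
  by (simp only: indet_def mpoly_var_def)

lemma mpoly_eval_var: "mpoly_eval g (mpoly_var i) = g i"
  by (simp add: mpoly_var_def mpoly_eval_single monom_eval_def)

section \<open>Degrees of polynomials with nonnegative coefficients\<close>

definition nonneg_poly :: "real poly \<Rightarrow> bool" where
  "nonneg_poly p \<longleftrightarrow> p \<noteq> 0 \<and> (\<forall>k. coeff p k \<ge> 0)"

lemma nonneg_poly_mult: "nonneg_poly p \<Longrightarrow> nonneg_poly q \<Longrightarrow> nonneg_poly (p * q)"
  by (auto simp: nonneg_poly_def coeff_mult intro: sum_nonneg)

text \<open>Both leading coefficients are positive and meet nothing negative, so the degree of a sum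
  is the maximum; up to sign this is tropical addition. Zero is excluded because its degree would
  not be additive on products.\<close>

lemma nonneg_poly_add:
  assumes "nonneg_poly p" "nonneg_poly q"
  shows "nonneg_poly (p + q)" "degree (p + q) = max (degree p) (degree q)"
proof -
  have nn: "coeff p k \<ge> 0" "coeff q k \<ge> 0" for k using assms by (auto simp: nonneg_poly_def)
  have lead: "coeff p (degree p) > 0" "coeff q (degree q) > 0"
    using assms nn by (auto simp: nonneg_poly_def order_less_le)
  have pos: "coeff (p + q) (max (degree p) (degree q)) > 0"
    using lead nn by (auto simp: max_def add_pos_nonneg add_nonneg_pos)
  then have "max (degree p) (degree q) \<le> degree (p + q)" by (intro le_degree) (metis less_irrefl)
  then show "degree (p + q) = max (degree p) (degree q)"
    using degree_add_le_max[of p q] by (intro antisym)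
  have "p + q \<noteq> 0" using pos by (metis coeff_0 less_irrefl)
  then show "nonneg_poly (p + q)" using nn by (simp add: nonneg_poly_def)
qed

lemma nonneg_poly_degree_mult: "nonneg_poly p \<Longrightarrow> nonneg_poly q \<Longrightarrow> degree (p * q) = degree p + degree q"
  by (simp add: nonneg_poly_def degree_mult_eq)

text \<open>
  Nothing cancels in a subtraction-free expression, so its tropical value at \<open>u\<^sub>j\<^sup>-\<^sup>1\<close> is minus the degree in
  \<open>x\<^sub>r\<^sub>+\<^sub>j\<close> after any positive specialization of the other variables.
\<close>

lemma sf_eval_degree:
  assumes "sf_vars E \<subseteq> {r+1..2*r}" and j: "j \<in> {1..r}" and Y: "Y > 0"
    and g: "g = (\<lambda>i. if i = r + j then [:0, 1:] else [:Y:])"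
  shows "\<exists>P Q. sf_eval (+) (*) (/) 1 indet E = Fract P Q \<and>
    nonneg_poly (mpoly_eval g P) \<and> nonneg_poly (mpoly_eval g Q) \<and>
    int (degree (mpoly_eval g P)) - int (degree (mpoly_eval g Q)) = - trop_eval (\<lambda>i. trop_gen_inv (i - r)) E j"
  using assms(1)
proof (induction E)
  case (SFVar i)
  have i: "i \<in> {r+1..2*r}" using SFVar by simp
  have "g i \<noteq> 0" "coeff (g i) k \<ge> 0" for k using Y by (auto simp: g coeff_pCons split: nat.splits)
  then have "nonneg_poly (g i)" "nonneg_poly (1 :: real poly)" by (auto simp: nonneg_poly_def)
  moreover have "int (degree (g i)) = (if i = r + j then 1 else 0)" by (simp add: g)
  moreover have "j = i - r \<longleftrightarrow> i = r + j" using i j by auto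
  ultimately show ?case
    by - (rule exI[of _ "mpoly_var i"], rule exI[of _ 1], simp add: indet_eq mpoly_eval_var trop_eval_def trop_gen_inv_def)
next
  case SFOne
  have "nonneg_poly (1 :: real poly)" by (simp add: nonneg_poly_def)
  then show ?case by - (rule exI[of _ 1], rule exI[of _ 1], simp add: trop_eval_def One_fract_def)
next
  case (SFAdd E E')
  obtain P Q where P: "sf_eval (+) (*) (/) 1 indet E = Fract P Q" "nonneg_poly (mpoly_eval g P)" "nonneg_poly (mpoly_eval g Q)"
    "int (degree (mpoly_eval g P)) - int (degree (mpoly_eval g Q)) = - trop_eval (\<lambda>i. trop_gen_inv (i - r)) E j"
    using SFAdd by auto
  obtain P' Q' where P': "sf_eval (+) (*) (/) 1 indet E' = Fract P' Q'" "nonneg_poly (mpoly_eval g P')" "nonneg_poly (mpoly_eval g Q')"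
    "int (degree (mpoly_eval g P')) - int (degree (mpoly_eval g Q')) = - trop_eval (\<lambda>i. trop_gen_inv (i - r)) E' j"
    using SFAdd by auto
  have "Q \<noteq> 0" "Q' \<noteq> 0" using P(3) P'(3) by (auto simp: nonneg_poly_def)
  then have "sf_eval (+) (*) (/) 1 indet (SFAdd E E') = Fract (P * Q' + P' * Q) (Q * Q')"
    using P(1) P'(1) by simp
  moreover have "trop_eval (\<lambda>i. trop_gen_inv (i - r)) (SFAdd E E') j
      = min (trop_eval (\<lambda>i. trop_gen_inv (i - r)) E j) (trop_eval (\<lambda>i. trop_gen_inv (i - r)) E' j)"
    by (simp add: trop_eval_def trop_add_def)
  ultimately show ?case
    using P P' nonneg_poly_mult[OF P(2) P'(3)] nonneg_poly_mult[OF P'(2) P(3)] nonneg_poly_mult[OF P(3) P'(3)]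
    by - (rule exI[of _ "P * Q' + P' * Q"], rule exI[of _ "Q * Q'"], simp add: mpoly_eval_add mpoly_eval_mult nonneg_poly_add nonneg_poly_degree_mult)
next
  case (SFMul E E')
  obtain P Q where P: "sf_eval (+) (*) (/) 1 indet E = Fract P Q" "nonneg_poly (mpoly_eval g P)" "nonneg_poly (mpoly_eval g Q)"
    "int (degree (mpoly_eval g P)) - int (degree (mpoly_eval g Q)) = - trop_eval (\<lambda>i. trop_gen_inv (i - r)) E j"
    using SFMul by auto
  obtain P' Q' where P': "sf_eval (+) (*) (/) 1 indet E' = Fract P' Q'" "nonneg_poly (mpoly_eval g P')" "nonneg_poly (mpoly_eval g Q')"
    "int (degree (mpoly_eval g P')) - int (degree (mpoly_eval g Q')) = - trop_eval (\<lambda>i. trop_gen_inv (i - r)) E' j"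
    using SFMul by auto
  show ?case
    using P P' nonneg_poly_mult[OF P(2) P'(2)] nonneg_poly_mult[OF P(3) P'(3)]
    by - (rule exI[of _ "P * P'"], rule exI[of _ "Q * Q'"], simp add: mpoly_eval_mult nonneg_poly_degree_mult trop_eval_def)
next
  case (SFDiv E E')
  obtain P Q where P: "sf_eval (+) (*) (/) 1 indet E = Fract P Q" "nonneg_poly (mpoly_eval g P)" "nonneg_poly (mpoly_eval g Q)"
    "int (degree (mpoly_eval g P)) - int (degree (mpoly_eval g Q)) = - trop_eval (\<lambda>i. trop_gen_inv (i - r)) E j"
    using SFDiv by auto
  obtain P' Q' where P': "sf_eval (+) (*) (/) 1 indet E' = Fract P' Q'" "nonneg_poly (mpoly_eval g P')" "nonneg_poly (mpoly_eval g Q')"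
    "int (degree (mpoly_eval g P')) - int (degree (mpoly_eval g Q')) = - trop_eval (\<lambda>i. trop_gen_inv (i - r)) E' j"
    using SFDiv by auto
  show ?case
    using P P' nonneg_poly_mult[OF P(2) P'(3)] nonneg_poly_mult[OF P(3) P'(2)]
    by - (rule exI[of _ "P * Q'"], rule exI[of _ "Q * P'"], simp add: mpoly_eval_mult nonneg_poly_degree_mult trop_eval_def)
qed

section \<open>Comparison of a polynomial with a subtraction-free expression\<close>

lemma Fract_sum: "(\<Sum>a\<in>A. Fract (f a) 1) = Fract (sum f A) 1"
  by (induction A rule: infinite_finite_induct) (simp_all add: Zero_fract_def)

lemma Fract_prod: "(\<Prod>a\<in>A. Fract (f a) 1) = Fract (prod f A) 1"
  by (induction A rule: infinite_finite_induct) (simp_all add: One_fract_def)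

lemma Fract_power: "Fract a 1 ^ k = Fract (a ^ k) 1"
  by (induction k) (simp_all add: One_fract_def)

lemma of_int_Fract: "of_int c = Fract (of_int c) 1"
proof -
  have nat: "of_nat k = Fract (of_nat k) 1" for k
    by (induction k) (simp_all add: One_fract_def Zero_fract_def)
  show ?thesis by (cases c rule: int_cases2) (simp_all add: nat)
qed

text \<open>The degree in the variable \<open>r + j\<close> is at most \<open>d j\<close>, and the
  coefficient of that power contains the monomial of \<open>d\<close> with coefficient 1. It
  survives when the other variables are set to a suitable positive real, and there
  \<open>sf_eval_degree\<close> reads the tropical value as minus this degree.\<close>

lemma trop_eval_dominant:
  fixes \<omega> :: "(nat \<Rightarrow> nat) \<Rightarrow> int"
  assumes X: "finite X" "d \<in> X" and \<omega>: "\<omega> d = 1"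
    and bound: "\<And>e i. e \<in> X \<Longrightarrow> e i \<le> d i" and supp: "\<And>e i. e \<in> X \<Longrightarrow> i \<notin> {1..r} \<Longrightarrow> e i = 0"
    and E: "sf_vars E \<subseteq> {r+1..2*r}"
      "sf_eval (+) (*) (/) 1 indet E = (\<Sum>e\<in>X. of_int (\<omega> e) * (\<Prod>i\<in>{1..r}. indet (r + i) ^ e i))"
    and j: "j \<in> {1..r}"
  shows "trop_eval (\<lambda>i. trop_gen_inv (i - r)) E j = - int (d j)"
proof -
  let ?J = "{1..r} - {j}"
  \<comment> \<open>The coefficient of the power \<open>d j\<close>, with all other variables merged
    into one. Merging may add up different exponents, but among those with \<open>e j = d j\<close>
    only \<open>d\<close> has the top total degree, so its coefficient 1 stands alone there.\<close>
  define q :: "real poly" where "q = (\<Sum>e | e \<in> X \<and> e j = d j. monom (of_int (\<omega> e)) (\<Sum>i\<in>?J. e i))"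
  have "coeff q (\<Sum>i\<in>?J. d i) = (\<Sum>e | e \<in> X \<and> e j = d j. if e = d then 1 else 0)"
    unfolding q_def coeff_sum
  proof (rule sum.cong[OF refl])
    fix e assume e: "e \<in> {e. e \<in> X \<and> e j = d j}"
    show "coeff (monom (of_int (\<omega> e)) (\<Sum>i\<in>?J. e i)) (\<Sum>i\<in>?J. d i) = (if e = d then (1::real) else 0)"
    proof (cases "e = d")
      case False
      then obtain i where i: "e i \<noteq> d i" by auto
      then have "i \<in> ?J" using e supp[of e i] supp[OF X(2), of i] by force
      then have "(\<Sum>i\<in>?J. e i) < (\<Sum>i\<in>?J. d i)"
        using bound e i by (intro sum_strict_mono_ex1) (auto simp: order_less_le)
      then show ?thesis using False by simp
    qed (simp add: \<omega>)
  qed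
  also have "\<dots> = 1" using X by simp
  finally have "q \<noteq> 0" by auto
  then have "finite {t. poly q t = 0}" by (rule poly_roots_finite)
  then have "infinite ({0<..} - {t. poly q t = 0})"
    by (intro Diff_infinite_finite infinite_Ioi)
  then obtain Y where Y: "Y > 0" "poly q Y \<noteq> 0" by (metis (mono_tags, lifting) DiffE finite.emptyI ex_in_conv greaterThan_iff mem_Collect_eq)
  define g where "g = (\<lambda>i. if i = r + j then [:0, 1:] else [:Y:])"
  define F where "F = (\<Sum>e\<in>X. of_int (\<omega> e) * (\<Prod>i\<in>{1..r}. mpoly_var (r + i) ^ e i))"
  have "(\<Sum>e\<in>X. of_int (\<omega> e) * (\<Prod>i\<in>{1..r}. indet (r + i) ^ e i)) = Fract F 1"
    by (simp add: F_def indet_eq Fract_power Fract_prod of_int_Fract flip: Fract_sum)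
  moreover obtain P Q where P: "sf_eval (+) (*) (/) 1 indet E = Fract P Q"
      "nonneg_poly (mpoly_eval g P)" "nonneg_poly (mpoly_eval g Q)"
      "int (degree (mpoly_eval g P)) - int (degree (mpoly_eval g Q)) = - trop_eval (\<lambda>i. trop_gen_inv (i - r)) E j"
    using sf_eval_degree[OF E(1) j Y(1) g_def] by blast
  moreover have "Q \<noteq> 0" using P(3) by (auto simp: nonneg_poly_def)
  \<comment> \<open>The fractions \<open>Fract P Q\<close> and \<open>Fract F 1\<close> agree, so
    the degree of \<open>F\<close> after specialization is the difference of degrees computed by
    \<open>sf_eval_degree\<close>.\<close>
  ultimately have "P = F * Q" using E(2) by (simp add: eq_fract)
  then have PFQ: "mpoly_eval g P = mpoly_eval g F * mpoly_eval g Q" by (simp add: mpoly_eval_mult)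
  then have nz: "mpoly_eval g F \<noteq> 0" "mpoly_eval g Q \<noteq> 0" using P(2) by (auto simp: nonneg_poly_def)
  have gF: "mpoly_eval g F = (\<Sum>e\<in>X. monom (of_int (\<omega> e) * Y ^ (\<Sum>i\<in>?J. e i)) (e j))"
    unfolding F_def mpoly_eval_sum
  proof (rule sum.cong[OF refl])
    fix e assume "e \<in> X"
    have "(\<Prod>i\<in>{1..r}. g (r + i) ^ e i) = g (r + j) ^ e j * (\<Prod>i\<in>?J. g (r + i) ^ e i)"
      using j by (intro prod.remove) auto
    also have "(\<Prod>i\<in>?J. g (r + i) ^ e i) = (\<Prod>i\<in>?J. [:Y:] ^ e i)"
      by (rule prod.cong) (auto simp: g_def)
    also have "\<dots> = [:Y:] ^ (\<Sum>i\<in>?J. e i)" by (rule power_sum[symmetric])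
    also have "\<dots> = [:Y ^ (\<Sum>i\<in>?J. e i):]" by (rule poly_const_pow)
    also have "g (r + j) ^ e j = monom 1 (e j)"
      by (simp add: g_def monom_altdef)
    finally have "(\<Prod>i\<in>{1..r}. g (r + i) ^ e i) = monom (Y ^ (\<Sum>i\<in>?J. e i)) (e j)"
      by (simp add: smult_monom mult.commute)
    then show "mpoly_eval g (of_int (\<omega> e) * (\<Prod>i\<in>{1..r}. mpoly_var (r + i) ^ e i))
        = monom (of_int (\<omega> e) * Y ^ (\<Sum>i\<in>?J. e i)) (e j)"
      by (simp add: mpoly_eval_mult mpoly_eval_of_int mpoly_eval_prod mpoly_eval_power mpoly_eval_var of_int_poly smult_monom)
  qed
  have "coeff (mpoly_eval g F) (d j) = (\<Sum>e\<in>X. if e j = d j then of_int (\<omega> e) * Y ^ (\<Sum>i\<in>?J. e i) else 0)"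
    unfolding gF coeff_sum by (rule sum.cong) (auto simp: coeff_monom)
  also have "\<dots> = poly q Y"
    unfolding q_def poly_sum poly_monom by (rule sum.inter_filter[OF X(1), symmetric])
  finally have "d j \<le> degree (mpoly_eval g F)" using Y(2) by (intro le_degree) simp
  moreover have "degree (mpoly_eval g F) \<le> d j"
    unfolding gF using bound by (intro degree_sum_le X(1)) (metis degree_monom_le order_trans)
  ultimately have "degree (mpoly_eval g F) = d j" by simp
  then show ?thesis using P(4) PFQ nz by (simp add: degree_mult_eq)
qed

no_notation vector_scalar_mult (infixl \<open>*s\<close> 70)

lemma linear_on_subD:
  assumes "linear_on_sub s s' V W f"
  shows "x \<in> V \<Longrightarrow> f x \<in> W"
    and "x \<in> V \<Longrightarrow> y \<in> V \<Longrightarrow> f (x + y) = f x + f y"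
    and "x \<in> V \<Longrightarrow> f (s c x) = s' c (f x)"
  using assms by (simp_all add: linear_on_sub_def)

section \<open>Bases modulo a subspace\<close>

text \<open>The family induces a basis of V/K. The quotient is never formed: arrow numbers, Ext
  dimensions and multiplicities are all obtained as a difference of the dimensions of
  \<open>V\<close> and \<open>K\<close>.\<close>

definition basis_mod ::
  "('k::field \<Rightarrow> 'v::ab_group_add \<Rightarrow> 'v) \<Rightarrow> 'v set \<Rightarrow> 'v set \<Rightarrow> 'i set \<Rightarrow> ('i \<Rightarrow> 'v) \<Rightarrow> bool" where
  "basis_mod s K V S x \<longleftrightarrow> finite S \<and> x ` S \<subseteq> V \<and>
     (\<forall>c. (\<Sum>i\<in>S. s (c i) (x i)) \<in> K \<longrightarrow> (\<forall>i\<in>S. c i = 0)) \<and>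
     (\<forall>v\<in>V. \<exists>c. v - (\<Sum>i\<in>S. s (c i) (x i)) \<in> K)"

context vector_space
begin

lemma finite_dim_sub_mono: "finite_dim_sub scale V \<Longrightarrow> K \<subseteq> V \<Longrightarrow> finite_dim_sub scale K"
  unfolding finite_dim_sub_def by blast

lemma finite_dim_sub_basis:
  assumes "finite_dim_sub scale V"
  obtains B where "finite B" "B \<subseteq> V" "independent B" "V \<subseteq> span B" "card B = dim V"
proof -
  obtain A where A: "finite A" "V \<subseteq> span A"
    using assms by (auto simp: finite_dim_sub_def)
  obtain B where B: "B \<subseteq> V" "independent B" "V \<subseteq> span B" "card B = dim V"
    using basis_exists by blast
  have "finite B"
    using independent_span_bound[OF A(1) B(2)] B(1) A(2) by blast
  with B that show thesis by blast
qed

text \<open>A basis of \<open>K\<close> together with the family is a basis of \<open>V\<close>.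
  Independence modulo \<open>K\<close> also shows that the family is injective and avoids
  \<open>K\<close>, so cardinalities add up.\<close>

lemma dim_basis_mod:
  assumes K: "subspace K" "finite_dim_sub scale K" and V: "subspace V" "K \<subseteq> V"
    and b: "basis_mod scale K V S x"
  shows "dim V = dim K + card S" "finite_dim_sub scale V"
proof -
  obtain B where B: "finite B" "B \<subseteq> K" "independent B" "K \<subseteq> span B" "card B = dim K"
    using finite_dim_sub_basis[OF K(2)] by blast
  have S: "finite S" "x ` S \<subseteq> V" and ind: "\<And>c. (\<Sum>i\<in>S. c i *s x i) \<in> K \<Longrightarrow> \<forall>i\<in>S. c i = 0"
    and gen: "\<And>v. v \<in> V \<Longrightarrow> \<exists>c. v - (\<Sum>i\<in>S. c i *s x i) \<in> K"
    using b by (auto simp: basis_mod_def)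
  have spB: "span B = K"
    using B K(1) by (metis span_minimal subset_antisym)
  have inj: "inj_on x S"
  proof (rule inj_onI, rule ccontr)
    fix i j assume ij: "i \<in> S" "j \<in> S" "x i = x j" "i \<noteq> j"
    let ?c = "\<lambda>l. if l = i then 1 else if l = j then -1 else (0::'a)"
    have "(\<Sum>l\<in>S. ?c l *s x l) = (\<Sum>l\<in>{i, j}. ?c l *s x l)"
      using ij S by (intro sum.mono_neutral_right) auto
    also have "\<dots> = 0" using ij by simp
    finally have "(\<Sum>l\<in>S. ?c l *s x l) \<in> K" using subspace_0[OF K(1)] by simp
    from ind[OF this] ij show False by auto
  qed
  have disj: "B \<inter> x ` S = {}"
  proof (rule ccontr)
    assume "B \<inter> x ` S \<noteq> {}"
    then obtain i where i: "i \<in> S" "x i \<in> K" using B by auto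
    let ?c = "\<lambda>l. if l = i then 1 else (0::'a)"
    have "(\<Sum>l\<in>S. ?c l *s x l) = (\<Sum>l\<in>S. if l = i then x l else 0)"
      by (intro sum.cong) auto
    also have "\<dots> = x i"
      using i S by simp
    finally have "(\<Sum>l\<in>S. ?c l *s x l) \<in> K" using i by simp
    from ind[OF this] i show False by auto
  qed
  have split: "(\<Sum>v\<in>B \<union> x ` S. g v *s v) = (\<Sum>v\<in>B. g v *s v) + (\<Sum>i\<in>S. g (x i) *s x i)" for g
    using B(1) S(1) disj inj by (simp add: sum.union_disjoint sum.reindex)
  have "independent (B \<union> x ` S)"
  proof (rule independent_if_scalars_zero)
    show "finite (B \<union> x ` S)" using B S by auto
    fix g v assume 0: "(\<Sum>v\<in>B \<union> x ` S. g v *s v) = 0" and v: "v \<in> B \<union> x ` S"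
    have "(\<Sum>i\<in>S. g (x i) *s x i) = - (\<Sum>v\<in>B. g v *s v)"
      using 0 split[of g] by (simp add: eq_neg_iff_add_eq_0 add.commute)
    also have "\<dots> \<in> K" unfolding spB[symmetric]
      by (intro span_neg span_sum span_scale span_base)
    finally have z: "\<forall>i\<in>S. g (x i) = 0" by (rule ind)
    then have "(\<Sum>v\<in>B. g v *s v) = 0" using 0 split[of g] by simp
    then have "\<forall>v\<in>B. g v = 0"
      using independentD[OF B(3,1) subset_refl, of g] by blast
    with z v show "g v = 0" by auto
  qed
  moreover have sp: "V \<subseteq> span (B \<union> x ` S)"
  proof
    fix v assume "v \<in> V"
    then obtain c where c: "v - (\<Sum>i\<in>S. c i *s x i) \<in> K" using gen by blast
    then have 1: "v - (\<Sum>i\<in>S. c i *s x i) \<in> span (B \<union> x ` S)"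
      using spB span_mono[of B "B \<union> x ` S"] by blast
    have "(\<Sum>i\<in>S. c i *s x i) \<in> span (B \<union> x ` S)"
      by (intro span_sum span_scale span_base) auto
    from span_add[OF 1 this] show "v \<in> span (B \<union> x ` S)" by simp
  qed
  moreover have "B \<union> x ` S \<subseteq> V" using B V S by auto
  moreover have "card (B \<union> x ` S) = dim K + card S"
    using B S disj inj by (simp add: card_Un_disjoint card_image)
  ultimately show "dim V = dim K + card S" by (metis basis_card_eq_dim)
  show "finite_dim_sub scale V"
    unfolding finite_dim_sub_def using sp B S by blast
qed

lemma basis_mod_exists:
  assumes K: "subspace K" "K \<subseteq> V" and V: "subspace V" "finite_dim_sub scale V"
  obtains S where "basis_mod scale K V S (\<lambda>v. v)" "dim V = dim K + card S"
proof -
  have fK: "finite_dim_sub scale K" using finite_dim_sub_mono[OF V(2) K(2)] .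
  obtain B where B: "finite B" "B \<subseteq> K" "independent B" "K \<subseteq> span B" "card B = dim K"
    using finite_dim_sub_basis[OF fK] by blast
  have spB: "span B = K" using B K(1) by (metis span_minimal subset_antisym)
  have BV: "B \<subseteq> V" using B K by blast
  obtain C where C: "B \<subseteq> C" "C \<subseteq> V" "independent C" "V \<subseteq> span C"
    using maximal_independent_subset_extend[OF BV B(3)] by blast
  obtain A where A: "finite A" "V \<subseteq> span A"
    using V(2) by (auto simp: finite_dim_sub_def)
  have fC: "finite C"
    using independent_span_bound[OF A(1) C(3)] C(2) A(2) by blast
  have b: "basis_mod scale K V (C - B) (\<lambda>v. v)"
    unfolding basis_mod_def
  proof (intro conjI allI impI ballI)
    show "finite (C - B)" "(\<lambda>v. v) ` (C - B) \<subseteq> V" using fC C by auto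
  next
    fix c v assume c: "(\<Sum>i\<in>C - B. c i *s i) \<in> K" and v: "v \<in> C - B"
    obtain g where g: "(\<Sum>i\<in>C - B. c i *s i) = (\<Sum>i\<in>B. g i *s i)"
      using c span_finite[OF B(1)] unfolding spB by auto
    let ?h = "\<lambda>i. if i \<in> B then - g i else c i"
    have "(\<Sum>i\<in>C. ?h i *s i) = (\<Sum>i\<in>C - B. ?h i *s i) + (\<Sum>i\<in>B. ?h i *s i)"
      using sum.subset_diff[OF C(1) fC] by blast
    also have "\<dots> = (\<Sum>i\<in>C - B. c i *s i) + (\<Sum>i\<in>B. - (g i *s i))"
      by (intro arg_cong2[where f = "(+)"] sum.cong) auto
    also have "\<dots> = 0" using g by (simp add: sum_negf)
    finally have "?h v = 0"
      using independentD[OF C(3) fC subset_refl, of ?h v] v by blast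
    then show "c v = 0" using v by simp
  next
    fix v assume "v \<in> V"
    then obtain g where g: "v = (\<Sum>i\<in>C. g i *s i)"
      using span_finite[OF fC] C(4) by auto
    have "v - (\<Sum>i\<in>C - B. g i *s i) = (\<Sum>i\<in>B. g i *s i)"
      using sum.subset_diff[OF C(1) fC, of "\<lambda>i. g i *s i"] by (simp add: g)
    also have "\<dots> \<in> K" unfolding spB[symmetric]
      by (intro span_sum span_scale span_base)
    finally show "\<exists>c. v - (\<Sum>i\<in>C - B. c i *s i) \<in> K" by blast
  qed
  show thesis using that[OF b dim_basis_mod(1)[OF K(1) fK V(1) K(2) b]] .
qed

text \<open>Coordinates modulo \<open>K\<close> are unique, and uniqueness makes them linear: they
  are the dual basis of V/K, pulled back to forms on \<open>V\<close> that vanish on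
  \<open>K\<close>.\<close>

lemma basis_mod_coords:
  assumes K: "subspace K" and V: "subspace V" "K \<subseteq> V" and b: "basis_mod scale K V S x"
  obtains l where "\<And>i. i \<in> S \<Longrightarrow> linear_on_sub scale (*) V UNIV (l i)"
    "\<And>i v. i \<in> S \<Longrightarrow> v \<in> K \<Longrightarrow> l i v = 0"
    "\<And>i j. i \<in> S \<Longrightarrow> j \<in> S \<Longrightarrow> l i (x j) = (if i = j then 1 else 0)"
    "\<And>v. v \<in> V \<Longrightarrow> v - (\<Sum>i\<in>S. l i v *s x i) \<in> K"
proof -
  have S: "finite S" "x ` S \<subseteq> V" and ind: "\<And>c. (\<Sum>i\<in>S. c i *s x i) \<in> K \<Longrightarrow> \<forall>i\<in>S. c i = 0"
    and gen: "\<forall>v\<in>V. \<exists>c. v - (\<Sum>i\<in>S. c i *s x i) \<in> K"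
    using b by (auto simp: basis_mod_def)
  obtain c where c: "\<And>v. v \<in> V \<Longrightarrow> v - (\<Sum>i\<in>S. c v i *s x i) \<in> K"
    using gen by metis
  have uniq: "c v i = d i" if v: "v \<in> V" and d: "v - (\<Sum>i\<in>S. d i *s x i) \<in> K" and i: "i \<in> S" for v d i
  proof -
    have "(\<Sum>i\<in>S. (d i - c v i) *s x i) = (v - (\<Sum>i\<in>S. c v i *s x i)) - (v - (\<Sum>i\<in>S. d i *s x i))"
      by (simp add: scale_left_diff_distrib sum_subtractf)
    also have "\<dots> \<in> K" by (rule subspace_diff[OF K c[OF v] d])
    finally have "d i - c v i = 0" using ind[of "\<lambda>i. d i - c v i"] i by blast
    then show ?thesis by simp
  qed
  show thesis
  proof (rule that)
    fix i assume i: "i \<in> S"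
    have "c (v + w) i = c v i + c w i" if vw: "v \<in> V" "w \<in> V" for v w
    proof -
      have "v + w - (\<Sum>i\<in>S. (c v i + c w i) *s x i)
          = (v - (\<Sum>i\<in>S. c v i *s x i)) + (w - (\<Sum>i\<in>S. c w i *s x i))"
        by (simp add: scale_left_distrib sum.distrib)
      also have "\<dots> \<in> K" by (rule subspace_add[OF K c[OF vw(1)] c[OF vw(2)]])
      finally show ?thesis
        by (rule uniq[where d = "\<lambda>i. c v i + c w i", OF subspace_add[OF V(1) vw] _ i])
    qed
    moreover have "c (a *s v) i = a * c v i" if v: "v \<in> V" for a v
    proof -
      have "a *s v - (\<Sum>i\<in>S. (a * c v i) *s x i) = a *s (v - (\<Sum>i\<in>S. c v i *s x i))"
        by (simp add: scale_right_diff_distrib scale_sum_right)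
      also have "\<dots> \<in> K" by (rule subspace_scale[OF K c[OF v]])
      finally show ?thesis
        by (rule uniq[where d = "\<lambda>i. a * c v i", OF subspace_scale[OF V(1) v] _ i])
    qed
    ultimately show "linear_on_sub scale (*) V UNIV (\<lambda>v. c v i)"
      by (auto simp: linear_on_sub_def)
    show "c v i = 0" if "v \<in> K" for v
      by (rule uniq[where d = "\<lambda>_. 0", OF _ _ i]) (use that V in auto)
    show "c (x j) i = (if i = j then 1 else 0)" if j: "j \<in> S" for j
    proof -
      have "(\<Sum>i\<in>S. (if i = j then 1 else 0) *s x i) = (\<Sum>i\<in>S. if i = j then x i else 0)"
        by (intro sum.cong) auto
      also have "\<dots> = x j"
        using j S by simp
      finally have "x j - (\<Sum>i\<in>S. (if i = j then 1 else 0) *s x i) \<in> K"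
        using subspace_0[OF K] by simp
      from uniq[where d = "\<lambda>i. if i = j then 1 else 0", OF _ this i] show ?thesis
        using j S by auto
    qed
  next
    fix v assume "v \<in> V"
    then show "v - (\<Sum>i\<in>S. c v i *s x i) \<in> K" by (rule c)
  qed
qed

lemma dim_subset_sub:
  assumes "subspace K" "subspace V" "K \<subseteq> V" "finite_dim_sub scale V"
  shows "dim K \<le> dim V" "dim K = dim V \<Longrightarrow> K = V"
proof -
  obtain S where b: "basis_mod scale K V S (\<lambda>v. v)" and d: "dim V = dim K + card S"
    using basis_mod_exists assms by metis
  show "dim K \<le> dim V" using d by simp
  assume "dim K = dim V"
  with b d have "S = {}" by (simp add: basis_mod_def)
  with b assms show "K = V" by (auto simp: basis_mod_def)
qed

lemma linear_on_sub_sum: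
  assumes f: "linear_on_sub scale s' V W f" and V: "subspace V" and s': "vector_space s'"
    and "finite A" "A \<subseteq> V"
  shows "f (\<Sum>v\<in>A. c v *s v) = (\<Sum>v\<in>A. s' (c v) (f v))"
  using assms(4,5)
proof (induction A)
  interpret W: vector_space s' by fact
  case empty
  then show ?case using linear_on_subD(3)[OF f subspace_0[OF V], of 0] by simp
next
  case (insert a A)
  have 1: "c a *s a \<in> V" "(\<Sum>v\<in>A. c v *s v) \<in> V"
    using insert.prems V by (auto intro!: subspace_scale subspace_sum)
  have "f (c a *s a) = s' (c a) (f a)"
    using insert.prems by (intro linear_on_subD(3)[OF f]) auto
  then show ?case using linear_on_subD(2)[OF f 1] insert by simp
qed

lemma dim_inj_image:
  assumes f: "linear_on_sub scale scale V W f" and V: "subspace V" "finite_dim_sub scale V"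
    and inj: "\<And>v. v \<in> V \<Longrightarrow> f v = 0 \<Longrightarrow> v = 0"
  shows "subspace (f ` V)" "dim (f ` V) = dim V"
proof -
  have "f 0 + f 0 = f 0"
    using linear_on_subD(2)[OF f subspace_0[OF V(1)] subspace_0[OF V(1)]] by simp
  then have f0: "f 0 = 0" by simp
  show sub: "subspace (f ` V)"
  proof (rule subspaceI)
    show "0 \<in> f ` V" using f0 subspace_0[OF V(1)] by force
  next
    fix x y assume "x \<in> f ` V" "y \<in> f ` V"
    then obtain v w where "v \<in> V" "w \<in> V" "x = f v" "y = f w" by blast
    then show "x + y \<in> f ` V"
      using linear_on_subD(2)[OF f, of v w] subspace_add[OF V(1), of v w] by (metis imageI)
  next
    fix c x assume "x \<in> f ` V"
    then obtain v where "v \<in> V" "x = f v" by blast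
    then show "c *s x \<in> f ` V"
      using linear_on_subD(3)[OF f, of v c] subspace_scale[OF V(1), of v c] by (metis imageI)
  qed
  have sub0: "subspace {0}" by (rule subspace_single_0)
  have fin0: "finite_dim_sub scale {0}"
    unfolding finite_dim_sub_def by (rule exI[of _ "{}"]) simp
  obtain S where S: "basis_mod scale {0} V S (\<lambda>v. v)" "dim V = dim {0} + card S"
    using basis_mod_exists[OF sub0 _ V] subspace_0[OF V(1)] by auto
  note fsum = linear_on_sub_sum[OF f V(1) vector_space_axioms]
  have fin: "finite S" "S \<subseteq> V" using S by (auto simp: basis_mod_def)
  have "basis_mod scale {0} (f ` V) S f"
    unfolding basis_mod_def
  proof (intro conjI allI impI ballI)
    show "finite S" "f ` S \<subseteq> f ` V" using fin by auto
  next
    fix c i assume "(\<Sum>i\<in>S. c i *s f i) \<in> {0}" and i: "i \<in> S"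
    then have "f (\<Sum>v\<in>S. c v *s v) = 0" using fsum[OF fin] by simp
    moreover have "(\<Sum>v\<in>S. c v *s v) \<in> V"
      using fin V(1) by (auto intro!: subspace_scale subspace_sum)
    ultimately have "(\<Sum>v\<in>S. c v *s v) \<in> {0}" using inj by simp
    then show "c i = 0" using S(1) i unfolding basis_mod_def by meson
  next
    fix y assume "y \<in> f ` V"
    then obtain v where v: "v \<in> V" "y = f v" by blast
    then obtain c where "v - (\<Sum>i\<in>S. c i *s i) \<in> {0}"
      using S(1) unfolding basis_mod_def by meson
    then have "v = (\<Sum>i\<in>S. c i *s i)" by simp
    then have "y - (\<Sum>i\<in>S. c i *s f i) \<in> {0}" using v fsum[OF fin] by simp
    then show "\<exists>c. y - (\<Sum>i\<in>S. c i *s f i) \<in> {0}" by blast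
  qed
  from dim_basis_mod(1)[OF sub0 fin0 sub _ this] S(2) subspace_0[OF sub]
  show "dim (f ` V) = dim V" by simp
qed

end

section \<open>The Euler characteristic of a point\<close>

lemma group_rank_trivial:
  assumes "trivial_group G"
  shows "group_rank G = 0"
  unfolding group_rank_def
proof (rule Greatest_equality)
  show "\<exists>g. (\<forall>s<0. g s \<in> carrier G) \<and>
      (\<forall>c. finprod G (\<lambda>s. g s [^]\<^bsub>G\<^esub> (c s :: int)) {..<0::nat} = \<one>\<^bsub>G\<^esub> \<longrightarrow> (\<forall>s<0. c s = 0))"
    by simp
next
  fix R :: nat
  assume "\<exists>g. (\<forall>s<R. g s \<in> carrier G) \<and>
      (\<forall>c. finprod G (\<lambda>s. g s [^]\<^bsub>G\<^esub> (c s :: int)) {..<R} = \<one>\<^bsub>G\<^esub> \<longrightarrow> (\<forall>s<R. c s = 0))"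
  then obtain g where g: "\<And>s. s < R \<Longrightarrow> g s \<in> carrier G"
    and ind: "\<And>c :: nat \<Rightarrow> int. finprod G (\<lambda>s. g s [^]\<^bsub>G\<^esub> c s) {..<R} = \<one>\<^bsub>G\<^esub> \<Longrightarrow> \<forall>s<R. c s = 0" by blast
  interpret group G using assms by (simp add: trivial_group_def)
  have car: "carrier G = {\<one>\<^bsub>G\<^esub>}" using assms by (simp add: trivial_group_def)
  have "comm_group G"
    by (rule group_comm_groupI) (use car in auto)
  then interpret comm_group G .
  have "finprod G (\<lambda>s. g s [^]\<^bsub>G\<^esub> (1::int)) {..<R} \<in> carrier G"
    using g by (intro finprod_closed) auto
  \<comment> \<open>The relation with all exponents equal to 1 holds, so independence leaves room
    for no generator.\<close>
  then have "finprod G (\<lambda>s. g s [^]\<^bsub>G\<^esub> ((\<lambda>_. 1::int) s)) {..<R} = \<one>\<^bsub>G\<^esub>" using car by auto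
  from ind[OF this] show "R \<le> 0" by (metis gr_zeroI le_refl zero_neq_one)
qed

lemma group_rank_integer:
  assumes G: "comm_group G" and iso: "G \<cong> integer_group"
  shows "group_rank G = 1"
  unfolding group_rank_def
proof (rule Greatest_equality)
  interpret comm_group G by fact
  obtain f where f: "f \<in> hom G integer_group" "bij_betw f (carrier G) UNIV"
    using iso by (auto simp: Group.is_iso_def iso_def)
  have inj: "x = \<one>\<^bsub>G\<^esub>" if "x \<in> carrier G" "f x = 0" for x
    using inj_onD[OF bij_betw_imp_inj_on[OF f(2)] _ that(1) one_closed]
      hom_one[OF f(1) is_group group_integer_group] that(2) by simp
  have fpow: "f (x [^]\<^bsub>G\<^esub> (c::int)) = c * f x" if "x \<in> carrier G" for x c
    using hom_int_pow[OF f(1) that is_group group_integer_group, of c] by simp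
  have fprod: "f (finprod G (\<lambda>s. g s [^]\<^bsub>G\<^esub> (c s :: int)) {..<R}) = (\<Sum>s<R. c s * f (g s))"
    if "\<And>s. s < R \<Longrightarrow> g s \<in> carrier G" for g :: "nat \<Rightarrow> 'a" and c R
    using that
  proof (induction R)
    case 0
    then show ?case using hom_one[OF f(1) is_group group_integer_group] by simp
  next
    case (Suc R)
    have "finprod G (\<lambda>s. g s [^]\<^bsub>G\<^esub> c s) {..<Suc R}
        = g R [^]\<^bsub>G\<^esub> c R \<otimes>\<^bsub>G\<^esub> finprod G (\<lambda>s. g s [^]\<^bsub>G\<^esub> c s) {..<R}"
      unfolding lessThan_Suc using Suc.prems by (intro finprod_insert) auto
    moreover have "finprod G (\<lambda>s. g s [^]\<^bsub>G\<^esub> c s) {..<R} \<in> carrier G"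
      using Suc.prems by (intro finprod_closed) auto
    ultimately show ?case
      using hom_mult[OF f(1)] Suc fpow by simp
  qed
  obtain x where x: "x \<in> carrier G" "f x = 1"
    using f(2) by (metis UNIV_I bij_betw_imp_surj_on imageE)
  show "\<exists>g. (\<forall>s<1. g s \<in> carrier G) \<and>
      (\<forall>c. finprod G (\<lambda>s. g s [^]\<^bsub>G\<^esub> (c s :: int)) {..<1::nat} = \<one>\<^bsub>G\<^esub> \<longrightarrow> (\<forall>s<1. c s = 0))"
  proof (intro exI[of _ "\<lambda>_. x"] conjI allI impI)
    fix c :: "nat \<Rightarrow> int" and s :: nat
    assume "finprod G (\<lambda>s. x [^]\<^bsub>G\<^esub> c s) {..<1::nat} = \<one>\<^bsub>G\<^esub>" and s: "s < 1"
    then have "f \<one>\<^bsub>G\<^esub> = (\<Sum>s<1. c s * f x)" using fprod[of 1 "\<lambda>_. x" c] x by simp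
    then show "c s = 0" using hom_one[OF f(1) is_group group_integer_group] x s by simp
  qed (use x in simp)
  fix R :: nat
  assume "\<exists>g. (\<forall>s<R. g s \<in> carrier G) \<and>
      (\<forall>c. finprod G (\<lambda>s. g s [^]\<^bsub>G\<^esub> (c s :: int)) {..<R} = \<one>\<^bsub>G\<^esub> \<longrightarrow> (\<forall>s<R. c s = 0))"
  then obtain g where g: "\<And>s. s < R \<Longrightarrow> g s \<in> carrier G"
    and ind: "\<And>c :: nat \<Rightarrow> int. finprod G (\<lambda>s. g s [^]\<^bsub>G\<^esub> c s) {..<R} = \<one>\<^bsub>G\<^esub> \<Longrightarrow> \<forall>s<R. c s = 0" by blast
  have ind': "\<forall>s<R. c s = 0" if c: "(\<Sum>s<R. c s * f (g s)) = 0" for c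
  proof (rule ind, rule inj)
    show "finprod G (\<lambda>s. g s [^]\<^bsub>G\<^esub> c s) {..<R} \<in> carrier G"
      using g by (intro finprod_closed) auto
    show "f (finprod G (\<lambda>s. g s [^]\<^bsub>G\<^esub> c s) {..<R}) = 0" using fprod[of R g c] g c by simp
  qed
  show "R \<le> 1"
  proof (rule ccontr)
    assume "\<not> R \<le> 1"
    then have R: "{0, 1} \<subseteq> {..<R}" "0 < R" "1 < R" by auto
    define a b where "a = f (g 0)" and "b = f (g 1)"
    \<comment> \<open>Two integers satisfy \<open>b * a - a * b = 0\<close>. If both vanish this
      relation is trivial, and the coefficient 1 at the first of them is taken instead.\<close>
    define c :: "nat \<Rightarrow> int" where "c s = (if s = 0 then (if a = 0 \<and> b = 0 then 1 else b) else if s = 1 then - a else 0)" for s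
    have "(\<Sum>s<R. c s * f (g s)) = (\<Sum>s\<in>{0, 1}. c s * f (g s))"
      using R by (intro sum.mono_neutral_right) (auto simp: c_def)
    also have "\<dots> = 0" by (simp add: c_def a_def b_def)
    finally have "c 0 = 0" "c 1 = 0" using ind' R by blast+
    then show False by (auto simp: c_def split: if_splits)
  qed
qed

lemma singular_betti_point:
  assumes \<A>: "\<And>D \<psi>. (D, \<psi>) \<in> \<A> \<Longrightarrow> \<psi> ` D \<subseteq> {V}"
  shows "singular_betti {V} \<A> \<tau> p = (if p = 0 then 1 else 0)"
proof -
  let ?X = "classical_topology {V} \<A> \<tau>"
  \<comment> \<open>The underlying set of the topology is the union of its open sets, so
    \<open>{V}\<close> has to be shown open: its preimage in each chart is the whole chart.\<close>
  have "openin ?X {V}"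
    unfolding openin_classical_topology
  proof (intro conjI ballI, simp, clarify)
    fix D \<psi> assume "(D, \<psi>) \<in> \<A>"
    then have "{y. \<tau> \<circ> y \<in> D \<and> \<psi> (\<tau> \<circ> y) \<in> {V}} = {y. \<tau> \<circ> y \<in> D}" using \<A> by blast
    then show "openin (top_of_set {y. \<tau> \<circ> y \<in> D}) {y. \<tau> \<circ> y \<in> D \<and> \<psi> (\<tau> \<circ> y) \<in> {V}}"
      by (metis openin_subtopology_self)
  qed
  moreover have "topspace ?X \<subseteq> {V}"
    using openin_topspace[of ?X] unfolding openin_classical_topology by blast
  ultimately have top: "topspace ?X = {V}" using openin_subset by blast
  show ?thesis
  proof (cases "p = 0")
    case True
    then show ?thesis
      using group_rank_integer[OF _ homology_coefficients[OF top]] by (simp add: singular_betti_def)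
  next
    case False
    then show ?thesis
      using group_rank_trivial[OF homology_dimension_axiom[OF top, of "int p"]] by (simp add: singular_betti_def)
  qed
qed

section \<open>Cech cohomology of a point\<close>

lemma alternating_sum: "(\<Sum>s<m. (- 1) ^ s) = (if even m then 0 else (1::int))"
  by (induction m) auto

text \<open>All faces of a constant tuple coincide, so the differential multiplies by an alternating
  sum of \<open>Suc m\<close> signs.\<close>

lemma cech_diff_replicate:
  "cech_diff \<phi> (replicate (Suc m) x) = (if odd m then 0 else \<phi> (replicate m x))"
proof -
  have "cech_diff \<phi> (replicate (Suc m) x) = (\<Sum>s<Suc m. (- 1) ^ s * \<phi> (replicate m x))"
    unfolding cech_diff_def length_replicate
  proof (intro sum.cong[OF refl] arg_cong2[where f = "(*)"] arg_cong[of _ _ \<phi>])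
    fix s assume "s \<in> {..<Suc m}"
    then show "take s (replicate (Suc m) x) @ drop (Suc s) (replicate (Suc m) x) = replicate m x"
      by (simp del: replicate_Suc flip: replicate_add)
  qed simp
  then show ?thesis by (simp flip: sum_distrib_right add: alternating_sum)
qed

lemma polyfuns_1: "(\<lambda>_. 1) \<in> polyfuns"
  by (rule polyfuns.const)

context
  fixes V :: 'p and \<A> :: "('i, 'k::field, 'p) chart set" and \<psi>0 :: "('i \<Rightarrow> 'k) \<Rightarrow> 'p"
  assumes chart: "({\<lambda>_. 0}, \<psi>0) \<in> \<A>" "\<psi>0 (\<lambda>_. 0) = V"
begin

text \<open>The identity of the point as a standard etale piece: the polynomial t has the single and
  simple root 0, and inverting 1 removes nothing.\<close>

definition point_cover :: "('i, 'k, 'p) piece list" where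
  "point_cover = [(({\<lambda>_. 0}, \<psi>0), \<lambda>_. [:0, 1:], \<lambda>_. 1)]"

lemma piece_pts_point: "piece_pts (({\<lambda>_. 0}, \<psi>0), \<lambda>_. [:0, 1:], \<lambda>_. 1) = {\<lambda>_. 0}"
proof -
  have "z \<circ> Some = (\<lambda>_. 0) \<and> z None = 0 \<longleftrightarrow> z = (\<lambda>_. 0)" for z :: "'i option \<Rightarrow> 'k"
    by (simp add: fun_eq_iff split_option_all conj_commute)
  moreover have "poly (pderiv [:0, 1:]) t \<noteq> (0::'k)" for t by (simp add: pderiv_pCons)
  ultimately show ?thesis by simp
qed

lemma point_cover_piece: "piece_pts (point_cover ! 0) = {\<lambda>_. 0}" "piece_map (point_cover ! 0) (\<lambda>_. 0) = V"
proof -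
  show "piece_pts (point_cover ! 0) = {\<lambda>_. 0}"
    unfolding point_cover_def nth_Cons_0 by (rule piece_pts_point)
  show "piece_map (point_cover ! 0) (\<lambda>_. 0) = V"
    unfolding point_cover_def nth_Cons_0 piece_map.simps comp_def by (rule chart(2))
qed

lemma etale_point_cover: "etale_cover {V} \<A> point_cover"
proof -
  have "poly_family (\<lambda>_ :: 'i \<Rightarrow> 'k. q)" for q
    by (auto simp: poly_family_def intro: polyfuns.const)
  then show ?thesis
    using chart by (simp add: etale_cover_def point_cover_def piece_pts_point comp_def del: piece_pts.simps)
qed

lemma cech_pts_point_cover: "cech_pts point_cover p = {replicate (Suc p) (0, \<lambda>_. 0)}"
proof -
  have "w = replicate (Suc p) (0, \<lambda>_. 0)" if "w \<in> cech_pts point_cover p" for w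
  proof (rule replicate_eqI)
    show "length w = Suc p" using that by (simp add: cech_pts_def)
    fix y assume "y \<in> set w"
    then have "fst y < length point_cover" "snd y \<in> piece_pts (point_cover ! fst y)"
      using that by (auto simp: cech_pts_def)
    then have "fst y = 0" "snd y = (\<lambda>_. 0)" using point_cover_piece(1) by (auto simp: point_cover_def)
    then show "y = (0, \<lambda>_. 0)" by (simp add: prod_eq_iff)
  qed
  moreover have "replicate (Suc p) (0, \<lambda>_. 0) \<in> cech_pts point_cover p"
    using point_cover_piece(1) by (auto simp: cech_pts_def simp del: replicate_Suc) (simp_all add: point_cover_def)
  ultimately show ?thesis by blast
qed

text \<open>Choosing a point of a covering amounts to refining it by \<open>point_cover\<close>.
  Evaluation of cochains at this point takes the place of the direct limit over all
  coverings.\<close>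

definition cover_point :: "('i, 'k, 'p) piece list \<Rightarrow> ('i, 'k) cpoint" where
  "cover_point Us = (SOME x. fst x < length Us \<and> snd x \<in> piece_pts (Us ! fst x))"

lemma cover_point:
  assumes "etale_cover {V} \<A> Us"
  shows "fst (cover_point Us) < length Us" "snd (cover_point Us) \<in> piece_pts (Us ! fst (cover_point Us))"
proof -
  have "(\<Union>u\<in>set Us. piece_map u ` piece_pts u) = {V}" using assms by (simp add: etale_cover_def)
  then obtain u z where "u \<in> set Us" "z \<in> piece_pts u" by blast
  then obtain i where "i < length Us" "z \<in> piece_pts (Us ! i)" by (metis in_set_conv_nth)
  then have "\<exists>x. fst x < length Us \<and> snd x \<in> piece_pts (Us ! fst x)" by (intro exI[of _ "(i, z)"]) simp
  from someI_ex[OF this] show "fst (cover_point Us) < length Us" "snd (cover_point Us) \<in> piece_pts (Us ! fst (cover_point Us))"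
    by (simp_all add: cover_point_def)
qed

lemma piece_map_point:
  assumes "etale_cover {V} \<A> Us" "i < length Us" "z \<in> piece_pts (Us ! i)"
  shows "piece_map (Us ! i) z = V"
proof -
  have "(\<Union>u\<in>set Us. piece_map u ` piece_pts u) = {V}" using assms by (simp add: etale_cover_def)
  then show ?thesis using assms nth_mem by blast
qed

lemma cech_pts_point:
  assumes "etale_cover {V} \<A> Us" "length w = Suc p" "\<And>x. x \<in> set w \<Longrightarrow> fst x < length Us \<and> snd x \<in> piece_pts (Us ! fst x)"
  shows "w \<in> cech_pts Us p"
  using assms(2,3) piece_map_point[OF assms(1)] by (fastforce simp: cech_pts_def)

lemma replicate_cover_point: "etale_cover {V} \<A> Us \<Longrightarrow> replicate (Suc p) (cover_point Us) \<in> cech_pts Us p"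
  by (rule cech_pts_point) (auto simp: cover_point)

text \<open>Pulled back to \<open>point_cover\<close>, cochains live on one constant tuple. There
  the differential of a constant \<open>h\<close> is \<open>h\<close> in even positive degrees and 0
  in odd ones, and degree 0 has no coboundaries; this is the case distinction in the
  assumption.\<close>

lemma cech_zeroI:
  assumes cov: "\<And>s. s < length cs \<Longrightarrow> etale_cover {V} \<A> (fst (snd (cs ! s)))"
    and eq: "[(\<Sum>s<length cs. fst (cs ! s) * snd (snd (cs ! s)) (replicate (Suc p) (cover_point (fst (snd (cs ! s))))))
      = (if odd p \<or> p = 0 then 0 else h)] (mod m)"
  shows "cech_zero {V} \<A> m p cs"
  unfolding cech_zero_def
proof (intro exI conjI allI impI ballI)
  let ?\<rho> = "\<lambda>s _. cover_point (fst (snd (cs ! s)))"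
  show "etale_cover {V} \<A> point_cover" by (rule etale_point_cover)
  show "refinement point_cover (fst (snd (cs ! s))) (?\<rho> s)" if "s < length cs" for s
  proof -
    let ?U = "fst (snd (cs ! s))"
    have r: "regular_on Z (\<lambda>z. a)" for Z :: "('i option \<Rightarrow> 'k) set" and a
      unfolding regular_on_def by (intro ballI bexI[of _ "\<lambda>_. a"] bexI[of _ "\<lambda>_. 1"]) (auto intro: polyfuns.const)
    have "piece_map (?U ! fst (cover_point ?U)) (snd (cover_point ?U)) = V"
      using cov[OF that] cover_point piece_map_point by blast
    moreover have "piece_map (point_cover ! j) z = V" if "j < length point_cover" "z \<in> piece_pts (point_cover ! j)" for j z
      using piece_map_point[OF etale_point_cover that] .
    ultimately show ?thesis
      unfolding refinement_def using cover_point[OF cov[OF that]] r by auto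
  qed
  show "cochain point_cover (p - 1) (\<lambda>_. h)"
    unfolding cochain_def by (intro ballI bexI[OF _ polyfuns_1]) simp
  fix w assume "w \<in> cech_pts point_cover p"
  then have w: "w = replicate (Suc p) (0, \<lambda>_. 0)" using cech_pts_point_cover by blast
  have "(if p = 0 then 0 else if odd p then 0 else h) = (if odd p \<or> p = 0 then 0 else h)" by simp
  with eq show "[(\<Sum>s<length cs. fst (cs ! s) * snd (snd (cs ! s)) (map (?\<rho> s) w))
      = (if p = 0 then 0 else cech_diff (\<lambda>_. h) w)] (mod m)"
    unfolding w map_replicate cech_diff_replicate by (simp only:)
qed

lemma cech_zero_mapI:
  assumes cov: "\<And>s. s < R \<Longrightarrow> etale_cover {V} \<A> (fst (\<xi> s))"
    and eq: "[(\<Sum>s<R. c s * snd (\<xi> s) (replicate (Suc p) (cover_point (fst (\<xi> s)))))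
      = (if odd p \<or> p = 0 then 0 else h)] (mod m)"
  shows "cech_zero {V} \<A> m p (map (\<lambda>s. (c s, \<xi> s)) [0..<R])"
proof (rule cech_zeroI)
  let ?cs = "map (\<lambda>s. (c s, \<xi> s)) [0..<R]"
  have nth: "?cs ! s = (c s, \<xi> s)" if "s < R" for s using that by simp
  show "etale_cover {V} \<A> (fst (snd (?cs ! s)))" if "s < length ?cs" for s
    using that cov nth by simp
  have "(\<Sum>s<length ?cs. fst (?cs ! s) * snd (snd (?cs ! s)) (replicate (Suc p) (cover_point (fst (snd (?cs ! s))))))
      = (\<Sum>s<R. c s * snd (\<xi> s) (replicate (Suc p) (cover_point (fst (\<xi> s)))))"
    by (rule sum.cong) (simp_all add: nth del: replicate_Suc)
  with eq show "[(\<Sum>s<length ?cs. fst (?cs ! s) * snd (snd (?cs ! s)) (replicate (Suc p) (cover_point (fst (snd (?cs ! s))))))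
      = (if odd p \<or> p = 0 then 0 else h)] (mod m)" by (simp only:)
qed

text \<open>On constant tuples the differential out of an odd degree returns the value itself, so
  the cocycle condition is already the divisibility.\<close>

lemma cocycle_odd:
  assumes "etale_cover {V} \<A> Us" "cocycle Us m p \<phi>" "odd p"
  shows "m dvd \<phi> (replicate (Suc p) (cover_point Us))"
proof -
  have "m dvd cech_diff \<phi> (replicate (Suc (Suc p)) (cover_point Us))"
    using assms(2) replicate_cover_point[OF assms(1)] unfolding cocycle_def by blast
  then show ?thesis using assms(3) by (simp only: cech_diff_replicate) simp
qed

text \<open>Any two points of the covering lie over the same point, hence form a point of the fibre
  product, where the differential is the difference of the two values.\<close>

lemma cocycle_0_const:
  assumes U: "etale_cover {V} \<A> Us" and coc: "cocycle Us m 0 \<phi>"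
    and x: "fst x < length Us" "snd x \<in> piece_pts (Us ! fst x)"
  shows "[\<phi> [x] = \<phi> [cover_point Us]] (mod m)"
proof -
  have "[cover_point Us, x] \<in> cech_pts Us (Suc 0)"
    by (rule cech_pts_point[OF U]) (use x cover_point[OF U] in auto)
  then have "m dvd cech_diff \<phi> [cover_point Us, x]" using coc by (simp add: cocycle_def)
  then show ?thesis by (simp add: cech_diff_def cong_iff_dvd_diff)
qed

lemma ladic_betti_point_pos:
  assumes l: "prime l" and p: "p > 0"
  shows "ladic_betti {V} \<A> l p = 0"
  unfolding ladic_betti_def
proof (rule Greatest_equality)
  fix R
  assume "\<exists>\<xi>. (\<forall>s<R. ladic_class {V} \<A> l p (\<xi> s)) \<and>
     (\<forall>c. (\<forall>s<R. ladic_int l (c s)) \<and>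
          (\<forall>m. cech_zero {V} \<A> (int l ^ m) p (map (\<lambda>s. (c s m, \<xi> s m)) [0..<R]))
        \<longrightarrow> (\<forall>s<R. \<forall>m. int l ^ m dvd c s m))"
  then obtain \<xi> where \<xi>: "\<And>s. s < R \<Longrightarrow> ladic_class {V} \<A> l p (\<xi> s)"
    and ind: "\<And>c. (\<forall>s<R. ladic_int l (c s)) \<Longrightarrow>
          (\<forall>m. cech_zero {V} \<A> (int l ^ m) p (map (\<lambda>s. (c s m, \<xi> s m)) [0..<R]))
        \<Longrightarrow> (\<forall>s<R. \<forall>m. int l ^ m dvd c s m)" by blast
  show "R \<le> 0"
  proof (rule ccontr)
    assume R: "\<not> R \<le> 0"
    \<comment> \<open>All coefficients 1 give a vanishing combination, so independence of a nonempty
      family would make every power of \<open>l\<close> divide 1.\<close>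
    have "\<forall>s<R. \<forall>m. int l ^ m dvd 1"
    proof (rule ind)
      show "\<forall>s<R. ladic_int l (\<lambda>_. 1)" by (simp add: ladic_int_def)
      show "\<forall>m. cech_zero {V} \<A> (int l ^ m) p (map (\<lambda>s. (1, \<xi> s m)) [0..<R])"
      proof
        fix m
        have cov: "etale_cover {V} \<A> (fst (\<xi> s m))" "cocycle (fst (\<xi> s m)) (int l ^ m) p (snd (\<xi> s m))" if "s < R" for s
          using \<xi>[OF that] by (auto simp: ladic_class_def)
        let ?f = "\<lambda>s. 1 * snd (\<xi> s m) (replicate (Suc p) (cover_point (fst (\<xi> s m))))"
        have "[(\<Sum>s<R. ?f s) = 0] (mod int l ^ m)" if "odd p"
          unfolding cong_0_iff by (rule dvd_sum, rule dvd_mult, rule cocycle_odd[OF cov that]) simp_all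
        \<comment> \<open>In even degrees the sum serves as its own primitive \<open>h\<close>; in
          odd degrees it vanishes modulo \<open>int l ^ m\<close>.\<close>
        then have "[(\<Sum>s<R. ?f s) = (if odd p \<or> p = 0 then 0 else \<Sum>s<R. ?f s)] (mod int l ^ m)"
          using p by (cases "odd p") simp_all
        then show "cech_zero {V} \<A> (int l ^ m) p (map (\<lambda>s. (1, \<xi> s m)) [0..<R])"
          by (rule cech_zero_mapI[rotated]) (rule cov)
      qed
    qed
    then have "int l ^ 1 dvd 1" using R by blast
    then show False using l by (simp add: prime_nat_iff)
  qed
qed simp

text \<open>By \<open>cocycle_0_const\<close> the value of a degree 0 cocycle depends neither on the
  point nor on the refinement on which the combination vanishes, and there are no coboundaries to
  correct it.\<close>

lemma cech_zero_0D:
  assumes cz: "cech_zero {V} \<A> m 0 cs"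
    and coc: "\<And>s. s < length cs \<Longrightarrow> etale_cover {V} \<A> (fst (snd (cs ! s))) \<and> cocycle (fst (snd (cs ! s))) m 0 (snd (snd (cs ! s)))"
  shows "[(\<Sum>s<length cs. fst (cs ! s) * snd (snd (cs ! s)) [cover_point (fst (snd (cs ! s)))]) = 0] (mod m)"
proof -
  obtain Vs \<rho> where Vs: "etale_cover {V} \<A> Vs" and ref: "\<forall>s<length cs. refinement Vs (fst (snd (cs ! s))) (\<rho> s)"
    and eq: "\<forall>w\<in>cech_pts Vs 0. [(\<Sum>s<length cs. fst (cs ! s) * snd (snd (cs ! s)) (map (\<rho> s) w)) = 0] (mod m)"
    using cz unfolding cech_zero_def by auto
  let ?x = "cover_point Vs"
  have "[?x] \<in> cech_pts Vs 0" using replicate_cover_point[OF Vs, of 0] by simp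
  with eq have sum: "[(\<Sum>s<length cs. fst (cs ! s) * snd (snd (cs ! s)) [\<rho> s ?x]) = 0] (mod m)" by fastforce
  have "[(\<Sum>s<length cs. fst (cs ! s) * snd (snd (cs ! s)) [cover_point (fst (snd (cs ! s)))])
      = (\<Sum>s<length cs. fst (cs ! s) * snd (snd (cs ! s)) [\<rho> s ?x])] (mod m)"
  proof (rule cong_sum, rule cong_mult[OF cong_refl], rule cong_sym)
    fix s assume "s \<in> {..<length cs}"
    then have s: "s < length cs" by simp
    note U = coc[OF s]
    have "refinement Vs (fst (snd (cs ! s))) (\<rho> s)" using ref s by blast
    then obtain i where i: "i < length (fst (snd (cs ! s)))"
      and pts: "\<forall>z\<in>piece_pts (Vs ! fst ?x). fst (\<rho> s (fst ?x, z)) = i \<and> snd (\<rho> s (fst ?x, z)) \<in> piece_pts (fst (snd (cs ! s)) ! i)"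
      unfolding refinement_def using cover_point(1)[OF Vs] by blast
    have "fst (\<rho> s ?x) = i \<and> snd (\<rho> s ?x) \<in> piece_pts (fst (snd (cs ! s)) ! i)"
      using pts cover_point(2)[OF Vs] by (metis prod.collapse)
    then show "[snd (snd (cs ! s)) [\<rho> s ?x] = snd (snd (cs ! s)) [cover_point (fst (snd (cs ! s)))]] (mod m)"
      using i U by (intro cocycle_0_const) auto
  qed
  from cong_trans[OF this sum] show ?thesis .
qed

text \<open>Evaluation turns a degree 0 class into an l-adic integer: compatibility of two
  successive levels is a vanishing combination with coefficients 1 and -1, to which
  \<open>cech_zero_0D\<close> applies.\<close>

lemma ladic_class_0_int:
  assumes "ladic_class {V} \<A> l 0 \<xi>"
  shows "ladic_int l (\<lambda>m. snd (\<xi> m) [cover_point (fst (\<xi> m))])"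
  unfolding ladic_int_def
proof
  fix m
  have cov: "etale_cover {V} \<A> (fst (\<xi> m))" "cocycle (fst (\<xi> m)) (int l ^ m) 0 (snd (\<xi> m))" for m
    using assms by (auto simp: ladic_class_def)
  have mono: "cocycle (fst (\<xi> (Suc m))) (int l ^ m) 0 (snd (\<xi> (Suc m)))"
    using cov(2)[of "Suc m"] dvd_trans[OF le_imp_power_dvd[of m "Suc m" "int l"]] unfolding cocycle_def by simp
  let ?cs = "[(1 :: int, \<xi> (Suc m)), (- 1, \<xi> m)]"
  have 1: "cech_zero {V} \<A> (int l ^ m) 0 ?cs"
    using assms by (simp add: ladic_class_def)
  have 2: "etale_cover {V} \<A> (fst (snd (?cs ! s))) \<and> cocycle (fst (snd (?cs ! s))) (int l ^ m) 0 (snd (snd (?cs ! s)))"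
    if "s < length ?cs" for s
    using that cov mono by (cases s) simp_all
  have "[(\<Sum>s<length ?cs. fst (?cs ! s) * snd (snd (?cs ! s)) [cover_point (fst (snd (?cs ! s)))]) = 0] (mod int l ^ m)"
    by (rule cech_zero_0D[OF 1 2])
  then show "[snd (\<xi> (Suc m)) [cover_point (fst (\<xi> (Suc m)))] = snd (\<xi> m) [cover_point (fst (\<xi> m))]] (mod int l ^ m)"
    by (simp add: cong_iff_dvd_diff)
qed

lemma ladic_betti_point_0:
  assumes l: "prime l"
  shows "ladic_betti {V} \<A> l 0 = 1"
  unfolding ladic_betti_def
proof (rule Greatest_equality)
  \<comment> \<open>The constant function 1 on the identity covering, at every level; its value is
    1, so only zero coefficients annihilate it.\<close>
  let ?\<xi> = "\<lambda>(s::nat) (m::nat). (point_cover, \<lambda>_. 1 :: int)"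
  have coc: "cocycle point_cover m 0 (\<lambda>_. 1)" for m
  proof -
    have "cochain point_cover 0 (\<lambda>_. 1)"
      unfolding cochain_def by (intro ballI bexI[OF _ polyfuns_1]) simp
    moreover have "m dvd cech_diff (\<lambda>_. 1) w" if "w \<in> cech_pts point_cover (Suc 0)" for w
    proof -
      have w: "w = replicate (Suc (Suc 0)) (0, \<lambda>_. 0)" using that cech_pts_point_cover by blast
      show ?thesis unfolding w cech_diff_replicate by simp
    qed
    ultimately show ?thesis by (simp add: cocycle_def)
  qed
  show "\<exists>\<xi>. (\<forall>s<(1::nat). ladic_class {V} \<A> l 0 (\<xi> s)) \<and>
     (\<forall>c. (\<forall>s<1. ladic_int l (c s)) \<and>
          (\<forall>m. cech_zero {V} \<A> (int l ^ m) 0 (map (\<lambda>s. (c s m, \<xi> s m)) [0..<1]))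
        \<longrightarrow> (\<forall>s<1. \<forall>m. int l ^ m dvd c s m))"
  proof (intro exI[of _ ?\<xi>] conjI allI impI)
    fix s :: nat
    have "cech_zero {V} \<A> (int l ^ m) 0 (map (\<lambda>s. ((if s = 0 then 1 else -1), ?\<xi> s m)) [0..<2])" for m
      by (rule cech_zero_mapI) (simp_all add: etale_point_cover numeral_2_eq_2)
    then show "ladic_class {V} \<A> l 0 (?\<xi> s)"
      using etale_point_cover coc by (simp add: ladic_class_def numeral_2_eq_2)
  next
    fix c :: "nat \<Rightarrow> nat \<Rightarrow> int" and s m :: nat
    assume *: "(\<forall>s<1. ladic_int l (c s)) \<and> (\<forall>m. cech_zero {V} \<A> (int l ^ m) 0 (map (\<lambda>s. (c s m, ?\<xi> s m)) [0..<1]))"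
      and s: "s < 1"
    then have "cech_zero {V} \<A> (int l ^ m) 0 [(c 0 m, point_cover, \<lambda>_. 1)]" by simp
    from cech_zero_0D[OF this] show "int l ^ m dvd c s m"
      using coc etale_point_cover s by (simp add: cong_0_iff)
  qed
next
  fix R
  assume "\<exists>\<xi>. (\<forall>s<R. ladic_class {V} \<A> l 0 (\<xi> s)) \<and>
     (\<forall>c. (\<forall>s<R. ladic_int l (c s)) \<and>
          (\<forall>m. cech_zero {V} \<A> (int l ^ m) 0 (map (\<lambda>s. (c s m, \<xi> s m)) [0..<R]))
        \<longrightarrow> (\<forall>s<R. \<forall>m. int l ^ m dvd c s m))"
  then obtain \<xi> where \<xi>: "\<And>s. s < R \<Longrightarrow> ladic_class {V} \<A> l 0 (\<xi> s)"
    and ind: "\<And>c. (\<forall>s<R. ladic_int l (c s)) \<Longrightarrow>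
          (\<forall>m. cech_zero {V} \<A> (int l ^ m) 0 (map (\<lambda>s. (c s m, \<xi> s m)) [0..<R]))
        \<Longrightarrow> (\<forall>s<R. \<forall>m. int l ^ m dvd c s m)" by blast
  define a where "a s m = snd (\<xi> s m) [cover_point (fst (\<xi> s m))]" for s m
  have cov: "etale_cover {V} \<A> (fst (\<xi> s m))" if "s < R" for s m
    using \<xi>[OF that] by (simp add: ladic_class_def)
  have a: "ladic_int l (a s)" if "s < R" for s
    using ladic_class_0_int[OF \<xi>[OF that]] by (simp add: a_def[abs_def])
  show "R \<le> 1"
  proof (rule ccontr)
    assume "\<not> R \<le> 1"
    then have R: "{0, 1} \<subseteq> {..<R}" "0 < R" "1 < R" by auto
    have rel: "(\<forall>m. int l ^ m dvd c 0 m) \<and> (\<forall>m. int l ^ m dvd c 1 m)"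
      if c: "\<And>s. ladic_int l (c s)" "\<And>s. s \<notin> {0, 1} \<Longrightarrow> c s = (\<lambda>_. 0)"
        and 0: "\<And>m. [c 0 m * a 0 m + c 1 m * a 1 m = 0] (mod int l ^ m)" for c :: "nat \<Rightarrow> nat \<Rightarrow> int"
    proof -
      have "cech_zero {V} \<A> (int l ^ m) 0 (map (\<lambda>s. (c s m, \<xi> s m)) [0..<R])" for m
      proof (rule cech_zero_mapI)
        have "(\<Sum>s<R. c s m * a s m) = (\<Sum>s\<in>{0, 1}. c s m * a s m)"
          using R c(2) by (intro sum.mono_neutral_right) auto
        then show "[(\<Sum>s<R. c s m * snd (\<xi> s m) (replicate (Suc 0) (cover_point (fst (\<xi> s m)))))
            = (if odd 0 \<or> (0::nat) = 0 then 0 else 0)] (mod int l ^ m)"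
          using 0[of m] by (simp add: a_def)
      qed (rule cov)
      then show ?thesis using ind[of c] c(1) R by blast
    qed
    \<comment> \<open>Two l-adic integers are always dependent: the coefficients \<open>a 1\<close>
      and \<open>- a 0\<close> give a relation, so independence forces both values to be
      zero.\<close>
    have a01: "(\<forall>m. int l ^ m dvd a 1 m) \<and> (\<forall>m. int l ^ m dvd - a 0 m)"
    proof -
      let ?c = "\<lambda>s. if s = 0 then a 1 else if s = 1 then (\<lambda>m. - a 0 m) else (\<lambda>_. 0)"
      have neg: "ladic_int l (\<lambda>m. - a 0 m)"
        using a[OF R(2)] by (simp add: ladic_int_def cong_minus_minus_iff)
      have "ladic_int l (?c s)" for s :: nat
        using a[OF R(3)] neg by (simp add: ladic_int_def)
      from rel[of ?c, OF this] show ?thesis by simp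
    qed
    \<comment> \<open>With both values zero, the coefficients 1 and 0 give a relation as well, and
      this contradicts independence.\<close>
    let ?d = "\<lambda>s. if s = 0 then (\<lambda>_. 1) else (\<lambda>_. 0 :: int)"
    have "ladic_int l (?d s)" for s :: nat by (simp add: ladic_int_def)
    from rel[of ?d, OF this] a01 have "int l ^ 1 dvd 1"
      by (auto simp: cong_0_iff dest: spec[of _ 1])
    then show False using l by (simp add: prime_nat_iff)
  qed
qed

end

lemma euler_char_point:
  fixes H :: "'k::field cohomology" and \<A> :: "('i, 'k, 'p) chart set"
  assumes H: "admissible H" and \<A>: "\<And>D \<psi>. (D, \<psi>) \<in> \<A> \<Longrightarrow> D = {\<lambda>_. 0} \<and> \<psi> (\<lambda>_. 0) = V" and ne: "\<A> \<noteq> {}"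
  shows "euler_char H {V} \<A> = 1"
proof -
  obtain D \<psi> where "(D, \<psi>) \<in> \<A>" using ne by auto
  with \<A> have chart: "({\<lambda>_. 0}, \<psi>) \<in> \<A>" "\<psi> (\<lambda>_. 0) = V" by auto
  have "betti H {V} \<A> p = (if p = 0 then 1 else 0)" for p
  proof (cases H)
    case (Ladic l)
    then have "prime l" using H by simp
    then show ?thesis
      using Ladic ladic_betti_point_0[OF chart] ladic_betti_point_pos[OF chart] by simp
  next
    case (Topological \<tau>)
    have "\<psi> ` D \<subseteq> {V}" if "(D, \<psi>) \<in> \<A>" for D \<psi> using \<A>[OF that] by auto
    then show ?thesis using Topological singular_betti_point[of \<A> V \<tau> p] by simp
  qed
  then show ?thesis by (simp add: euler_char_def)
qed

text \<open>In full dimension a chart has no free coordinates, because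
  \<open>length bs = dim V\<close> leaves no room for an index \<open>l\<close> of a complementary
  vector. Every chart is a one-point affine space.\<close>

lemma (in vector_space) euler_char_grass_top:
  fixes H :: "'a cohomology"
  assumes H: "admissible H" and V: "subspace V" "finite_dim_sub scale V"
  shows "euler_char H {V} (grass_charts scale V (dim V) {V}) = 1"
proof (rule euler_char_point[OF H])
  have len: "length bs = dim V" and pt: "grass_point scale (dim V) bs (\<lambda>_. 0) = V"
    if "distinct bs" "independent (set bs)" "span (set bs) = V" for bs
  proof -
    have "set bs \<subseteq> V" using that(3) span_superset by blast
    then show len: "length bs = dim V"
      using basis_card_eq_dim[of "set bs" V] that distinct_card by fastforce
    have "(\<lambda>j. bs ! j + (\<Sum>l\<in>{dim V..<length bs}. scale ((\<lambda>_. 0) (j, l)) (bs ! l))) ` {..<dim V} = set bs"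
      using len by (auto simp: set_conv_nth)
    then show "grass_point scale (dim V) bs (\<lambda>_. 0) = V"
      using that(3) by (simp add: grass_point_def)
  qed
  fix D \<psi> assume "(D, \<psi>) \<in> grass_charts scale V (dim V) {V}"
  then obtain bs where bs: "distinct bs" "independent (set bs)" "span (set bs) = V"
    and D: "D = {a. (\<forall>j l. \<not> (j < dim V \<and> dim V \<le> l \<and> l < length bs) \<longrightarrow> a (j, l) = 0) \<and> grass_point scale (dim V) bs a \<in> {V}}"
    and \<psi>: "\<psi> = grass_point scale (dim V) bs"
    unfolding grass_charts_def by blast
  have "a = (\<lambda>_. 0) \<longleftrightarrow> (\<forall>j l. a (j, l) = 0)" for a :: "nat \<times> nat \<Rightarrow> 'a" by (auto simp: fun_eq_iff)
  then have "D = {\<lambda>_. 0}"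
    unfolding D len[OF bs] using pt[OF bs] by auto
  then show "D = {\<lambda>_. 0} \<and> \<psi> (\<lambda>_. 0) = V" using pt[OF bs] \<psi> by simp
next
  obtain B where B: "finite B" "B \<subseteq> V" "independent B" "V \<subseteq> span B" "card B = dim V"
    by (rule finite_dim_sub_basis[OF V(2)])
  obtain bs where bs: "set bs = B" "distinct bs" using finite_distinct_list[OF B(1)] by blast
  have "span B = V" using B(2,4) span_minimal[OF B(2) V(1)] by blast
  moreover have "dim V \<le> length bs" using B(5) bs distinct_card[OF bs(2)] by simp
  ultimately show "grass_charts scale V (dim V) {V} \<noteq> {}"
    unfolding grass_charts_def using bs B(3) by blast
qed

section \<open>Local endomorphism rings and the radical\<close>

locale linear_cat =
  fixes C :: "('k::field, 'o, 'v::ab_group_add) tcat"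
  assumes linear_category: "linear_category C"
begin

sublocale vector_space "Scal C"
  using linear_category by (simp add: linear_category_def)

lemma Mor_subspace [simp]: "subspace (Mor C X Y)"
  using linear_category by (simp add: linear_category_def)

lemma Mor_closed [simp]:
  "0 \<in> Mor C X Y"
  "f \<in> Mor C X Y \<Longrightarrow> g \<in> Mor C X Y \<Longrightarrow> f + g \<in> Mor C X Y"
  "f \<in> Mor C X Y \<Longrightarrow> g \<in> Mor C X Y \<Longrightarrow> f - g \<in> Mor C X Y"
  "f \<in> Mor C X Y \<Longrightarrow> - f \<in> Mor C X Y"
  "f \<in> Mor C X Y \<Longrightarrow> Scal C c f \<in> Mor C X Y"
  by (auto intro: subspace_0 subspace_add subspace_diff subspace_neg subspace_scale)

lemma Mor_sum [simp]: "(\<And>i. i \<in> I \<Longrightarrow> f i \<in> Mor C X Y) \<Longrightarrow> sum f I \<in> Mor C X Y"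
  by (rule subspace_sum) auto

lemma Idm_in [simp]: "Idm C X \<in> Mor C X X"
  using linear_category by (simp add: linear_category_def)

lemma Cmp_Idm [simp]:
  "f \<in> Mor C X Y \<Longrightarrow> Cmp C X X Y f (Idm C X) = f"
  "f \<in> Mor C X Y \<Longrightarrow> Cmp C X Y Y (Idm C Y) f = f"
  using linear_category by (simp_all add: linear_category_def)

lemma Cmp_linear_left:
  "f \<in> Mor C X Y \<Longrightarrow> linear_on_sub (Scal C) (Scal C) (Mor C Y Z) (Mor C X Z) (\<lambda>g. Cmp C X Y Z g f)"
  using linear_category by (simp add: linear_category_def)

lemma Cmp_linear_right:
  "g \<in> Mor C Y Z \<Longrightarrow> linear_on_sub (Scal C) (Scal C) (Mor C X Y) (Mor C X Z) (Cmp C X Y Z g)"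
  using linear_category by (simp add: linear_category_def)

lemma Cmp_in [simp]: "f \<in> Mor C X Y \<Longrightarrow> g \<in> Mor C Y Z \<Longrightarrow> Cmp C X Y Z g f \<in> Mor C X Z"
  by (rule linear_on_subD(1)[OF Cmp_linear_left])

lemma Cmp_assoc:
  "f \<in> Mor C W X \<Longrightarrow> g \<in> Mor C X Y \<Longrightarrow> h \<in> Mor C Y Z \<Longrightarrow>
    Cmp C W X Z (Cmp C X Y Z h g) f = Cmp C W Y Z h (Cmp C W X Y g f)"
  using linear_category by (simp add: linear_category_def)

lemma Cmp_add [simp]:
  "f \<in> Mor C X Y \<Longrightarrow> g \<in> Mor C Y Z \<Longrightarrow> g' \<in> Mor C Y Z \<Longrightarrow>
    Cmp C X Y Z (g + g') f = Cmp C X Y Z g f + Cmp C X Y Z g' f"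
  "f \<in> Mor C X Y \<Longrightarrow> f' \<in> Mor C X Y \<Longrightarrow> g \<in> Mor C Y Z \<Longrightarrow>
    Cmp C X Y Z g (f + f') = Cmp C X Y Z g f + Cmp C X Y Z g f'"
  by (rule linear_on_subD(2)[OF Cmp_linear_left] linear_on_subD(2)[OF Cmp_linear_right]; assumption)+

lemma Cmp_Scal [simp]:
  "f \<in> Mor C X Y \<Longrightarrow> g \<in> Mor C Y Z \<Longrightarrow> Cmp C X Y Z (Scal C c g) f = Scal C c (Cmp C X Y Z g f)"
  "f \<in> Mor C X Y \<Longrightarrow> g \<in> Mor C Y Z \<Longrightarrow> Cmp C X Y Z g (Scal C c f) = Scal C c (Cmp C X Y Z g f)"
  by (rule linear_on_subD(3)[OF Cmp_linear_left] linear_on_subD(3)[OF Cmp_linear_right]; assumption)+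

lemma Cmp_zero [simp]:
  "f \<in> Mor C X Y \<Longrightarrow> Cmp C X Y Z 0 f = 0"
  "g \<in> Mor C Y Z \<Longrightarrow> Cmp C X Y Z g 0 = 0"
  using Cmp_Scal(1)[of f X Y 0 Z 0] Cmp_Scal(2)[of 0 X Y g Z 0] by simp_all

lemma Cmp_minus [simp]:
  "f \<in> Mor C X Y \<Longrightarrow> g \<in> Mor C Y Z \<Longrightarrow> Cmp C X Y Z (- g) f = - Cmp C X Y Z g f"
  "f \<in> Mor C X Y \<Longrightarrow> g \<in> Mor C Y Z \<Longrightarrow> Cmp C X Y Z g (- f) = - Cmp C X Y Z g f"
  using Cmp_Scal(1)[of f X Y g Z "-1"] Cmp_Scal(2)[of f X Y g Z "-1"] by simp_all

lemma Cmp_diff [simp]: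
  "f \<in> Mor C X Y \<Longrightarrow> g \<in> Mor C Y Z \<Longrightarrow> g' \<in> Mor C Y Z \<Longrightarrow>
    Cmp C X Y Z (g - g') f = Cmp C X Y Z g f - Cmp C X Y Z g' f"
  "f \<in> Mor C X Y \<Longrightarrow> f' \<in> Mor C X Y \<Longrightarrow> g \<in> Mor C Y Z \<Longrightarrow>
    Cmp C X Y Z g (f - f') = Cmp C X Y Z g f - Cmp C X Y Z g f'"
  using Cmp_add(1)[of f X Y g Z "- g'"] Cmp_add(2)[of f X Y "- f'" g Z] by simp_all

lemma Cmp_sum_left:
  assumes "f \<in> Mor C X Y" "\<And>i. i \<in> I \<Longrightarrow> g i \<in> Mor C Y Z"
  shows "Cmp C X Y Z (sum g I) f = (\<Sum>i\<in>I. Cmp C X Y Z (g i) f)"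
  using assms(2) by (induction I rule: infinite_finite_induct) (simp_all add: assms(1))

lemma Cmp_sum_right:
  assumes "g \<in> Mor C Y Z" "\<And>i. i \<in> I \<Longrightarrow> f i \<in> Mor C X Y"
  shows "Cmp C X Y Z g (sum f I) = (\<Sum>i\<in>I. Cmp C X Y Z g (f i))"
  using assms(2) by (induction I rule: infinite_finite_induct) (simp_all add: assms(1))

lemma is_isoI:
  "f \<in> Mor C X Y \<Longrightarrow> g \<in> Mor C Y X \<Longrightarrow> Cmp C X Y X g f = Idm C X \<Longrightarrow> Cmp C Y X Y f g = Idm C Y
    \<Longrightarrow> is_iso C X Y f"
  by (auto simp: is_iso_def inverse_maps_def)

lemma is_isoE:
  assumes "is_iso C X Y f"
  obtains g where "f \<in> Mor C X Y" "g \<in> Mor C Y X" "Cmp C X Y X g f = Idm C X" "Cmp C Y X Y f g = Idm C Y"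
  using assms by (auto simp: is_iso_def inverse_maps_def)

lemma is_iso_Idm [simp]: "is_iso C X X (Idm C X)"
  by (rule is_isoI[of _ _ _ "Idm C X"]) auto

lemma is_iso_Cmp:
  assumes "is_iso C X Y f" "is_iso C Y Z g"
  shows "is_iso C X Z (Cmp C X Y Z g f)"
proof -
  obtain f' where f: "f \<in> Mor C X Y" "f' \<in> Mor C Y X" "Cmp C X Y X f' f = Idm C X" "Cmp C Y X Y f f' = Idm C Y"
    using assms(1) by (rule is_isoE)
  obtain g' where g: "g \<in> Mor C Y Z" "g' \<in> Mor C Z Y" "Cmp C Y Z Y g' g = Idm C Y" "Cmp C Z Y Z g g' = Idm C Z"
    using assms(2) by (rule is_isoE)
  have "Cmp C X Z Y g' (Cmp C X Y Z g f) = f" "Cmp C Z X Y f (Cmp C Z Y X f' g') = g'"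
    using f g Cmp_assoc[of f X Y g Z g' Y, symmetric] Cmp_assoc[of g' Z Y f' X f Y, symmetric] by simp_all
  then show ?thesis
    by (intro is_isoI[of _ _ _ "Cmp C Z Y X f' g'"]) (use f g in \<open>simp_all add: Cmp_assoc\<close>)
qed

lemma zero_object_iff_is_iso_0: "zero_object C X \<longleftrightarrow> is_iso C X X 0"
proof
  assume "is_iso C X X 0"
  then show "zero_object C X" by (rule is_isoE) (simp add: zero_object_def)
next
  assume "zero_object C X"
  then show "is_iso C X X 0"
    using is_iso_Idm[of X] by (simp add: zero_object_def)
qed

lemma Mor_zero_object:
  assumes "zero_object C X" "f \<in> Mor C X Y \<or> f \<in> Mor C Y X"
  shows "f = 0"
proof -
  have 0: "Idm C X = 0" using assms(1) by (simp add: zero_object_def)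
  from assms(2) show ?thesis
  proof
    assume "f \<in> Mor C X Y"
    from Cmp_Idm(1)[OF this] this show ?thesis by (simp add: 0)
  next
    assume "f \<in> Mor C Y X"
    from Cmp_Idm(2)[OF this] this show ?thesis by (simp add: 0)
  qed
qed

section \<open>Polynomials in an endomorphism, and the splitting of idempotents\<close>

definition End_poly :: "'o \<Rightarrow> 'v \<Rightarrow> 'k poly \<Rightarrow> 'v" where
  "End_poly X a p = fold_coeffs (\<lambda>c b. Scal C c (Idm C X) + Cmp C X X X b a) p 0"

lemma End_poly_0 [simp]: "End_poly X a 0 = 0"
  by (simp add: End_poly_def)

lemma End_poly_pCons:
  assumes "a \<in> Mor C X X"
  shows "End_poly X a (pCons c p) = Scal C c (Idm C X) + Cmp C X X X (End_poly X a p) a"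
proof (cases "c = 0 \<and> p = 0")
  case True
  then show ?thesis using assms by simp
next
  case False
  then show ?thesis
    unfolding End_poly_def by (cases "p = 0") simp_all
qed

lemma End_poly_in [simp]: "a \<in> Mor C X X \<Longrightarrow> End_poly X a p \<in> Mor C X X"
  by (induction p) (simp_all add: End_poly_pCons)

lemma End_poly_1 [simp]: "a \<in> Mor C X X \<Longrightarrow> End_poly X a 1 = Idm C X"
  by (simp add: one_pCons End_poly_pCons)

lemma End_poly_add:
  assumes "a \<in> Mor C X X"
  shows "End_poly X a (p + q) = End_poly X a p + End_poly X a q"
  by (induction p q rule: poly_induct2) (simp_all add: End_poly_pCons assms scale_left_distrib)

lemma End_poly_smult:
  assumes "a \<in> Mor C X X"
  shows "End_poly X a (smult c p) = Scal C c (End_poly X a p)"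
  by (induction p) (simp_all add: End_poly_pCons assms scale_right_distrib)

lemma End_poly_commute:
  assumes "a \<in> Mor C X X"
  shows "Cmp C X X X a (End_poly X a p) = Cmp C X X X (End_poly X a p) a"
  by (induction p) (simp_all add: End_poly_pCons assms flip: Cmp_assoc)

lemma End_poly_mult:
  assumes a: "a \<in> Mor C X X"
  shows "End_poly X a (p * q) = Cmp C X X X (End_poly X a p) (End_poly X a q)"
proof (induction p)
  case 0
  then show ?case using a by simp
next
  case (pCons c p)
  have "End_poly X a (pCons c p * q) = Scal C c (End_poly X a q) + Cmp C X X X (End_poly X a (p * q)) a"
    using a by (simp add: End_poly_add End_poly_smult End_poly_pCons)
  then show ?case
    using a pCons by (simp add: End_poly_pCons Cmp_assoc End_poly_commute)
qed

text \<open>More powers of \<open>a\<close> than the dimension of the endomorphism space cannot be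
  linearly independent.\<close>

lemma End_poly_annihilator:
  assumes "finite_dim_sub (Scal C) (Mor C X X)" and a: "a \<in> Mor C X X"
  obtains p where "p \<noteq> 0" "End_poly X a p = 0"
proof (rule ccontr)
  assume "\<not> thesis"
  then have inj: "End_poly X a p = 0 \<Longrightarrow> p = 0" for p using that by blast
  define N where "N = Suc (dim (Mor C X X))"
  let ?x = "\<lambda>i. End_poly X a (monom 1 i)"
  let ?V = "span (?x ` {..<N})"
  have V: "?V \<subseteq> Mor C X X" by (rule span_minimal) (use a in auto)
  have sm: "End_poly X a (\<Sum>i\<in>A. monom (c i) i) = (\<Sum>i\<in>A. Scal C (c i) (?x i))" for A c
    by (induction A rule: infinite_finite_induct)
      (simp_all add: a End_poly_add smult_monom flip: End_poly_smult)
  have ind: "\<forall>i\<in>{..<N}. c i = 0" if "(\<Sum>i<N. Scal C (c i) (?x i)) = 0" for c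
  proof
    fix j assume j: "j \<in> {..<N}"
    have "coeff (\<Sum>i<N. monom (c i) i) j = (\<Sum>i<N. if i = j then c i else 0)"
      by (simp add: coeff_sum)
    also have "\<dots> = c j" using j by simp
    finally show "c j = 0" using inj[of "\<Sum>i<N. monom (c i) i"] that sm by simp
  qed
  have b: "basis_mod (Scal C) {0} ?V {..<N} ?x"
    unfolding basis_mod_def
  proof (intro conjI allI impI)
    show "?x ` {..<N} \<subseteq> ?V" by (rule span_superset)
    show "\<forall>v\<in>?V. \<exists>c. v - (\<Sum>i<N. Scal C (c i) (?x i)) \<in> {0}"
    proof
      fix v assume "v \<in> ?V"
      then have "\<exists>c. v = (\<Sum>i<N. Scal C (c i) (?x i))"
      proof (induction rule: span_induct_alt)
        case base
        show ?case by (rule exI[of _ "\<lambda>_. 0"]) simp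
      next
        case (step c x y)
        obtain d where d: "y = (\<Sum>i<N. Scal C (d i) (?x i))" using step(2) by blast
        obtain j where j: "j < N" "x = ?x j" using step(1) by blast
        have "Scal C c x = (\<Sum>i<N. Scal C (if i = j then c else 0) (?x i))"
        proof -
          have "(\<Sum>i<N. Scal C (if i = j then c else 0) (?x i)) = (\<Sum>i<N. if i = j then Scal C c (?x i) else 0)"
            by (intro sum.cong) auto
          then show ?thesis using j by simp
        qed
        then have "Scal C c x + y = (\<Sum>i<N. Scal C ((if i = j then c else 0) + d i) (?x i))"
          by (simp only: d scale_left_distrib sum.distrib)
        then show ?case by (rule exI[of _ "\<lambda>i. (if i = j then c else 0) + d i"])
      qed
      then show "\<exists>c. v - (\<Sum>i<N. Scal C (c i) (?x i)) \<in> {0}" by simp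
    qed
  qed (use ind in auto)
  have "finite_dim_sub (Scal C) {0}"
    unfolding finite_dim_sub_def by (rule exI[of _ "{}"]) simp
  from dim_basis_mod(1)[OF subspace_single_0 this subspace_span _ b]
  have "dim ?V \<ge> N" by (simp add: span_zero)
  moreover have "dim ?V \<le> dim (Mor C X X)"
    using V assms by (intro dim_subset_sub) auto
  ultimately show False by (simp add: N_def)
qed

text \<open>Both \<open>e\<close> and its complement split. The mixed composites vanish because
  \<open>e\<close> fixes the inclusion of \<open>Y\<close> and kills that of
  \<open>Y'\<close>.\<close>

lemma split_idempotent_sum:
  assumes si: "split_idempotents C" and e: "e \<in> Mor C X X" "Cmp C X X X e e = e"
  obtains Y Y' p i p' i' where "p \<in> Mor C X Y" "i \<in> Mor C Y X" "p' \<in> Mor C X Y'" "i' \<in> Mor C Y' X"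
    "Cmp C X Y X i p = e" "Cmp C X Y' X i' p' = Idm C X - e"
    "Cmp C Y X Y p i = Idm C Y" "Cmp C Y' X Y' p' i' = Idm C Y'"
    "Cmp C Y' X Y p i' = 0" "Cmp C Y X Y' p' i = 0"
    "is_sum_of_two C X Y Y'"
proof -
  obtain Y p i where p: "p \<in> Mor C X Y" "i \<in> Mor C Y X" "Cmp C X Y X i p = e" "Cmp C Y X Y p i = Idm C Y"
    using si e unfolding split_idempotents_def by blast
  have "Idm C X - e \<in> Mor C X X" "Cmp C X X X (Idm C X - e) (Idm C X - e) = Idm C X - e"
    using e by auto
  then obtain Y' p' i' where q: "p' \<in> Mor C X Y'" "i' \<in> Mor C Y' X" "Cmp C X Y' X i' p' = Idm C X - e"
      "Cmp C Y' X Y' p' i' = Idm C Y'"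
    using si unfolding split_idempotents_def by blast
  have pe: "Cmp C X X Y p e = p"
    using p by (simp flip: p(3)) (simp flip: Cmp_assoc)
  have qe: "Cmp C X X Y' p' (Idm C X - e) = p'"
    using q by (simp flip: q(3)) (simp flip: Cmp_assoc)
  have ei: "Cmp C Y X X e i = i" using p by (simp add: Cmp_assoc flip: p(3))
  have ei': "Cmp C Y' X X (Idm C X - e) i' = i'" using q by (simp add: Cmp_assoc flip: q(3))
  have "Cmp C Y' X Y p i' = Cmp C Y' X Y p (Cmp C Y' X X e i')"
    using p q e pe by (simp flip: Cmp_assoc)
  also have "Cmp C Y' X X e i' = 0" using ei' q e by simp
  finally have 1: "Cmp C Y' X Y p i' = 0" using p by simp
  have "Cmp C Y X Y' p' i = Cmp C Y X Y' p' (Cmp C Y X X (Idm C X - e) i)"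
    using p q e by (subst (1) qe[symmetric], subst Cmp_assoc) auto
  also have "Cmp C Y X X (Idm C X - e) i = 0" using ei p e by simp
  finally have 2: "Cmp C Y X Y' p' i = 0" using q by simp
  have "is_sum_of_two C X Y Y'"
    unfolding is_sum_of_two_def direct_sum_def
    by (rule exI[of _ "\<lambda>b. if b then i else i'"], rule exI[of _ "\<lambda>b. if b then p else p'"])
      (use p q 1 2 in \<open>auto simp: UNIV_bool\<close>)
  with p q 1 2 show thesis using that by blast
qed

lemma indecomposable_idempotent:
  assumes "split_idempotents C" "indecomposable C X" "e \<in> Mor C X X" "Cmp C X X X e e = e"
  shows "e = 0 \<or> e = Idm C X"
proof -
  obtain Y Y' p i p' i' where *: "p \<in> Mor C X Y" "i \<in> Mor C Y X" "p' \<in> Mor C X Y'" "i' \<in> Mor C Y' X"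
    "Cmp C X Y X i p = e" "Cmp C X Y' X i' p' = Idm C X - e" "is_sum_of_two C X Y Y'"
    using split_idempotent_sum[OF assms(1,3,4)] by metis
  then have "zero_object C Y \<or> zero_object C Y'"
    using assms(2) by (simp add: indecomposable_def)
  then have "p = 0 \<or> p' = 0" using * Mor_zero_object by blast
  then show ?thesis using * by auto
qed

end

text \<open>The relation for \<open>Suc m\<close> is the product of the one for \<open>m\<close> and
  the one for exponent 1. The latter is synthetic division of \<open>q\<close> by the linear factor,
  divided by the nonzero remainder \<open>poly q c\<close>.\<close>

lemma bezout_linear_power:
  fixes q :: "'k::field poly"
  assumes "poly q c \<noteq> 0"
  shows "\<exists>u v. u * [:- c, 1:] ^ m + v * q = 1"
proof (induction m)
  case 0
  show ?case by (rule exI[of _ 1], rule exI[of _ 0]) simp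
next
  case (Suc m)
  then obtain u v where uv: "u * [:- c, 1:] ^ m + v * q = 1" by blast
  define s where "s = smult (- inverse (poly q c)) (synthetic_div q c)"
  define t where "t = [:inverse (poly q c):]"
  have "[:- c, 1:] * synthetic_div q c + [:poly q c:] = q"
    using synthetic_div_correct'[of c q] by simp
  then have "smult (inverse (poly q c)) q =
      smult (inverse (poly q c)) ([:- c, 1:] * synthetic_div q c + [:poly q c:])" by simp
  then have st: "s * [:- c, 1:] + t * q = 1"
    using assms by (simp add: s_def t_def smult_add_right one_pCons mult.commute)
  have "1 = (u * [:- c, 1:] ^ m + v * q) * (s * [:- c, 1:] + t * q)"
    using uv st by simp
  also have "\<dots> = (u * s) * [:- c, 1:] ^ Suc m + (u * [:- c, 1:] ^ m * t + v * s * [:- c, 1:] + v * q * t) * q"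
    by (simp only: power_Suc distrib_left distrib_right mult_ac)
       (simp only: add_ac)
  finally show ?case by metis
qed

context linear_cat
begin

section \<open>The radical as a two-sided ideal\<close>

lemma rad_Mor: "f \<in> rad C X Y \<Longrightarrow> f \<in> Mor C X Y"
  by (simp add: rad_def)

text \<open>If w inverts 1 - g f, then 1 + f w g inverts 1 - f g. This makes the definition of the
  radical symmetric in left and right.\<close>

lemma is_iso_Idm_minus_swap:
  assumes f: "f \<in> Mor C X Y" and g: "g \<in> Mor C Y X"
    and "is_iso C X X (Idm C X - Cmp C X Y X g f)"
  shows "is_iso C Y Y (Idm C Y - Cmp C Y X Y f g)"
proof -
  obtain w where w: "w \<in> Mor C X X" "Cmp C X X X w (Idm C X - Cmp C X Y X g f) = Idm C X"
      "Cmp C X X X (Idm C X - Cmp C X Y X g f) w = Idm C X"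
    using assms(3) by (rule is_isoE)
  let ?v = "Idm C Y + Cmp C Y X Y f (Cmp C Y X X w g)"
  have 1: "w = Idm C X + Cmp C X Y X g (Cmp C X X Y f w)"
    using w f g by (simp add: Cmp_assoc diff_eq_eq)
  have 2: "w = Idm C X + Cmp C X Y X (Cmp C Y X X w g) f"
    using w f g by (simp add: Cmp_assoc diff_eq_eq)
  have 3: "Cmp C Y X X w g = g + Cmp C Y Y X g (Cmp C Y X Y f (Cmp C Y X X w g))"
    using arg_cong[OF 1, of "\<lambda>w. Cmp C Y X X w g"] w f g by (simp add: Cmp_assoc)
  have "Cmp C Y X X w g = Cmp C Y X X (Idm C X + Cmp C X Y X (Cmp C Y X X w g) f) g"
    by (rule arg_cong[OF 2])
  also have "\<dots> = g + Cmp C Y Y X (Cmp C Y X X w g) (Cmp C Y X Y f g)"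
    using w(1) f g by (simp add: Cmp_assoc)
  finally have 4: "Cmp C Y X X w g = g + Cmp C Y Y X (Cmp C Y X X w g) (Cmp C Y X Y f g)" .
  let ?h = "Cmp C Y X X w g"
  have a5: "Cmp C Y X Y f ?h = Cmp C Y X Y f g + Cmp C Y X Y f (Cmp C Y Y X g (Cmp C Y X Y f ?h))"
    using arg_cong[OF 3, of "Cmp C Y X Y f"] w(1) f g by simp
  have "Cmp C Y Y Y (Idm C Y - Cmp C Y X Y f g) ?v
      = Idm C Y + Cmp C Y X Y f ?h - (Cmp C Y X Y f g + Cmp C Y X Y f (Cmp C Y Y X g (Cmp C Y X Y f ?h)))"
    using w(1) f g by (simp add: Cmp_assoc)
  then have 5: "Cmp C Y Y Y (Idm C Y - Cmp C Y X Y f g) ?v = Idm C Y"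
    unfolding a5[symmetric] by simp
  have a6: "Cmp C Y X Y f ?h = Cmp C Y X Y f g + Cmp C Y X Y f (Cmp C Y Y X ?h (Cmp C Y X Y f g))"
    using arg_cong[OF 4, of "Cmp C Y X Y f"] w(1) f g by simp
  have "Cmp C Y Y Y ?v (Idm C Y - Cmp C Y X Y f g)
      = Idm C Y + Cmp C Y X Y f ?h - (Cmp C Y X Y f g + Cmp C Y X Y f (Cmp C Y Y X ?h (Cmp C Y X Y f g)))"
    using w(1) f g by (simp add: Cmp_assoc)
  then have 6: "Cmp C Y Y Y ?v (Idm C Y - Cmp C Y X Y f g) = Idm C Y"
    unfolding a6[symmetric] by simp
  show ?thesis
    by (rule is_isoI[OF _ _ 6 5]) (use w f g in simp_all)
qed

lemma rad_iff':
  "f \<in> rad C X Y \<longleftrightarrow> f \<in> Mor C X Y \<and> (\<forall>g\<in>Mor C Y X. is_iso C Y Y (Idm C Y - Cmp C Y X Y f g))"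
  unfolding rad_def using is_iso_Idm_minus_swap by blast

lemma rad_0 [simp]: "0 \<in> rad C X Y"
  by (simp add: rad_def)

lemma rad_Cmp_left: "f \<in> rad C X Y \<Longrightarrow> h \<in> Mor C Y Z \<Longrightarrow> Cmp C X Y Z h f \<in> rad C X Z"
  unfolding rad_def by (auto simp flip: Cmp_assoc)

lemma rad_Cmp_right: "f \<in> rad C X Y \<Longrightarrow> h \<in> Mor C W X \<Longrightarrow> Cmp C W X Y f h \<in> rad C W Y"
  unfolding rad_iff' by (auto simp: Cmp_assoc)

lemma rad_add:
  assumes "f \<in> rad C X Y" "f' \<in> rad C X Y"
  shows "f + f' \<in> rad C X Y"
  unfolding rad_def
proof (intro CollectI conjI ballI)
  have f: "f \<in> Mor C X Y" "f' \<in> Mor C X Y" using assms by (simp_all add: rad_Mor)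
  show "f + f' \<in> Mor C X Y" using f by simp
  fix g assume g: "g \<in> Mor C Y X"
  let ?u = "Idm C X - Cmp C X Y X g f"
  have i: "is_iso C X X ?u" using assms(1) g by (simp add: rad_def)
  then obtain w where w: "w \<in> Mor C X X" "Cmp C X X X ?u w = Idm C X"
    by (rule is_isoE)
  have "Cmp C X X X ?u (Cmp C X X X w (Cmp C X Y X g f')) = Cmp C X Y X g f'"
    using w f g by (subst Cmp_assoc[symmetric]) simp_all
  \<comment> \<open>With u = 1 - g f and its inverse w, the map 1 - g (f + f') equals u (1 - w g
    f'), a product of two isomorphisms.\<close>
  then have "Idm C X - Cmp C X Y X g (f + f') = Cmp C X X X ?u (Idm C X - Cmp C X Y X (Cmp C Y X X w g) f')"
    using w f g by (simp add: Cmp_assoc)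
  moreover have "is_iso C X X (Idm C X - Cmp C X Y X (Cmp C Y X X w g) f')"
    using assms(2) w g by (simp add: rad_def)
  ultimately show "is_iso C X X (Idm C X - Cmp C X Y X g (f + f'))"
    using i is_iso_Cmp by simp
qed

lemma rad_Scal:
  assumes "f \<in> rad C X Y"
  shows "Scal C c f \<in> rad C X Y"
  using rad_Cmp_left[OF assms, of "Scal C c (Idm C Y)" Y] assms by (simp add: rad_Mor)

lemma rad_minus: "f \<in> rad C X Y \<Longrightarrow> - f \<in> rad C X Y"
  using rad_Scal[of f X Y "-1"] by simp

lemma rad_diff: "f \<in> rad C X Y \<Longrightarrow> g \<in> rad C X Y \<Longrightarrow> f - g \<in> rad C X Y"
  using rad_add[of f X Y "- g"] rad_minus by simp

lemma rad_subspace [simp]: "subspace (rad C X Y)"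
  by (rule subspaceI) (auto intro: rad_add rad_Scal)

lemma rad_sum: "(\<And>i. i \<in> I \<Longrightarrow> f i \<in> rad C X Y) \<Longrightarrow> sum f I \<in> rad C X Y"
  by (rule subspace_sum) auto

lemma Idm_notin_rad: "\<not> zero_object C X \<Longrightarrow> Idm C X \<notin> rad C X X"
  unfolding zero_object_iff_is_iso_0
proof
  assume "\<not> is_iso C X X 0" and "Idm C X \<in> rad C X X"
  then have "is_iso C X X (Idm C X - Cmp C X X X (Idm C X) (Idm C X))"
    unfolding rad_def by blast
  then show False using \<open>\<not> is_iso C X X 0\<close> by simp
qed

end

locale krull_schmidt_cat = linear_cat C for C :: "('k::alg_closed_field, 'o, 'v::ab_group_add) tcat" +
  assumes hom_finite: "hom_finite C" and split_idempotents: "split_idempotents C"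
begin

lemma Mor_finite_dim [simp]: "finite_dim_sub (Scal C) (Mor C X Y)"
  using hom_finite by (simp add: hom_finite_def)

text \<open>The endomorphism ring has no idempotents besides 0 and 1, so a minimal polynomial of
  \<open>a\<close> cannot have two coprime factors and is a power of one linear factor. Hence
  \<open>a\<close> has the single eigenvalue \<open>c\<close>, which decides about the invertibility
  of all polynomials in \<open>a\<close>.\<close>

lemma indecomposable_End_eigenvalue:
  assumes X: "indecomposable C X" and a: "a \<in> Mor C X X"
  obtains c where "\<And>q. is_iso C X X (End_poly X a q) \<longleftrightarrow> poly q c \<noteq> 0"
proof -
  have nz: "Idm C X \<noteq> 0" using X by (simp add: indecomposable_def zero_object_def)
  obtain p0 where "p0 \<noteq> 0 \<and> End_poly X a p0 = 0"
    using End_poly_annihilator[OF Mor_finite_dim a] by blast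
  from ex_has_least_nat[of "\<lambda>p. p \<noteq> 0 \<and> End_poly X a p = 0", OF this, of degree]
  obtain p where p: "p \<noteq> 0" "End_poly X a p = 0"
    and min: "\<And>q. q \<noteq> 0 \<Longrightarrow> End_poly X a q = 0 \<Longrightarrow> degree p \<le> degree q"
    by blast
  have "degree p > 0"
  proof (rule ccontr)
    assume "\<not> degree p > 0"
    then obtain d where "p = [:d:]" by (metis degree_eq_zeroE gr0I)
    then show False using p a nz by (simp add: End_poly_pCons)
  qed
  then obtain c where c: "poly p c = 0" using alg_closed_imp_poly_has_root by blast
  define m where "m = order c p"
  obtain q where q: "p = [:- c, 1:] ^ m * q" "\<not> [:- c, 1:] dvd q"
    using order_decomp[OF p(1)] m_def by blast
  have m: "m > 0" using c p(1) by (simp add: m_def order_root)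
  have qc: "poly q c \<noteq> 0" using q(2) by (simp add: poly_eq_0_iff_dvd)
  obtain u v where uv: "u * [:- c, 1:] ^ m + v * q = 1"
    using bezout_linear_power[OF qc] by blast
  \<comment> \<open>The idempotent of the Bezout relation u P + v q = 1, where P q = p annihilates
    \<open>a\<close>. It is not 0, since otherwise \<open>q\<close> would annihilate
    \<open>a\<close> with a degree smaller than that of \<open>p\<close>; so it is 1, and P alone
    annihilates \<open>a\<close>.\<close>
  let ?e = "End_poly X a (v * q)" and ?P = "[:- c, 1:] ^ m"
  have uP: "End_poly X a (u * ?P) = Idm C X - ?e"
    using arg_cong[OF uv, of "End_poly X a"] a by (simp add: End_poly_add eq_diff_eq)
  have "Cmp C X X X ?e (Idm C X - ?e) = End_poly X a (v * u * p)"
    unfolding uP[symmetric] using a by (simp add: q(1) mult_ac flip: End_poly_mult)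
  also have "\<dots> = 0" using a p(2) by (simp add: End_poly_mult)
  finally have "Cmp C X X X ?e ?e = ?e" using a by simp
  then have "?e = 0 \<or> ?e = Idm C X"
    using indecomposable_idempotent[OF split_idempotents X] a by simp
  moreover have "?e \<noteq> 0"
  proof
    assume "?e = 0"
    then have "End_poly X a q = Cmp C X X X (End_poly X a (u * ?P)) (End_poly X a q)"
      using uP a by simp
    also have "\<dots> = End_poly X a (u * p)"
      using a by (simp add: q(1) mult_ac flip: End_poly_mult)
    also have "\<dots> = 0" using a p(2) by (simp add: End_poly_mult)
    finally have "degree p \<le> degree q" using min q p(1) by auto
    moreover have "degree p = m + degree q"
      using p(1) q(1) by (simp add: degree_mult_eq degree_power_eq)
    ultimately show False using m by simp
  qed
  ultimately have "?e = Idm C X" by blast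
  then have "End_poly X a ?P = Cmp C X X X (End_poly X a ?P) ?e" using a by simp
  also have "\<dots> = End_poly X a (v * p)"
    using a by (simp add: q(1) mult_ac flip: End_poly_mult)
  also have "\<dots> = 0" using a p(2) by (simp add: End_poly_mult)
  finally have P0: "End_poly X a ?P = 0" .
  show thesis
  proof (rule that, rule iffI)
    fix s assume iso: "is_iso C X X (End_poly X a s)"
    show "poly s c \<noteq> 0"
    proof
      assume "poly s c = 0"
      then obtain t where t: "s = [:- c, 1:] * t" by (metis dvdE poly_eq_0_iff_dvd)
      have "is_iso C X X (End_poly X a (s ^ i))" for i
        by (induction i) (use iso a in \<open>auto simp: End_poly_mult intro: is_iso_Cmp\<close>)
      moreover have "End_poly X a (s ^ m) = 0"
        using a P0 by (simp only: t power_mult_distrib End_poly_mult) simp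
      ultimately have "is_iso C X X 0" by metis
      then show False using nz by (simp add: zero_object_def flip: zero_object_iff_is_iso_0)
    qed
  next
    fix s assume "poly s c \<noteq> 0"
    then obtain u v where uv: "u * ?P + v * s = 1" using bezout_linear_power by blast
    have "End_poly X a (v * s) = Idm C X"
      using arg_cong[OF uv, of "End_poly X a"] a P0 by (simp add: End_poly_add End_poly_mult)
    then show "is_iso C X X (End_poly X a s)"
      using a by (intro is_isoI[of _ _ _ "End_poly X a v"])
        (simp_all flip: End_poly_mult add: mult.commute)
  qed
qed

text \<open>A non-invertible endomorphism has eigenvalue 0, so 1 - a has eigenvalue 1.\<close>

lemma indecomposable_local:
  assumes "indecomposable C X" "a \<in> Mor C X X" "\<not> is_iso C X X a"
  shows "is_iso C X X (Idm C X - a)"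
proof -
  obtain c where c: "\<And>q. is_iso C X X (End_poly X a q) \<longleftrightarrow> poly q c \<noteq> 0"
    using indecomposable_End_eigenvalue[OF assms(1,2)] by blast
  have "c = 0" using c[of "[:0, 1:]"] assms(2,3) by (simp add: End_poly_pCons)
  then show ?thesis using c[of "[:1, -1:]"] assms(2) by (simp add: End_poly_pCons)
qed

text \<open>Outside the radical some g f is invertible because the ring at \<open>X\<close> is
  local, so f has a left inverse h. Then f h is a nonzero idempotent at \<open>Y\<close>, hence
  1.\<close>

lemma indecomposable_rad_or_iso:
  assumes X: "indecomposable C X" and Y: "indecomposable C Y" and f: "f \<in> Mor C X Y" "f \<notin> rad C X Y"
  shows "is_iso C X Y f"
proof -
  obtain g where g: "g \<in> Mor C Y X" "\<not> is_iso C X X (Idm C X - Cmp C X Y X g f)"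
    using f by (auto simp: rad_def)
  then have "is_iso C X X (Cmp C X Y X g f)"
    using indecomposable_local[OF X, of "Cmp C X Y X g f"] f by auto
  then obtain w where w: "w \<in> Mor C X X" "Cmp C X X X w (Cmp C X Y X g f) = Idm C X"
    by (rule is_isoE)
  let ?h = "Cmp C Y X X w g" let ?e = "Cmp C Y X Y f ?h"
  have hf: "Cmp C X Y X ?h f = Idm C X" using w f g by (simp add: Cmp_assoc)
  have "Cmp C Y Y Y ?e ?e = Cmp C Y X Y f (Cmp C Y X X (Cmp C X Y X ?h f) ?h)"
    using w(1) f g by (simp add: Cmp_assoc)
  then have "Cmp C Y Y Y ?e ?e = ?e" using hf w(1) f g by simp
  then have "?e = 0 \<or> ?e = Idm C Y"
    using indecomposable_idempotent[OF split_idempotents Y] w(1) f g by simp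
  moreover have "?e \<noteq> 0"
  proof
    assume e: "?e = 0"
    have "f = Cmp C X X Y f (Cmp C X Y X ?h f)" using hf f by simp
    also have "\<dots> = Cmp C X Y Y ?e f" using w(1) f g by (simp add: Cmp_assoc)
    also have "\<dots> = 0" using e f by simp
    finally show False using f by simp
  qed
  ultimately show ?thesis
    using hf w(1) f g by (intro is_isoI[of _ _ _ ?h]) simp_all
qed

lemma rad_eq_Mor:
  assumes "indecomposable C X" "indecomposable C Y" "\<not> isomorphic C X Y"
  shows "rad C X Y = Mor C X Y"
  using indecomposable_rad_or_iso[OF assms(1,2)] assms(3) rad_Mor by (auto simp: isomorphic_def)

section \<open>The residue map from the endomorphisms of an indecomposable to the field\<close>

definition residue :: "'o \<Rightarrow> 'v \<Rightarrow> 'k" where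
  "residue X a = (THE c. a - Scal C c (Idm C X) \<in> rad C X X)"

lemma residue_unique:
  assumes X: "indecomposable C X"
    and "a - Scal C c (Idm C X) \<in> rad C X X" "a - Scal C d (Idm C X) \<in> rad C X X"
  shows "c = d"
proof (rule ccontr)
  assume "c \<noteq> d"
  have "Scal C (d - c) (Idm C X) \<in> rad C X X"
    using rad_diff[OF assms(2,3)] by (simp add: scale_left_diff_distrib)
  then have "Scal C (inverse (d - c)) (Scal C (d - c) (Idm C X)) \<in> rad C X X" by (rule rad_Scal)
  then have "Idm C X \<in> rad C X X" using \<open>c \<noteq> d\<close> by simp
  then show False using Idm_notin_rad X by (auto simp: indecomposable_def)
qed

text \<open>Subtracting the eigenvalue makes an endomorphism non-invertible and therefore radical.
  Here the algebraically closed field shows: the residue field is \<open>k\<close> itself and no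
  larger division algebra.\<close>

lemma residue_diff:
  assumes X: "indecomposable C X" and a: "a \<in> Mor C X X"
  shows "a - Scal C (residue X a) (Idm C X) \<in> rad C X X"
proof -
  obtain c where c: "\<And>q. is_iso C X X (End_poly X a q) \<longleftrightarrow> poly q c \<noteq> 0"
    using indecomposable_End_eigenvalue[OF X a] by blast
  have "End_poly X a [:-c, 1:] = a - Scal C c (Idm C X)"
    using a by (simp add: End_poly_pCons)
  with c[of "[:-c, 1:]"] have "\<not> is_iso C X X (a - Scal C c (Idm C X))" by simp
  then have c1: "a - Scal C c (Idm C X) \<in> rad C X X"
    using indecomposable_rad_or_iso[OF X X, of "a - Scal C c (Idm C X)"] a by auto
  show ?thesis
    unfolding residue_def by (rule theI[of _ c]) (rule c1, rule residue_unique[OF X _ c1])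
qed

lemma residue_eqI:
  assumes "indecomposable C X" "a \<in> Mor C X X" "a - Scal C c (Idm C X) \<in> rad C X X"
  shows "residue X a = c"
  using residue_unique[OF assms(1) residue_diff[OF assms(1,2)] assms(3)] .

lemma residue_rad: "indecomposable C X \<Longrightarrow> a \<in> rad C X X \<Longrightarrow> residue X a = 0"
  by (rule residue_eqI) (simp_all add: rad_Mor)

lemma residue_Idm: "indecomposable C X \<Longrightarrow> residue X (Idm C X) = 1"
  by (rule residue_eqI) simp_all

lemma residue_add:
  assumes X: "indecomposable C X" and "a \<in> Mor C X X" "b \<in> Mor C X X"
  shows "residue X (a + b) = residue X a + residue X b"
proof (rule residue_eqI[OF X])
  have "a + b - Scal C (residue X a + residue X b) (Idm C X)
      = (a - Scal C (residue X a) (Idm C X)) + (b - Scal C (residue X b) (Idm C X))"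
    by (simp only: scale_left_distrib add_diff_add)
  then show "a + b - Scal C (residue X a + residue X b) (Idm C X) \<in> rad C X X"
    using rad_add[OF residue_diff[OF X assms(2)] residue_diff[OF X assms(3)]] by (simp only:)
qed (use assms in simp)

lemma residue_Scal:
  assumes X: "indecomposable C X" and "a \<in> Mor C X X"
  shows "residue X (Scal C c a) = c * residue X a"
proof (rule residue_eqI[OF X])
  have "Scal C c a - Scal C (c * residue X a) (Idm C X) = Scal C c (a - Scal C (residue X a) (Idm C X))"
    by (simp add: scale_right_diff_distrib)
  then show "Scal C c a - Scal C (c * residue X a) (Idm C X) \<in> rad C X X"
    using rad_Scal[OF residue_diff[OF X assms(2)]] by simp
qed (use assms in simp)

section \<open>Decompositions in add(T)\<close>

text \<open>The complement is split off by the idempotent 1 - \<alpha> \<beta>, whose composites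
  with \<alpha> before it and \<beta> after it vanish.\<close>

lemma split_mono_complement:
  assumes a: "\<alpha> \<in> Mor C Z S" and b: "\<beta> \<in> Mor C S Z" and ba: "Cmp C Z S Z \<beta> \<alpha> = Idm C Z"
  obtains Y p i where "p \<in> Mor C S Y" "i \<in> Mor C Y S" "Cmp C S Y S i p = Idm C S - Cmp C S Z S \<alpha> \<beta>"
    "Cmp C Y S Y p i = Idm C Y" "Cmp C Z S Y p \<alpha> = 0" "Cmp C Y S Z \<beta> i = 0"
proof -
  define e where "e = Idm C S - Cmp C S Z S \<alpha> \<beta>"
  have e: "e \<in> Mor C S S" using a b by (simp add: e_def)
  have ea: "Cmp C Z S S e \<alpha> = 0" using a b ba by (simp add: e_def Cmp_assoc)
  have "Cmp C S S Z \<beta> (Cmp C S Z S \<alpha> \<beta>) = \<beta>"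
    using a b ba by (subst Cmp_assoc[symmetric]) simp_all
  then have be: "Cmp C S S Z \<beta> e = 0" using a b by (simp add: e_def)
  have "Cmp C S S S (Idm C S - Cmp C S Z S \<alpha> \<beta>) e = e"
    using a b e be by (simp add: Cmp_assoc)
  then have "Cmp C S S S e e = e" unfolding e_def[symmetric] .
  then obtain Y p i where p: "p \<in> Mor C S Y" "i \<in> Mor C Y S" "Cmp C S Y S i p = e" "Cmp C Y S Y p i = Idm C Y"
    using split_idempotents e unfolding split_idempotents_def by meson
  have "Cmp C Z S Y p \<alpha> = Cmp C Z Y Y (Cmp C Y S Y p i) (Cmp C Z S Y p \<alpha>)" using p a by simp
  also have "\<dots> = Cmp C Z S Y p (Cmp C Z S S (Cmp C S Y S i p) \<alpha>)" using p(1,2) a by (simp add: Cmp_assoc)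
  also have "\<dots> = 0" using p ea by simp
  finally have 1: "Cmp C Z S Y p \<alpha> = 0" .
  have "Cmp C Y S Z \<beta> i = Cmp C Y S Z \<beta> (Cmp C Y Y S i (Cmp C Y S Y p i))" using p b by simp
  also have "\<dots> = Cmp C Y S Z (Cmp C S S Z \<beta> (Cmp C S Y S i p)) i" using p(1,2) b by (simp add: Cmp_assoc)
  also have "\<dots> = 0" using p be by simp
  finally have 2: "Cmp C Y S Z \<beta> i = 0" .
  from that[OF p(1,2) _ p(4) 1 2] p(3) show thesis by (simp add: e_def)
qed

text \<open>Since idempotents split, direct factors are the same as retracts; the pair of maps is
  the form in which they are used.\<close>

lemma direct_factorI:
  assumes a: "\<alpha> \<in> Mor C Z S" and b: "\<beta> \<in> Mor C S Z" and ba: "Cmp C Z S Z \<beta> \<alpha> = Idm C Z"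
  shows "direct_factor C Z S"
proof -
  obtain Y p i where p: "p \<in> Mor C S Y" "i \<in> Mor C Y S" "Cmp C S Y S i p = Idm C S - Cmp C S Z S \<alpha> \<beta>"
    "Cmp C Y S Y p i = Idm C Y" "Cmp C Z S Y p \<alpha> = 0" "Cmp C Y S Z \<beta> i = 0"
    using split_mono_complement[OF assms] by metis
  have "is_sum_of_two C S Z Y"
    unfolding is_sum_of_two_def direct_sum_def
    by (rule exI[of _ "\<lambda>t. if t then \<alpha> else i"], rule exI[of _ "\<lambda>t. if t then \<beta> else p"])
      (use p a b ba in \<open>auto simp: UNIV_bool\<close>)
  then show ?thesis by (auto simp: direct_factor_def)
qed

lemma direct_factorE:
  assumes "direct_factor C Z S"
  obtains \<alpha> \<beta> where "\<alpha> \<in> Mor C Z S" "\<beta> \<in> Mor C S Z" "Cmp C Z S Z \<beta> \<alpha> = Idm C Z"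
proof -
  obtain Y \<iota> \<pi> where "direct_sum C S (UNIV :: bool set) (\<lambda>b. if b then Z else Y) \<iota> \<pi>"
    using assms by (auto simp: direct_factor_def is_sum_of_two_def)
  then have 1: "\<forall>i\<in>UNIV. \<iota> i \<in> Mor C (if i then Z else Y) S \<and> \<pi> i \<in> Mor C S (if i then Z else Y)"
    and 2: "\<forall>i\<in>UNIV. \<forall>j\<in>UNIV. Cmp C (if i then Z else Y) S (if j then Z else Y) (\<pi> j) (\<iota> i)
      = (if i = j then Idm C (if i then Z else Y) else 0)"
    by (auto simp: direct_sum_def)
  show thesis
    using that[of "\<iota> True" "\<pi> True"] 1[THEN bspec, of True] 2[THEN bspec, of True, THEN bspec, of True] by simp
qed

lemma add_of_generator: "T \<in> add_of C {T}"
proof -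
  have "direct_sum C T {..<1::nat} (\<lambda>_. T) (\<lambda>_. Idm C T) (\<lambda>_. Idm C T)"
    by (auto simp: direct_sum_def)
  moreover have "direct_factor C T T"
    by (rule direct_factorI[of "Idm C T" _ _ "Idm C T"]) simp_all
  ultimately show ?thesis unfolding add_of_def by blast
qed

lemma add_of_direct_factor:
  assumes "direct_factor C X Y" "Y \<in> add_of C \<S>"
  shows "X \<in> add_of C \<S>"
proof -
  obtain S m Xs \<iota> \<pi> where S: "direct_sum C S {..<m::nat} Xs \<iota> \<pi>" "\<forall>i<m. Xs i \<in> \<S>" "direct_factor C Y S"
    using assms(2) by (auto simp: add_of_def)
  obtain a b where ab: "a \<in> Mor C X Y" "b \<in> Mor C Y X" "Cmp C X Y X b a = Idm C X"
    using assms(1) by (rule direct_factorE)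
  obtain c d where cd: "c \<in> Mor C Y S" "d \<in> Mor C S Y" "Cmp C Y S Y d c = Idm C Y"
    using S(3) by (rule direct_factorE)
  have "Cmp C X S Y d (Cmp C X Y S c a) = a" using ab cd by (simp flip: Cmp_assoc)
  then have "direct_factor C X S"
    by (intro direct_factorI[of "Cmp C X Y S c a" _ _ "Cmp C S Y X b d"]) (use ab cd in \<open>simp_all add: Cmp_assoc\<close>)
  then show ?thesis using S unfolding add_of_def by blast
qed

end

locale basic_object = krull_schmidt_cat C for C :: "('k::alg_closed_field, 'o, 'v::ab_group_add) tcat" +
  fixes T :: 'o and Ts :: "nat \<Rightarrow> 'o" and n :: nat and \<iota> \<pi> :: "nat \<Rightarrow> 'v"
  assumes T_sum: "direct_sum C T {1..n} Ts \<iota> \<pi>"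
    and Ts_indec: "i \<in> {1..n} \<Longrightarrow> indecomposable C (Ts i)"
    and Ts_noniso: "i \<in> {1..n} \<Longrightarrow> j \<in> {1..n} \<Longrightarrow> i \<noteq> j \<Longrightarrow> \<not> isomorphic C (Ts i) (Ts j)"
begin

declare One_nat_def [simp del] atLeastAtMost_iff [simp del]

lemma incl_proj_in [simp]:
  "i \<in> {1..n} \<Longrightarrow> \<iota> i \<in> Mor C (Ts i) T"
  "i \<in> {1..n} \<Longrightarrow> \<pi> i \<in> Mor C T (Ts i)"
  using T_sum by (auto simp: direct_sum_def)

lemma proj_incl:
  "i \<in> {1..n} \<Longrightarrow> j \<in> {1..n} \<Longrightarrow> Cmp C (Ts i) T (Ts j) (\<pi> j) (\<iota> i) = (if i = j then Idm C (Ts i) else 0)"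
  using T_sum by (auto simp: direct_sum_def)

lemma incl_proj_sum: "(\<Sum>i\<in>{1..n}. Cmp C T (Ts i) T (\<iota> i) (\<pi> i)) = Idm C T"
  using T_sum by (auto simp: direct_sum_def)

lemma Ts_nonzero [simp]: "i \<in> {1..n} \<Longrightarrow> Idm C (Ts i) \<noteq> 0"
  using Ts_indec[of i] by (simp add: indecomposable_def zero_object_def)

lemma Ts_in_add: "i \<in> {1..n} \<Longrightarrow> Ts i \<in> add_of C {T}"
  by (rule add_of_direct_factor[OF direct_factorI[of "\<iota> i" _ _ "\<pi> i"] add_of_generator])
    (simp_all add: proj_incl)

lemma rad_Ts: "i \<in> {1..n} \<Longrightarrow> j \<in> {1..n} \<Longrightarrow> i \<noteq> j \<Longrightarrow> rad C (Ts i) (Ts j) = Mor C (Ts i) (Ts j)"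
  by (rule rad_eq_Mor) (simp_all only: Ts_indec Ts_noniso not_False_eq_True)

text \<open>Membership in add(T) without naming a direct sum: the identity of \<open>Z\<close> is a
  finite sum of maps through the \<open>Ts l\<close>. Pairs as indices serve both for copies of
  \<open>T\<close> cut into summands and for families with multiplicities.\<close>

definition factors_through :: "'o \<Rightarrow> bool" where
  "factors_through Z \<longleftrightarrow> (\<exists>(S :: (nat \<times> nat) set) l \<alpha> \<beta>. finite S \<and>
     (\<forall>s\<in>S. l s \<in> {1..n} \<and> \<alpha> s \<in> Mor C Z (Ts (l s)) \<and> \<beta> s \<in> Mor C (Ts (l s)) Z) \<and>
     (\<Sum>s\<in>S. Cmp C Z (Ts (l s)) Z (\<beta> s) (\<alpha> s)) = Idm C Z)"

lemma factors_throughE: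
  assumes "factors_through Z"
  obtains S :: "(nat \<times> nat) set" and l \<alpha> \<beta> where "finite S" "\<And>s. s \<in> S \<Longrightarrow> l s \<in> {1..n}"
    "\<And>s. s \<in> S \<Longrightarrow> \<alpha> s \<in> Mor C Z (Ts (l s))" "\<And>s. s \<in> S \<Longrightarrow> \<beta> s \<in> Mor C (Ts (l s)) Z"
    "(\<Sum>s\<in>S. Cmp C Z (Ts (l s)) Z (\<beta> s) (\<alpha> s)) = Idm C Z"
  using assms unfolding factors_through_def by blast

lemma factors_throughI:
  fixes S :: "(nat \<times> nat) set"
  assumes "finite S" "\<And>s. s \<in> S \<Longrightarrow> l s \<in> {1..n}"
    "\<And>s. s \<in> S \<Longrightarrow> \<alpha> s \<in> Mor C Z (Ts (l s))" "\<And>s. s \<in> S \<Longrightarrow> \<beta> s \<in> Mor C (Ts (l s)) Z"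
    "(\<Sum>s\<in>S. Cmp C Z (Ts (l s)) Z (\<beta> s) (\<alpha> s)) = Idm C Z"
  shows "factors_through Z"
  using assms unfolding factors_through_def by blast

lemma factors_through_retract:
  assumes "factors_through Z" and p: "p \<in> Mor C Z Y" and i: "i \<in> Mor C Y Z" and pi: "Cmp C Y Z Y p i = Idm C Y"
  shows "factors_through Y"
proof -
  obtain S :: "(nat \<times> nat) set" and l \<alpha> \<beta> where S: "finite S" "\<And>s. s \<in> S \<Longrightarrow> l s \<in> {1..n}"
    "\<And>s. s \<in> S \<Longrightarrow> \<alpha> s \<in> Mor C Z (Ts (l s))" "\<And>s. s \<in> S \<Longrightarrow> \<beta> s \<in> Mor C (Ts (l s)) Z"
    "(\<Sum>s\<in>S. Cmp C Z (Ts (l s)) Z (\<beta> s) (\<alpha> s)) = Idm C Z"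
    using factors_throughE[OF assms(1)] by blast
  have "(\<Sum>s\<in>S. Cmp C Y (Ts (l s)) Y (Cmp C (Ts (l s)) Z Y p (\<beta> s)) (Cmp C Y Z (Ts (l s)) (\<alpha> s) i))
      = (\<Sum>s\<in>S. Cmp C Y Z Y p (Cmp C Y Z Z (Cmp C Z (Ts (l s)) Z (\<beta> s) (\<alpha> s)) i))"
    using S p i by (intro sum.cong) (simp_all add: Cmp_assoc)
  also have "\<dots> = Cmp C Y Z Y p (\<Sum>s\<in>S. Cmp C Y Z Z (Cmp C Z (Ts (l s)) Z (\<beta> s) (\<alpha> s)) i)"
    using S p i by (intro Cmp_sum_right[symmetric]) simp_all
  also have "(\<Sum>s\<in>S. Cmp C Y Z Z (Cmp C Z (Ts (l s)) Z (\<beta> s) (\<alpha> s)) i) = Cmp C Y Z Z (Idm C Z) i"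
    unfolding S(5)[symmetric] using S p i by (intro Cmp_sum_left[symmetric]) simp_all
  finally have "(\<Sum>s\<in>S. Cmp C Y (Ts (l s)) Y (Cmp C (Ts (l s)) Z Y p (\<beta> s)) (Cmp C Y Z (Ts (l s)) (\<alpha> s) i)) = Idm C Y"
    using i pi by simp
  then show ?thesis
    by (rule factors_throughI[rotated 4]) (use S(1-4) p i in simp_all)
qed

lemma add_of_factors_through:
  assumes "Z \<in> add_of C {T}"
  shows "factors_through Z"
proof -
  obtain S m Xs \<iota>' \<pi>' where S: "direct_sum C S {..<m::nat} Xs \<iota>' \<pi>'" "\<forall>i<m. Xs i \<in> {T}" "direct_factor C Z S"
    using assms by (auto simp: add_of_def)
  have i': "\<And>i. i < m \<Longrightarrow> \<iota>' i \<in> Mor C T S" "\<And>i. i < m \<Longrightarrow> \<pi>' i \<in> Mor C S T"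
    using S(1,2) by (auto simp: direct_sum_def)
  have "Idm C S = (\<Sum>i<m. Cmp C S (Xs i) S (\<iota>' i) (\<pi>' i))"
    using S(1) by (auto simp: direct_sum_def)
  also have "\<dots> = (\<Sum>i<m. Cmp C S T S (\<iota>' i) (\<pi>' i))"
    using S(2) by (intro sum.cong) auto
  finally have id: "Idm C S = (\<Sum>i<m. Cmp C S T S (\<iota>' i) (\<pi>' i))" .
  have "Cmp C S T S (\<iota>' i) (\<pi>' i)
      = (\<Sum>l\<in>{1..n}. Cmp C S (Ts l) S (Cmp C (Ts l) T S (\<iota>' i) (\<iota> l)) (Cmp C S T (Ts l) (\<pi> l) (\<pi>' i)))"
    if "i < m" for i
  proof -
    have "Cmp C S T S (\<iota>' i) (\<pi>' i) = Cmp C S T S (\<iota>' i) (Cmp C S T T (Idm C T) (\<pi>' i))"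
      using i' that by simp
    also have "\<dots> = Cmp C S T S (\<iota>' i) (\<Sum>l\<in>{1..n}. Cmp C S T T (Cmp C T (Ts l) T (\<iota> l) (\<pi> l)) (\<pi>' i))"
      unfolding incl_proj_sum[symmetric] using i' that by (subst Cmp_sum_left) simp_all
    also have "\<dots> = (\<Sum>l\<in>{1..n}. Cmp C S T S (\<iota>' i) (Cmp C S T T (Cmp C T (Ts l) T (\<iota> l) (\<pi> l)) (\<pi>' i)))"
      using i' that by (subst Cmp_sum_right) simp_all
    also have "\<dots> = (\<Sum>l\<in>{1..n}. Cmp C S (Ts l) S (Cmp C (Ts l) T S (\<iota>' i) (\<iota> l)) (Cmp C S T (Ts l) (\<pi> l) (\<pi>' i)))"
      using i' that by (intro sum.cong) (simp_all add: Cmp_assoc)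
    finally show ?thesis .
  qed
  then have "Idm C S = (\<Sum>i<m. \<Sum>l\<in>{1..n}. Cmp C S (Ts l) S (Cmp C (Ts l) T S (\<iota>' i) (\<iota> l)) (Cmp C S T (Ts l) (\<pi> l) (\<pi>' i)))"
    unfolding id by (intro sum.cong) simp_all
  also have "\<dots> = (\<Sum>s\<in>{..<m} \<times> {1..n}. Cmp C S (Ts (snd s)) S (Cmp C (Ts (snd s)) T S (\<iota>' (fst s)) (\<iota> (snd s)))
       (Cmp C S T (Ts (snd s)) (\<pi> (snd s)) (\<pi>' (fst s))))"
    by (simp add: sum.cartesian_product case_prod_unfold)
  finally have fS: "factors_through S"
    by (intro factors_throughI[where S = "{..<m} \<times> {1..n}" and l = snd
        and \<alpha> = "\<lambda>s. Cmp C S T (Ts (snd s)) (\<pi> (snd s)) (\<pi>' (fst s))"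
        and \<beta> = "\<lambda>s. Cmp C (Ts (snd s)) T S (\<iota>' (fst s)) (\<iota> (snd s))"])
       (use i' in auto)
  obtain a b where ab: "a \<in> Mor C Z S" "b \<in> Mor C S Z" "Cmp C Z S Z b a = Idm C Z"
    using S(3) by (rule direct_factorE)
  show ?thesis by (rule factors_through_retract[OF fS ab(2,1,3)])
qed

definition mult_index :: "(nat \<Rightarrow> nat) \<Rightarrow> (nat \<times> nat) set" where
  "mult_index a = {s. fst s \<in> {1..n} \<and> snd s < a (fst s)}"

lemma mult_index_fst: "s \<in> mult_index a \<Longrightarrow> fst s \<in> {1..n}"
  by (simp add: mult_index_def)

lemma has_multiplicities_iff:
  "has_multiplicities C Ts n Z a \<longleftrightarrow> (\<exists>\<iota> \<pi>. direct_sum C Z (mult_index a) (\<lambda>s. Ts (fst s)) \<iota> \<pi>)"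
proof -
  have "(\<lambda>(i, s :: nat). Ts i) = (\<lambda>s. Ts (fst s))"
    "{(i, s). i \<in> {1..n} \<and> s < a i} = mult_index a" by (auto simp: mult_index_def)
  then show ?thesis by (simp only: has_multiplicities_def)
qed

lemma has_multiplicitiesE:
  assumes "has_multiplicities C Ts n Z a"
  obtains \<iota>' \<pi>' where "finite (mult_index a)"
    "\<And>s. s \<in> mult_index a \<Longrightarrow> \<iota>' s \<in> Mor C (Ts (fst s)) Z"
    "\<And>s. s \<in> mult_index a \<Longrightarrow> \<pi>' s \<in> Mor C Z (Ts (fst s))"
    "\<And>s t. s \<in> mult_index a \<Longrightarrow> t \<in> mult_index a \<Longrightarrow>
      Cmp C (Ts (fst s)) Z (Ts (fst t)) (\<pi>' t) (\<iota>' s) = (if s = t then Idm C (Ts (fst s)) else 0)"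
    "(\<Sum>s\<in>mult_index a. Cmp C Z (Ts (fst s)) Z (\<iota>' s) (\<pi>' s)) = Idm C Z"
  using assms unfolding has_multiplicities_iff direct_sum_def by blast

lemma has_multiplicities_factors_through:
  assumes "has_multiplicities C Ts n Z a"
  shows "factors_through Z"
  using assms
proof (rule has_multiplicitiesE)
  fix \<iota>' \<pi>'
  assume *: "finite (mult_index a)"
    "\<And>s. s \<in> mult_index a \<Longrightarrow> \<iota>' s \<in> Mor C (Ts (fst s)) Z"
    "\<And>s. s \<in> mult_index a \<Longrightarrow> \<pi>' s \<in> Mor C Z (Ts (fst s))"
    "(\<Sum>s\<in>mult_index a. Cmp C Z (Ts (fst s)) Z (\<iota>' s) (\<pi>' s)) = Idm C Z"
  show "factors_through Z"
    by (rule factors_throughI[where l = fst and \<alpha> = \<pi>' and \<beta> = \<iota>', OF *(1)]) (use * mult_index_fst in simp_all)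
qed

text \<open>If all the maps \<alpha> were radical, the identity of \<open>Z\<close> would be
  radical. One that is not has a right inverse up to a unit, because the endomorphism ring of its
  target is local.\<close>

lemma factors_through_summand:
  assumes "factors_through Z" "\<not> zero_object C Z"
  obtains l \<alpha> \<beta> where "l \<in> {1..n}" "\<alpha> \<in> Mor C Z (Ts l)" "\<beta> \<in> Mor C (Ts l) Z" "Cmp C (Ts l) Z (Ts l) \<alpha> \<beta> = Idm C (Ts l)"
proof -
  obtain S :: "(nat \<times> nat) set" and l \<alpha> \<beta> where S: "finite S" "\<And>s. s \<in> S \<Longrightarrow> l s \<in> {1..n}"
    "\<And>s. s \<in> S \<Longrightarrow> \<alpha> s \<in> Mor C Z (Ts (l s))" "\<And>s. s \<in> S \<Longrightarrow> \<beta> s \<in> Mor C (Ts (l s)) Z"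
    "(\<Sum>s\<in>S. Cmp C Z (Ts (l s)) Z (\<beta> s) (\<alpha> s)) = Idm C Z"
    using factors_throughE[OF assms(1)] by blast
  have "\<exists>s\<in>S. \<alpha> s \<notin> rad C Z (Ts (l s))"
  proof (rule ccontr)
    assume "\<not> ?thesis"
    then have "(\<Sum>s\<in>S. Cmp C Z (Ts (l s)) Z (\<beta> s) (\<alpha> s)) \<in> rad C Z Z"
      using S by (intro rad_sum rad_Cmp_left) auto
    then show False using S(5) Idm_notin_rad assms(2) by simp
  qed
  then obtain s where s: "s \<in> S" "\<alpha> s \<notin> rad C Z (Ts (l s))" by blast
  then obtain g where g: "g \<in> Mor C (Ts (l s)) Z"
      "\<not> is_iso C (Ts (l s)) (Ts (l s)) (Idm C (Ts (l s)) - Cmp C (Ts (l s)) Z (Ts (l s)) (\<alpha> s) g)"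
    using S(3) unfolding rad_iff' by blast
  then have "is_iso C (Ts (l s)) (Ts (l s)) (Cmp C (Ts (l s)) Z (Ts (l s)) (\<alpha> s) g)"
    using indecomposable_local[OF Ts_indec[OF S(2)[OF s(1)]], of "Cmp C (Ts (l s)) Z (Ts (l s)) (\<alpha> s) g"] S(3)[OF s(1)] by auto
  then obtain w where w: "w \<in> Mor C (Ts (l s)) (Ts (l s))"
      "Cmp C (Ts (l s)) (Ts (l s)) (Ts (l s)) w (Cmp C (Ts (l s)) Z (Ts (l s)) (\<alpha> s) g) = Idm C (Ts (l s))"
    by (rule is_isoE)
  show thesis
    by (rule that[of "l s" "Cmp C Z (Ts (l s)) (Ts (l s)) w (\<alpha> s)" g]) (use S s w g in \<open>simp_all add: Cmp_assoc\<close>)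
qed

lemma has_multiplicities_add:
  assumes Y: "has_multiplicities C Ts n Y a" and l: "l \<in> {1..n}"
    and b: "\<beta> \<in> Mor C (Ts l) Z" "\<alpha> \<in> Mor C Z (Ts l)" "Cmp C (Ts l) Z (Ts l) \<alpha> \<beta> = Idm C (Ts l)"
    and p: "p \<in> Mor C Z Y" "i \<in> Mor C Y Z" "Cmp C Z Y Z i p = Idm C Z - Cmp C Z (Ts l) Z \<beta> \<alpha>"
      "Cmp C Y Z Y p i = Idm C Y" "Cmp C (Ts l) Z Y p \<beta> = 0" "Cmp C Y Z (Ts l) \<alpha> i = 0"
  shows "has_multiplicities C Ts n Z (a(l := Suc (a l)))"
proof -
  let ?I = "mult_index a" and ?J = "mult_index (a(l := Suc (a l)))" and ?x = "(l, a l)"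
  obtain \<iota>' \<pi>' where fin: "finite ?I"
    and m: "\<And>s. s \<in> ?I \<Longrightarrow> \<iota>' s \<in> Mor C (Ts (fst s)) Y" "\<And>s. s \<in> ?I \<Longrightarrow> \<pi>' s \<in> Mor C Y (Ts (fst s))"
    and ortho: "\<And>s t. s \<in> ?I \<Longrightarrow> t \<in> ?I \<Longrightarrow> Cmp C (Ts (fst s)) Y (Ts (fst t)) (\<pi>' t) (\<iota>' s) = (if s = t then Idm C (Ts (fst s)) else 0)"
    and id: "(\<Sum>s\<in>?I. Cmp C Y (Ts (fst s)) Y (\<iota>' s) (\<pi>' s)) = Idm C Y"
    using Y by (rule has_multiplicitiesE) blast
  \<comment> \<open>The copies of \<open>Ts l\<close> in \<open>Y\<close> are numbered below
    \<open>a l\<close>, so \<open>a l\<close> is the first free number.\<close>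
  have J: "?J = insert ?x ?I" using l by (auto simp: mult_index_def split: if_splits)
  have x: "?x \<notin> ?I" by (simp add: mult_index_def)
  let ?i = "\<lambda>s. if s = ?x then \<beta> else Cmp C (Ts (fst s)) Y Z i (\<iota>' s)"
  let ?p = "\<lambda>s. if s = ?x then \<alpha> else Cmp C Z Y (Ts (fst s)) (\<pi>' s) p"
  have 1: "Cmp C (Ts (fst s)) Z (Ts l) \<alpha> (Cmp C (Ts (fst s)) Y Z i (\<iota>' s)) = 0" if "s \<in> ?I" for s
    using p b m that by (subst Cmp_assoc[symmetric]) simp_all
  have 2: "Cmp C (Ts l) Z (Ts (fst s)) (Cmp C Z Y (Ts (fst s)) (\<pi>' s) p) \<beta> = 0" if "s \<in> ?I" for s
    using p b m that by (subst Cmp_assoc) simp_all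
  have 3: "Cmp C (Ts (fst s)) Z (Ts (fst t)) (Cmp C Z Y (Ts (fst t)) (\<pi>' t) p) (Cmp C (Ts (fst s)) Y Z i (\<iota>' s))
      = (if s = t then Idm C (Ts (fst s)) else 0)" if "s \<in> ?I" "t \<in> ?I" for s t
  proof -
    have "Cmp C (Ts (fst s)) Z Y p (Cmp C (Ts (fst s)) Y Z i (\<iota>' s)) = \<iota>' s"
      using p m that by (simp flip: Cmp_assoc)
    then have "Cmp C (Ts (fst s)) Z (Ts (fst t)) (Cmp C Z Y (Ts (fst t)) (\<pi>' t) p) (Cmp C (Ts (fst s)) Y Z i (\<iota>' s))
      = Cmp C (Ts (fst s)) Y (Ts (fst t)) (\<pi>' t) (\<iota>' s)"
      using p(1,2) m that by (subst Cmp_assoc) simp_all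
    then show ?thesis using ortho that by simp
  qed
  have "(\<Sum>s\<in>?I. Cmp C Z (Ts (fst s)) Z (Cmp C (Ts (fst s)) Y Z i (\<iota>' s)) (Cmp C Z Y (Ts (fst s)) (\<pi>' s) p))
      = (\<Sum>s\<in>?I. Cmp C Z Y Z i (Cmp C Z Y Y (Cmp C Y (Ts (fst s)) Y (\<iota>' s) (\<pi>' s)) p))"
    using p(1,2) m by (intro sum.cong) (simp_all add: Cmp_assoc)
  also have "\<dots> = Cmp C Z Y Z i (\<Sum>s\<in>?I. Cmp C Z Y Y (Cmp C Y (Ts (fst s)) Y (\<iota>' s) (\<pi>' s)) p)"
    using p(1,2) m by (intro Cmp_sum_right[symmetric]) simp_all
  also have "(\<Sum>s\<in>?I. Cmp C Z Y Y (Cmp C Y (Ts (fst s)) Y (\<iota>' s) (\<pi>' s)) p) = Cmp C Z Y Y (Idm C Y) p"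
    unfolding id[symmetric] using p(1,2) m by (intro Cmp_sum_left[symmetric]) simp_all
  finally have 4: "(\<Sum>s\<in>?I. Cmp C Z (Ts (fst s)) Z (Cmp C (Ts (fst s)) Y Z i (\<iota>' s)) (Cmp C Z Y (Ts (fst s)) (\<pi>' s) p))
      = Idm C Z - Cmp C Z (Ts l) Z \<beta> \<alpha>"
    using p by simp
  have "(\<Sum>s\<in>insert ?x ?I. Cmp C Z (Ts (fst s)) Z (?i s) (?p s))
      = Cmp C Z (Ts l) Z \<beta> \<alpha> + (\<Sum>s\<in>?I. Cmp C Z (Ts (fst s)) Z (?i s) (?p s))"
    using fin x by (subst sum.insert) simp_all
  also have "(\<Sum>s\<in>?I. Cmp C Z (Ts (fst s)) Z (?i s) (?p s)) =
      (\<Sum>s\<in>?I. Cmp C Z (Ts (fst s)) Z (Cmp C (Ts (fst s)) Y Z i (\<iota>' s)) (Cmp C Z Y (Ts (fst s)) (\<pi>' s) p))"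
    using x by (intro sum.cong refl) (auto split: if_splits)
  finally have 5: "(\<Sum>s\<in>insert ?x ?I. Cmp C Z (Ts (fst s)) Z (?i s) (?p s)) = Idm C Z"
    unfolding 4 by simp
  have "direct_sum C Z ?J (\<lambda>s. Ts (fst s)) ?i ?p"
    unfolding direct_sum_def J
  proof (intro conjI ballI)
    show "finite (insert ?x ?I)" using fin by simp
    show "(\<Sum>s\<in>insert ?x ?I. Cmp C Z (Ts (fst s)) Z (?i s) (?p s)) = Idm C Z" by (rule 5)
  next
    fix s assume s: "s \<in> insert ?x ?I"
    show "?i s \<in> Mor C (Ts (fst s)) Z"
      using s p(2) b(1) m(1)[of s] by (cases "s = ?x") simp_all
    show "?p s \<in> Mor C Z (Ts (fst s))"
      using s p(1) b(2) m(2)[of s] by (cases "s = ?x") simp_all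
    fix t assume t: "t \<in> insert ?x ?I"
    show "Cmp C (Ts (fst s)) Z (Ts (fst t)) (?p t) (?i s) = (if s = t then Idm C (Ts (fst s)) else 0)"
      using 1[of s] 2[of t] 3[of s t] b(3) s t by (cases "s = ?x"; cases "t = ?x") simp_all
  qed
  then show ?thesis unfolding has_multiplicities_iff by blast
qed

text \<open>One summand is split off at a time. The dimension of the endomorphism space drops,
  because sending x to i x p embeds the endomorphisms of the complement without reaching the
  identity of \<open>Z\<close>.\<close>

lemma factors_through_has_multiplicities:
  "factors_through Z \<Longrightarrow> \<exists>a. has_multiplicities C Ts n Z a"
proof (induction "dim (Mor C Z Z)" arbitrary: Z rule: less_induct)
  case less
  show ?case
  proof (cases "zero_object C Z")
    case True
    then have "has_multiplicities C Ts n Z (\<lambda>_. 0)"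
      by (simp add: has_multiplicities_iff direct_sum_def mult_index_def zero_object_def)
    then show ?thesis by blast
  next
    case False
    obtain l \<alpha> \<beta> where l: "l \<in> {1..n}" and ab: "\<alpha> \<in> Mor C Z (Ts l)" "\<beta> \<in> Mor C (Ts l) Z"
        "Cmp C (Ts l) Z (Ts l) \<alpha> \<beta> = Idm C (Ts l)"
      using factors_through_summand[OF less.prems False] by blast
    obtain Y p i where p: "p \<in> Mor C Z Y" "i \<in> Mor C Y Z" "Cmp C Z Y Z i p = Idm C Z - Cmp C Z (Ts l) Z \<beta> \<alpha>"
      "Cmp C Y Z Y p i = Idm C Y" "Cmp C (Ts l) Z Y p \<beta> = 0" "Cmp C Y Z (Ts l) \<alpha> i = 0"
      using split_mono_complement[OF ab(2,1,3)] by metis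
    let ?f = "\<lambda>x. Cmp C Z Y Z i (Cmp C Z Y Y x p)"
    have lin: "linear_on_sub (Scal C) (Scal C) (Mor C Y Y) (Mor C Z Z) ?f"
      using p(1,2) by (simp add: linear_on_sub_def)
    have inj: "x = 0" if x: "x \<in> Mor C Y Y" "?f x = 0" for x
    proof -
      have "Cmp C Y Y Y x (Cmp C Y Z Y p i) = Cmp C Y Z Y p (Cmp C Y Z Z (?f x) i)"
        using p(1,2,4) x(1) by (simp add: Cmp_assoc) (simp add: p(4) flip: Cmp_assoc)
      then show ?thesis using p x by simp
    qed
    have im: "subspace (?f ` Mor C Y Y)" "dim (?f ` Mor C Y Y) = dim (Mor C Y Y)"
      using dim_inj_image[OF lin Mor_subspace Mor_finite_dim inj] by auto
    have sub: "?f ` Mor C Y Y \<subseteq> Mor C Z Z" using p by auto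
    have "dim (Mor C Y Y) \<noteq> dim (Mor C Z Z)"
    proof
      assume "dim (Mor C Y Y) = dim (Mor C Z Z)"
      then have "?f ` Mor C Y Y = Mor C Z Z"
        using dim_subset_sub(2)[OF im(1) Mor_subspace sub Mor_finite_dim] im(2) by simp
      \<comment> \<open>The identity cannot have the form i x p, since p kills the inclusion \<beta>
        of the summand.\<close>
      then obtain x where x: "x \<in> Mor C Y Y" "Idm C Z = ?f x" using Idm_in by blast
      have "\<beta> = Cmp C (Ts l) Z Z (?f x) \<beta>" using ab unfolding x(2)[symmetric] by simp
      also have "\<dots> = 0" using p x(1) ab by (simp add: Cmp_assoc)
      finally show False using ab l by simp
    qed
    then have "dim (Mor C Y Y) < dim (Mor C Z Z)"
      using dim_subset_sub(1)[OF im(1) Mor_subspace sub Mor_finite_dim] im(2) by simp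
    moreover have "factors_through Y"
      using factors_through_retract[OF less.prems p(1,2,4)] .
    ultimately obtain a where "has_multiplicities C Ts n Y a" using less.hyps by blast
    from has_multiplicities_add[OF this l ab(2,1,3) p] show ?thesis by blast
  qed
qed

end

section \<open>Exact sequences from triangles\<close>

locale triangulated_cat = krull_schmidt_cat C for C :: "('k::alg_closed_field, 'o, 'v::ab_group_add) tcat" +
  assumes triangulated: "triangulated C"
begin

lemma suspension: "suspension C"
  using triangulated unfolding triangulated_def by (elim conjE)

lemma SusM_linear: "linear_on_sub (Scal C) (Scal C) (Mor C X Y) (Mor C (Sus C X) (Sus C Y)) (SusM C X Y)"
  using suspension unfolding suspension_def by (elim conjE allE)

lemma SusM_in [simp]: "f \<in> Mor C X Y \<Longrightarrow> SusM C X Y f \<in> Mor C (Sus C X) (Sus C Y)"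
  by (rule linear_on_subD(1)[OF SusM_linear])

lemma SusM_zero [simp]: "SusM C X Y 0 = 0"
  using linear_on_subD(3)[OF SusM_linear, of 0 X Y 0] by simp

lemma SusM_minus: "f \<in> Mor C X Y \<Longrightarrow> SusM C X Y (- f) = - SusM C X Y f"
  using linear_on_subD(3)[OF SusM_linear, of f X Y "-1"] by simp

lemma SusM_bij: "bij_betw (SusM C X Y) (Mor C X Y) (Mor C (Sus C X) (Sus C Y))"
  using suspension unfolding suspension_def by (elim conjE allE)

lemma SusM_full:
  assumes "f \<in> Mor C (Sus C X) (Sus C Y)"
  obtains g where "g \<in> Mor C X Y" "f = SusM C X Y g"
  using SusM_bij assms unfolding bij_betw_def by blast

lemma SusM_inj: "f \<in> Mor C X Y \<Longrightarrow> g \<in> Mor C X Y \<Longrightarrow> SusM C X Y f = SusM C X Y g \<Longrightarrow> f = g"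
  using SusM_bij[of X Y] unfolding bij_betw_def by (blast dest: inj_onD)

lemma SusM_Idm [simp]: "SusM C X X (Idm C X) = Idm C (Sus C X)"
  using suspension unfolding suspension_def by (elim conjE allE)

lemma SusM_Cmp: "f \<in> Mor C X Y \<Longrightarrow> g \<in> Mor C Y Z \<Longrightarrow>
    SusM C X Z (Cmp C X Y Z g f) = Cmp C (Sus C X) (Sus C Y) (Sus C Z) (SusM C Y Z g) (SusM C X Y f)"
  using suspension unfolding suspension_def by blast

lemma Sus_dense: "\<exists>X. isomorphic C (Sus C X) Y"
  using suspension unfolding suspension_def by (elim conjE allE)

lemma Sus_zero_object: "zero_object C Z \<Longrightarrow> zero_object C (Sus C Z)"
  using SusM_Idm[of Z] by (simp add: zero_object_def)

lemma Tri_in: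
  assumes "Tri C X Y Z u v w"
  shows "u \<in> Mor C X Y" "v \<in> Mor C Y Z" "w \<in> Mor C Z (Sus C X)"
  using triangulated[unfolded triangulated_def, THEN conjunct2, THEN conjunct2, THEN conjunct1, rule_format, OF assms] by blast+

lemma Tri_iso:
  assumes "Tri C X Y Z u v w" "u' \<in> Mor C X' Y'" "v' \<in> Mor C Y' Z'" "w' \<in> Mor C Z' (Sus C X')"
    "is_iso C X X' a" "is_iso C Y Y' b" "is_iso C Z Z' c"
    "Cmp C X Y Y' b u = Cmp C X X' Y' u' a" "Cmp C Y Z Z' c v = Cmp C Y Y' Z' v' b"
    "Cmp C Z (Sus C X) (Sus C X') (SusM C X X' a) w = Cmp C Z Z' (Sus C X') w' c"
  shows "Tri C X' Y' Z' u' v' w'"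
  by (rule triangulated[unfolded triangulated_def, THEN conjunct2, THEN conjunct2, THEN conjunct2, THEN conjunct1, rule_format,
      of X Y Z u v w u' X' Y' v' Z' w' a b c]) (use assms in simp)

lemma Tri_Idm: "zero_object C Z \<Longrightarrow> Tri C X X Z (Idm C X) 0 0"
  by (rule triangulated[unfolded triangulated_def, THEN conjunct2, THEN conjunct2, THEN conjunct2, THEN conjunct2, THEN conjunct1, rule_format])

lemma Tri_cone:
  assumes "u \<in> Mor C X Y"
  obtains Z v w where "Tri C X Y Z u v w"
  using triangulated[unfolded triangulated_def, THEN conjunct2, THEN conjunct2, THEN conjunct2, THEN conjunct2, THEN conjunct2, THEN conjunct1, rule_format, OF assms] by blast

lemma Tri_rotate_iff:
  assumes "u \<in> Mor C X Y" "v \<in> Mor C Y Z" "w \<in> Mor C Z (Sus C X)"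
  shows "Tri C X Y Z u v w \<longleftrightarrow> Tri C Y Z (Sus C X) v w (- SusM C X Y u)"
  by (rule triangulated[unfolded triangulated_def, THEN conjunct2, THEN conjunct2, THEN conjunct2, THEN conjunct2, THEN conjunct2, THEN conjunct2, THEN conjunct1, rule_format, OF assms])

lemma Tri_rotate:
  assumes "Tri C X Y Z u v w"
  shows "Tri C Y Z (Sus C X) v w (- SusM C X Y u)"
  by (rule iffD1[OF Tri_rotate_iff[OF Tri_in[OF assms]] assms])

lemma Tri_map:
  assumes "Tri C X Y Z u v w" "Tri C X' Y' Z' u' v' w'" "a \<in> Mor C X X'" "b \<in> Mor C Y Y'"
    "Cmp C X Y Y' b u = Cmp C X X' Y' u' a"
  obtains c where "c \<in> Mor C Z Z'" "Cmp C Y Z Z' c v = Cmp C Y Y' Z' v' b"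
    "Cmp C Z (Sus C X) (Sus C X') (SusM C X X' a) w = Cmp C Z Z' (Sus C X') w' c"
  using triangulated[unfolded triangulated_def, THEN conjunct2, THEN conjunct2, THEN conjunct2, THEN conjunct2, THEN conjunct2, THEN conjunct2, THEN conjunct2, THEN conjunct1, rule_format,
      OF assms(3,4) conjI[OF assms(1) conjI[OF assms(2,5)]]] that by blast

lemma zero_object_exists: obtains Z where "zero_object C Z"
  using triangulated[unfolded triangulated_def additive_category_def, THEN conjunct1, THEN conjunct1] by blast

text \<open>The pair consisting of the identity of \<open>X\<close> and \<open>u\<close> maps the
  triangle of that identity to the given one; the third component starts at a zero object, and the
  composite factors through it.\<close>

lemma Tri_zero_Cmp:
  assumes "Tri C X Y Z u v w"
  shows "Cmp C X Y Z v u = 0" "Cmp C Y Z (Sus C X) w v = 0"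
proof -
  have *: "Cmp C X Y Z v u = 0" if t: "Tri C X Y Z u v w" for X Y Z u v w
  proof -
    obtain N where N: "zero_object C N" by (rule zero_object_exists)
    obtain c where "c \<in> Mor C N Z" "Cmp C X N Z c 0 = Cmp C X Y Z v u"
      using Tri_map[OF Tri_Idm[OF N, of X] t, of "Idm C X" u] Tri_in[OF t] by auto
    then show ?thesis by simp
  qed
  from *[OF assms] *[OF Tri_rotate[OF assms]]
  show "Cmp C X Y Z v u = 0" "Cmp C Y Z (Sus C X) w v = 0" .
qed

text \<open>A map killed by \<open>u\<close> is a map to the triangle 0 -> A = A on the first two
  terms; TR3 supplies the third one.\<close>

lemma Tri_factor_cone:
  assumes t: "Tri C X Y Z u v w" and g: "g \<in> Mor C Y A" "Cmp C X Y A g u = 0"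
  obtains m where "m \<in> Mor C Z A" "g = Cmp C Y Z A m v"
proof -
  obtain N where N: "zero_object C N" by (rule zero_object_exists)
  have "Tri C N A A 0 (Idm C A) 0"
    using Tri_Idm[OF Sus_zero_object[OF N], of A] by (subst Tri_rotate_iff) simp_all
  then obtain c where "c \<in> Mor C Z A" "Cmp C Y Z A c v = Cmp C Y A A (Idm C A) g"
    using Tri_map[OF t, of N A A 0 "Idm C A" 0 0 g] g by auto
  with g that show thesis by simp
qed

text \<open>After two rotations this is \<open>Tri_factor_cone\<close> for maps out of
  \<open>Sus C X\<close>. The suspension is full and faithful, and the sign of the rotation is
  absorbed into the extension.\<close>

lemma Tri_factor_source:
  assumes t: "Tri C X Y Z u v w" and f: "f \<in> Mor C X A" "Cmp C Z (Sus C X) (Sus C A) (SusM C X A f) w = 0"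
  obtains g where "g \<in> Mor C Y A" "f = Cmp C X Y A g u"
proof -
  note in_t = Tri_in[OF t]
  obtain m where m: "m \<in> Mor C (Sus C Y) (Sus C A)"
      "SusM C X A f = Cmp C (Sus C X) (Sus C Y) (Sus C A) m (- SusM C X Y u)"
    using Tri_factor_cone[OF Tri_rotate[OF Tri_rotate[OF t]] SusM_in[OF f(1)] f(2)] by blast
  obtain g where g: "g \<in> Mor C Y A" "m = SusM C Y A g"
    using SusM_full[OF m(1)] by blast
  have "SusM C X A f = SusM C X A (Cmp C X Y A (- g) u)"
    using m(2) g in_t by (simp add: SusM_Cmp SusM_minus)
  then have "f = Cmp C X Y A (- g) u"
    by (rule SusM_inj[rotated 2]) (use f(1) g in_t in simp_all)
  with Mor_closed(4)[OF g(1)] show thesis by (rule that)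
qed

text \<open>TR3 only completes the third map, so both triangles are rotated until the wanted map
  stands there, suspended; full faithfulness of the suspension brings it back.\<close>

lemma Tri_factor_fibre:
  assumes t: "Tri C X Y Z u v w" and h: "h \<in> Mor C A Y" "Cmp C A Y Z v h = 0"
  obtains k where "k \<in> Mor C A X" "h = Cmp C A X Y u k"
proof -
  note in_t = Tri_in[OF t]
  obtain N where N: "zero_object C N" by (rule zero_object_exists)
  obtain c where c: "c \<in> Mor C (Sus C A) (Sus C X)"
     "Cmp C (Sus C A) (Sus C A) (Sus C Y) (SusM C A Y h) (- SusM C A A (Idm C A)) =
      Cmp C (Sus C A) (Sus C X) (Sus C Y) (- SusM C X Y u) c"
    using Tri_map[OF Tri_rotate[OF Tri_Idm[OF N, of A]] Tri_rotate[OF t] h(1), of 0] h by auto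
  obtain k where k: "k \<in> Mor C A X" "c = SusM C A X k" using SusM_full[OF c(1)] by blast
  have "SusM C A Y h = SusM C A Y (Cmp C A X Y u k)"
    using c(2) k h in_t by (simp add: SusM_Cmp)
  then have "h = Cmp C A X Y u k"
    by (rule SusM_inj[rotated 2]) (use h k in_t in simp_all)
  with k(1) show thesis by (rule that)
qed

text \<open>The suspension is only essentially surjective, so the cone of \<open>v\<close> is first
  transported along an isomorphism to some \<open>Sus C X\<close>. The sign of the rotation explains
  the first map \<open>- u\<close>.\<close>

lemma Tri_fibre:
  assumes v: "v \<in> Mor C Y Z"
  obtains X u w where "Tri C X Y Z u v w"
proof -
  obtain A v' w' where t: "Tri C Y Z A v v' w'" using Tri_cone[OF v] by blast
  obtain X where "isomorphic C (Sus C X) A" using Sus_dense by blast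
  then obtain a where "is_iso C (Sus C X) A a" by (auto simp: isomorphic_def)
  then obtain b where ab: "a \<in> Mor C (Sus C X) A" "b \<in> Mor C A (Sus C X)" "Cmp C (Sus C X) A (Sus C X) b a = Idm C (Sus C X)"
      "Cmp C A (Sus C X) A a b = Idm C A"
    by (rule is_isoE)
  note in_t = Tri_in[OF t]
  let ?w = "Cmp C Z A (Sus C X) b v'" and ?u = "Cmp C (Sus C X) A (Sus C Y) w' a"
  have "is_iso C A (Sus C X) b" by (rule is_isoI[of _ _ _ a]) (use ab in simp_all)
  then have t': "Tri C Y Z (Sus C X) v ?w ?u"
    by (intro Tri_iso[OF t, where a = "Idm C Y" and b = "Idm C Z" and c = b])
      (use ab in_t in \<open>simp_all add: Cmp_assoc\<close>)
  obtain u where u: "u \<in> Mor C X Y" "?u = SusM C X Y u"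
    using SusM_full[of ?u X Y] ab in_t by auto
  have "Tri C X Y Z (- u) v ?w"
    using t' u ab in_t by (subst Tri_rotate_iff) (simp_all add: SusM_minus)
  then show thesis by (rule that)
qed

end

section \<open>Modules over End(T)\<close>

context basic_object
begin

lemma sum_components:
  assumes f: "f \<in> Mor C T X"
  shows "f = (\<Sum>m\<in>{1..n}. Cmp C T (Ts m) X (Cmp C (Ts m) T X f (\<iota> m)) (\<pi> m))"
proof -
  have "f = Cmp C T T X f (\<Sum>m\<in>{1..n}. Cmp C T (Ts m) T (\<iota> m) (\<pi> m))"
    using f by (simp add: incl_proj_sum)
  also have "\<dots> = (\<Sum>m\<in>{1..n}. Cmp C T T X f (Cmp C T (Ts m) T (\<iota> m) (\<pi> m)))"
    using f by (intro Cmp_sum_right) simp_all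
  also have "\<dots> = (\<Sum>m\<in>{1..n}. Cmp C T (Ts m) X (Cmp C (Ts m) T X f (\<iota> m)) (\<pi> m))"
    using f by (intro sum.cong) (simp_all add: Cmp_assoc)
  finally show ?thesis .
qed

lemma rad_Idm_minus:
  assumes "r \<in> rad C X X"
  shows "is_iso C X X (Idm C X - r)"
proof -
  have "is_iso C X X (Idm C X - Cmp C X X X (Idm C X) r)"
    using assms Idm_in unfolding rad_def by (simp only: mem_Collect_eq)
  then show ?thesis using rad_Mor[OF assms] by simp
qed

lemma rad_T_I:
  assumes f: "f \<in> Mor C T X" and "\<And>m. m \<in> {1..n} \<Longrightarrow> Cmp C (Ts m) T X f (\<iota> m) \<in> rad C (Ts m) X"
  shows "f \<in> rad C T X"
proof -
  have "(\<Sum>m\<in>{1..n}. Cmp C T (Ts m) X (Cmp C (Ts m) T X f (\<iota> m)) (\<pi> m)) \<in> rad C T X"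
    by (rule rad_sum, rule rad_Cmp_right) (use assms(2) in simp_all)
  then show ?thesis using sum_components[OF f] by simp
qed

text \<open>The character of \<open>End(T)\<close> belonging to the simple module \<open>S\<^sub>i\<close>.\<close>

definition char_at :: "nat \<Rightarrow> 'v \<Rightarrow> 'k" where
  "char_at i a = residue (Ts i) (Cmp C (Ts i) T (Ts i) (\<pi> i) (Cmp C (Ts i) T T a (\<iota> i)))"

lemma char_at_add: "i \<in> {1..n} \<Longrightarrow> a \<in> Mor C T T \<Longrightarrow> b \<in> Mor C T T \<Longrightarrow> char_at i (a + b) = char_at i a + char_at i b"
  by (simp add: char_at_def residue_add Ts_indec)

lemma char_at_Scal: "i \<in> {1..n} \<Longrightarrow> a \<in> Mor C T T \<Longrightarrow> char_at i (Scal C c a) = c * char_at i a"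
  by (simp add: char_at_def residue_Scal Ts_indec)

lemma char_at_Idm: "i \<in> {1..n} \<Longrightarrow> char_at i (Idm C T) = 1"
  by (simp add: char_at_def proj_incl residue_Idm Ts_indec)

text \<open>On the summand \<open>Ts i\<close> the residue is subtracted; on every other summand all
  maps to \<open>Ts i\<close> are radical, as the summands are pairwise non-isomorphic.\<close>

lemma proj_minus_char_rad:
  assumes i: "i \<in> {1..n}" and a: "a \<in> Mor C T T"
  shows "Cmp C T T (Ts i) (\<pi> i) a - Scal C (char_at i a) (\<pi> i) \<in> rad C T (Ts i)"
proof (rule rad_T_I)
  show "Cmp C T T (Ts i) (\<pi> i) a - Scal C (char_at i a) (\<pi> i) \<in> Mor C T (Ts i)"
    using i a by simp
  fix m assume m: "m \<in> {1..n}"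
  show "Cmp C (Ts m) T (Ts i) (Cmp C T T (Ts i) (\<pi> i) a - Scal C (char_at i a) (\<pi> i)) (\<iota> m) \<in> rad C (Ts m) (Ts i)"
  proof (cases "m = i")
    case True
    have "Cmp C (Ts i) T (Ts i) (\<pi> i) (Cmp C (Ts i) T T a (\<iota> i)) - Scal C (char_at i a) (Idm C (Ts i))
        \<in> rad C (Ts i) (Ts i)"
      unfolding char_at_def using i a by (intro residue_diff) (simp_all add: Ts_indec)
    then show ?thesis using True i a by (simp add: Cmp_assoc proj_incl)
  next
    case False
    then show ?thesis using rad_Ts[OF m i] i m a by simp
  qed
qed

lemma char_at_rad:
  assumes i: "i \<in> {1..n}" and a: "a \<in> Mor C T T" and "Cmp C T T (Ts i) (\<pi> i) a \<in> rad C T (Ts i)"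
  shows "char_at i a = 0"
proof -
  have "Cmp C (Ts i) T (Ts i) (\<pi> i) (Cmp C (Ts i) T T a (\<iota> i)) = Cmp C (Ts i) T (Ts i) (Cmp C T T (Ts i) (\<pi> i) a) (\<iota> i)"
    using i a by (simp add: Cmp_assoc)
  also have "\<dots> \<in> rad C (Ts i) (Ts i)" by (rule rad_Cmp_right[OF assms(3)]) (simp add: i)
  finally show ?thesis unfolding char_at_def using i by (intro residue_rad) (simp_all add: Ts_indec)
qed

text \<open>Modulo the radical, \<open>\<pi> i\<close> composed with \<open>a\<close> is
  \<open>char_at i a\<close> times \<open>\<pi> i\<close>, and composing with \<open>b\<close>
  preserves the radical. So \<open>a\<close> b minus \<open>char_at i a\<close> times
  \<open>b\<close> has character 0.\<close>

lemma char_at_mult: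
  assumes i: "i \<in> {1..n}" and ab: "a \<in> Mor C T T" "b \<in> Mor C T T"
  shows "char_at i (Cmp C T T T a b) = char_at i a * char_at i b"
proof -
  let ?r = "Cmp C T T (Ts i) (\<pi> i) a - Scal C (char_at i a) (\<pi> i)"
  have r: "?r \<in> rad C T (Ts i)" using i ab by (intro proj_minus_char_rad)
  have "Cmp C T T (Ts i) (\<pi> i) (Cmp C T T T a b - Scal C (char_at i a) b) = Cmp C T T (Ts i) ?r b"
    using i ab by (simp flip: Cmp_assoc)
  then have "char_at i (Cmp C T T T a b - Scal C (char_at i a) b) = 0"
    using i ab rad_Cmp_right[OF r ab(2)] by (intro char_at_rad) simp_all
  then have "char_at i (Cmp C T T T a b + Scal C (- char_at i a) b) = 0"
    by simp
  then show ?thesis using i ab by (simp only: char_at_add char_at_Scal Mor_closed Cmp_in) simp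
qed

definition vertex_idem :: "nat \<Rightarrow> 'v" where
  "vertex_idem i = Cmp C T (Ts i) T (\<iota> i) (\<pi> i)"

lemma vertex_idem_in [simp]: "i \<in> {1..n} \<Longrightarrow> vertex_idem i \<in> Mor C T T"
  by (simp add: vertex_idem_def)

lemma vertex_idem_mult:
  assumes "i \<in> {1..n}" "j \<in> {1..n}"
  shows "Cmp C T T T (vertex_idem i) (vertex_idem j) = (if i = j then vertex_idem i else 0)"
proof -
  have "Cmp C T T T (vertex_idem i) (vertex_idem j)
      = Cmp C T (Ts i) T (\<iota> i) (Cmp C T (Ts j) (Ts i) (Cmp C (Ts j) T (Ts i) (\<pi> i) (\<iota> j)) (\<pi> j))"
    using assms by (simp add: vertex_idem_def Cmp_assoc)
  then show ?thesis using assms by (simp add: proj_incl vertex_idem_def)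
qed

lemma char_at_vertex_idem:
  assumes i: "i \<in> {1..n}" "j \<in> {1..n}"
  shows "char_at i (vertex_idem j) = (if i = j then 1 else 0)"
proof -
  have "Cmp C (Ts i) T (Ts i) (\<pi> i) (Cmp C (Ts i) T T (vertex_idem j) (\<iota> i))
      = Cmp C (Ts i) (Ts j) (Ts i) (Cmp C (Ts j) T (Ts i) (\<pi> i) (\<iota> j)) (Cmp C (Ts i) T (Ts j) (\<pi> j) (\<iota> i))"
    using i by (simp add: vertex_idem_def Cmp_assoc)
  then show ?thesis
    using i residue_Idm[OF Ts_indec[OF i(1)]] residue_rad[OF Ts_indec[OF i(1)] rad_0]
    by (cases "i = j") (simp_all add: char_at_def proj_incl)
qed

section \<open>Submodules of finite-dimensional right modules\<close>

abbreviation rmodule :: "'v set \<Rightarrow> ('v \<Rightarrow> 'v \<Rightarrow> 'v) \<Rightarrow> bool" where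
  "rmodule N act \<equiv> is_rmod C T \<lparr>Car = N, Act = act\<rparr>"

lemma rmoduleD:
  assumes "rmodule N act"
  shows "subspace N"
    and "x \<in> N \<Longrightarrow> a \<in> Mor C T T \<Longrightarrow> act x a \<in> N"
    and "x \<in> N \<Longrightarrow> y \<in> N \<Longrightarrow> a \<in> Mor C T T \<Longrightarrow> act (x + y) a = act x a + act y a"
    and "x \<in> N \<Longrightarrow> a \<in> Mor C T T \<Longrightarrow> act (Scal C c x) a = Scal C c (act x a)"
    and "x \<in> N \<Longrightarrow> a \<in> Mor C T T \<Longrightarrow> b \<in> Mor C T T \<Longrightarrow> act x (a + b) = act x a + act x b"
    and "x \<in> N \<Longrightarrow> a \<in> Mor C T T \<Longrightarrow> act x (Scal C c a) = Scal C c (act x a)"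
    and "x \<in> N \<Longrightarrow> act x (Idm C T) = x"
    and "x \<in> N \<Longrightarrow> a \<in> Mor C T T \<Longrightarrow> b \<in> Mor C T T \<Longrightarrow> act (act x a) b = act x (Cmp C T T T a b)"
  using assms by (simp_all add: is_rmod_def linear_on_sub_def)

lemma rmodule_diff:
  assumes N: "rmodule N act"
  shows "x \<in> N \<Longrightarrow> y \<in> N \<Longrightarrow> a \<in> Mor C T T \<Longrightarrow> act (x - y) a = act x a - act y a"
    and "x \<in> N \<Longrightarrow> a \<in> Mor C T T \<Longrightarrow> b \<in> Mor C T T \<Longrightarrow> act x (a - b) = act x a - act x b"
  using rmoduleD(3)[OF N, of x "Scal C (-1) y" a] rmoduleD(4)[OF N, of y a "-1"]
    rmoduleD(5)[OF N, of x a "Scal C (-1) b"] rmoduleD(6)[OF N, of x b "-1"]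
    subspace_neg[OF rmoduleD(1)[OF N], of y]
  by simp_all

lemma rmodule_sum:
  assumes N: "rmodule N act" and x: "x \<in> N" and "\<And>i. i \<in> I \<Longrightarrow> f i \<in> Mor C T T"
  shows "act x (sum f I) = (\<Sum>i\<in>I. act x (f i))"
proof -
  have "act x (Scal C 0 0) = 0" using rmoduleD(6)[OF N x, of 0 0] by simp
  then have 0: "act x 0 = 0" by simp
  show ?thesis
    using assms(3) by (induction I rule: infinite_finite_induct) (simp_all add: 0 rmoduleD(5)[OF N x])
qed

lemma rmodule_components:
  assumes N: "rmodule N act" and x: "x \<in> N"
  shows "x = (\<Sum>i\<in>{1..n}. act x (vertex_idem i))"
  using rmodule_sum[OF N x, of "{1..n}" vertex_idem] rmoduleD(7)[OF N x]
  by (simp add: incl_proj_sum[folded vertex_idem_def])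

definition submod :: "'v set \<Rightarrow> ('v \<Rightarrow> 'v \<Rightarrow> 'v) \<Rightarrow> 'v set \<Rightarrow> bool" where
  "submod N act W \<longleftrightarrow> W \<subseteq> N \<and> subspace W \<and> (\<forall>x\<in>W. \<forall>a\<in>Mor C T T. act x a \<in> W)"

lemma submod_rmodule: "rmodule N act \<Longrightarrow> submod N act W \<Longrightarrow> rmodule W act"
  unfolding is_rmod_def linear_on_sub_def submod_def by (simp add: subset_eq)

lemma submod_extend:
  assumes N: "rmodule N act" and W: "submod N act W" and x: "x \<in> N"
  shows "submod N act {w + act x a |w a. w \<in> W \<and> a \<in> Mor C T T}"
proof -
  note D = rmoduleD[OF N]
  have W': "W \<subseteq> N" "subspace W" "\<And>x a. x \<in> W \<Longrightarrow> a \<in> Mor C T T \<Longrightarrow> act x a \<in> W"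
    using W by (auto simp: submod_def)
  define E where "E = {w + act x a |w a. w \<in> W \<and> a \<in> Mor C T T}"
  have EI: "w + act x a \<in> E" if "w \<in> W" "a \<in> Mor C T T" for w a
    using that by (auto simp: E_def)
  have EE: "\<exists>w a. w \<in> W \<and> a \<in> Mor C T T \<and> y = w + act x a" if "y \<in> E" for y
    using that by (auto simp: E_def)
  have act0: "act x 0 = 0" using D(6)[OF x Mor_closed(1), of 0] by simp
  have "submod N act E"
    unfolding submod_def
  proof (intro conjI ballI subspaceI subsetI)
    fix y assume "y \<in> E"
    then obtain v a where "v \<in> W" "a \<in> Mor C T T" "y = v + act x a" using EE by blast
    then show "y \<in> N" using W'(1) D(2)[OF x, of a] subspace_add[OF D(1), of v] by blast
  next
    show "0 \<in> E" using EI[OF subspace_0[OF W'(2)] Mor_closed(1)] act0 by simp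
  next
    fix y z assume y: "y \<in> E" and z: "z \<in> E"
    obtain v a where va: "v \<in> W" "a \<in> Mor C T T" "y = v + act x a" using EE[OF y] by blast
    obtain w b where wb: "w \<in> W" "b \<in> Mor C T T" "z = w + act x b" using EE[OF z] by blast
    have "y + z = (v + w) + act x (a + b)" using D(5)[OF x va(2) wb(2)] va(3) wb(3) by simp
    then show "y + z \<in> E" using EI[OF subspace_add[OF W'(2) va(1) wb(1)] Mor_closed(2)[OF va(2) wb(2)]] by simp
  next
    fix c y assume y: "y \<in> E"
    obtain v a where va: "v \<in> W" "a \<in> Mor C T T" "y = v + act x a" using EE[OF y] by blast
    have "Scal C c y = Scal C c v + act x (Scal C c a)"
      using D(6)[OF x va(2)] va(3) by (simp add: scale_right_distrib)
    then show "Scal C c y \<in> E" using EI[OF subspace_scale[OF W'(2) va(1)] Mor_closed(5)[OF va(2)]] by simp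
  next
    fix y b assume y: "y \<in> E" and b: "b \<in> Mor C T T"
    obtain v a where va: "v \<in> W" "a \<in> Mor C T T" "y = v + act x a" using EE[OF y] by blast
    have "v \<in> N" using va W'(1) by blast
    then have "act y b = act v b + act x (Cmp C T T T a b)"
      using D(3)[OF _ D(2)[OF x va(2)] b] D(8)[OF x va(2) b] va(3) by simp
    then show "act y b \<in> E" using EI[OF W'(3)[OF va(1) b] Cmp_in[OF b va(2)]] by simp
  qed
  then show ?thesis by (simp only: E_def)
qed

text \<open>
  Every maximal submodule \<open>N'\<close> of \<open>N\<close> has a one-dimensional quotient: for a generator \<open>x = x \<epsilon>\<^sub>i\<close> of the
  quotient and \<open>b\<close> with \<open>\<pi>\<^sub>i b\<close> in the radical, \<open>x b \<notin> N'\<close> would give \<open>x = x b a\<close> modulo \<open>N'\<close>,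
  contradicting the invertibility of \<open>1 - \<pi>\<^sub>i b a \<iota>\<^sub>i\<close>.
\<close>

lemma maximal_submod:
  assumes N: "rmodule N act" "finite_dim_sub (Scal C) N" and W: "submod N act W" "W \<noteq> N"
  obtains N' i x where "submod N act N'" "W \<subseteq> N'" "i \<in> {1..n}" "x \<in> N" "x \<notin> N'" "act x (vertex_idem i) = x"
    "\<And>y. y \<in> N \<Longrightarrow> \<exists>c. y - Scal C c x \<in> N'"
    "\<And>a. a \<in> Mor C T T \<Longrightarrow> act x a - Scal C (char_at i a) x \<in> N'"
proof -
  note D = rmoduleD[OF N(1)]
  let ?P = "\<lambda>V. submod N act V \<and> W \<subseteq> V \<and> V \<noteq> N"
  have bound: "\<forall>V. ?P V \<longrightarrow> dim V < Suc (dim N)"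
    using dim_subset_sub(1)[OF _ D(1) _ N(2)] by (simp add: submod_def less_Suc_eq_le)
  have "?P W" using W by simp
  from ex_has_greatest_nat[where P = ?P, OF this bound]
  obtain N' where N': "submod N act N'" "W \<subseteq> N'" "N' \<noteq> N" and max: "\<And>V. ?P V \<Longrightarrow> dim V \<le> dim N'"
    by blast
  note S = N'(1)[unfolded submod_def]
  have sN': "subspace N'" and N'N: "N' \<subseteq> N" and N'act: "\<And>x a. x \<in> N' \<Longrightarrow> a \<in> Mor C T T \<Longrightarrow> act x a \<in> N'"
    using S by blast+
  have whole: "V = N" if V: "submod N act V" "N' \<subseteq> V" "z \<in> V" "z \<notin> N'" for V z
  proof (rule ccontr)
    assume "V \<noteq> N"
    then have "dim V \<le> dim N'" using V N' max by blast
    moreover have sV: "subspace V" "finite_dim_sub (Scal C) V"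
      using V(1) finite_dim_sub_mono[OF N(2)] by (auto simp: submod_def)
    ultimately have "N' = V"
      using dim_subset_sub[OF sN' sV(1) V(2) sV(2)] by simp
    then show False using V by blast
  qed
  obtain y where y: "y \<in> N" "y \<notin> N'" using N'(3) N'N by blast
  have "\<exists>i\<in>{1..n}. act y (vertex_idem i) \<notin> N'"
  proof (rule ccontr)
    assume "\<not> ?thesis"
    then have "(\<Sum>i\<in>{1..n}. act y (vertex_idem i)) \<in> N'" using sN' by (intro subspace_sum) blast+
    then show False using y rmodule_components[OF N(1) y(1)] by simp
  qed
  then obtain i where i: "i \<in> {1..n}" "act y (vertex_idem i) \<notin> N'" by blast
  define x where "x = act y (vertex_idem i)"
  have x: "x \<in> N" "x \<notin> N'" "act x (vertex_idem i) = x"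
    using i y D(2) D(8)[of y "vertex_idem i" "vertex_idem i"] vertex_idem_mult[of i i] by (simp_all add: x_def)
  have gen: "\<exists>w\<in>N'. \<exists>a\<in>Mor C T T. v = w + act z a" if z: "z \<in> N" "z \<notin> N'" and v: "v \<in> N" for z v
  proof -
    define E where "E = {w + act z a |w a. w \<in> N' \<and> a \<in> Mor C T T}"
    have EI: "w + act z a \<in> E" if "w \<in> N'" "a \<in> Mor C T T" for w a
      using that by (auto simp: E_def)
    have act0: "act z 0 = 0" using D(6)[OF z(1) Mor_closed(1), of 0] by simp
    have "N' \<subseteq> E" using EI[OF _ Mor_closed(1)] act0 by auto
    moreover have "z \<in> E" using EI[OF subspace_0[OF sN'] Idm_in] D(7)[OF z(1)] by simp
    ultimately have "E = N"
      using whole[OF submod_extend[OF N(1) N'(1) z(1), folded E_def]] z(2) by blast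
    then show ?thesis using v by (auto simp: E_def)
  qed
  have radz: "act x b \<in> N'" if b: "b \<in> Mor C T T" "Cmp C T T (Ts i) (\<pi> i) b \<in> rad C T (Ts i)" for b
  proof (rule ccontr)
    assume nb: "act x b \<notin> N'"
    obtain w a where wa: "w \<in> N'" "a \<in> Mor C T T" "x = w + act (act x b) a"
      using gen[OF D(2)[OF x(1) b(1)] nb x(1)] by blast
    let ?ba = "Cmp C T T T b a"
    have "act x (Idm C T - ?ba) = x - act (act x b) a"
      using rmodule_diff(2)[OF N(1) x(1), of "Idm C T" ?ba] wa(2) b(1) by (simp add: D(7,8) x(1))
    also have "\<dots> = w" using wa(3) by (metis add_diff_cancel_right')
    finally have w: "w = act x (Idm C T - ?ba)" ..
    let ?r = "Cmp C (Ts i) T (Ts i) (Cmp C T T (Ts i) (\<pi> i) b) (Cmp C (Ts i) T T a (\<iota> i))"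
    have "?r \<in> rad C (Ts i) (Ts i)"
      by (rule rad_Cmp_right[OF b(2)]) (use wa(2) i in simp)
    then have "is_iso C (Ts i) (Ts i) (Idm C (Ts i) - ?r)" by (rule rad_Idm_minus)
    then obtain v where v: "v \<in> Mor C (Ts i) (Ts i)" "Cmp C (Ts i) (Ts i) (Ts i) (Idm C (Ts i) - ?r) v = Idm C (Ts i)"
      by (rule is_isoE)
    \<comment> \<open>The inverse at \<open>Ts i\<close>, extended by zero to \<open>T\<close>.
      Applied to w = x (1 - b a) it returns x, which would then lie in \<open>N'\<close>.\<close>
    let ?v = "Cmp C T (Ts i) T (Cmp C (Ts i) (Ts i) T (\<iota> i) v) (\<pi> i)"
    have v_in: "?v \<in> Mor C T T" using v i by simp
    have pv: "Cmp C T T (Ts i) (\<pi> i) ?v = Cmp C T (Ts i) (Ts i) v (\<pi> i)"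
      using v(1) i(1) by (simp flip: Cmp_assoc add: proj_incl)
    have "Cmp C T T (Ts i) (\<pi> i) (Cmp C T T T (Idm C T - ?ba) ?v)
        = Cmp C T (Ts i) (Ts i) (Cmp C (Ts i) (Ts i) (Ts i) (Idm C (Ts i) - ?r) v) (\<pi> i)"
      using v(1) wa(2) b(1) i(1) pv by (simp add: Cmp_assoc)
    then have "Cmp C T T (Ts i) (\<pi> i) (Cmp C T T T (Idm C T - ?ba) ?v) = \<pi> i"
      using v(2) i(1) by simp
    then have "Cmp C T T T (vertex_idem i) (Cmp C T T T (Idm C T - ?ba) ?v) = vertex_idem i"
      using v_in wa(2) b(1) i(1) unfolding vertex_idem_def by (subst Cmp_assoc) simp_all
    then have "act (act x (vertex_idem i)) (Cmp C T T T (Idm C T - ?ba) ?v) = act x (vertex_idem i)"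
      using D(8)[OF x(1), of "vertex_idem i" "Cmp C T T T (Idm C T - ?ba) ?v"] v_in wa(2) b(1) i(1) by simp
    then have "act x (Cmp C T T T (Idm C T - ?ba) ?v) = x" by (simp only: x(3))
    moreover have "act (act x (Idm C T - ?ba)) ?v = act x (Cmp C T T T (Idm C T - ?ba) ?v)"
      using D(8)[OF x(1), of "Idm C T - ?ba" ?v] v_in wa(2) b(1) by simp
    ultimately have "act w ?v = x" using w by simp
    then show False using N'act[OF wa(1) v_in] x(2) by simp
  qed
  have char: "act x a - Scal C (char_at i a) x \<in> N'" if a: "a \<in> Mor C T T" for a
  proof -
    have "Cmp C T T (Ts i) (\<pi> i) (a - Scal C (char_at i a) (Idm C T)) \<in> rad C T (Ts i)"
      using proj_minus_char_rad[OF i(1) a] i(1) a by simp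
    then have "act x (a - Scal C (char_at i a) (Idm C T)) \<in> N'"
      using a by (intro radz) simp_all
    then show ?thesis
      using rmodule_diff(2)[OF N(1) x(1) a, of "Scal C (char_at i a) (Idm C T)"] D(6)[OF x(1)] D(7)[OF x(1)] by simp
  qed
  have "\<exists>c. v - Scal C c x \<in> N'" if v: "v \<in> N" for v
  proof -
    obtain w a where wa: "w \<in> N'" "a \<in> Mor C T T" "v = w + act x a"
      using gen[OF x(1,2) v] by blast
    then have "v - Scal C (char_at i a) x = w + (act x a - Scal C (char_at i a) x)" by simp
    also have "\<dots> \<in> N'" using wa char sN' by (intro subspace_add)
    finally show ?thesis by blast
  qed
  with that[OF N'(1,2) i(1) x _ char] show thesis by blast
qed

section \<open>The index at the frozen vertices\<close>

lemma rad2_subset: "rad2 C \<T> X Y \<subseteq> rad C X Y"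
  unfolding rad2_def by (rule span_minimal) (auto intro: rad_Cmp_left rad_Mor)

lemma rad_finite_dim [simp]: "finite_dim_sub (Scal C) (rad C X Y)"
  by (rule finite_dim_sub_mono[OF Mor_finite_dim]) (auto dest: rad_Mor)

lemma arrows_eq_0D:
  assumes "arrows C \<T> X Y = 0"
  shows "rad C X Y = rad2 C \<T> X Y"
proof -
  have s: "subspace (rad2 C \<T> X Y)" unfolding rad2_def by (rule subspace_span)
  note d = dim_subset_sub[OF s rad_subspace rad2_subset rad_finite_dim]
  show ?thesis using d assms by (simp add: arrows_def vdim_def)
qed

lemma rmodule_Mor: "rmodule (Mor C T X) (Cmp C T T X)"
  by (simp add: is_rmod_def linear_on_sub_def Cmp_assoc)

lemma rmodule_rad: "rmodule (rad C T X) (Cmp C T T X)"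
  by (rule submod_rmodule[OF rmodule_Mor])
    (auto simp: submod_def rad_Mor intro: rad_Cmp_right)

lemma Cmp_span_in:
  assumes x: "x \<in> span B" and B: "B \<subseteq> Mor C Y Z" and V: "subspace V"
    and g: "g \<in> Mor C X Y" and "\<And>b. b \<in> B \<Longrightarrow> Cmp C X Y Z b g \<in> V"
  shows "Cmp C X Y Z x g \<in> V"
proof -
  from x have "x \<in> Mor C Y Z \<and> Cmp C X Y Z x g \<in> V"
  proof (induction rule: span_induct_alt)
    case base
    then show ?case using g V subspace_0 by simp
  next
    case (step c b y)
    have b: "b \<in> Mor C Y Z" using step(1) B by blast
    then have "Cmp C X Y Z (Scal C c b + y) g = Scal C c (Cmp C X Y Z b g) + Cmp C X Y Z y g"
      using step(2) g by simp
    then show ?case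
      using assms(5)[OF step(1)] step(2) b V by (simp add: subspace_add subspace_scale)
  qed
  then show ?thesis by blast
qed

text \<open>An object of add(T) is cut into summands of \<open>T\<close>, and the pieces of radical
  maps stay radical, so factorizations through the single object \<open>T\<close> suffice.\<close>

lemma rad2_eq_span:
  "rad2 C (add_of C {T}) X Y = span {Cmp C X T Y g f |f g. f \<in> rad C X T \<and> g \<in> rad C T Y}"
    (is "_ = span ?B")
proof
  show "span ?B \<subseteq> rad2 C (add_of C {T}) X Y"
    unfolding rad2_def by (rule span_mono) (use add_of_generator in blast)
  show "rad2 C (add_of C {T}) X Y \<subseteq> span ?B"
    unfolding rad2_def
  proof (rule span_minimal[OF _ subspace_span], rule subsetI)
    fix b assume "b \<in> (\<Union>Z\<in>add_of C {T}. {Cmp C X Z Y g f |f g. f \<in> rad C X Z \<and> g \<in> rad C Z Y})"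
    then obtain Z f g where Z: "Z \<in> add_of C {T}" "f \<in> rad C X Z" "g \<in> rad C Z Y" "b = Cmp C X Z Y g f"
      by blast
    obtain S :: "(nat \<times> nat) set" and m \<alpha> \<beta> where S: "finite S" "\<And>s. s \<in> S \<Longrightarrow> m s \<in> {1..n}"
      "\<And>s. s \<in> S \<Longrightarrow> \<alpha> s \<in> Mor C Z (Ts (m s))" "\<And>s. s \<in> S \<Longrightarrow> \<beta> s \<in> Mor C (Ts (m s)) Z"
      "(\<Sum>s\<in>S. Cmp C Z (Ts (m s)) Z (\<beta> s) (\<alpha> s)) = Idm C Z"
      using factors_throughE[OF add_of_factors_through[OF Z(1)]] by blast
    note fg = rad_Mor[OF Z(2)] rad_Mor[OF Z(3)]
    let ?g = "\<lambda>s. Cmp C T (Ts (m s)) Y (Cmp C (Ts (m s)) Z Y g (\<beta> s)) (\<pi> (m s))"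
    let ?f = "\<lambda>s. Cmp C X (Ts (m s)) T (\<iota> (m s)) (Cmp C X Z (Ts (m s)) (\<alpha> s) f)"
    have "b = Cmp C X Z Y g (Cmp C X Z Z (\<Sum>s\<in>S. Cmp C Z (Ts (m s)) Z (\<beta> s) (\<alpha> s)) f)"
      using Z(4) S(5) fg by simp
    also have "Cmp C X Z Z (\<Sum>s\<in>S. Cmp C Z (Ts (m s)) Z (\<beta> s) (\<alpha> s)) f
        = (\<Sum>s\<in>S. Cmp C X Z Z (Cmp C Z (Ts (m s)) Z (\<beta> s) (\<alpha> s)) f)"
      by (rule Cmp_sum_left) (use S fg in simp_all)
    also have "Cmp C X Z Y g \<dots> = (\<Sum>s\<in>S. Cmp C X Z Y g (Cmp C X Z Z (Cmp C Z (Ts (m s)) Z (\<beta> s) (\<alpha> s)) f))"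
      by (rule Cmp_sum_right) (use S fg in simp_all)
    also have "\<dots> = (\<Sum>s\<in>S. Cmp C X T Y (?g s) (?f s))"
    proof (rule sum.cong[OF refl])
      fix s assume s: "s \<in> S"
      have "Cmp C X T (Ts (m s)) (\<pi> (m s)) (?f s) = Cmp C X Z (Ts (m s)) (\<alpha> s) f"
        using S(2,3)[OF s] fg by (subst Cmp_assoc[symmetric]) (simp_all add: proj_incl)
      then show "Cmp C X Z Y g (Cmp C X Z Z (Cmp C Z (Ts (m s)) Z (\<beta> s) (\<alpha> s)) f) = Cmp C X T Y (?g s) (?f s)"
        using S(2-4)[OF s] fg by (simp add: Cmp_assoc)
    qed
    also have "\<dots> \<in> span ?B"
    proof (rule span_sum, rule span_base)
      fix s assume s: "s \<in> S"
      have "?g s \<in> rad C T Y"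
        by (rule rad_Cmp_right, rule rad_Cmp_right[OF Z(3)]) (use S(2,4)[OF s] in simp_all)
      moreover have "?f s \<in> rad C X T"
        by (rule rad_Cmp_left, rule rad_Cmp_left[OF Z(2)]) (use S(2,3)[OF s] in simp_all)
      ultimately show "Cmp C X T Y (?g s) (?f s) \<in> ?B" by blast
    qed
    finally show "b \<in> span ?B" .
  qed
qed

text \<open>The part of the radical generated by radical maps out of the \<open>Ts l\<close> with
  \<open>l \<in> L\<close>. If \<open>Y\<close> is a summand of \<open>T\<close> and
  \<open>L\<close> contains the sources of all arrows into it, this exhausts the radical on
  add(T).\<close>

definition rad_through :: "nat set \<Rightarrow> 'o \<Rightarrow> 'o \<Rightarrow> 'v set" where
  "rad_through L X Y = span (\<Union>l\<in>L. {Cmp C X (Ts l) Y h k |h k. h \<in> rad C (Ts l) Y \<and> k \<in> Mor C X (Ts l)})"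

lemma rad_through_I:
  "l \<in> L \<Longrightarrow> h \<in> rad C (Ts l) Y \<Longrightarrow> k \<in> Mor C X (Ts l) \<Longrightarrow> Cmp C X (Ts l) Y h k \<in> rad_through L X Y"
  unfolding rad_through_def by (rule span_base) blast

lemma rad_through_Cmp:
  assumes w: "w \<in> rad_through L X Y" and g: "g \<in> Mor C W X"
  shows "Cmp C W X Y w g \<in> rad_through L W Y"
proof (rule Cmp_span_in[OF w[unfolded rad_through_def] _ _ g])
  show "subspace (rad_through L W Y)" unfolding rad_through_def by (rule subspace_span)
  fix b assume "b \<in> (\<Union>l\<in>L. {Cmp C X (Ts l) Y h k |h k. h \<in> rad C (Ts l) Y \<and> k \<in> Mor C X (Ts l)})"
  then obtain l h k where b: "l \<in> L" "h \<in> rad C (Ts l) Y" "k \<in> Mor C X (Ts l)" "b = Cmp C X (Ts l) Y h k" by blast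
  show "Cmp C W X Y b g \<in> rad_through L W Y"
    using rad_through_I[OF b(1,2) Cmp_in[OF g b(3)]] b g rad_Mor[OF b(2)] by (simp add: Cmp_assoc)
qed (auto dest: rad_Mor)

text \<open>Nakayama's lemma for the radical of \<open>C(?, T\<^sub>i)\<close>, with a maximal submodule in place of nilpotency.\<close>

lemma rad_generated_T:
  assumes i: "i \<in> {1..n}" and L: "L \<subseteq> {1..n}"
    and arr: "\<And>l. l \<in> {1..n} \<Longrightarrow> l \<notin> L \<Longrightarrow> rad C (Ts l) (Ts i) = rad2 C (add_of C {T}) (Ts l) (Ts i)"
  shows "rad C T (Ts i) = rad_through L T (Ts i)"
proof (rule ccontr)
  assume neq: "rad C T (Ts i) \<noteq> rad_through L T (Ts i)"
  let ?N = "rad C T (Ts i)" and ?W = "rad_through L T (Ts i)"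
  have sub: "submod ?N (Cmp C T T (Ts i)) ?W"
    unfolding submod_def
  proof (intro conjI ballI)
    show "?W \<subseteq> ?N" unfolding rad_through_def
      by (rule span_minimal) (auto intro: rad_Cmp_right)
    show "subspace ?W" unfolding rad_through_def by (rule subspace_span)
  qed (rule rad_through_Cmp)
  obtain N' j x where N': "submod ?N (Cmp C T T (Ts i)) N'" "?W \<subseteq> N'" "j \<in> {1..n}" "x \<in> ?N" "x \<notin> N'"
      and gen: "\<And>y. y \<in> ?N \<Longrightarrow> \<exists>c. y - Scal C c x \<in> N'"
      and char: "\<And>a. a \<in> Mor C T T \<Longrightarrow> Cmp C T T (Ts i) x a - Scal C (char_at j a) x \<in> N'"
    using maximal_submod[OF rmodule_rad rad_finite_dim sub neq[symmetric]] by metis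
  have sN': "subspace N'" and N'N: "N' \<subseteq> ?N"
    and N'act: "\<And>x a. x \<in> N' \<Longrightarrow> a \<in> Mor C T T \<Longrightarrow> Cmp C T T (Ts i) x a \<in> N'"
    using N'(1) by (auto simp: submod_def)
  \<comment> \<open>The quotient by \<open>N'\<close> is a line on which End(T) acts through
    \<open>char_at j\<close>, so elements of character 0 map everything into
    \<open>N'\<close>.\<close>
  have kill: "Cmp C T T (Ts i) y b \<in> N'" if y: "y \<in> ?N" and b: "b \<in> Mor C T T" "char_at j b = 0" for y b
  proof -
    obtain c where c: "y - Scal C c x \<in> N'" using gen[OF y] by blast
    have "Cmp C T T (Ts i) y b = Cmp C T T (Ts i) (y - Scal C c x) b + Scal C c (Cmp C T T (Ts i) x b)"
      using b(1) rad_Mor[OF y] rad_Mor[OF N'(4)] by simp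
    also have "\<dots> \<in> N'"
      using N'act[OF c b(1)] char[OF b(1)] b(2) sN' by (intro subspace_add subspace_scale) simp_all
    finally show ?thesis .
  qed
  have comp: "Cmp C T (Ts l) (Ts i) (Cmp C (Ts l) T (Ts i) h (\<iota> l)) (\<pi> l) \<in> N'"
    if h: "h \<in> ?N" and l: "l \<in> {1..n}" for h l
  proof (cases "l \<in> L")
    case True
    have "Cmp C (Ts l) T (Ts i) h (\<iota> l) \<in> rad C (Ts l) (Ts i)"
      using h l by (intro rad_Cmp_right[OF h]) simp
    then have "Cmp C T (Ts l) (Ts i) (Cmp C (Ts l) T (Ts i) h (\<iota> l)) (\<pi> l) \<in> ?W"
      using True l by (intro rad_through_I) simp_all
    then show ?thesis using N'(2) by blast
  next
    case False
    have "Cmp C (Ts l) T (Ts i) h (\<iota> l) \<in> rad2 C (add_of C {T}) (Ts l) (Ts i)"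
      using rad_Cmp_right[OF h, of "\<iota> l" "Ts l"] l arr[OF l False] by simp
    then show ?thesis
      unfolding rad2_eq_span
    proof (rule Cmp_span_in[OF _ _ sN'])
      show "\<pi> l \<in> Mor C T (Ts l)" using l by simp
      fix b assume "b \<in> {Cmp C (Ts l) T (Ts i) g f |f g. f \<in> rad C (Ts l) T \<and> g \<in> rad C T (Ts i)}"
      then obtain f g where fg: "f \<in> rad C (Ts l) T" "g \<in> rad C T (Ts i)" "b = Cmp C (Ts l) T (Ts i) g f"
        by blast
      let ?b = "Cmp C T (Ts l) T f (\<pi> l)"
      have b_in: "?b \<in> Mor C T T" using rad_Mor[OF fg(1)] l by simp
      \<comment> \<open>The right factor is radical, hence of character 0: a product of two radical
        maps already lies in \<open>N'\<close>.\<close>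
      have "Cmp C T T (Ts j) (\<pi> j) ?b \<in> rad C T (Ts j)"
        by (rule rad_Cmp_left, rule rad_Cmp_right[OF fg(1)]) (use l N'(3) in simp_all)
      then have "Cmp C T T (Ts i) g ?b \<in> N'"
        by (intro kill[OF fg(2) b_in] char_at_rad[OF N'(3) b_in])
      then show "Cmp C T (Ts l) (Ts i) b (\<pi> l) \<in> N'"
        using fg(3) rad_Mor[OF fg(1)] rad_Mor[OF fg(2)] l by (simp add: Cmp_assoc)
    qed (auto intro: Cmp_in rad_Mor)
  qed
  have "x = (\<Sum>l\<in>{1..n}. Cmp C T (Ts l) (Ts i) (Cmp C (Ts l) T (Ts i) x (\<iota> l)) (\<pi> l))"
    using sum_components[OF rad_Mor[OF N'(4)]] .
  also have "\<dots> \<in> N'" using comp[OF N'(4)] by (rule subspace_sum[OF sN'])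
  finally show False using N'(5) by simp
qed

text \<open>Generation passes from \<open>T\<close> to \<open>X\<close> because the identity of
  \<open>X\<close> is a sum of maps through summands of \<open>T\<close>.\<close>

lemma rad_generated:
  assumes i: "i \<in> {1..n}" and L: "L \<subseteq> {1..n}"
    and arr: "\<And>l. l \<in> {1..n} \<Longrightarrow> l \<notin> L \<Longrightarrow> rad C (Ts l) (Ts i) = rad2 C (add_of C {T}) (Ts l) (Ts i)"
    and X: "factors_through X" and h: "h \<in> rad C X (Ts i)"
  shows "h \<in> rad_through L X (Ts i)"
proof -
  obtain S :: "(nat \<times> nat) set" and m \<alpha> \<beta> where S: "finite S" "\<And>s. s \<in> S \<Longrightarrow> m s \<in> {1..n}"
    "\<And>s. s \<in> S \<Longrightarrow> \<alpha> s \<in> Mor C X (Ts (m s))" "\<And>s. s \<in> S \<Longrightarrow> \<beta> s \<in> Mor C (Ts (m s)) X"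
    "(\<Sum>s\<in>S. Cmp C X (Ts (m s)) X (\<beta> s) (\<alpha> s)) = Idm C X"
    using factors_throughE[OF X] by blast
  let ?y = "\<lambda>s. Cmp C T (Ts (m s)) (Ts i) (Cmp C (Ts (m s)) X (Ts i) h (\<beta> s)) (\<pi> (m s))"
  note hM = rad_Mor[OF h]
  have "h = Cmp C X X (Ts i) h (\<Sum>s\<in>S. Cmp C X (Ts (m s)) X (\<beta> s) (\<alpha> s))" using S(5) hM by simp
  also have "\<dots> = (\<Sum>s\<in>S. Cmp C X X (Ts i) h (Cmp C X (Ts (m s)) X (\<beta> s) (\<alpha> s)))"
    by (rule Cmp_sum_right) (use S hM in simp_all)
  also have "\<dots> = (\<Sum>s\<in>S. Cmp C X T (Ts i) (?y s) (Cmp C X (Ts (m s)) T (\<iota> (m s)) (\<alpha> s)))"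
  proof (rule sum.cong[OF refl])
    fix s assume s: "s \<in> S"
    have "Cmp C X T (Ts (m s)) (\<pi> (m s)) (Cmp C X (Ts (m s)) T (\<iota> (m s)) (\<alpha> s)) = \<alpha> s"
      using S(2,3)[OF s] by (subst Cmp_assoc[symmetric]) (simp_all add: proj_incl)
    then show "Cmp C X X (Ts i) h (Cmp C X (Ts (m s)) X (\<beta> s) (\<alpha> s))
        = Cmp C X T (Ts i) (?y s) (Cmp C X (Ts (m s)) T (\<iota> (m s)) (\<alpha> s))"
      using S(2-4)[OF s] hM by (simp add: Cmp_assoc)
  qed
  also have "\<dots> \<in> rad_through L X (Ts i)"
  proof (rule subspace_sum)
    show "subspace (rad_through L X (Ts i))" unfolding rad_through_def by (rule subspace_span)
    fix s assume s: "s \<in> S"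
    have "?y s \<in> rad C T (Ts i)"
      by (rule rad_Cmp_right, rule rad_Cmp_right[OF h]) (use S(2,4)[OF s] in simp_all)
    then have "?y s \<in> rad_through L T (Ts i)" using rad_generated_T[OF i L arr] by simp
    then show "Cmp C X T (Ts i) (?y s) (Cmp C X (Ts (m s)) T (\<iota> (m s)) (\<alpha> s)) \<in> rad_through L X (Ts i)"
      by (rule rad_through_Cmp) (use S(2,3)[OF s] in simp)
  qed
  finally show ?thesis .
qed

text \<open>The projections onto the copies of \<open>Ts i\<close> form a basis of the top of C(Z,
  T_i), so the multiplicity of \<open>Ts i\<close> is the dimension of this top. In this form
  multiplicities can be compared along a map.\<close>

lemma basis_mod_rad_multiplicities:
  assumes Z: "has_multiplicities C Ts n Z a" and i: "i \<in> {1..n}"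
  obtains p where "basis_mod (Scal C) (rad C Z (Ts i)) (Mor C Z (Ts i)) {..<a i} p"
proof -
  obtain \<iota>' \<pi>' where fin: "finite (mult_index a)"
    and m: "\<And>s. s \<in> mult_index a \<Longrightarrow> \<iota>' s \<in> Mor C (Ts (fst s)) Z" "\<And>s. s \<in> mult_index a \<Longrightarrow> \<pi>' s \<in> Mor C Z (Ts (fst s))"
    and ortho: "\<And>s t. s \<in> mult_index a \<Longrightarrow> t \<in> mult_index a \<Longrightarrow>
      Cmp C (Ts (fst s)) Z (Ts (fst t)) (\<pi>' t) (\<iota>' s) = (if s = t then Idm C (Ts (fst s)) else 0)"
    and id: "(\<Sum>s\<in>mult_index a. Cmp C Z (Ts (fst s)) Z (\<iota>' s) (\<pi>' s)) = Idm C Z"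
    using Z by (rule has_multiplicitiesE) blast
  define p where "p t = \<pi>' (i, t)" for t
  define q where "q t = \<iota>' (i, t)" for t
  have mem: "(i, t) \<in> mult_index a \<longleftrightarrow> t < a i" for t using i by (simp add: mult_index_def)
  have pq: "\<And>t. t < a i \<Longrightarrow> p t \<in> Mor C Z (Ts i)" "\<And>t. t < a i \<Longrightarrow> q t \<in> Mor C (Ts i) Z"
    "\<And>s t. s < a i \<Longrightarrow> t < a i \<Longrightarrow> Cmp C (Ts i) Z (Ts i) (p t) (q s) = (if s = t then Idm C (Ts i) else 0)"
    using m[of "(i, _)"] ortho[of "(i, _)" "(i, _)"] by (simp_all add: mem p_def q_def)
  have "basis_mod (Scal C) (rad C Z (Ts i)) (Mor C Z (Ts i)) {..<a i} p"
    unfolding basis_mod_def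
  proof (intro conjI allI impI ballI)
    show "finite {..<a i}" "p ` {..<a i} \<subseteq> Mor C Z (Ts i)" using pq by auto
  next
    fix c t assume r: "(\<Sum>s<a i. Scal C (c s) (p s)) \<in> rad C Z (Ts i)" and t: "t \<in> {..<a i}"
    have "Cmp C (Ts i) Z (Ts i) (\<Sum>s<a i. Scal C (c s) (p s)) (q t)
        = (\<Sum>s<a i. Cmp C (Ts i) Z (Ts i) (Scal C (c s) (p s)) (q t))"
      by (rule Cmp_sum_left) (use t pq in simp_all)
    also have "\<dots> = (\<Sum>s<a i. if s = t then Scal C (c t) (Idm C (Ts i)) else 0)"
      by (rule sum.cong) (use t pq in auto)
    also have "\<dots> = Scal C (c t) (Idm C (Ts i))" using t by simp
    finally have "Scal C (c t) (Idm C (Ts i)) \<in> rad C (Ts i) (Ts i)"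
      using rad_Cmp_right[OF r pq(2)[of t]] t by simp
    then have "residue (Ts i) (Scal C (c t) (Idm C (Ts i))) = 0"
      using i by (intro residue_rad Ts_indec)
    then show "c t = 0" using i by (simp add: residue_Scal residue_Idm Ts_indec)
  next
    fix v assume v: "v \<in> Mor C Z (Ts i)"
    \<comment> \<open>The coefficients are the residues of \<open>v\<close> on the copies of
      \<open>Ts i\<close>; on the other summands \<open>v\<close> is radical anyway.\<close>
    let ?c = "\<lambda>t. residue (Ts i) (Cmp C (Ts i) Z (Ts i) v (q t))"
    let ?t = "\<lambda>s. Cmp C Z (Ts (fst s)) (Ts i) (Cmp C (Ts (fst s)) Z (Ts i) v (\<iota>' s)) (\<pi>' s)"
    have "v = Cmp C Z Z (Ts i) v (\<Sum>s\<in>mult_index a. Cmp C Z (Ts (fst s)) Z (\<iota>' s) (\<pi>' s))"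
      using v id by simp
    also have "\<dots> = (\<Sum>s\<in>mult_index a. Cmp C Z Z (Ts i) v (Cmp C Z (Ts (fst s)) Z (\<iota>' s) (\<pi>' s)))"
      by (rule Cmp_sum_right) (use v m in simp_all)
    also have "\<dots> = (\<Sum>s\<in>mult_index a. ?t s)"
      by (rule sum.cong) (use v m in \<open>simp_all add: Cmp_assoc\<close>)
    also have "\<dots> = (\<Sum>s\<in>mult_index a - Pair i ` {..<a i}. ?t s) + (\<Sum>s\<in>Pair i ` {..<a i}. ?t s)"
      by (rule sum.subset_diff) (use fin mem in auto)
    also have "(\<Sum>s\<in>Pair i ` {..<a i}. ?t s) = (\<Sum>t<a i. Cmp C Z (Ts i) (Ts i) (Cmp C (Ts i) Z (Ts i) v (q t)) (p t))"
      by (subst sum.reindex) (simp_all add: inj_on_def p_def q_def)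
    finally have "v - (\<Sum>t<a i. Scal C (?c t) (p t)) = (\<Sum>s\<in>mult_index a - Pair i ` {..<a i}. ?t s)
        + (\<Sum>t<a i. Cmp C Z (Ts i) (Ts i) (Cmp C (Ts i) Z (Ts i) v (q t)) (p t) - Scal C (?c t) (p t))"
      by (simp add: sum_subtractf)
    also have "\<dots> \<in> rad C Z (Ts i)"
    proof (rule rad_add)
      show "(\<Sum>s\<in>mult_index a - Pair i ` {..<a i}. ?t s) \<in> rad C Z (Ts i)"
      proof (rule rad_sum, rule rad_Cmp_right)
        fix s assume s: "s \<in> mult_index a - Pair i ` {..<a i}"
        then have s': "s \<in> mult_index a" by blast
        have "fst s \<noteq> i"
        proof
          assume "fst s = i"
          then have "s = (i, snd s)" "snd s < a i" using s' by (auto simp: mult_index_def)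
          then show False using s by (metis DiffD2 imageI lessThan_iff)
        qed
        then show "Cmp C (Ts (fst s)) Z (Ts i) v (\<iota>' s) \<in> rad C (Ts (fst s)) (Ts i)"
          using rad_Ts[OF mult_index_fst[OF s'] i] m[OF s'] v by simp
        show "\<pi>' s \<in> Mor C Z (Ts (fst s))" using m s' by blast
      qed
      show "(\<Sum>t<a i. Cmp C Z (Ts i) (Ts i) (Cmp C (Ts i) Z (Ts i) v (q t)) (p t) - Scal C (?c t) (p t)) \<in> rad C Z (Ts i)"
      proof (rule rad_sum)
        fix t assume "t \<in> {..<a i}"
        then have t: "p t \<in> Mor C Z (Ts i)" "q t \<in> Mor C (Ts i) Z" using pq by auto
        have "Cmp C (Ts i) Z (Ts i) v (q t) - Scal C (?c t) (Idm C (Ts i)) \<in> rad C (Ts i) (Ts i)"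
          by (rule residue_diff[OF Ts_indec[OF i]]) (use v t in simp)
        from rad_Cmp_right[OF this t(1)]
        show "Cmp C Z (Ts i) (Ts i) (Cmp C (Ts i) Z (Ts i) v (q t)) (p t) - Scal C (?c t) (p t) \<in> rad C Z (Ts i)"
          using t v by simp
      qed
    qed
    finally show "\<exists>c. v - (\<Sum>t<a i. Scal C (c t) (p t)) \<in> rad C Z (Ts i)" by (rule exI[of _ ?c])
  qed
  then show thesis by (rule that)
qed

end

section \<open>The 2-Calabi-Yau symmetry and the index of M\<close>

locale cluster_tilted = basic_object C T Ts n \<iota> \<pi> + triangulated_cat C
  for C :: "('k::alg_closed_field, 'o, 'v::ab_group_add) tcat" and T Ts n \<iota> \<pi> +
  assumes cluster_tilting: "cluster_tilting C (add_of C {T})" and two_calabi_yau: "two_calabi_yau C"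
begin

text \<open>The form pairs a map from \<open>Y\<close> to \<open>Sus C X\<close> with maps from
  \<open>Sus C X\<close> to the double suspension of \<open>Y\<close>. These are suspensions of maps
  from \<open>X\<close> to \<open>Sus C Y\<close>, hence zero, and non-degeneracy concludes.\<close>

lemma ext1_zero_sym:
  assumes "ext1_zero C X Y"
  shows "ext1_zero C Y X"
proof -
  obtain t where t': "\<forall>X. linear_on_sub (Scal C) (*) (Mor C X (SusPow C 2 X)) UNIV (t X)"
    and nondeg': "\<forall>X Y. \<forall>g\<in>Mor C X Y.
      (\<forall>f\<in>Mor C Y (SusPow C 2 X). t X (Cmp C X Y (SusPow C 2 X) f g) = 0) \<longrightarrow> g = 0"
    using two_calabi_yau[unfolded two_calabi_yau_def] by (elim exE conjE) (rule that; assumption)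
  note t = t'[rule_format] and nondeg = nondeg'[rule_format]
  have S2: "SusPow C 2 Y = Sus C (Sus C Y)" by (simp add: SusPow_def numeral_2_eq_2)
  have t0: "t Y 0 = 0" using linear_on_subD(3)[OF t Mor_closed(1), of Y 0] by simp
  have "g = 0" if g: "g \<in> Mor C Y (Sus C X)" for g
  proof (rule nondeg[OF g])
    fix f assume "f \<in> Mor C (Sus C X) (SusPow C 2 Y)"
    then obtain f' where f': "f' \<in> Mor C X (Sus C Y)" "f = SusM C X (Sus C Y) f'"
      unfolding S2 by (rule SusM_full)
    then have "f = 0" using assms by (simp add: ext1_zero_def)
    then show "t Y (Cmp C Y (Sus C X) (SusPow C 2 Y) f g) = 0" using g t0 by simp
  qed
  then show ?thesis by (auto simp: ext1_zero_def)
qed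

text \<open>\<open>T0\<close> is a right approximation of \<open>M\<close>, and its fibre
  \<open>T1\<close> passes the Ext test for add(T): a map from \<open>W\<close> to
  \<open>Sus C T1\<close> dies in \<open>Sus C T0\<close>, so it comes from \<open>M\<close>, lifts
  to \<open>T0\<close>, and is then a composite through two consecutive maps of the
  triangle.\<close>

lemma index_exists: "\<exists>g. is_index C Ts n M g"
proof -
  obtain T0 v where T0: "T0 \<in> add_of C {T}" "v \<in> Mor C T0 M"
    and approx: "\<And>W g. W \<in> add_of C {T} \<Longrightarrow> g \<in> Mor C W M \<Longrightarrow> \<exists>h\<in>Mor C W T0. g = Cmp C W T0 M v h"
    using cluster_tilting unfolding cluster_tilting_def right_approx_def by blast
  obtain T1 u w where t: "Tri C T1 T0 M u v w" using Tri_fibre[OF T0(2)] by blast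
  note in_t = Tri_in[OF t]
  have "ext1_zero C W T1" if W: "W \<in> add_of C {T}" for W
  proof -
    have "x = 0" if x: "x \<in> Mor C W (Sus C T1)" for x
    proof -
      have "ext1_zero C W T0" using cluster_tilting W T0(1) unfolding cluster_tilting_def by blast
      moreover have "Cmp C W (Sus C T1) (Sus C T0) (- SusM C T1 T0 u) x \<in> Mor C W (Sus C T0)"
        using x in_t by simp
      ultimately have "Cmp C W (Sus C T1) (Sus C T0) (- SusM C T1 T0 u) x = 0"
        by (simp add: ext1_zero_def)
      then obtain k where k: "k \<in> Mor C W M" "x = Cmp C W M (Sus C T1) w k"
        using Tri_factor_fibre[OF Tri_rotate[OF Tri_rotate[OF t]] x] by blast
      obtain h where h: "h \<in> Mor C W T0" "k = Cmp C W T0 M v h" using approx[OF W k(1)] by blast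
      have "x = Cmp C W T0 (Sus C T1) (Cmp C T0 M (Sus C T1) w v) h"
        using k h in_t by (simp add: Cmp_assoc)
      then show "x = 0" using Tri_zero_Cmp(2)[OF t] h by simp
    qed
    then show ?thesis by (auto simp: ext1_zero_def)
  qed
  then have T1: "T1 \<in> add_of C {T}"
    using cluster_tilting unfolding cluster_tilting_def by blast
  obtain a1 where "has_multiplicities C Ts n T1 a1"
    using factors_through_has_multiplicities[OF add_of_factors_through[OF T1]] by blast
  moreover obtain a0 where "has_multiplicities C Ts n T0 a0"
    using factors_through_has_multiplicities[OF add_of_factors_through[OF T0(1)]] by blast
  ultimately have "is_index C Ts n M (\<lambda>i. int (a0 i) - int (a1 i))"
    unfolding is_index_def using t by blast
  then show ?thesis by blast
qed

text \<open>
  Composition with \<open>T\<^sub>1 \<rightarrow> T\<^sub>0\<close> induces an isomorphism between the tops of \<open>C(T\<^sub>0, T\<^sub>i)\<close> and \<open>C(T\<^sub>1, T\<^sub>i)\<close>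
  when there is no extension of \<open>M\<close> by the \<open>T\<^sub>l\<close> with \<open>l \<in> L\<close> and every arrow into \<open>T\<^sub>i\<close> starts in \<open>L\<close>.
\<close>

lemma is_index_eq_0:
  assumes i: "i \<in> L" and L: "L \<subseteq> {1..n}"
    and arr: "\<And>l. l \<in> {1..n} \<Longrightarrow> l \<notin> L \<Longrightarrow> rad C (Ts l) (Ts i) = rad2 C (add_of C {T}) (Ts l) (Ts i)"
    and ext: "\<And>l. l \<in> L \<Longrightarrow> ext1_zero C (Ts l) M"
    and M: "indecomposable C M" "\<not> isomorphic C M (Ts i)"
    and g: "is_index C Ts n M g"
  shows "g i = 0"
proof -
  have i': "i \<in> {1..n}" using i L by blast
  obtain T1 T0 u v w a1 a0 where t: "Tri C T1 T0 M u v w"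
    and a1: "has_multiplicities C Ts n T1 a1" and a0: "has_multiplicities C Ts n T0 a0"
    and g': "\<forall>i\<in>{1..n}. g i = int (a0 i) - int (a1 i)"
    using g unfolding is_index_def by blast
  note in_t = Tri_in[OF t]
  \<comment> \<open>By symmetry Ext(M, T_l) vanishes too, so every map from \<open>T1\<close> to
    \<open>Ts l\<close> extends along \<open>u\<close>.\<close>
  have surj: "\<exists>h\<in>Mor C T0 (Ts l). f = Cmp C T1 T0 (Ts l) h u" if l: "l \<in> L" and f: "f \<in> Mor C T1 (Ts l)" for l f
  proof -
    have "Mor C M (Sus C (Ts l)) = {0}"
      using ext1_zero_sym[OF ext[OF l]] by (simp add: ext1_zero_def)
    moreover have "Cmp C M (Sus C T1) (Sus C (Ts l)) (SusM C T1 (Ts l) f) w \<in> Mor C M (Sus C (Ts l))"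
      using f in_t by simp
    ultimately have "Cmp C M (Sus C T1) (Sus C (Ts l)) (SusM C T1 (Ts l) f) w = 0" by blast
    then show ?thesis using Tri_factor_source[OF t f] by blast
  qed
  have lift: "\<exists>h'\<in>rad C T0 (Ts i). x = Cmp C T1 T0 (Ts i) h' u" if "x \<in> rad_through L T1 (Ts i)" for x
    using that unfolding rad_through_def
  proof (induction rule: span_induct_alt)
    case base
    show ?case by (rule bexI[of _ 0]) (use in_t in simp_all)
  next
    case (step c b y)
    obtain h' where h': "h' \<in> rad C T0 (Ts i)" "y = Cmp C T1 T0 (Ts i) h' u" using step(2) by blast
    obtain l h k where b: "l \<in> L" "h \<in> rad C (Ts l) (Ts i)" "k \<in> Mor C T1 (Ts l)" "b = Cmp C T1 (Ts l) (Ts i) h k"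
      using step(1) by blast
    obtain k' where k': "k' \<in> Mor C T0 (Ts l)" "k = Cmp C T1 T0 (Ts l) k' u" using surj[OF b(1,3)] by blast
    let ?h = "Scal C c (Cmp C T0 (Ts l) (Ts i) h k') + h'"
    have "?h \<in> rad C T0 (Ts i)"
      by (rule rad_add, rule rad_Scal, rule rad_Cmp_right[OF b(2) k'(1)], rule h'(1))
    moreover have "Scal C c b + y = Cmp C T1 T0 (Ts i) ?h u"
      using b(4) h' k' rad_Mor[OF b(2)] rad_Mor[OF h'(1)] in_t by (simp add: Cmp_assoc)
    ultimately show ?case by (rule bexI[rotated])
  qed
  \<comment> \<open>If h u is radical, it equals h' u for a radical h'. The difference h - h'
    factors through \<open>M\<close>, and all maps from \<open>M\<close> to the non-isomorphic
    \<open>Ts i\<close> are radical.\<close>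
  have refl: "h \<in> rad C T0 (Ts i)" if h: "h \<in> Mor C T0 (Ts i)" "Cmp C T1 T0 (Ts i) h u \<in> rad C T1 (Ts i)" for h
  proof -
    obtain h' where h': "h' \<in> rad C T0 (Ts i)" "Cmp C T1 T0 (Ts i) h u = Cmp C T1 T0 (Ts i) h' u"
      using lift[OF rad_generated[OF i' L arr has_multiplicities_factors_through[OF a1] h(2)]] by blast
    note h'M = rad_Mor[OF h'(1)]
    have "Cmp C T1 T0 (Ts i) (h - h') u = 0" using h h' h'M in_t by simp
    then obtain m where m: "m \<in> Mor C M (Ts i)" "h - h' = Cmp C T0 M (Ts i) m v"
      using Tri_factor_cone[OF t Mor_closed(3)[OF h(1) h'M]] by blast
    have "m \<in> rad C M (Ts i)" using m(1) rad_eq_Mor[OF M(1) Ts_indec[OF i'] M(2)] by simp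
    then have "h - h' \<in> rad C T0 (Ts i)" unfolding m(2) by (rule rad_Cmp_right) (use in_t in simp)
    from rad_add[OF this h'(1)] show ?thesis by simp
  qed
  obtain p0 where p0: "basis_mod (Scal C) (rad C T0 (Ts i)) (Mor C T0 (Ts i)) {..<a0 i} p0"
    using basis_mod_rad_multiplicities[OF a0 i'] by blast
  obtain p1 where p1: "basis_mod (Scal C) (rad C T1 (Ts i)) (Mor C T1 (Ts i)) {..<a1 i} p1"
    using basis_mod_rad_multiplicities[OF a1 i'] by blast
  have p0M: "\<And>s. s < a0 i \<Longrightarrow> p0 s \<in> Mor C T0 (Ts i)" using p0 by (auto simp: basis_mod_def)
  have comb: "(\<Sum>s<a0 i. Scal C (c s) (Cmp C T1 T0 (Ts i) (p0 s) u)) = Cmp C T1 T0 (Ts i) (\<Sum>s<a0 i. Scal C (c s) (p0 s)) u" for c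
    by (subst Cmp_sum_left) (use p0M in_t in simp_all)
  have combM: "(\<Sum>s<a0 i. Scal C (c s) (p0 s)) \<in> Mor C T0 (Ts i)" for c
    by (rule Mor_sum) (use p0M in simp)
  \<comment> \<open>By \<open>refl\<close> and \<open>surj\<close>, composition with
    \<open>u\<close> carries a basis of one top to a basis of the other, whence both multiplicities
    agree.\<close>
  have u0: "basis_mod (Scal C) (rad C T1 (Ts i)) (Mor C T1 (Ts i)) {..<a0 i} (\<lambda>s. Cmp C T1 T0 (Ts i) (p0 s) u)"
    unfolding basis_mod_def comb
  proof (intro conjI allI impI)
    show "finite {..<a0 i}" "(\<lambda>s. Cmp C T1 T0 (Ts i) (p0 s) u) ` {..<a0 i} \<subseteq> Mor C T1 (Ts i)"
      using p0M in_t by auto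
  next
    fix c assume "Cmp C T1 T0 (Ts i) (\<Sum>s<a0 i. Scal C (c s) (p0 s)) u \<in> rad C T1 (Ts i)"
    from refl[OF combM this] show "\<forall>s\<in>{..<a0 i}. c s = 0"
      using p0 unfolding basis_mod_def by blast
  next
    show "\<forall>f\<in>Mor C T1 (Ts i). \<exists>c. f - Cmp C T1 T0 (Ts i) (\<Sum>s<a0 i. Scal C (c s) (p0 s)) u \<in> rad C T1 (Ts i)"
    proof
      fix f assume "f \<in> Mor C T1 (Ts i)"
      then obtain h where h: "h \<in> Mor C T0 (Ts i)" "f = Cmp C T1 T0 (Ts i) h u" using surj[OF i] by blast
      obtain c where c: "h - (\<Sum>s<a0 i. Scal C (c s) (p0 s)) \<in> rad C T0 (Ts i)"
        using p0 h(1) unfolding basis_mod_def by blast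
      have "f - Cmp C T1 T0 (Ts i) (\<Sum>s<a0 i. Scal C (c s) (p0 s)) u
          = Cmp C T1 T0 (Ts i) (h - (\<Sum>s<a0 i. Scal C (c s) (p0 s))) u"
        using h combM in_t by simp
      also have "\<dots> \<in> rad C T1 (Ts i)" by (rule rad_Cmp_right[OF c in_t(1)])
      finally show "\<exists>c. f - Cmp C T1 T0 (Ts i) (\<Sum>s<a0 i. Scal C (c s) (p0 s)) u \<in> rad C T1 (Ts i)"
        by (rule exI[of _ c])
    qed
  qed
  have sub: "rad C T1 (Ts i) \<subseteq> Mor C T1 (Ts i)" by (auto dest: rad_Mor)
  have "a0 i = a1 i"
    using dim_basis_mod(1)[OF rad_subspace rad_finite_dim Mor_subspace sub u0]
      dim_basis_mod(1)[OF rad_subspace rad_finite_dim Mor_subspace sub p1] by simp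
  then show ?thesis using g' i' by simp
qed

end

section \<open>Simple modules and their extensions\<close>

text \<open>Determined only for nonzero \<open>x\<close> and for \<open>y\<close> on the line
  through it.\<close>

definition line_coord :: "('k \<Rightarrow> 'v \<Rightarrow> 'v) \<Rightarrow> 'v \<Rightarrow> 'v \<Rightarrow> 'k" where
  "line_coord s x y = (THE c. y = s c x)"

context vector_space
begin

lemma finite_dim_sub_image:
  assumes f: "linear_on_sub scale scale V W f" and V: "subspace V" "finite_dim_sub scale V"
  shows "finite_dim_sub scale (f ` V)"
proof -
  obtain B where B: "finite B" "B \<subseteq> V" "independent B" "V \<subseteq> span B" "card B = dim V"
    by (rule finite_dim_sub_basis[OF V(2)])
  have "f v \<in> span (f ` B)" if v: "v \<in> V" for v
  proof -
    have "v \<in> span B" using B(4) v by blast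
    then obtain g where g: "v = (\<Sum>i\<in>B. g i *s i)"
      unfolding span_finite[OF B(1)] by blast
    have "f v = (\<Sum>i\<in>B. g i *s f i)"
      unfolding g by (rule linear_on_sub_sum[OF f V(1) vector_space_axioms B(1,2)])
    also have "\<dots> \<in> span (f ` B)" by (intro span_sum span_scale span_base imageI)
    finally show ?thesis .
  qed
  then have "f ` V \<subseteq> span (f ` B)" by blast
  with finite_imageI[OF B(1)] show ?thesis unfolding finite_dim_sub_def by blast
qed

lemma vector_space_fun: "vector_space (\<lambda>c f x. c *s f x)"
  by unfold_locales (simp_all add: fun_eq_iff scale_right_distrib scale_left_distrib)

lemma line_coord_scale [simp]: "x \<noteq> 0 \<Longrightarrow> line_coord scale x (c *s x) = c"
  unfolding line_coord_def by (rule the_equality) auto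

lemma scale_line_coord: "x \<noteq> 0 \<Longrightarrow> y \<in> span {x} \<Longrightarrow> line_coord scale x y *s x = y"
  by (auto simp: span_singleton)

end

context basic_object
begin

text \<open>Any nonzero vector of the ambient space can carry the simple module with character \<open>char_at i\<close>.\<close>

lemma simple_top_exists:
  assumes i: "i \<in> {1..n}"
  shows "\<exists>S. simple_rmod C T S \<and> (\<exists>\<phi>. rmod_map C T (hom_module C T (Ts i)) S \<phi> \<and> \<phi> ` Mor C T (Ts i) = Car S)"
proof -
  let ?x = "Idm C (Ts i)"
  let ?S = "\<lparr>Car = span {?x}, Act = \<lambda>x a. Scal C (char_at i a) x\<rparr>"
  let ?\<phi> = "\<lambda>g. Scal C (char_at i (Cmp C T (Ts i) T (\<iota> i) g)) ?x"
  have "is_rmod C T ?S"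
    using i by (auto simp: is_rmod_def linear_on_sub_def span_scale char_at_add char_at_Scal char_at_Idm char_at_mult
      scale_right_distrib scale_left_distrib mult.commute)
  moreover have "N = {0} \<or> N = span {?x}" if N: "submodule C T ?S N" for N
  proof (cases "N \<subseteq> {0}")
    case True
    then show ?thesis using N subspace_0[of N] by (auto simp: submodule_def)
  next
    case False
    then obtain y where y: "y \<in> N" "y \<noteq> 0" by blast
    have N': "N \<subseteq> span {?x}" "subspace N" using N by (auto simp: submodule_def)
    obtain c where c: "y = Scal C c ?x" using y N' unfolding span_singleton by blast
    then have "c \<noteq> 0" using y by auto
    have "Scal C (inverse c) y \<in> N" using y N' by (intro subspace_scale)
    then have "?x \<in> N" using c \<open>c \<noteq> 0\<close> by simp
    then have "span {?x} \<subseteq> N" using N' by (intro span_minimal) auto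
    with N' show ?thesis by blast
  qed
  moreover have "span {?x} \<noteq> {0}"
  proof
    assume "span {?x} = {0}"
    then have "?x \<in> {0}" using span_base[of ?x "{?x}"] by simp
    then show False using i by simp
  qed
  ultimately have "simple_rmod C T ?S" by (simp add: simple_rmod_def)
  moreover have "rmod_map C T (hom_module C T (Ts i)) ?S ?\<phi>"
    unfolding rmod_map_def linear_on_sub_def hom_module_def rmod.simps
  proof (intro conjI ballI allI)
    fix g assume g: "g \<in> Mor C T (Ts i)"
    have ig: "Cmp C T (Ts i) T (\<iota> i) g \<in> Mor C T T" using i g by simp
    show "?\<phi> g \<in> span {?x}" by (intro span_scale span_base) simp
    show "?\<phi> (Scal C c g) = Scal C c (?\<phi> g)" for c
      using i g char_at_Scal[OF i ig] by simp
    show "?\<phi> (g + h) = ?\<phi> g + ?\<phi> h" if "h \<in> Mor C T (Ts i)" for h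
      using i g that char_at_add[OF i ig, of "Cmp C T (Ts i) T (\<iota> i) h"] by (simp add: scale_left_distrib)
    fix a assume a: "a \<in> Mor C T T"
    have "Cmp C T (Ts i) T (\<iota> i) (Cmp C T T (Ts i) g a) = Cmp C T T T (Cmp C T (Ts i) T (\<iota> i) g) a"
      using i g a by (simp add: Cmp_assoc)
    then show "?\<phi> (Cmp C T T (Ts i) g a) = Scal C (char_at i a) (?\<phi> g)"
      using char_at_mult[OF i ig a] by (simp add: mult.commute)
  qed
  moreover have "?\<phi> ` Mor C T (Ts i) = Car ?S"
  proof
    show "?\<phi> ` Mor C T (Ts i) \<subseteq> Car ?S" by (auto intro: span_scale span_base)
    show "Car ?S \<subseteq> ?\<phi> ` Mor C T (Ts i)"
    proof
      fix y assume "y \<in> Car ?S"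
      then obtain c where c: "y = Scal C c ?x" by (auto simp: span_singleton)
      have "?\<phi> (Scal C c (\<pi> i)) = y"
        using i c char_at_vertex_idem[OF i i] by (simp add: char_at_Scal flip: vertex_idem_def)
      then show "y \<in> ?\<phi> ` Mor C T (Ts i)" using i by (intro image_eqI[of _ _ "Scal C c (\<pi> i)"]) simp_all
    qed
  qed
  ultimately show ?thesis by blast
qed

text \<open>The simple top is fixed by a choice, so its shape has to be derived. Its maximal
  submodule is 0, which leaves a line with some character \<open>char_at j\<close>. For
  \<open>j \<noteq> i\<close> the generator \<open>\<pi> i\<close> of C(T, T_i), which is fixed by
  \<open>vertex_idem i\<close>, would be sent to 0.\<close>

lemma simple_top_char:
  assumes i: "i \<in> {1..n}"
  obtains x where "x \<noteq> 0" "Car (simple_top C T (Ts i)) = span {x}"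
    "\<And>y a. y \<in> span {x} \<Longrightarrow> a \<in> Mor C T T \<Longrightarrow> Act (simple_top C T (Ts i)) y a = Scal C (char_at i a) y"
proof -
  define S where "S = simple_top C T (Ts i)"
  have "simple_rmod C T S \<and> (\<exists>\<phi>. rmod_map C T (hom_module C T (Ts i)) S \<phi> \<and> \<phi> ` Mor C T (Ts i) = Car S)"
    unfolding S_def simple_top_def by (rule someI_ex[OF simple_top_exists[OF i]])
  then obtain \<phi> where S: "simple_rmod C T S" and \<phi>: "rmod_map C T (hom_module C T (Ts i)) S \<phi>" "\<phi> ` Mor C T (Ts i) = Car S"
    by blast
  have SM: "rmodule (Car S) (Act S)" using S by (cases S) (simp add: simple_rmod_def)
  note D = rmoduleD[OF SM]
  have lin: "linear_on_sub (Scal C) (Scal C) (Mor C T (Ts i)) (Car S) \<phi>"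
    and \<phi>act: "\<And>x a. x \<in> Mor C T (Ts i) \<Longrightarrow> a \<in> Mor C T T \<Longrightarrow> \<phi> (Cmp C T T (Ts i) x a) = Act S (\<phi> x) a"
    using \<phi>(1) by (auto simp: rmod_map_def hom_module_def)
  have fin: "finite_dim_sub (Scal C) (Car S)"
    using finite_dim_sub_image[OF lin Mor_subspace Mor_finite_dim] \<phi>(2) by simp
  have "submod (Car S) (Act S) {0}"
    unfolding submod_def
  proof (intro conjI ballI)
    show "{0} \<subseteq> Car S" using subspace_0[OF D(1)] by simp
    fix x a assume "x \<in> {0::'v}" "a \<in> Mor C T T"
    then show "Act S x a \<in> {0}" using D(4)[OF subspace_0[OF D(1)], of a 0] by simp
  qed (rule subspace_single_0)
  moreover have "{0} \<noteq> Car S" using S unfolding simple_rmod_def by metis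
  ultimately obtain N j y where N: "submod (Car S) (Act S) N" and j: "j \<in> {1..n}" and y: "y \<in> Car S" "y \<notin> N"
    and yj: "Act S y (vertex_idem j) = y"
    and gen: "\<And>z. z \<in> Car S \<Longrightarrow> \<exists>c. z - Scal C c y \<in> N"
    and char: "\<And>a. a \<in> Mor C T T \<Longrightarrow> Act S y a - Scal C (char_at j a) y \<in> N"
    using maximal_submod[OF SM fin] by metis
  have "submodule C T S N" using N by (simp add: submod_def submodule_def)
  then have N0: "N = {0}" using S y by (auto simp: simple_rmod_def)
  have y0: "y \<noteq> 0" using y N0 by simp
  have CarS: "Car S = span {y}"
  proof
    show "span {y} \<subseteq> Car S" using y D(1) by (intro span_minimal) auto
    show "Car S \<subseteq> span {y}" using gen N0 by (fastforce simp: span_singleton)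
  qed
  have act: "Act S y a = Scal C (char_at j a) y" if "a \<in> Mor C T T" for a
    using char[OF that] N0 by simp
  have acts: "Act S z a = Scal C (char_at j a) z" if z: "z \<in> span {y}" and a: "a \<in> Mor C T T" for z a
  proof -
    obtain c where "z = Scal C c y" using z by (auto simp: span_singleton)
    then show ?thesis using D(4)[OF y(1) a, of c] act[OF a] by (simp add: mult.commute)
  qed
  have "j = i"
  proof (rule ccontr)
    assume "j \<noteq> i"
    have "Cmp C T T (Ts i) (\<pi> i) (vertex_idem i) = \<pi> i"
      using i by (simp add: vertex_idem_def proj_incl flip: Cmp_assoc)
    then have "\<phi> (\<pi> i) = Act S (\<phi> (\<pi> i)) (vertex_idem i)"
      using \<phi>act[of "\<pi> i" "vertex_idem i"] i by simp
    also have "\<dots> = 0"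
      using acts[of "\<phi> (\<pi> i)" "vertex_idem i"] linear_on_subD(1)[OF lin, of "\<pi> i"] CarS i j \<open>j \<noteq> i\<close>
      by (simp add: char_at_vertex_idem)
    finally have 0: "\<phi> (\<pi> i) = 0" .
    have "\<phi> g = 0" if g: "g \<in> Mor C T (Ts i)" for g
    proof -
      have "Cmp C T T (Ts i) (\<pi> i) (Cmp C T (Ts i) T (\<iota> i) g) = g"
        using i g by (simp add: proj_incl flip: Cmp_assoc)
      then have "\<phi> g = Act S (\<phi> (\<pi> i)) (Cmp C T (Ts i) T (\<iota> i) g)"
        using \<phi>act[of "\<pi> i" "Cmp C T (Ts i) T (\<iota> i) g"] i g by simp
      also have "\<dots> = 0"
        using acts[of 0 "Cmp C T (Ts i) T (\<iota> i) g"] i g 0 by (simp add: span_zero)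
      finally show ?thesis .
    qed
    then have "Car S \<subseteq> {0}" using \<phi>(2) by auto
    then show False using y y0 by auto
  qed
  with acts y0 CarS that show thesis unfolding S_def by blast
qed

text \<open>
  The bilinear function \<open>(c x, a) \<mapsto> c m(a) z\<close>, through which all cocycles between the simple modules
  spanned by \<open>x\<close> and by \<open>z\<close> are given by linear forms \<open>m\<close> on \<open>End(T)\<close>.
\<close>

definition form_cocycle :: "'v \<Rightarrow> 'v \<Rightarrow> ('v \<Rightarrow> 'k) \<Rightarrow> 'v \<Rightarrow> 'v \<Rightarrow> 'v" where
  "form_cocycle x z m = (\<lambda>y a. if y \<in> span {x} \<and> a \<in> Mor C T T then Scal C (line_coord (Scal C) x y * m a) z else 0)"

text \<open>A derivation of End(T) into \<open>k\<close>, on which the left action is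
  \<open>char_at i\<close> and the right action is \<open>char_at l\<close>. The product rule is the
  cocycle condition for extensions of the simple module at \<open>i\<close> by the one at
  \<open>l\<close>.\<close>

definition skew_derivation :: "nat \<Rightarrow> nat \<Rightarrow> ('v \<Rightarrow> 'k) \<Rightarrow> bool" where
  "skew_derivation i l m \<longleftrightarrow> linear_on_sub (Scal C) (*) (Mor C T T) UNIV m \<and>
     (\<forall>a\<in>Mor C T T. \<forall>b\<in>Mor C T T. m (Cmp C T T T a b) = char_at l b * m a + char_at i a * m b)"

lemma skew_derivationD:
  assumes "skew_derivation i l m"
  shows "a \<in> Mor C T T \<Longrightarrow> b \<in> Mor C T T \<Longrightarrow> m (a + b) = m a + m b"
    and "a \<in> Mor C T T \<Longrightarrow> m (Scal C c a) = c * m a"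
    and "a \<in> Mor C T T \<Longrightarrow> b \<in> Mor C T T \<Longrightarrow> m (Cmp C T T T a b) = char_at l b * m a + char_at i a * m b"
  using assms by (simp_all add: skew_derivation_def linear_on_sub_def)

text \<open>Up to a multiple of the inner derivation \<open>char_at l b - char_at i b\<close>, the
  values on the corner C(T_l, T_i) determine \<open>m\<close>. The formula is the product rule for b
  between the two idempotents; the idempotents have opposite values under \<open>m\<close> because
  their product is 0.\<close>

lemma skew_derivation_eq:
  assumes m: "skew_derivation i l m" and il: "i \<in> {1..n}" "l \<in> {1..n}" "i \<noteq> l" and b: "b \<in> Mor C T T"
  shows "m b = m (Cmp C T T T (vertex_idem i) (Cmp C T T T b (vertex_idem l)))
    - m (vertex_idem i) * (char_at l b - char_at i b)"
proof -
  let ?e = "vertex_idem i" and ?f = "vertex_idem l"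
  have e: "?e \<in> Mor C T T" "?f \<in> Mor C T T" using il by simp_all
  have m0: "m 0 = 0" using skew_derivationD(2)[OF m Mor_closed(1), of 0] by simp
  have "m (Cmp C T T T ?e ?f) = m ?e + m ?f"
    using skew_derivationD(3)[OF m e] il by (simp add: char_at_vertex_idem)
  then have f: "m ?f = - m ?e" using m0 il vertex_idem_mult[of i l] by (simp add: eq_neg_iff_add_eq_0 add.commute)
  have be: "Cmp C T T T b ?f \<in> Mor C T T" using e b by simp
  have "m (Cmp C T T T ?e (Cmp C T T T b ?f)) = char_at l (Cmp C T T T b ?f) * m ?e + m (Cmp C T T T b ?f)"
    using skew_derivationD(3)[OF m e(1) be] il by (simp add: char_at_vertex_idem)
  also have "char_at l (Cmp C T T T b ?f) = char_at l b"
    using char_at_mult[OF il(2) b e(2)] il by (simp add: char_at_vertex_idem)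
  also have "m (Cmp C T T T b ?f) = m b - char_at i b * m ?e"
    using skew_derivationD(3)[OF m b e(2)] il f by (simp add: char_at_vertex_idem)
  finally show ?thesis by (simp add: algebra_simps)
qed

text \<open>In the product rule for two radical factors both characters vanish.\<close>

lemma skew_derivation_rad2:
  assumes m: "skew_derivation i l m" and il: "i \<in> {1..n}" "l \<in> {1..n}"
    and z: "z \<in> rad2 C (add_of C {T}) (Ts l) (Ts i)"
  shows "m (Cmp C T (Ts i) T (\<iota> i) (Cmp C T (Ts l) (Ts i) z (\<pi> l))) = 0"
proof -
  have m0: "m 0 = 0" using skew_derivationD(2)[OF m Mor_closed(1), of 0] by simp
  have "z \<in> Mor C (Ts l) (Ts i) \<and> m (Cmp C T (Ts i) T (\<iota> i) (Cmp C T (Ts l) (Ts i) z (\<pi> l))) = 0"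
    using z unfolding rad2_eq_span
  proof (induction rule: span_induct_alt)
    case base
    then show ?case using m0 il by simp
  next
    case (step c b y)
    obtain f g where fg: "f \<in> rad C (Ts l) T" "g \<in> rad C T (Ts i)" "b = Cmp C (Ts l) T (Ts i) g f"
      using step(1) by blast
    note M = rad_Mor[OF fg(1)] rad_Mor[OF fg(2)]
    let ?p = "Cmp C T (Ts i) T (\<iota> i) g" and ?q = "Cmp C T (Ts l) T f (\<pi> l)"
    have p: "?p \<in> Mor C T T" and q: "?q \<in> Mor C T T" using M il by simp_all
    have b: "b \<in> Mor C (Ts l) (Ts i)" using fg M by simp
    have "Cmp C T (Ts i) T (\<iota> i) (Cmp C T (Ts l) (Ts i) b (\<pi> l)) = Cmp C T T T ?p ?q"
      using fg(3) M il by (simp add: Cmp_assoc)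
    moreover have "char_at i ?p = 0"
      by (rule char_at_rad[OF il(1) p], rule rad_Cmp_left, rule rad_Cmp_left[OF fg(2)]) (use il in simp_all)
    moreover have "char_at l ?q = 0"
      by (rule char_at_rad[OF il(2) q], rule rad_Cmp_left, rule rad_Cmp_right[OF fg(1)]) (use il in simp_all)
    ultimately have "m (Cmp C T (Ts i) T (\<iota> i) (Cmp C T (Ts l) (Ts i) b (\<pi> l))) = 0"
      using skew_derivationD(3)[OF m p q] by simp
    moreover have "m (Cmp C T (Ts i) T (\<iota> i) (Cmp C T (Ts l) (Ts i) (Scal C c b + y) (\<pi> l)))
        = c * m (Cmp C T (Ts i) T (\<iota> i) (Cmp C T (Ts l) (Ts i) b (\<pi> l))) + m (Cmp C T (Ts i) T (\<iota> i) (Cmp C T (Ts l) (Ts i) y (\<pi> l)))"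
      using b step(2) il by (simp add: skew_derivationD(1,2)[OF m])
    ultimately show ?case using step(2) b by simp
  qed
  then show ?thesis by blast
qed

text \<open>The mirror image of \<open>proj_minus_char_rad\<close>, for inclusions instead of
  projections.\<close>

lemma incl_minus_char_rad:
  assumes l: "l \<in> {1..n}" and b: "b \<in> Mor C T T"
  shows "Cmp C (Ts l) T T b (\<iota> l) - Scal C (char_at l b) (\<iota> l) \<in> rad C (Ts l) T"
proof -
  let ?f = "Cmp C (Ts l) T T b (\<iota> l) - Scal C (char_at l b) (\<iota> l)"
  have f: "?f \<in> Mor C (Ts l) T" using l b by simp
  have "Cmp C (Ts l) T (Ts m) (\<pi> m) ?f \<in> rad C (Ts l) (Ts m)" if m: "m \<in> {1..n}" for m
  proof (cases "m = l")
    case True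
    have "Cmp C (Ts l) T (Ts l) (\<pi> l) (Cmp C (Ts l) T T b (\<iota> l)) - Scal C (char_at l b) (Idm C (Ts l)) \<in> rad C (Ts l) (Ts l)"
      unfolding char_at_def using l b by (intro residue_diff) (simp_all add: Ts_indec)
    then show ?thesis using True l b by (simp add: proj_incl)
  next
    case False
    then show ?thesis using rad_Ts[OF l m] l m b by simp
  qed
  then have "(\<Sum>m\<in>{1..n}. Cmp C (Ts l) (Ts m) T (\<iota> m) (Cmp C (Ts l) T (Ts m) (\<pi> m) ?f)) \<in> rad C (Ts l) T"
    by (intro rad_sum rad_Cmp_left[where Y = "Ts _"]) simp_all
  also have "(\<Sum>m\<in>{1..n}. Cmp C (Ts l) (Ts m) T (\<iota> m) (Cmp C (Ts l) T (Ts m) (\<pi> m) ?f))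
      = (\<Sum>m\<in>{1..n}. Cmp C (Ts l) T T (Cmp C T (Ts m) T (\<iota> m) (\<pi> m)) ?f)"
    by (rule sum.cong[OF refl], rule Cmp_assoc[symmetric, OF f]) simp_all
  also have "\<dots> = Cmp C (Ts l) T T (Idm C T) ?f"
    unfolding incl_proj_sum[symmetric] by (rule Cmp_sum_left[symmetric, OF f]) simp
  also have "\<dots> = ?f" using f by simp
  finally show ?thesis .
qed

text \<open>Split \<open>a\<close> after \<open>\<pi> i\<close> and \<open>b\<close> before
  \<open>\<iota> l\<close> into character multiples and radical remainders. The two remainders
  multiply into the square of the radical, where \<open>k\<close> vanishes; the two main terms
  multiply to 0 because \<open>i \<noteq> l\<close>; the mixed terms give the product rule.\<close>

lemma skew_derivationI:
  assumes il: "i \<in> {1..n}" "l \<in> {1..n}" "i \<noteq> l"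
    and k: "linear_on_sub (Scal C) (*) (Mor C (Ts l) (Ts i)) UNIV k"
    and k0: "\<And>z. z \<in> rad2 C (add_of C {T}) (Ts l) (Ts i) \<Longrightarrow> k z = 0"
  shows "skew_derivation i l (\<lambda>a. k (Cmp C (Ts l) T (Ts i) (\<pi> i) (Cmp C (Ts l) T T a (\<iota> l))))"
  unfolding skew_derivation_def
proof (intro conjI ballI)
  show "linear_on_sub (Scal C) (*) (Mor C T T) UNIV (\<lambda>a. k (Cmp C (Ts l) T (Ts i) (\<pi> i) (Cmp C (Ts l) T T a (\<iota> l))))"
    using il linear_on_subD[OF k] by (simp add: linear_on_sub_def)
  fix a b assume ab: "a \<in> Mor C T T" "b \<in> Mor C T T"
  let ?r = "Cmp C T T (Ts i) (\<pi> i) a - Scal C (char_at i a) (\<pi> i)"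
  let ?s = "Cmp C (Ts l) T T b (\<iota> l) - Scal C (char_at l b) (\<iota> l)"
  let ?h = "\<lambda>a. Cmp C (Ts l) T (Ts i) (\<pi> i) (Cmp C (Ts l) T T a (\<iota> l))"
  have r: "?r \<in> rad C T (Ts i)" by (rule proj_minus_char_rad[OF il(1) ab(1)])
  have s: "?s \<in> rad C (Ts l) T" by (rule incl_minus_char_rad[OF il(2) ab(2)])
  have rs: "Cmp C (Ts l) T (Ts i) ?r ?s \<in> rad2 C (add_of C {T}) (Ts l) (Ts i)"
    unfolding rad2_eq_span by (rule span_base) (use r s in blast)
  have "Cmp C (Ts l) T (Ts i) ?r ?s = ?h (Cmp C T T T a b) - Scal C (char_at l b) (?h a) - Scal C (char_at i a) (?h b)"
    using ab il by (simp add: Cmp_assoc proj_incl)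
  then have "?h (Cmp C T T T a b) = Cmp C (Ts l) T (Ts i) ?r ?s + (Scal C (char_at l b) (?h a) + Scal C (char_at i a) (?h b))"
    by simp
  moreover have "k \<dots> = k (Cmp C (Ts l) T (Ts i) ?r ?s) + (char_at l b * k (?h a) + char_at i a * k (?h b))"
  proof -
    have 1: "Cmp C (Ts l) T (Ts i) ?r ?s \<in> Mor C (Ts l) (Ts i)"
      by (rule Cmp_in[OF rad_Mor[OF s] rad_Mor[OF r]])
    have 2: "?h a \<in> Mor C (Ts l) (Ts i)" "?h b \<in> Mor C (Ts l) (Ts i)" using ab il by simp_all
    show ?thesis
      using linear_on_subD(2)[OF k 1 Mor_closed(2)[OF Mor_closed(5)[OF 2(1)] Mor_closed(5)[OF 2(2)]]]
        linear_on_subD(2)[OF k Mor_closed(5)[OF 2(1)] Mor_closed(5)[OF 2(2)]]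
        linear_on_subD(3)[OF k 2(1)] linear_on_subD(3)[OF k 2(2)] by (simp only:)
  qed
  ultimately show "k (?h (Cmp C T T T a b)) = char_at l b * k (?h a) + char_at i a * k (?h b)"
    using k0[OF rs] by simp
qed

section \<open>Hom and first extensions between simple modules\<close>

abbreviation scale_fun2 :: "'k \<Rightarrow> ('v \<Rightarrow> 'v \<Rightarrow> 'v) \<Rightarrow> 'v \<Rightarrow> 'v \<Rightarrow> 'v" where
  "scale_fun2 \<equiv> (\<lambda>c \<psi> x a. Scal C c (\<psi> x a))"

lemma vector_space_fun2: "vector_space scale_fun2"
  by (rule vector_space.vector_space_fun[OF vector_space_fun])

lemma form_cocycle_add: "form_cocycle x z (\<lambda>a. m a + m' a) = form_cocycle x z m + form_cocycle x z m'"
  by (simp add: form_cocycle_def fun_eq_iff distrib_left scale_left_distrib)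

lemma form_cocycle_scale: "form_cocycle x z (\<lambda>a. c * m a) = scale_fun2 c (form_cocycle x z m)"
  by (simp add: form_cocycle_def fun_eq_iff mult.left_commute)

lemma form_cocycle_0: "form_cocycle x z (\<lambda>a. 0) = 0"
  by (simp add: form_cocycle_def fun_eq_iff)

lemma form_cocycle_sum:
  "form_cocycle x z (\<lambda>a. \<Sum>s\<in>S. c s * m s a) = (\<Sum>s\<in>S. scale_fun2 (c s) (form_cocycle x z (m s)))"
proof (induction S rule: infinite_finite_induct)
  case (insert s S)
  then show ?case by (simp add: form_cocycle_add form_cocycle_scale)
qed (simp_all add: form_cocycle_0)

lemma form_cocycle_apply:
  assumes "x \<noteq> 0" "a \<in> Mor C T T"
  shows "form_cocycle x z m (Scal C c x) a = Scal C (c * m a) z"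
  using assms by (simp add: form_cocycle_def span_scale span_base)

lemma form_cocycle_inj:
  assumes "x \<noteq> 0" "z \<noteq> 0" "form_cocycle x z m = form_cocycle x z m'" "a \<in> Mor C T T"
  shows "m a = m' a"
  using form_cocycle_apply[OF assms(1,4), of z m 1] form_cocycle_apply[OF assms(1,4), of z m' 1] assms by simp

lemma form_cocycle_cong: "(\<And>a. a \<in> Mor C T T \<Longrightarrow> m a = m' a) \<Longrightarrow> form_cocycle x z m = form_cocycle x z m'"
  by (auto simp: form_cocycle_def fun_eq_iff)

text \<open>The idempotent \<open>vertex_idem i\<close> acts by 1 on the source and by 0 on the
  target, which kills every homomorphism.\<close>

lemma dim_hom_simple_tops:
  assumes il: "i \<in> {1..n}" "l \<in> {1..n}" "i \<noteq> l"
  shows "dim_hom C T (simple_top C T (Ts i)) (simple_top C T (Ts l)) = 0"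
proof -
  let ?S = "simple_top C T (Ts i)" and ?R = "simple_top C T (Ts l)"
  obtain x where x: "x \<noteq> 0" "Car ?S = span {x}"
    "\<And>y a. y \<in> span {x} \<Longrightarrow> a \<in> Mor C T T \<Longrightarrow> Act ?S y a = Scal C (char_at i a) y"
    using simple_top_char[OF il(1)] by metis
  obtain z where z: "z \<noteq> 0" "Car ?R = span {z}"
    "\<And>y a. y \<in> span {z} \<Longrightarrow> a \<in> Mor C T T \<Longrightarrow> Act ?R y a = Scal C (char_at l a) y"
    using simple_top_char[OF il(2)] by metis
  have e: "vertex_idem i \<in> Mor C T T" using il by simp
  have "f = 0" if f: "f \<in> hom_space C T ?S ?R" for f
  proof
    fix y
    show "f y = 0 y"
    proof (cases "y \<in> span {x}")
      case True
      have "f y \<in> span {z}" "f (Act ?S y (vertex_idem i)) = Act ?R (f y) (vertex_idem i)"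
        using f True e x(2) z(2) by (auto simp: hom_space_def rmod_map_def linear_on_sub_def)
      then show ?thesis using x(3)[OF True e] z(3)[OF _ e] il by (simp add: char_at_vertex_idem)
    next
      case False
      then show ?thesis using f x(2) by (simp add: hom_space_def)
    qed
  qed
  moreover have "0 \<in> hom_space C T ?S ?R"
  proof -
    have "Act ?R 0 a = 0" if "a \<in> Mor C T T" for a using z(3)[OF span_zero that] by simp
    then show ?thesis by (simp add: hom_space_def rmod_map_def linear_on_sub_def z(2) span_zero)
  qed
  ultimately have hs: "hom_space C T ?S ?R = {0}" by blast
  interpret F: vector_space "\<lambda>c f x. Scal C c (f x)" by (rule vector_space_fun)
  show ?thesis
    unfolding dim_hom_def hs using F.basis_card_eq_dim[of "{}" "{0}"] by (simp add: F.independent_empty)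
qed

text \<open>A bilinear map out of a line is given by its values at the generator \<open>x\<close>,
  and their coordinates along \<open>z\<close> form the linear form m. Associativity of the
  extension becomes the product rule.\<close>

lemma ext_cocycles_iff:
  assumes x: "x \<noteq> 0" "Car S = span {x}"
      "\<And>y a. y \<in> span {x} \<Longrightarrow> a \<in> Mor C T T \<Longrightarrow> Act S y a = Scal C (char_at i a) y"
    and z: "z \<noteq> 0" "Car R = span {z}"
      "\<And>y a. y \<in> span {z} \<Longrightarrow> a \<in> Mor C T T \<Longrightarrow> Act R y a = Scal C (char_at l a) y"
  shows "\<psi> \<in> ext_cocycles C T S R \<longleftrightarrow> (\<exists>m. skew_derivation i l m \<and> \<psi> = form_cocycle x z m)"
proof -
  let ?F = "form_cocycle x z"
  have xs: "x \<in> span {x}" "z \<in> span {z}" by (simp_all add: span_base)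
  have lc: "\<And>c. line_coord (Scal C) x (Scal C c x) = c" "\<And>c. line_coord (Scal C) z (Scal C c z) = c"
    using x(1) z(1) by simp_all
  show ?thesis
  proof
    assume "\<psi> \<in> ext_cocycles C T S R"
    then have out: "\<And>y a. y \<notin> span {x} \<or> a \<notin> Mor C T T \<Longrightarrow> \<psi> y a = 0"
      and lin1: "\<And>a. a \<in> Mor C T T \<Longrightarrow> linear_on_sub (Scal C) (Scal C) (span {x}) (span {z}) (\<lambda>y. \<psi> y a)"
      and lin2: "\<And>y. y \<in> span {x} \<Longrightarrow> linear_on_sub (Scal C) (Scal C) (Mor C T T) (span {z}) (\<psi> y)"
      and coc: "\<And>y a b. y \<in> span {x} \<Longrightarrow> a \<in> Mor C T T \<Longrightarrow> b \<in> Mor C T T \<Longrightarrow>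
        \<psi> y (Cmp C T T T a b) = Act R (\<psi> y a) b + \<psi> (Act S y a) b"
      unfolding ext_cocycles_def x(2) z(2) by blast+
    define m where "m a = line_coord (Scal C) z (\<psi> x a)" for a
    have \<psi>x: "\<psi> x a = Scal C (m a) z" if "a \<in> Mor C T T" for a
      unfolding m_def using scale_line_coord[OF z(1) linear_on_subD(1)[OF lin2[OF xs(1)] that]] by simp
    have m_eqI: "m a = c" if "\<psi> x a = Scal C c z" for a c
      using that lc by (simp add: m_def)
    have "skew_derivation i l m"
      unfolding skew_derivation_def linear_on_sub_def
    proof (intro conjI ballI allI)
      fix a b assume ab: "a \<in> Mor C T T" "b \<in> Mor C T T"
      show "m (a + b) = m a + m b"
        by (rule m_eqI) (simp add: linear_on_subD(2)[OF lin2[OF xs(1)] ab] \<psi>x ab scale_left_distrib)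
      have "Act R (\<psi> x a) b = Scal C (char_at l b * m a) z"
        using z(3)[OF linear_on_subD(1)[OF lin2[OF xs(1)] ab(1)] ab(2)] \<psi>x[OF ab(1)] by simp
      moreover have "\<psi> (Act S x a) b = Scal C (char_at i a * m b) z"
        using x(3)[OF xs(1) ab(1)] linear_on_subD(3)[OF lin1[OF ab(2)] xs(1)] \<psi>x[OF ab(2)] by simp
      ultimately show "m (Cmp C T T T a b) = char_at l b * m a + char_at i a * m b"
        by (intro m_eqI) (simp add: coc[OF xs(1) ab] scale_left_distrib)
    next
      fix c a assume a: "a \<in> Mor C T T"
      show "m (Scal C c a) = c * m a"
        by (rule m_eqI) (simp add: linear_on_subD(3)[OF lin2[OF xs(1)] a] \<psi>x a)
    qed simp
    moreover have "\<psi> = ?F m"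
    proof (intro ext)
      fix y a
      show "\<psi> y a = ?F m y a"
      proof (cases "y \<in> span {x} \<and> a \<in> Mor C T T")
        case True
        then obtain c where c: "y = Scal C c x" by (auto simp: span_singleton)
        then show ?thesis
          using True linear_on_subD(3)[OF lin1 xs(1), of a c] \<psi>x[of a] form_cocycle_apply[OF x(1), of a z m c] by simp
      next
        case False
        then show ?thesis using out[of y a] by (auto simp: form_cocycle_def)
      qed
    qed
    ultimately show "\<exists>m. skew_derivation i l m \<and> \<psi> = ?F m" by blast
  next
    assume "\<exists>m. skew_derivation i l m \<and> \<psi> = ?F m"
    then obtain m where m: "skew_derivation i l m" and \<psi>: "\<psi> = ?F m" by blast
    note D = skew_derivationD[OF m]
    have app: "\<psi> (Scal C c x) a = Scal C (c * m a) z" if "a \<in> Mor C T T" for c a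
      unfolding \<psi> by (rule form_cocycle_apply[OF x(1) that])
    show "\<psi> \<in> ext_cocycles C T S R"
      unfolding ext_cocycles_def mem_Collect_eq x(2) z(2)
    proof (intro conjI allI impI ballI)
      show "\<psi> y a = 0" if "y \<notin> span {x} \<or> a \<notin> Mor C T T" for y a
        using that unfolding \<psi> by (auto simp: form_cocycle_def)
    next
      fix a assume a: "a \<in> Mor C T T"
      show "linear_on_sub (Scal C) (Scal C) (span {x}) (span {z}) (\<lambda>y. \<psi> y a)"
        unfolding linear_on_sub_def
      proof (intro conjI ballI allI)
        fix y assume y: "y \<in> span {x}"
        then obtain c where c: "y = Scal C c x" by (auto simp: span_singleton)
        show "\<psi> y a \<in> span {z}" unfolding c app[OF a] by (rule span_scale[OF xs(2)])
        show "\<psi> (Scal C d y) a = Scal C d (\<psi> y a)" for d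
          using app[OF a, of "d * c"] app[OF a, of c] by (simp add: c)
        fix y' assume "y' \<in> span {x}"
        then obtain c' where c': "y' = Scal C c' x" by (auto simp: span_singleton)
        show "\<psi> (y + y') a = \<psi> y a + \<psi> y' a"
          using app[OF a, of "c + c'"] app[OF a, of c] app[OF a, of c'] by (simp add: c c' scale_left_distrib distrib_right)
      qed
    next
      fix y assume "y \<in> span {x}"
      then obtain c where c: "y = Scal C c x" by (auto simp: span_singleton)
      show "linear_on_sub (Scal C) (Scal C) (Mor C T T) (span {z}) (\<psi> y)"
        unfolding linear_on_sub_def c
        by (simp add: app span_scale[OF xs(2)] D distrib_left scale_left_distrib mult.left_commute)
      fix a b assume ab: "a \<in> Mor C T T" "b \<in> Mor C T T"
      have "Act R (\<psi> y a) b = Scal C (c * (char_at l b * m a)) z"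
        using z(3)[OF span_scale[OF xs(2)] ab(2), of "c * m a"] by (simp add: c app[OF ab(1)] mult_ac)
      moreover have "\<psi> (Act S y a) b = Scal C (c * (char_at i a * m b)) z"
        using x(3)[OF span_scale[OF xs(1)] ab(1), of c] app[OF ab(2), of "char_at i a * c"] by (simp add: c mult_ac)
      ultimately show "\<psi> y (Cmp C T T T a b) = Act R (\<psi> y a) b + \<psi> (Act S y a) b"
        using ab by (simp add: c app D distrib_left scale_left_distrib)
    qed
  qed
qed

lemma ext_coboundaries_iff:
  assumes x: "x \<noteq> 0" "Car S = span {x}"
      "\<And>y a. y \<in> span {x} \<Longrightarrow> a \<in> Mor C T T \<Longrightarrow> Act S y a = Scal C (char_at i a) y"
    and z: "z \<noteq> 0" "Car R = span {z}"
      "\<And>y a. y \<in> span {z} \<Longrightarrow> a \<in> Mor C T T \<Longrightarrow> Act R y a = Scal C (char_at l a) y"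
  shows "\<psi> \<in> ext_coboundaries C T S R \<longleftrightarrow> (\<exists>t. \<psi> = form_cocycle x z (\<lambda>a. t * (char_at l a - char_at i a)))"
proof -
  let ?F = "form_cocycle x z" and ?\<delta> = "\<lambda>t a. t * (char_at l a - char_at i a)"
  have xs: "x \<in> span {x}" "z \<in> span {z}" by (simp_all add: span_base)
  have lc: "\<And>c. line_coord (Scal C) x (Scal C c x) = c" "\<And>c. line_coord (Scal C) z (Scal C c z) = c"
    using x(1) z(1) by simp_all
  show ?thesis
  proof
    assume "\<psi> \<in> ext_coboundaries C T S R"
    then obtain \<theta> where out: "\<And>y a. y \<notin> span {x} \<or> a \<notin> Mor C T T \<Longrightarrow> \<psi> y a = 0"
      and \<theta>: "linear_on_sub (Scal C) (Scal C) (span {x}) (span {z}) \<theta>"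
      and eq: "\<And>y a. y \<in> span {x} \<Longrightarrow> a \<in> Mor C T T \<Longrightarrow> \<psi> y a = Act R (\<theta> y) a - \<theta> (Act S y a)"
      unfolding ext_coboundaries_def x(2) z(2) by blast
    obtain t where t: "\<theta> x = Scal C t z" using linear_on_subD(1)[OF \<theta> xs(1)] by (auto simp: span_singleton)
    have \<theta>c: "\<theta> (Scal C c x) = Scal C (c * t) z" for c using linear_on_subD(3)[OF \<theta> xs(1)] t by simp
    have "\<psi> y a = ?F (?\<delta> t) y a" for y a
    proof (cases "y \<in> span {x} \<and> a \<in> Mor C T T")
      case True
      then obtain c where c: "y = Scal C c x" and a: "a \<in> Mor C T T" by (auto simp: span_singleton)
      have "\<psi> y a = Scal C (char_at l a * (c * t)) z - Scal C (char_at i a * c * t) z"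
        using eq[of y a] True z(3)[OF span_scale[OF xs(2)] a, of "c * t"] x(3)[of y a]
          \<theta>c[of "char_at i a * c"] \<theta>c[of c] by (simp add: c)
      also have "\<dots> = ?F (?\<delta> t) y a"
        unfolding c form_cocycle_apply[OF x(1) a] by (simp add: algebra_simps)
      finally show ?thesis .
    next
      case False
      then show ?thesis using out[of y a] by (auto simp: form_cocycle_def)
    qed
    then show "\<exists>t. \<psi> = ?F (?\<delta> t)" by blast
  next
    assume "\<exists>t. \<psi> = ?F (?\<delta> t)"
    then obtain t where \<psi>: "\<psi> = ?F (?\<delta> t)" by blast
    let ?\<theta> = "\<lambda>y. Scal C (line_coord (Scal C) x y * t) z"
    have \<theta>c: "?\<theta> (Scal C c x) = Scal C (c * t) z" for c using lc by simp
    have "linear_on_sub (Scal C) (Scal C) (span {x}) (span {z}) ?\<theta>"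
      unfolding linear_on_sub_def
    proof (intro conjI ballI allI)
      fix y assume y: "y \<in> span {x}"
      then obtain c where c: "y = Scal C c x" by (auto simp: span_singleton)
      show "?\<theta> y \<in> span {z}" by (rule span_scale[OF xs(2)])
      show "?\<theta> (Scal C d y) = Scal C d (?\<theta> y)" for d
        by (simp add: c lc mult.assoc)
      fix y' assume "y' \<in> span {x}"
      then obtain c' where c': "y' = Scal C c' x" by (auto simp: span_singleton)
      show "?\<theta> (y + y') = ?\<theta> y + ?\<theta> y'"
        using lc(1)[of "c + c'"] by (simp add: c c' lc scale_left_distrib distrib_right)
    qed
    moreover have "\<psi> y a = Act R (?\<theta> y) a - ?\<theta> (Act S y a)" if y: "y \<in> span {x}" and a: "a \<in> Mor C T T" for y a
    proof -
      obtain c where c: "y = Scal C c x" using y by (auto simp: span_singleton)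
      have "Act S y a = Scal C (char_at i a * c) x" using x(3)[OF y a] c by simp
      then have 1: "?\<theta> (Act S y a) = Scal C (char_at i a * c * t) z" by (simp only: \<theta>c)
      have "?\<theta> y = Scal C (c * t) z" by (simp only: c \<theta>c)
      then have 2: "Act R (?\<theta> y) a = Scal C (char_at l a * (c * t)) z"
        by (simp only: z(3)[OF span_scale[OF xs(2)] a] scale_scale)
      have "\<psi> y a = Scal C (c * ?\<delta> t a) z"
        unfolding \<psi> c by (rule form_cocycle_apply[OF x(1) a])
      also have "c * ?\<delta> t a = char_at l a * (c * t) - char_at i a * c * t" by (simp add: algebra_simps)
      also have "Scal C \<dots> z = Act R (?\<theta> y) a - ?\<theta> (Act S y a)"
        unfolding 1 2 by (rule scale_left_diff_distrib)
      finally show ?thesis .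
    qed
    moreover have "\<psi> y a = 0" if "y \<notin> span {x} \<or> a \<notin> Mor C T T" for y a
      using that unfolding \<psi> by (auto simp: form_cocycle_def)
    ultimately show "\<psi> \<in> ext_coboundaries C T S R"
      unfolding ext_coboundaries_def mem_Collect_eq x(2) z(2) by blast
  qed
qed

text \<open>
  A skew derivation is determined up to multiples of \<open>\<chi>\<^sub>l - \<chi>\<^sub>i\<close>, which are the coboundaries, by its restriction
  to \<open>C(T\<^sub>l, T\<^sub>i)\<close>, and the restrictions are the linear forms that vanish on the square of the radical.
\<close>

lemma dim_ext1_simple_tops:
  assumes il: "i \<in> {1..n}" "l \<in> {1..n}" "i \<noteq> l"
  shows "dim_ext1 C T (simple_top C T (Ts i)) (simple_top C T (Ts l)) = arrows C (add_of C {T}) (Ts l) (Ts i)"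
proof -
  let ?S = "simple_top C T (Ts i)" and ?R = "simple_top C T (Ts l)"
  obtain x where x: "x \<noteq> 0" "Car ?S = span {x}"
    "\<And>y a. y \<in> span {x} \<Longrightarrow> a \<in> Mor C T T \<Longrightarrow> Act ?S y a = Scal C (char_at i a) y"
    using simple_top_char[OF il(1)] by metis
  obtain z where z: "z \<noteq> 0" "Car ?R = span {z}"
    "\<And>y a. y \<in> span {z} \<Longrightarrow> a \<in> Mor C T T \<Longrightarrow> Act ?R y a = Scal C (char_at l a) y"
    using simple_top_char[OF il(2)] by metis
  let ?F = "form_cocycle x z" and ?\<delta> = "\<lambda>t a. t * (char_at l a - char_at i a)"
  have cocycle: "\<psi> \<in> ext_cocycles C T ?S ?R \<longleftrightarrow> (\<exists>m. skew_derivation i l m \<and> \<psi> = ?F m)" for \<psi>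
    by (rule ext_cocycles_iff) (fact x z)+
  have coboundary: "\<psi> \<in> ext_coboundaries C T ?S ?R \<longleftrightarrow> (\<exists>t. \<psi> = ?F (?\<delta> t))" for \<psi>
    by (rule ext_coboundaries_iff) (fact x z)+
  interpret F2: vector_space scale_fun2 by (rule vector_space_fun2)
  let ?Z = "ext_cocycles C T ?S ?R" and ?B = "ext_coboundaries C T ?S ?R"
  have skew_add: "skew_derivation i l (\<lambda>a. m a + m' a)" if "skew_derivation i l m" "skew_derivation i l m'" for m m'
    using that by (simp add: skew_derivation_def linear_on_sub_def algebra_simps)
  have skew_scale: "skew_derivation i l (\<lambda>a. c * m a)" if "skew_derivation i l m" for c m
    using that by (simp add: skew_derivation_def linear_on_sub_def algebra_simps)
  have skew_\<delta>: "skew_derivation i l (?\<delta> t)" for t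
    using il by (simp add: skew_derivation_def linear_on_sub_def char_at_add char_at_Scal char_at_mult algebra_simps)
  have subZ: "F2.subspace ?Z"
  proof (rule F2.subspaceI)
    show "0 \<in> ?Z" unfolding cocycle
      by (rule exI[of _ "\<lambda>_. 0"]) (simp add: form_cocycle_0 skew_derivation_def linear_on_sub_def)
    fix \<phi> \<psi> assume "\<phi> \<in> ?Z" "\<psi> \<in> ?Z"
    then obtain m m' where m: "skew_derivation i l m" "\<phi> = ?F m" "skew_derivation i l m'" "\<psi> = ?F m'"
      unfolding cocycle by blast
    show "\<phi> + \<psi> \<in> ?Z" unfolding cocycle m(2,4) form_cocycle_add[symmetric]
      by (rule exI, rule conjI[OF skew_add[OF m(1,3)] refl])
    show "scale_fun2 c \<phi> \<in> ?Z" for c unfolding cocycle m(2) form_cocycle_scale[symmetric]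
      by (rule exI, rule conjI[OF skew_scale[OF m(1)] refl])
  qed
  have \<delta>_eq: "?F (?\<delta> t) = scale_fun2 t (?F (?\<delta> 1))" for t
    using form_cocycle_scale[of x z t "?\<delta> 1"] by simp
  have B_span: "?B = F2.span {?F (?\<delta> 1)}"
  proof (rule Set.set_eqI)
    fix \<psi>
    show "\<psi> \<in> ?B \<longleftrightarrow> \<psi> \<in> F2.span {?F (?\<delta> 1)}"
      unfolding coboundary F2.span_singleton image_iff bex_UNIV \<delta>_eq[symmetric] ..
  qed
  have subB: "F2.subspace ?B" unfolding B_span by (rule F2.subspace_span)
  have finB: "finite_dim_sub scale_fun2 ?B"
    unfolding B_span finite_dim_sub_def by (rule exI, rule conjI[OF _ subset_refl]) simp
  have BZ: "?B \<subseteq> ?Z"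
  proof
    fix \<psi> assume "\<psi> \<in> ?B"
    then obtain t where "\<psi> = ?F (?\<delta> t)" unfolding coboundary by blast
    with skew_\<delta> show "\<psi> \<in> ?Z" unfolding cocycle by blast
  qed
  let ?W = "rad C (Ts l) (Ts i)" and ?K = "rad2 C (add_of C {T}) (Ts l) (Ts i)"
  have W: "?W = Mor C (Ts l) (Ts i)" using rad_Ts il by metis
  have K: "subspace ?K" "?K \<subseteq> ?W" unfolding rad2_eq_span[of "Ts l" "Ts i"]
    using rad2_subset[of "add_of C {T}" "Ts l" "Ts i"] by (simp_all add: rad2_eq_span)
  obtain S where S: "basis_mod (Scal C) ?K ?W S (\<lambda>v. v)" and dimW: "dim ?W = dim ?K + card S"
    using basis_mod_exists[OF K rad_subspace rad_finite_dim] by metis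
  obtain k where k: "\<And>s. s \<in> S \<Longrightarrow> linear_on_sub (Scal C) (*) ?W UNIV (k s)"
    "\<And>s v. s \<in> S \<Longrightarrow> v \<in> ?K \<Longrightarrow> k s v = 0"
    "\<And>s t. s \<in> S \<Longrightarrow> t \<in> S \<Longrightarrow> k s t = (if s = t then 1 else 0)"
    "\<And>v. v \<in> ?W \<Longrightarrow> v - (\<Sum>s\<in>S. Scal C (k s v) s) \<in> ?K"
    by (rule basis_mod_coords[OF K(1) rad_subspace K(2) S], rule that)
  have SW: "finite S" "S \<subseteq> ?W" using S by (auto simp: basis_mod_def)
  let ?h = "\<lambda>a. Cmp C (Ts l) T (Ts i) (\<pi> i) (Cmp C (Ts l) T T a (\<iota> l))"
  let ?j = "\<lambda>v. Cmp C T (Ts i) T (\<iota> i) (Cmp C T (Ts l) (Ts i) v (\<pi> l))"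
  let ?m = "\<lambda>s a. k s (?h a)"
  have skew_m: "skew_derivation i l (?m s)" if "s \<in> S" for s
    by (rule skew_derivationI[OF il k(1)[OF that, unfolded W] k(2)[OF that]])
  have j_in: "?j v \<in> Mor C T T" if "v \<in> ?W" for v using that il W by simp
  have hj: "?h (?j v) = v" if v: "v \<in> ?W" for v
  proof -
    have "Cmp C (Ts l) T T (?j v) (\<iota> l) = Cmp C (Ts l) (Ts i) T (\<iota> i) v"
      using v il W by (simp add: Cmp_assoc proj_incl)
    then show ?thesis using v il W by (simp add: proj_incl flip: Cmp_assoc)
  qed
  have \<delta>j: "?\<delta> t (?j v) = 0" if v: "v \<in> ?W" for t v
  proof -
    have "char_at i (?j v) = 0"
      by (rule char_at_rad[OF il(1) j_in[OF v]], rule rad_Cmp_left, rule rad_Cmp_left, rule rad_Cmp_right[OF v])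
        (use il in simp_all)
    moreover have "char_at l (?j v) = 0"
      by (rule char_at_rad[OF il(2) j_in[OF v]], rule rad_Cmp_left, rule rad_Cmp_left, rule rad_Cmp_right[OF v])
        (use il in simp_all)
    ultimately show ?thesis by simp
  qed
  \<comment> \<open>The forms dual to a basis of the radical modulo its square, extended from the
    corner to End(T), are a basis of the cocycles modulo the coboundaries.\<close>
  have "basis_mod scale_fun2 ?B ?Z S (\<lambda>s. ?F (?m s))"
    unfolding basis_mod_def
  proof (intro conjI allI impI ballI)
    show "finite S" by (rule SW)
    show "(\<lambda>s. ?F (?m s)) ` S \<subseteq> ?Z"
    proof (rule image_subsetI)
      fix s assume "s \<in> S"
      show "?F (?m s) \<in> ?Z" unfolding cocycle by (rule exI, rule conjI[OF skew_m[OF \<open>s \<in> S\<close>] refl])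
    qed
  next
    fix c s assume "(\<Sum>s\<in>S. scale_fun2 (c s) (?F (?m s))) \<in> ?B" and s: "s \<in> S"
    then obtain t where t: "?F (\<lambda>a. \<Sum>s\<in>S. c s * ?m s a) = ?F (?\<delta> t)"
      unfolding coboundary form_cocycle_sum by blast
    have sW: "s \<in> ?W" using s SW by blast
    have "(\<Sum>s'\<in>S. c s' * k s' s) = 0"
      using form_cocycle_inj[OF x(1) z(1) t j_in[OF sW]] hj[OF sW] \<delta>j[OF sW] by simp
    moreover have "(\<Sum>s'\<in>S. c s' * k s' s) = (\<Sum>s'\<in>S. if s' = s then c s' else 0)"
      by (rule sum.cong[OF refl]) (use k(3) s in simp)
    ultimately show "c s = 0" using s SW(1) by simp
  next
    fix \<psi> assume "\<psi> \<in> ?Z"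
    then obtain m where m: "skew_derivation i l m" and \<psi>: "\<psi> = ?F m" unfolding cocycle by blast
    note D = skew_derivationD[OF m]
    have msum: "m (\<Sum>s\<in>A. f s) = (\<Sum>s\<in>A. m (f s))" if "\<And>s. s \<in> A \<Longrightarrow> f s \<in> Mor C T T" for f and A :: "'v set"
    proof -
      have "m 0 = 0" using D(2)[OF Mor_closed(1), of 0] by simp
      then show ?thesis using that by (induction A rule: infinite_finite_induct) (simp_all add: D(1))
    qed
    \<comment> \<open>The coefficients are the values of m on the chosen arrows; \<open>?t\<close>
      is the inner part according to \<open>skew_derivation_eq\<close>.\<close>
    let ?c = "\<lambda>s. m (?j s)" and ?t = "- m (vertex_idem i)"
    have "m b = (\<Sum>s\<in>S. ?c s * ?m s b) + ?\<delta> ?t b" if b: "b \<in> Mor C T T" for b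
    proof -
      let ?v = "?h b" let ?w = "?v - (\<Sum>s\<in>S. Scal C (k s ?v) s)"
      have v: "?v \<in> ?W" using il b W by simp
      have sM: "s \<in> Mor C (Ts l) (Ts i)" if "s \<in> S" for s using that SW(2) W by blast
      have wM: "?w \<in> Mor C (Ts l) (Ts i)"
        by (rule Mor_closed(3), use v W in simp, rule Mor_sum, rule Mor_closed(5), rule sM)
      have sumM: "(\<Sum>s\<in>S. Scal C (k s ?v) s) \<in> Mor C (Ts l) (Ts i)"
        by (rule Mor_sum, rule Mor_closed(5), rule sM)
      have "?j (\<Sum>s\<in>S. Scal C (k s ?v) s) = Cmp C T (Ts i) T (\<iota> i) (\<Sum>s\<in>S. Cmp C T (Ts l) (Ts i) (Scal C (k s ?v) s) (\<pi> l))"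
        by (subst Cmp_sum_left) (use il sM in simp_all)
      also have "\<dots> = (\<Sum>s\<in>S. Cmp C T (Ts i) T (\<iota> i) (Cmp C T (Ts l) (Ts i) (Scal C (k s ?v) s) (\<pi> l)))"
        by (rule Cmp_sum_right) (use il sM in simp_all)
      also have "\<dots> = (\<Sum>s\<in>S. Scal C (k s ?v) (?j s))"
        by (rule sum.cong[OF refl]) (use il sM in simp)
      finally have js: "?j (\<Sum>s\<in>S. Scal C (k s ?v) s) = (\<Sum>s\<in>S. Scal C (k s ?v) (?j s))" .
      have "?j ?v = ?j (?w + (\<Sum>s\<in>S. Scal C (k s ?v) s))" by simp
      also have "\<dots> = ?j ?w + ?j (\<Sum>s\<in>S. Scal C (k s ?v) s)"
        using wM sumM il by (simp only: Cmp_add Cmp_in incl_proj_in)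
      finally have jv: "?j ?v = ?j ?w + (\<Sum>s\<in>S. Scal C (k s ?v) (?j s))" by (simp only: js)
      have jM: "?j s \<in> Mor C T T" if "s \<in> S" for s using j_in that SW by blast
      have "m (?j ?v) = m (?j ?w) + m (\<Sum>s\<in>S. Scal C (k s ?v) (?j s))"
        unfolding jv by (rule D(1)) (use wM il in simp, rule Mor_sum, rule Mor_closed(5), rule jM)
      also have "m (?j ?w) = 0" by (rule skew_derivation_rad2[OF m il(1,2) k(4)[OF v]])
      also have "m (\<Sum>s\<in>S. Scal C (k s ?v) (?j s)) = (\<Sum>s\<in>S. ?c s * ?m s b)"
        by (subst msum, use jM in simp, rule sum.cong[OF refl]) (use D(2) jM in simp)
      finally have 1: "m (?j ?v) = (\<Sum>s\<in>S. ?c s * ?m s b)" by simp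
      have "?j ?v = Cmp C T T T (vertex_idem i) (Cmp C T T T b (vertex_idem l))"
        using il b by (simp add: vertex_idem_def Cmp_assoc)
      then show ?thesis using skew_derivation_eq[OF m il b] 1 by (simp add: algebra_simps)
    qed
    then have "\<psi> = ?F (\<lambda>a. (\<Sum>s\<in>S. ?c s * ?m s a) + ?\<delta> ?t a)"
      unfolding \<psi> by (rule form_cocycle_cong)
    then have "\<psi> - (\<Sum>s\<in>S. scale_fun2 (?c s) (?F (?m s))) = ?F (?\<delta> ?t)"
      unfolding form_cocycle_add form_cocycle_sum by simp
    then have "\<psi> - (\<Sum>s\<in>S. scale_fun2 (?c s) (?F (?m s))) \<in> ?B"
      by (rule iffD2[OF coboundary exI[of _ ?t]])
    then show "\<exists>c. \<psi> - (\<Sum>s\<in>S. scale_fun2 (c s) (?F (?m s))) \<in> ?B"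
      by (rule exI[of _ ?c])
  qed
  from F2.dim_basis_mod(1)[OF subB finB subZ BZ this]
  show ?thesis unfolding dim_ext1_def arrows_def vdim_def using dimW by simp
qed

text \<open>Hom vanishes in both directions, so only Ext dimensions remain: arrows from
  \<open>l\<close> to \<open>i\<close> count with sign -1 and arrows from \<open>i\<close> to
  \<open>l\<close> with sign +1.\<close>

lemma mod_form_a_simple_tops:
  assumes il: "i \<in> {1..n}" "l \<in> {1..n}" "i \<noteq> l"
  shows "mod_form_a C T (simple_top C T (Ts i)) (simple_top C T (Ts l))
    = quiver_matrix (arrows C (add_of C {T})) (Ts i) (Ts l)"
  using dim_hom_simple_tops[OF il] dim_hom_simple_tops[OF il(2,1) il(3)[symmetric]]
    dim_ext1_simple_tops[OF il] dim_ext1_simple_tops[OF il(2,1) il(3)[symmetric]]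
  by (simp add: mod_form_a_def mod_form_def quiver_matrix_def)

section \<open>Composition series and dimension vectors\<close>

abbreviation component :: "'v set \<Rightarrow> ('v \<Rightarrow> 'v \<Rightarrow> 'v) \<Rightarrow> nat \<Rightarrow> 'v set" where
  "component N act j \<equiv> (\<lambda>x. act x (vertex_idem j)) ` N"

lemma component_subspace:
  assumes N: "rmodule N act" and j: "j \<in> {1..n}"
  shows "subspace (component N act j)" "component N act j \<subseteq> N"
proof -
  note D = rmoduleD[OF N]
  have e: "vertex_idem j \<in> Mor C T T" using j by simp
  have lin: "linear_on_sub (Scal C) (Scal C) N N (\<lambda>x. act x (vertex_idem j))"
    using D(2-4) e by (simp add: linear_on_sub_def)
  show "component N act j \<subseteq> N" using D(2) e by blast
  show "subspace (component N act j)"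
  proof (rule subspaceI)
    have "act (Scal C 0 0) (vertex_idem j) = Scal C 0 (act 0 (vertex_idem j))"
      by (rule D(4)[OF subspace_0[OF D(1)] e])
    then show "0 \<in> component N act j" using subspace_0[OF D(1)] by force
  next
    fix x y assume "x \<in> component N act j" "y \<in> component N act j"
    then obtain v w where v: "v \<in> N" "x = act v (vertex_idem j)" and w: "w \<in> N" "y = act w (vertex_idem j)" by blast
    have "x + y = act (v + w) (vertex_idem j)" using D(3)[OF v(1) w(1) e] v w by simp
    then show "x + y \<in> component N act j" using subspace_add[OF D(1) v(1) w(1)] by blast
  next
    fix c x assume "x \<in> component N act j"
    then obtain v where v: "v \<in> N" "x = act v (vertex_idem j)" by blast
    have "Scal C c x = act (Scal C c v) (vertex_idem j)" using D(4)[OF v(1) e] v by simp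
    then show "Scal C c x \<in> component N act j" using subspace_scale[OF D(1) v(1)] by blast
  qed
qed

text \<open>A preimage of the generator, made homogeneous by \<open>vertex_idem i\<close>, spans a
  complement of \<open>K\<close> which the other vertex idempotents kill. So passing from
  \<open>K\<close> to \<open>N\<close> changes only the component at \<open>i\<close>, by one
  dimension.\<close>

lemma simple_quotient_dims:
  assumes N: "rmodule N act" and i: "i \<in> {1..n}"
    and \<phi>: "rmod_map C T \<lparr>Car = N, Act = act\<rparr> (simple_top C T (Ts i)) \<phi>"
    and onto: "\<phi> ` N = Car (simple_top C T (Ts i))" and K: "K = {x \<in> N. \<phi> x = 0}"
    and fin: "finite_dim_sub (Scal C) K"
  shows "submod N act K" "finite_dim_sub (Scal C) N" "dim N = Suc (dim K)"
    "\<And>j. j \<in> {1..n} \<Longrightarrow> dim (component N act j) = dim (component K act j) + (if j = i then 1 else 0)"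
proof -
  let ?S = "simple_top C T (Ts i)"
  obtain s where s: "s \<noteq> 0" "Car ?S = span {s}"
    "\<And>y a. y \<in> span {s} \<Longrightarrow> a \<in> Mor C T T \<Longrightarrow> Act ?S y a = Scal C (char_at i a) y"
    using simple_top_char[OF i] by metis
  note D = rmoduleD[OF N]
  have lin: "linear_on_sub (Scal C) (Scal C) N (span {s}) \<phi>"
    and \<phi>act: "\<And>x a. x \<in> N \<Longrightarrow> a \<in> Mor C T T \<Longrightarrow> \<phi> (act x a) = Scal C (char_at i a) (\<phi> x)"
    using \<phi> s(2,3) by (auto simp: rmod_map_def linear_on_sub_def)
  note L = linear_on_subD[OF lin]
  have \<phi>0: "\<phi> 0 = 0" using L(3)[OF subspace_0[OF D(1)], of 0] by simp
  have sK: "subspace K"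
    unfolding K
  proof (rule subspaceI)
    show "0 \<in> {x \<in> N. \<phi> x = 0}" using \<phi>0 subspace_0[OF D(1)] by simp
    show "x + y \<in> {x \<in> N. \<phi> x = 0}" if "x \<in> {x \<in> N. \<phi> x = 0}" "y \<in> {x \<in> N. \<phi> x = 0}" for x y
      using that L(2)[of x y] subspace_add[OF D(1), of x y] by simp
    show "Scal C c x \<in> {x \<in> N. \<phi> x = 0}" if "x \<in> {x \<in> N. \<phi> x = 0}" for c x
      using that L(3)[of x c] subspace_scale[OF D(1), of x c] by simp
  qed
  have KN: "K \<subseteq> N" using K by blast
  show subK: "submod N act K"
    unfolding submod_def using sK KN \<phi>act D(2) by (auto simp: K)
  note DK = rmoduleD[OF submod_rmodule[OF N subK]]
  have ei: "vertex_idem i \<in> Mor C T T" using i by simp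
  have "s \<in> \<phi> ` N" using onto s(2) by (simp add: span_base)
  then obtain y where y: "y \<in> N" "\<phi> y = s" by blast
  define x where "x = act y (vertex_idem i)"
  have x: "x \<in> N" "\<phi> x = s" "act x (vertex_idem i) = x"
    using y D(2)[OF y(1) ei] \<phi>act[OF y(1) ei] D(8)[OF y(1) ei ei] i
    by (simp_all add: x_def char_at_vertex_idem vertex_idem_mult)
  have \<phi>x: "\<phi> (Scal C c x) = Scal C c s" for c using L(3)[OF x(1)] x(2) by simp
  have gen: "\<exists>c. v - Scal C c x \<in> K" if v: "v \<in> N" for v
  proof -
    obtain c where c: "\<phi> v = Scal C c s" using L(1)[OF v] by (auto simp: span_singleton)
    have cx: "Scal C (- c) x \<in> N" using x(1) D(1) by (rule subspace_scale[rotated])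
    have "\<phi> (v + Scal C (- c) x) = 0" using L(2)[OF v cx] c \<phi>x[of "- c"] by simp
    moreover have "v + Scal C (- c) x \<in> N" using subspace_add[OF D(1) v cx] .
    ultimately have "v - Scal C c x \<in> K" by (simp add: K)
    then show ?thesis by blast
  qed
  have ind: "c = 0" if "Scal C c x \<in> K" for c
    using that \<phi>x[of c] s(1) by (simp add: K)
  have b: "basis_mod (Scal C) K N {()} (\<lambda>_. x)"
    unfolding basis_mod_def using x(1) gen ind by (auto intro: exI[of _ "\<lambda>_. _"])
  from dim_basis_mod[OF sK fin D(1) KN b]
  show finN: "finite_dim_sub (Scal C) N" and "dim N = Suc (dim K)" by simp_all
  fix j assume j: "j \<in> {1..n}"
  then have ej: "vertex_idem j \<in> Mor C T T" by simp
  have compN: "act v (vertex_idem j) = act (v - Scal C c x) (vertex_idem j) + (if j = i then Scal C c x else 0)"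
    if v: "v \<in> N" for v c
  proof -
    have cx: "Scal C c x \<in> N" using x(1) D(1) by (rule subspace_scale[rotated])
    have "act x (vertex_idem j) = act (act x (vertex_idem i)) (vertex_idem j)" by (simp only: x(3))
    also have "\<dots> = act x (if i = j then vertex_idem i else 0)"
      using D(8)[OF x(1) ei ej] i j by (simp add: vertex_idem_mult)
    also have "\<dots> = (if i = j then x else 0)"
      using x(3) D(6)[OF x(1) Mor_closed(1), of 0] by (cases "i = j") simp_all
    finally have "act (Scal C c x) (vertex_idem j) = (if j = i then Scal C c x else 0)"
      using D(4)[OF x(1) ej, of c] by auto
    then show ?thesis using rmodule_diff(1)[OF N v cx ej] by simp
  qed
  show "dim (component N act j) = dim (component K act j) + (if j = i then 1 else 0)"
  proof (cases "j = i")
    case False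
    have "component N act j = component K act j"
    proof
      show "component K act j \<subseteq> component N act j" using KN by blast
      show "component N act j \<subseteq> component K act j"
      proof
        fix z assume "z \<in> component N act j"
        then obtain v where v: "v \<in> N" "z = act v (vertex_idem j)" by blast
        obtain c where c: "v - Scal C c x \<in> K" using gen[OF v(1)] by blast
        have "z = act (v - Scal C c x) (vertex_idem j)" using compN[OF v(1), of c] v(2) False by simp
        then show "z \<in> component K act j" using c by blast
      qed
    qed
    then show ?thesis using False by simp
  next
    case True
    note cN = component_subspace[OF N j] and cK = component_subspace[OF submod_rmodule[OF N subK] j]
    have "basis_mod (Scal C) (component K act j) (component N act j) {()} (\<lambda>_. x)"
      unfolding basis_mod_def
    proof (intro conjI allI impI ballI)
      show "finite {()}" by simp
      show "(\<lambda>_. x) ` {()} \<subseteq> component N act j" using x True by force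
    next
      fix c u assume "(\<Sum>u\<in>{()}. Scal C (c u) x) \<in> component K act j"
      then have "Scal C (c ()) x \<in> K" using cK(2) by auto
      then show "c u = 0" using ind by simp
    next
      fix z assume "z \<in> component N act j"
      then obtain v where v: "v \<in> N" "z = act v (vertex_idem j)" by blast
      obtain c where c: "v - Scal C c x \<in> K" using gen[OF v(1)] by blast
      have "z - (\<Sum>u\<in>{()}. Scal C ((\<lambda>_. c) u) x) = act (v - Scal C c x) (vertex_idem j)"
        using compN[OF v(1), of c] v(2) True by simp
      also have "\<dots> \<in> component K act j" using c by blast
      finally show "\<exists>c. z - (\<Sum>u\<in>{()}. Scal C (c u) x) \<in> component K act j" by (rule exI[of _ "\<lambda>_. c"])
    qed
    moreover have "component K act j \<subseteq> component N act j" using KN by blast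
    ultimately have "dim (component N act j) = dim (component K act j) + card {()}"
      using finite_dim_sub_mono[OF fin cK(2)] by (intro dim_basis_mod(1)[OF cK(1) _ cN(1)])
    then show ?thesis using True by simp
  qed
qed

text \<open>Each step of a composition series adds one dimension at one vertex, so the class is the
  dimension vector, whichever series is used.\<close>

lemma mod_class_dims:
  assumes "mod_class C T Ts n act N e" "rmodule N act"
  shows "finite_dim_sub (Scal C) N \<and> dim N = (\<Sum>i\<in>{1..n}. e i) \<and>
    (\<forall>j\<in>{1..n}. dim (component N act j) = e j) \<and> (\<forall>j. j \<notin> {1..n} \<longrightarrow> e j = 0)"
  using assms
proof (induction rule: mod_class.induct)
  case zero
  have d0: "dim {0} = 0" using basis_card_eq_dim[of "{}" "{0}"] by (simp add: independent_empty)
  have "act 0 a = 0" if "a \<in> Mor C T T" for a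
    using rmoduleD(4)[OF zero _ that, of 0 0] by simp
  then have "component {0} act j = {0}" if "j \<in> {1..n}" for j using that by simp
  moreover have "finite_dim_sub (Scal C) {0}"
    unfolding finite_dim_sub_def by (rule exI[of _ "{}"]) simp
  ultimately show ?case using d0 by simp
next
  case (step N' e N i \<phi>)
  have N': "N' = {x \<in> N. \<phi> x = 0}" using step.hyps(6) by simp
  have "submod N act N'"
    unfolding submod_def
  proof (intro conjI ballI)
    have lin: "linear_on_sub (Scal C) (Scal C) N (Car (simple_top C T (Ts i))) \<phi>"
      and \<phi>act: "\<And>x a. x \<in> N \<Longrightarrow> a \<in> Mor C T T \<Longrightarrow> \<phi> (act x a) = Act (simple_top C T (Ts i)) (\<phi> x) a"
      using step.hyps(4) by (auto simp: rmod_map_def)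
    note D = rmoduleD[OF step.prems]
    obtain s where s: "Car (simple_top C T (Ts i)) = span {s}"
      "\<And>y a. y \<in> span {s} \<Longrightarrow> a \<in> Mor C T T \<Longrightarrow> Act (simple_top C T (Ts i)) y a = Scal C (char_at i a) y"
      using simple_top_char[OF step.hyps(3)] by metis
    show "N' \<subseteq> N" using N' by blast
    show "subspace N'"
      unfolding N'
    proof (rule subspaceI)
      show "0 \<in> {x \<in> N. \<phi> x = 0}"
        using linear_on_subD(3)[OF lin subspace_0[OF D(1)], of 0] subspace_0[OF D(1)] by simp
      show "x + y \<in> {x \<in> N. \<phi> x = 0}" if "x \<in> {x \<in> N. \<phi> x = 0}" "y \<in> {x \<in> N. \<phi> x = 0}" for x y
        using that linear_on_subD(2)[OF lin, of x y] subspace_add[OF D(1), of x y] by simp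
      show "Scal C c x \<in> {x \<in> N. \<phi> x = 0}" if "x \<in> {x \<in> N. \<phi> x = 0}" for c x
        using that linear_on_subD(3)[OF lin, of x c] subspace_scale[OF D(1), of x c] by simp
    qed
    fix x a assume "x \<in> N'" and a: "a \<in> Mor C T T"
    then have x: "x \<in> N" "\<phi> x = 0" using N' by auto
    then show "act x a \<in> N'"
      using \<phi>act[OF x(1) a] s(2)[OF span_zero a] D(2)[OF x(1) a] by (simp add: N')
  qed
  then have IH: "finite_dim_sub (Scal C) N'" "dim N' = (\<Sum>i\<in>{1..n}. e i)"
    "\<And>j. j \<in> {1..n} \<Longrightarrow> dim (component N' act j) = e j" "\<And>j. j \<notin> {1..n} \<Longrightarrow> e j = 0"
    using step.IH[OF submod_rmodule[OF step.prems]] by auto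
  note Q = simple_quotient_dims[OF step.prems step.hyps(3-5) N' IH(1)]
  have "(\<Sum>j\<in>{1..n}. (e(i := Suc (e i))) j) = Suc (\<Sum>j\<in>{1..n}. e j)"
    using step.hyps(3) by (simp add: sum.remove[of _ i])
  then show ?case using Q(2-4) IH step.hyps(3) by auto
qed

text \<open>Induction on the dimension: a maximal submodule has a one-dimensional quotient with the
  character of some vertex, and the coordinate along it maps \<open>N\<close> onto the simple module
  there.\<close>

lemma mod_class_exists:
  assumes "rmodule N act" "finite_dim_sub (Scal C) N"
  shows "\<exists>e. mod_class C T Ts n act N e"
  using assms
proof (induction "dim N" arbitrary: N rule: less_induct)
  case less
  note D = rmoduleD[OF less.prems(1)]
  show ?case
  proof (cases "N = {0}")
    case True
    then show ?thesis using mod_class.zero by metis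
  next
    case False
    have "submod N act {0}"
      unfolding submod_def
    proof (intro conjI ballI)
      show "{0} \<subseteq> N" using subspace_0[OF D(1)] by simp
      fix x a assume "x \<in> {0::'v}" "a \<in> Mor C T T"
      then show "act x a \<in> {0}" using D(4)[OF subspace_0[OF D(1)], of a 0] by simp
    qed (rule subspace_single_0)
    then obtain N' i x where N': "submod N act N'" and i: "i \<in> {1..n}" and x: "x \<in> N" "x \<notin> N'"
      and gen: "\<And>y. y \<in> N \<Longrightarrow> \<exists>c. y - Scal C c x \<in> N'"
      and char: "\<And>a. a \<in> Mor C T T \<Longrightarrow> act x a - Scal C (char_at i a) x \<in> N'"
      using maximal_submod[OF less.prems, of "{0}"] False by metis
    have sN': "subspace N'" "N' \<subseteq> N" and N'act: "\<And>y a. y \<in> N' \<Longrightarrow> a \<in> Mor C T T \<Longrightarrow> act y a \<in> N'"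
      using N' by (auto simp: submod_def)
    have ind: "c = 0" if "Scal C c x \<in> N'" for c
    proof (rule ccontr)
      assume "c \<noteq> 0"
      then have "Scal C (inverse c) (Scal C c x) = x" by simp
      then show False using subspace_scale[OF sN'(1) that, of "inverse c"] x(2) by simp
    qed
    have b: "basis_mod (Scal C) N' N {()} (\<lambda>_. x)"
      unfolding basis_mod_def using x(1) gen ind by (auto intro: exI[of _ "\<lambda>_. _"])
    obtain k where lin: "linear_on_sub (Scal C) (*) N UNIV k" and k0: "\<And>v. v \<in> N' \<Longrightarrow> k v = 0"
      and kx: "k x = 1" and kgen: "\<And>v. v \<in> N \<Longrightarrow> v - Scal C (k v) x \<in> N'"
    proof (rule basis_mod_coords[OF sN'(1) D(1) sN'(2) b])
      fix l :: "unit \<Rightarrow> 'v \<Rightarrow> 'k"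
      assume *: "\<And>i. i \<in> {()} \<Longrightarrow> linear_on_sub (Scal C) (*) N UNIV (l i)"
        "\<And>i v. i \<in> {()} \<Longrightarrow> v \<in> N' \<Longrightarrow> l i v = 0"
        "\<And>i j. i \<in> {()} \<Longrightarrow> j \<in> {()} \<Longrightarrow> l i x = (if i = j then 1 else 0)"
        "\<And>v. v \<in> N \<Longrightarrow> v - (\<Sum>i\<in>{()}. Scal C (l i v) x) \<in> N'"
      show thesis by (rule that[of "l ()"]) (use * in simp_all)
    qed
    note L = linear_on_subD[OF lin]
    obtain s where s: "s \<noteq> 0" "Car (simple_top C T (Ts i)) = span {s}"
      "\<And>y a. y \<in> span {s} \<Longrightarrow> a \<in> Mor C T T \<Longrightarrow> Act (simple_top C T (Ts i)) y a = Scal C (char_at i a) y"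
      using simple_top_char[OF i] by metis
    let ?\<phi> = "\<lambda>y. Scal C (k y) s"
    have ss: "s \<in> span {s}" by (simp add: span_base)
    have kact: "k (act y a) = char_at i a * k y" if y: "y \<in> N" and a: "a \<in> Mor C T T" for y a
    proof -
      have cx: "Scal C (k y) x \<in> N" using x(1) by (rule subspace_scale[OF D(1)])
      have "act (y - Scal C (k y) x) a \<in> N'" using N'act[OF kgen[OF y] a] .
      moreover have "Scal C (k y) (act x a - Scal C (char_at i a) x) \<in> N'"
        by (rule subspace_scale[OF sN'(1) char[OF a]])
      ultimately have "act (y - Scal C (k y) x) a + Scal C (k y) (act x a - Scal C (char_at i a) x) \<in> N'"
        by (rule subspace_add[OF sN'(1)])
      moreover have "act (y - Scal C (k y) x) a + Scal C (k y) (act x a - Scal C (char_at i a) x)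
          = act y a + Scal C (- (k y * char_at i a)) x"
        using rmodule_diff(1)[OF less.prems(1) y cx a] D(4)[OF x(1) a, of "k y"] by (simp add: scale_right_diff_distrib)
      ultimately have "k (act y a + Scal C (- (k y * char_at i a)) x) = 0" using k0 by simp
      moreover have "k (act y a + Scal C (- (k y * char_at i a)) x) = k (act y a) - k y * char_at i a"
        using L(2)[OF D(2)[OF y a] subspace_scale[OF D(1) x(1)], of "- (k y * char_at i a)"]
          L(3)[OF x(1), of "- (k y * char_at i a)"] kx by simp
      ultimately show ?thesis by (simp add: mult.commute)
    qed
    have \<phi>: "rmod_map C T \<lparr>Car = N, Act = act\<rparr> (simple_top C T (Ts i)) ?\<phi>"
      unfolding rmod_map_def linear_on_sub_def rmod.simps s(2)
    proof (intro conjI ballI allI)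
      fix y assume y: "y \<in> N"
      show "?\<phi> y \<in> span {s}" by (rule span_scale[OF ss])
      show "?\<phi> (y + z) = ?\<phi> y + ?\<phi> z" if "z \<in> N" for z using L(2)[OF y that] by (simp add: scale_left_distrib)
      show "?\<phi> (Scal C c y) = Scal C c (?\<phi> y)" for c using L(3)[OF y] by simp
      show "?\<phi> (act y a) = Act (simple_top C T (Ts i)) (?\<phi> y) a" if "a \<in> Mor C T T" for a
        using kact[OF y that] s(3)[OF span_scale[OF ss] that] by simp
    qed
    have onto: "?\<phi> ` N = Car (simple_top C T (Ts i))"
    proof
      show "?\<phi> ` N \<subseteq> Car (simple_top C T (Ts i))" unfolding s(2) using span_scale[OF ss] by blast
      show "Car (simple_top C T (Ts i)) \<subseteq> ?\<phi> ` N"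
      proof
        fix y assume "y \<in> Car (simple_top C T (Ts i))"
        then obtain c where "y = Scal C c s" unfolding s(2) by (auto simp: span_singleton)
        then have "y = ?\<phi> (Scal C c x)" using L(3)[OF x(1), of c] kx by simp
        then show "y \<in> ?\<phi> ` N" using subspace_scale[OF D(1) x(1)] by blast
      qed
    qed
    have ker: "{y \<in> N. ?\<phi> y = 0} = N'"
    proof
      show "{y \<in> N. ?\<phi> y = 0} \<subseteq> N'"
      proof
        fix y assume "y \<in> {y \<in> N. ?\<phi> y = 0}"
        then have "y \<in> N" "k y = 0" using s(1) by auto
        then show "y \<in> N'" using kgen[of y] by simp
      qed
      show "N' \<subseteq> {y \<in> N. ?\<phi> y = 0}" using k0 sN'(2) by auto
    qed
    have finN': "finite_dim_sub (Scal C) N'" by (rule finite_dim_sub_mono[OF less.prems(2) sN'(2)])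
    have "dim N' < dim N" using dim_basis_mod(1)[OF sN'(1) finN' D(1) sN'(2) b] by simp
    then obtain e where "mod_class C T Ts n act N' e"
      using less.hyps submod_rmodule[OF less.prems(1) N'] finN' by blast
    from mod_class.step[OF this less.prems(1) i \<phi> onto ker] show ?thesis by blast
  qed
qed

lemma dim_simple_top:
  assumes "i \<in> {1..n}"
  shows "vdim C (Car (simple_top C T (Ts i))) = 1"
proof -
  obtain s where "s \<noteq> 0" "Car (simple_top C T (Ts i)) = span {s}"
    using simple_top_char[OF assms] by metis
  then show ?thesis
    unfolding vdim_def using dim_eq_card_independent[of "{s}"] by (simp add: dependent_single)
qed

section \<open>The top-degree term of the F-polynomial\<close>

lemma quiver_grass_iff:
  "N \<in> quiver_grass C T Ts n (hom_module C T X) e \<longleftrightarrow>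
     submod (Mor C T X) (Cmp C T T X) N \<and> mod_class C T Ts n (Cmp C T T X) N e"
  by (simp add: quiver_grass_def submodule_def submod_def hom_module_def)

lemma dim_vector_eq:
  "dim_vector C T Ts \<iota> \<pi> (hom_module C T X) i = dim (component (Mor C T X) (Cmp C T T X) i)"
  by (simp add: dim_vector_def hom_module_def vdim_def vertex_idem_def)

lemma quiver_grass_bound:
  assumes N: "N \<in> quiver_grass C T Ts n (hom_module C T X) e"
  shows "i \<in> {1..n} \<Longrightarrow> e i \<le> dim_vector C T Ts \<iota> \<pi> (hom_module C T X) i" "i \<notin> {1..n} \<Longrightarrow> e i = 0"
    "dim N = (\<Sum>i\<in>{1..n}. e i)"
proof -
  have sub: "submod (Mor C T X) (Cmp C T T X) N" and cl: "mod_class C T Ts n (Cmp C T T X) N e"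
    using N by (simp_all add: quiver_grass_iff)
  have rN: "rmodule N (Cmp C T T X)" by (rule submod_rmodule[OF rmodule_Mor sub])
  note D = mod_class_dims[OF cl rN]
  show "i \<notin> {1..n} \<Longrightarrow> e i = 0" "dim N = (\<Sum>i\<in>{1..n}. e i)" using D by simp_all
  assume i: "i \<in> {1..n}"
  have "component N (Cmp C T T X) i \<subseteq> component (Mor C T X) (Cmp C T T X) i"
    using sub by (auto simp: submod_def)
  moreover have "finite_dim_sub (Scal C) (component (Mor C T X) (Cmp C T T X) i)"
    by (rule finite_dim_sub_mono[OF Mor_finite_dim component_subspace(2)[OF rmodule_Mor i]])
  ultimately have "dim (component N (Cmp C T T X) i) \<le> dim (component (Mor C T X) (Cmp C T T X) i)"
    by (rule dim_subset_sub(1)[OF component_subspace(1)[OF rN i] component_subspace(1)[OF rmodule_Mor i]])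
  then show "e i \<le> dim_vector C T Ts \<iota> \<pi> (hom_module C T X) i" using D i by (simp add: dim_vector_eq)
qed

text \<open>A submodule of the full class has the full dimension and is everything; conversely the
  whole module has a composition series, whose class can only be its dimension vector.\<close>

lemma quiver_grass_top:
  assumes e: "e = (\<lambda>i. if i \<in> {1..n} then dim_vector C T Ts \<iota> \<pi> (hom_module C T X) i else 0)"
  shows "quiver_grass C T Ts n (hom_module C T X) e = {Mor C T X}" "dim (Mor C T X) = (\<Sum>i\<in>{1..n}. e i)"
proof -
  obtain e' where e': "mod_class C T Ts n (Cmp C T T X) (Mor C T X) e'"
    using mod_class_exists[OF rmodule_Mor Mor_finite_dim] by blast
  note D = mod_class_dims[OF e' rmodule_Mor]
  have "e' = e" using D by (auto simp: e dim_vector_eq)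
  then have M: "Mor C T X \<in> quiver_grass C T Ts n (hom_module C T X) e"
    using e' by (simp add: quiver_grass_iff submod_def)
  show dM: "dim (Mor C T X) = (\<Sum>i\<in>{1..n}. e i)" using D \<open>e' = e\<close> by simp
  have "N = Mor C T X" if N: "N \<in> quiver_grass C T Ts n (hom_module C T X) e" for N
  proof (rule dim_subset_sub(2)[OF _ Mor_subspace _ Mor_finite_dim])
    show "subspace N" "N \<subseteq> Mor C T X" using N by (simp_all add: quiver_grass_iff submod_def)
    show "dim N = dim (Mor C T X)" using quiver_grass_bound(3)[OF N] dM by simp
  qed
  with M show "quiver_grass C T Ts n (hom_module C T X) e = {Mor C T X}" by blast
qed

text \<open>Simple tops are lines, so the rank d of the charts is the dimension of the whole module
  and the Grassmannian is a point.\<close>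

lemma grass_euler_top:
  assumes e: "e = (\<lambda>i. if i \<in> {1..n} then dim_vector C T Ts \<iota> \<pi> (hom_module C T X) i else 0)"
    and H: "admissible H"
  shows "grass_euler H C T Ts n (hom_module C T X) e = 1"
proof -
  have "(\<Sum>i\<in>{1..n}. e i * vdim C (Car (simple_top C T (Ts i)))) = dim (Mor C T X)"
    unfolding quiver_grass_top(2)[OF e] by (rule sum.cong) (simp_all add: dim_simple_top)
  then show ?thesis
    unfolding grass_euler_def Let_def quiver_grass_top(1)[OF e]
    using euler_char_grass_top[OF H Mor_subspace[of T X] Mor_finite_dim] by (simp add: hom_module_def)
qed

end

section \<open>The F-polynomial over a framed quiver\<close>

context cluster_tilted
begin

context
  fixes r :: nat and M :: 'o
  assumes n: "n = 2 * r"
    and framing: "\<And>i j. i \<in> {1..r} \<Longrightarrow> j \<in> {1..r} \<Longrightarrow>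
      quiver_matrix (arrows C (add_of C {T})) (Ts (r + i)) (Ts j) = (if i = j then 1 else 0)"
    and no_2_cycle: "\<And>i j. i \<in> {1..n} \<Longrightarrow> j \<in> {1..n} \<Longrightarrow>
      arrows C (add_of C {T}) (Ts i) (Ts j) = 0 \<or> arrows C (add_of C {T}) (Ts j) (Ts i) = 0"
    and ext: "\<And>l. l \<in> {r+1..2*r} \<Longrightarrow> ext1_zero C (Ts l) M"
    and M: "indecomposable C M" and M_Ts: "\<And>i. i \<in> {1..n} \<Longrightarrow> \<not> isomorphic C M (Ts i)"
begin

text \<open>The entry of the framed matrix is 0 or 1, hence not negative: an arrow from
  \<open>Ts l\<close> to \<open>Ts (r + j)\<close> would require one in the opposite direction, and
  2-cycles are excluded.\<close>

lemma rad_eq_rad2_frozen: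
  assumes "l \<in> {1..r}" "j \<in> {1..r}"
  shows "rad C (Ts l) (Ts (r + j)) = rad2 C (add_of C {T}) (Ts l) (Ts (r + j))"
proof (rule arrows_eq_0D)
  have "l \<in> {1..n}" "r + j \<in> {1..n}" using assms n by (auto simp: atLeastAtMost_iff)
  then show "arrows C (add_of C {T}) (Ts l) (Ts (r + j)) = 0"
    using no_2_cycle[of l "r + j"] framing[OF assms(2,1)] by (auto simp: quiver_matrix_def split: if_splits)
qed

text \<open>Here \<open>L\<close> is the set of frozen vertices: all arrows into
  \<open>r + j\<close> start there, and the condition defining the subcategory U says that
  \<open>M\<close> has no extensions with them.\<close>

lemma index_coeff_frozen:
  assumes j: "j \<in> {1..r}"
  shows "index_coeff C Ts n M (r + j) = 0"
proof (rule is_index_eq_0[where L = "{r+1..2*r}"])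
  show "\<not> isomorphic C M (Ts (r + j))" by (rule M_Ts) (use j n in \<open>auto simp: atLeastAtMost_iff\<close>)
  show "r + j \<in> {r+1..2*r}" using j by (auto simp: atLeastAtMost_iff)
  show "{r+1..2*r} \<subseteq> {1..n}" using n by (auto simp: atLeastAtMost_iff)
  show "rad C (Ts l) (Ts (r + j)) = rad2 C (add_of C {T}) (Ts l) (Ts (r + j))"
    if "l \<in> {1..n}" "l \<notin> {r+1..2*r}" for l
    by (rule rad_eq_rad2_frozen[OF _ j]) (use that n in \<open>auto simp: atLeastAtMost_iff\<close>)
  show "is_index C Ts n M (index_coeff C Ts n M)"
    unfolding index_coeff_def by (rule someI_ex[OF index_exists])
qed (rule ext M, assumption?)+

text \<open>The component at \<open>l\<close> factors through C(T_l, \<Sigma> M), which is Ext(T_l,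
  M).\<close>

lemma dim_vector_frozen:
  assumes l: "l \<in> {r+1..2*r}"
  shows "dim_vector C T Ts \<iota> \<pi> (hom_module C T (Sus C M)) l = 0"
proof -
  have l': "l \<in> {1..n}" using l n by (auto simp: atLeastAtMost_iff)
  have "Cmp C T T (Sus C M) x (vertex_idem l) = 0" if x: "x \<in> Mor C T (Sus C M)" for x
  proof -
    have "Cmp C (Ts l) T (Sus C M) x (\<iota> l) \<in> Mor C (Ts l) (Sus C M)" using x l' by simp
    then have "Cmp C (Ts l) T (Sus C M) x (\<iota> l) = 0" using ext[OF l] by (simp add: ext1_zero_def)
    moreover have "Cmp C T T (Sus C M) x (vertex_idem l)
        = Cmp C T (Ts l) (Sus C M) (Cmp C (Ts l) T (Sus C M) x (\<iota> l)) (\<pi> l)"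
      using x l' by (simp add: vertex_idem_def Cmp_assoc)
    ultimately show ?thesis using l' by simp
  qed
  then have "component (Mor C T (Sus C M)) (Cmp C T T (Sus C M)) l \<subseteq> {0}" by auto
  then have "component (Mor C T (Sus C M)) (Cmp C T T (Sus C M)) l = {0}"
    using subspace_0[OF component_subspace(1)[OF rmodule_Mor l', of "Sus C M"]] by (simp add: subset_singleton_iff) force
  then show ?thesis
    using basis_card_eq_dim[of "{}" "{0}"] by (simp add: dim_vector_eq independent_empty)
qed

lemma F_poly_eq:
  "F_poly H C r T Ts M = (\<Sum>e | quiver_grass C T Ts n (hom_module C T (Sus C M)) e \<noteq> {}.
     of_int (grass_euler H C T Ts n (hom_module C T (Sus C M)) e) * (\<Prod>i\<in>{1..r}. indet (r + i) ^ e i))"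
proof -
  let ?x = "\<lambda>i. if i \<le> r then 1 else indet i" and ?S = "\<lambda>i. simple_top C T (Ts i)"
  let ?L = "hom_module C T (Sus C M)"
  have split: "(\<Prod>i\<in>{1..n}. ?x i powi k i) = (\<Prod>i\<in>{1..r}. indet (r + i) powi k (r + i))" for k
  proof -
    have "{1..n} = {1..r} \<union> (+) r ` {1..r}"
      unfolding n image_add_atLeastAtMost by (auto simp: atLeastAtMost_iff)
    then have "(\<Prod>i\<in>{1..n}. ?x i powi k i) = (\<Prod>i\<in>{1..r}. ?x i powi k i) * (\<Prod>i\<in>(+) r ` {1..r}. ?x i powi k i)"
      by (simp only:) (rule prod.union_disjoint, auto simp: atLeastAtMost_iff)
    also have "(\<Prod>i\<in>{1..r}. ?x i powi k i) = 1"
      by (rule prod.neutral) (simp add: atLeastAtMost_iff)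
    also have "(\<Prod>i\<in>(+) r ` {1..r}. ?x i powi k i) = (\<Prod>i\<in>{1..r}. ?x (r + i) powi k (r + i))"
      by (subst prod.reindex) (simp_all add: inj_on_def)
    also have "\<dots> = (\<Prod>i\<in>{1..r}. indet (r + i) powi k (r + i))"
      by (rule prod.cong) (auto simp: atLeastAtMost_iff)
    finally show ?thesis by simp
  qed
  have exponent: "(\<Sum>j\<in>{1..n}. int (e j) * mod_form_a C T (?S (r + i)) (?S j)) = int (e i)"
    if e: "quiver_grass C T Ts n ?L e \<noteq> {}" and i: "i \<in> {1..r}" for e i
  proof -
    have i': "i \<in> {1..n}" "r + i \<in> {1..n}" using i n by (auto simp: atLeastAtMost_iff)
    have "int (e j) * mod_form_a C T (?S (r + i)) (?S j) = (if j = i then int (e i) else 0)"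
      if j: "j \<in> {1..n}" for j
    proof (cases "j \<le> r")
      case True
      then have j': "j \<in> {1..r}" and "r + i \<noteq> j" using i j by (auto simp: atLeastAtMost_iff)
      then show ?thesis
        using mod_form_a_simple_tops[OF i'(2) j] framing[OF i j'] by simp
    next
      case False
      then have l: "j \<in> {r+1..2*r}" "j \<noteq> i" using i j n by (auto simp: atLeastAtMost_iff)
      obtain N where "N \<in> quiver_grass C T Ts n ?L e" using e by blast
      from quiver_grass_bound(1)[OF this j] have "e j = 0" using dim_vector_frozen[OF l(1)] by simp
      then show ?thesis using l by simp
    qed
    then have "(\<Sum>j\<in>{1..n}. int (e j) * mod_form_a C T (?S (r + i)) (?S j)) = (\<Sum>j\<in>{1..n}. if j = i then int (e i) else 0)"
      by (rule sum.cong[OF refl])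
    then show ?thesis using i' by simp
  qed
  have "(\<Prod>i\<in>{1..n}. ?x i powi index_coeff C Ts n M i) = 1"
    unfolding split by (rule prod.neutral) (simp add: index_coeff_frozen)
  then show ?thesis
    unfolding F_poly_def cluster_character_def Let_def n[symmetric] split
    by (simp add: exponent)
qed

lemma f_vector_eq_dim_vector:
  assumes H: "admissible H" and f: "is_f_vector H C r T Ts M f" and j: "j \<in> {1..r}"
  shows "int (dim_vector C T Ts \<iota> \<pi> (hom_module C T (Sus C M)) j) = f j"
proof -
  let ?L = "hom_module C T (Sus C M)"
  \<comment> \<open>Cut off outside the vertices, where classes of modules vanish, so that
    \<open>d\<close> is itself one of the exponents and dominates all of them.\<close>
  define d where "d = (\<lambda>i. if i \<in> {1..n} then dim_vector C T Ts \<iota> \<pi> ?L i else 0)"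
  let ?X = "{e. quiver_grass C T Ts n ?L e \<noteq> {}}"
  have bound: "e i \<le> d i" if "e \<in> ?X" for e i
    using that quiver_grass_bound(1,2)[of _ "Sus C M" e i] by (auto simp: d_def)
  have d0: "d i = 0" if "i \<notin> {1..r}" for i
  proof (cases "i \<in> {1..n}")
    case True
    then have "i \<in> {r+1..2*r}" using that n by (auto simp: atLeastAtMost_iff)
    then show ?thesis using dim_vector_frozen by (simp add: d_def)
  qed (simp add: d_def)
  have supp: "e i = 0" if "e \<in> ?X" "i \<notin> {1..r}" for e i
    using bound[OF that(1), of i] d0[OF that(2)] by simp
  \<comment> \<open>All exponents lie in a box below \<open>d\<close>, so there are finitely
    many.\<close>
  have "?X \<subseteq> {e. \<forall>i. (i \<in> {1..r} \<longrightarrow> e i \<in> {..Max (d ` {1..r})}) \<and> (i \<notin> {1..r} \<longrightarrow> e i = 0)}"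
  proof (intro subsetI CollectI allI conjI impI)
    fix e i assume e: "e \<in> ?X"
    show "e i = 0" if "i \<notin> {1..r}" using supp[OF e that] .
    assume "i \<in> {1..r}"
    then have "d i \<le> Max (d ` {1..r})" by (intro Max_ge) auto
    then show "e i \<in> {..Max (d ` {1..r})}" using bound[OF e, of i] by simp
  qed
  then have fin: "finite ?X"
    by (rule finite_subset) (rule finite_set_of_finite_funs, simp_all)
  have dX: "d \<in> ?X" using quiver_grass_top(1)[OF d_def] by simp
  obtain E where E: "sf_vars E \<subseteq> {r+1..2*r}" "sf_eval (+) (*) (/) 1 indet E = F_poly H C r T Ts M"
    "\<forall>j\<in>{1..r}. trop_eval (\<lambda>i. trop_gen_inv (i - r)) E j = - f j"
    using f unfolding is_f_vector_def by blast
  have "trop_eval (\<lambda>i. trop_gen_inv (i - r)) E j = - int (d j)"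
  proof (rule trop_eval_dominant[where X = ?X and d = d and \<omega> = "grass_euler H C T Ts n ?L"])
    show "grass_euler H C T Ts n ?L d = 1" by (rule grass_euler_top[OF d_def H])
    show "sf_vars E \<subseteq> {r+1..2*r}" by (rule E(1))
    show "sf_eval (+) (*) (/) 1 indet E =
        (\<Sum>e\<in>?X. of_int (grass_euler H C T Ts n ?L e) * (\<Prod>i\<in>{1..r}. indet (r + i) ^ e i))"
      by (rule E(2)[unfolded F_poly_eq])
    show "e i = 0" if "e \<in> ?X" "i \<notin> {1..r}" for e i by (rule supp[OF that])
    show "e i \<le> d i" if "e \<in> ?X" for e i by (rule bound[OF that])
  qed (fact fin dX j)+
  then have "int (d j) = f j" using E(3) j by simp
  moreover have "j \<in> {1..n}" using j n by (auto simp: atLeastAtMost_iff)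
  ultimately show ?thesis by (simp add: d_def)
qed

end

end

theorem proposition6p6:
  fixes C :: "('k::alg_closed_field, 'o, 'v::ab_group_add) tcat"
    and r :: nat and B :: "nat \<Rightarrow> nat \<Rightarrow> int"
    and T :: 'o and Ts :: "nat \<Rightarrow> 'o" and \<iota> \<pi> :: "nat \<Rightarrow> 'v"
    and P :: 'o and \<iota>P \<pi>P :: "nat \<Rightarrow> 'v" and \<P> \<U> :: "'o set"
    and H :: "'k cohomology" and M :: 'o
    and d :: "nat \<Rightarrow> nat" and f :: "nat \<Rightarrow> int"
  assumes "r \<ge> 1"
    and "\<forall>i\<in>{1..2*r}. \<forall>j\<in>{1..2*r}. B i j = - B j i"
    and "\<forall>i\<in>{1..r}. \<forall>j\<in>{1..r}. B (r + i) j = (if i = j then 1 else 0)"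
    and "cy_realization C (2*r) B T Ts \<iota> \<pi>"
    and "direct_sum C P {r+1..2*r} Ts \<iota>P \<pi>P"
    and "\<P> = add_of C {P}"
    and "\<U> = {X. \<forall>i\<in>{r+1..2*r}. ext1_zero C (Ts i) X}"
    and "admissible H"
    and "indecomposable C M" and "rigid C M" and "M \<in> \<U>"
    and "reachable C \<U> \<P> T M"
    and "\<forall>i\<in>{1..2*r}. \<not> isomorphic C M (Ts i)"
    and "\<forall>i\<in>{1..r}. d i = dim_vector C T Ts \<iota> \<pi> (hom_module C T (Sus C M)) i"
    and "is_f_vector H C r T Ts M f"
  shows "\<forall>i\<in>{1..r}. int (d i) = f i"
proof -
  note real = assms(4)[unfolded cy_realization_def]
  have base: "linear_category C" "hom_finite C" "triangulated C" "split_idempotents C" "two_calabi_yau C"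
    and cs: "cluster_structure C" and ct: "cluster_tilting_object C T"
    and sum: "direct_sum C T {1..2*r} Ts \<iota> \<pi>"
    and ind: "\<forall>i\<in>{1..2*r}. indecomposable C (Ts i)"
    and noniso: "\<forall>i\<in>{1..2*r}. \<forall>j\<in>{1..2*r}. i \<noteq> j \<longrightarrow> \<not> isomorphic C (Ts i) (Ts j)"
    and quiver: "\<forall>i\<in>{1..2*r}. \<forall>j\<in>{1..2*r}. quiver_matrix (arrows C (add_of C {T})) (Ts i) (Ts j) = B i j"
    using real by - (elim conjE, assumption)+
  have ct': "cluster_tilting C (add_of C {T})" using ct by (simp add: cluster_tilting_object_def)
  interpret cluster_tilted C T Ts "2 * r" \<iota> \<pi>
    using base sum ind noniso ct' by unfold_locales blast+
  have no2: "arrows C (add_of C {T}) (Ts i) (Ts j) = 0 \<or> arrows C (add_of C {T}) (Ts j) (Ts i) = 0"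
    if "i \<in> {1..2*r}" "j \<in> {1..2*r}" for i j
  proof -
    have "Ts i \<in> indec C (add_of C {T})" "Ts j \<in> indec C (add_of C {T})"
      using that ind Ts_in_add by (simp_all add: indec_def)
    \<comment> \<open>The fourth clause of \<open>cluster_structure\<close>; its second half
      excludes 2-cycles.\<close>
    then show ?thesis
      by (rule cs[unfolded cluster_structure_def, THEN conjunct2, THEN conjunct2, THEN conjunct2, THEN conjunct1,
        THEN spec, THEN mp, OF ct', THEN conjunct2, THEN bspec, THEN bspec])
  qed
  have framing: "quiver_matrix (arrows C (add_of C {T})) (Ts (r + i)) (Ts j) = (if i = j then 1 else 0)"
    if "i \<in> {1..r}" "j \<in> {1..r}" for i j
  proof -
    have "r + i \<in> {1..2*r}" "j \<in> {1..2*r}" using that by (auto simp: atLeastAtMost_iff)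
    then show ?thesis using quiver assms(3) that by simp
  qed
  show ?thesis
  proof
    fix i assume i: "i \<in> {1..r}"
    have "int (dim_vector C T Ts \<iota> \<pi> (hom_module C T (Sus C M)) i) = f i"
      by (rule f_vector_eq_dim_vector[OF refl framing no2 _ assms(9) _ assms(8,15) i])
        (use assms(7,11,13) in blast)+
    then show "int (d i) = f i" using assms(14) i by simp
  qed
qed

end
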